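(* Let a right principal $G$-bundle $p:P\to M$ be endowed with a $G$-invariant Poisson structure $\pi_P$, and let $G$ act on the left on a Poisson manifold $(X,\pi_X)$ by Poisson diffeomorphisms. Then there exist Poisson structures $\pi_M$ on $M$ and $\pi_\Sigma$ on the associated bundle $\Sigma:=P\times_GX$ for which the four maps in the commutative square given by the quotient map $q:(P,\pi_P)\times(X,\pi_X)\to(\Sigma,\pi_\Sigma)$, the projection $\mathrm{pr}_1:(P,\pi_P)\times(X,\pi_X)\to(P,\pi_P)$, $p:(P,\pi_P)\to(M,\pi_M)$ and $p:(\Sigma,\pi_\Sigma)\to(M,\pi_M)$ are all Poisson submersions. If $p:(P,\pi_P)\to(M,\pi_M)$ is a Poisson submersion with Poisson fibres, then so is $p:(\Sigma,\pi_\Sigma)\to(M,\pi_M)$; and if $p:(P,\pi_P)\to(M,\pi_M)$ is an orthogonal pencil, then so is $p:(\Sigma,\pi_\Sigma)\to(M,\pi_M)$.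
   Context: The associated bundle $\Sigma=P\times_GX$ is the quotient of $P\times X$ by the free left action $g\cdot(y,x)=(yg^{-1},gx)$, with quotient map $q$ and projection $p:\Sigma\to M$, $p[y,x]=p(y)$. A Poisson submersion is a submersion between Poisson manifolds which is a Poisson map. A submanifold $i:F\to\Sigma$ of a Poisson manifold is Poisson-Dirac if $\{u+i^*\xi:i_*u=\pi_\Sigma^\sharp(\xi)\}\subset TF\oplus T^*F$ is the graph $\{\pi_F^\sharp(\eta)+\eta\}$ of a smooth bivector $\pi_F$ on $F$ (automatically Poisson). A submersion from a Poisson manifold has Poisson fibres if all its fibres are Poisson-Dirac submanifolds. Orthogonal pencil: a Poisson submersion $p:(\Sigma,\pi_\Sigma)\to(M,\pi_M)$, with vertical bundle $V=\ker p_*$, such that $\pi_\Sigma=\pi_V+\pi_H$ with $\pi_V,\pi_H$ commuting Poisson structures (all Schouten brackets among them vanish), $\pi_V\in\Gamma(\wedge^2V)$ and $\pi_H^\sharp(T^*\Sigma)\cap V=0$. *)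

theory Defs
  imports "HOL-Analysis.Analysis" "HOL-Algebra.Group_Action"
begin

section \<open>Smooth functions on open subsets of Euclidean space\<close>

text \<open>Points of the $n$-dimensional space are real sequences vanishing from index \<open>n\<close> on, with the
  topology \<^const>\<open>Euclidean_space\<close>; the dimension is a natural number and may be \<open>0\<close>.
  All predicates below only look at functions on the indicated (open) sets.\<close>

definition partial :: "nat \<Rightarrow> ((nat \<Rightarrow> real) \<Rightarrow> real) \<Rightarrow> (nat \<Rightarrow> real) \<Rightarrow> real" where
  "partial i f x = deriv (\<lambda>t. f (x(i := t))) (x i)"

primrec Ck_on :: "nat \<Rightarrow> nat \<Rightarrow> (nat \<Rightarrow> real) set \<Rightarrow> ((nat \<Rightarrow> real) \<Rightarrow> real) \<Rightarrow> bool" where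
  "Ck_on 0 n U f \<longleftrightarrow> continuous_map (subtopology (Euclidean_space n) U) euclideanreal f"
| "Ck_on (Suc k) n U f \<longleftrightarrow>
     continuous_map (subtopology (Euclidean_space n) U) euclideanreal f \<and>
     (\<forall>i<n. (\<forall>x\<in>U. (\<lambda>t. f (x(i := t))) field_differentiable at (x i)) \<and>
            Ck_on k n U (partial i f))"

definition Cinf_on :: "nat \<Rightarrow> (nat \<Rightarrow> real) set \<Rightarrow> ((nat \<Rightarrow> real) \<Rightarrow> real) \<Rightarrow> bool" where
  "Cinf_on n U f \<longleftrightarrow> (\<forall>k. Ck_on k n U f)"


section \<open>Smooth manifolds\<close>

text \<open>A chart is a pair \<open>(U, \<phi>)\<close> of its domain and its coordinate map.\<close>

type_synonym 'a chart = "'a set \<times> ('a \<Rightarrow> nat \<Rightarrow> real)"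

record 'a manifold =
  mtop :: "'a topology"
  mdim :: nat
  atlas :: "'a chart set"

abbreviation points :: "'a manifold \<Rightarrow> 'a set" where
  "points M \<equiv> topspace (mtop M)"

fun is_chart :: "'a topology \<Rightarrow> nat \<Rightarrow> 'a chart \<Rightarrow> bool" where
  "is_chart T n (U, \<phi>) \<longleftrightarrow>
     openin T U \<and> openin (Euclidean_space n) (\<phi> ` U) \<and>
     homeomorphic_map (subtopology T U) (subtopology (Euclidean_space n) (\<phi> ` U)) \<phi>"

fun smooth_transition :: "nat \<Rightarrow> 'a chart \<Rightarrow> 'a chart \<Rightarrow> bool" where
  "smooth_transition n (U, \<phi>) (V, \<psi>) \<longleftrightarrow>
     (\<forall>i<n. Cinf_on n (\<phi> ` (U \<inter> V)) (\<lambda>u. \<psi> (inv_into U \<phi> u) i))"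

definition smooth_manifold :: "'a manifold \<Rightarrow> bool" where
  "smooth_manifold M \<longleftrightarrow>
     Hausdorff_space (mtop M) \<and> second_countable (mtop M) \<and>
     (\<forall>c\<in>atlas M. is_chart (mtop M) (mdim M) c) \<and>
     (\<Union>c\<in>atlas M. fst c) = points M \<and>
     (\<forall>c\<in>atlas M. \<forall>c'\<in>atlas M. smooth_transition (mdim M) c c')"

text \<open>The maximal atlas.\<close>

definition smooth_charts :: "'a manifold \<Rightarrow> 'a chart set" where
  "smooth_charts M =
     {c. is_chart (mtop M) (mdim M) c \<and>
         (\<forall>c'\<in>atlas M. smooth_transition (mdim M) c c' \<and> smooth_transition (mdim M) c' c)}"

definition smooth_fun_on :: "'a manifold \<Rightarrow> 'a set \<Rightarrow> ('a \<Rightarrow> real) \<Rightarrow> bool" where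
  "smooth_fun_on M W f \<longleftrightarrow>
     (\<forall>(U, \<phi>)\<in>atlas M. Cinf_on (mdim M) (\<phi> ` (U \<inter> W)) (\<lambda>u. f (inv_into U \<phi> u)))"

definition smooth_map :: "'a manifold \<Rightarrow> 'b manifold \<Rightarrow> ('a \<Rightarrow> 'b) \<Rightarrow> bool" where
  "smooth_map M N f \<longleftrightarrow>
     continuous_map (mtop M) (mtop N) f \<and>
     (\<forall>(U, \<phi>)\<in>atlas M. \<forall>(V, \<psi>)\<in>atlas N. \<forall>i<mdim N.
        Cinf_on (mdim M) (\<phi> ` {x\<in>U. f x \<in> V}) (\<lambda>u. \<psi> (f (inv_into U \<phi> u)) i))"

definition diffeo :: "'a manifold \<Rightarrow> 'b manifold \<Rightarrow> ('a \<Rightarrow> 'b) \<Rightarrow> bool" where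
  "diffeo M N f \<longleftrightarrow>
     (\<exists>g. smooth_map M N f \<and> smooth_map N M g \<and>
          (\<forall>x\<in>points M. g (f x) = x) \<and> (\<forall>y\<in>points N. f (g y) = y))"

definition open_submanifold :: "'a manifold \<Rightarrow> 'a set \<Rightarrow> 'a manifold" where
  "open_submanifold M W =
     \<lparr>mtop = subtopology (mtop M) W, mdim = mdim M, atlas = {(U \<inter> W, \<phi>) | U \<phi>. (U, \<phi>) \<in> atlas M}\<rparr>"

definition join_coords :: "nat \<Rightarrow> (nat \<Rightarrow> real) \<Rightarrow> (nat \<Rightarrow> real) \<Rightarrow> nat \<Rightarrow> real" where
  "join_coords m u v = (\<lambda>i. if i < m then u i else v (i - m))"

definition prod_manifold :: "'a manifold \<Rightarrow> 'b manifold \<Rightarrow> ('a \<times> 'b) manifold" where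
  "prod_manifold M N =
     \<lparr>mtop = prod_topology (mtop M) (mtop N), mdim = mdim M + mdim N,
      atlas = {(U \<times> V, \<lambda>(x, y). join_coords (mdim M) (\<phi> x) (\<psi> y)) | U \<phi> V \<psi>.
                 (U, \<phi>) \<in> atlas M \<and> (V, \<psi>) \<in> atlas N}\<rparr>"

text \<open>Embedded submanifolds of dimension \<open>k\<close>, by the slice condition. Since
  \<open>topspace (Euclidean_space k) \<subseteq> topspace (Euclidean_space n)\<close> for \<open>k \<le> n\<close>, a slice chart
  restricted to the subset directly takes values in \<open>k\<close>-dimensional space.\<close>

definition slice_charts :: "'a manifold \<Rightarrow> nat \<Rightarrow> 'a set \<Rightarrow> 'a chart set" where
  "slice_charts M k S =
     {(U, \<phi>). (U, \<phi>) \<in> smooth_charts M \<and>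
              \<phi> ` (U \<inter> S) = \<phi> ` U \<inter> topspace (Euclidean_space k)}"

definition embedded_submanifold :: "'a manifold \<Rightarrow> nat \<Rightarrow> 'a set \<Rightarrow> bool" where
  "embedded_submanifold M k S \<longleftrightarrow>
     k \<le> mdim M \<and> S \<subseteq> points M \<and> S \<subseteq> (\<Union>c\<in>slice_charts M k S. fst c)"

definition submanifold :: "'a manifold \<Rightarrow> nat \<Rightarrow> 'a set \<Rightarrow> 'a manifold" where
  "submanifold M k S =
     \<lparr>mtop = subtopology (mtop M) S, mdim = k,
      atlas = {(U \<inter> S, \<phi>) | U \<phi>. (U, \<phi>) \<in> slice_charts M k S}\<rparr>"

text \<open>The quotient of \<open>N\<close> under a map \<open>q\<close> (of dimension \<open>n\<close>): it carries the quotient topology, and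
  its charts are those in which a function on an open subset is smooth iff its pullback along \<open>q\<close>
  is smooth. When \<open>N\<close> has a quotient manifold, i.e. a smooth structure on the quotient space making
  \<open>q\<close> a submersion, this is its maximal atlas.\<close>

definition quotient_manifold :: "'a manifold \<Rightarrow> ('a \<Rightarrow> 'b) \<Rightarrow> nat \<Rightarrow> 'b manifold" where
  "quotient_manifold N q n =
     (let T = topology (\<lambda>W. W \<subseteq> q ` points N \<and> openin (mtop N) {z\<in>points N. q z \<in> W})
      in \<lparr>mtop = T, mdim = n,
          atlas = {(U, \<phi>). is_chart T n (U, \<phi>) \<and>
                     (\<forall>W h. openin T W \<and> W \<subseteq> U \<longrightarrow>
                        (Cinf_on n (\<phi> ` W) h \<longleftrightarrow>
                         smooth_fun_on N {z\<in>points N. q z \<in> W} (\<lambda>z. h (\<phi> (q z)))))}\<rparr>)"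


section \<open>Tangent and cotangent spaces\<close>

text \<open>Tangent vectors at \<open>x\<close> are the linear derivations on germs of smooth functions at \<open>x\<close>. A germ
  is represented by any total function that is smooth near \<open>x\<close>; the Leibniz rule forces a derivation
  to depend on the germ only (if \<open>h\<close> vanishes near \<open>x\<close>, then \<open>h = h * k\<close> for some \<open>k\<close> vanishing
  near \<open>x\<close>). Tangent vectors and covectors are \<open>0\<close> outside their domains, so that equality of
  representatives is equality of vectors.\<close>

type_synonym 'a tangent = "('a \<Rightarrow> real) \<Rightarrow> real"
type_synonym 'a cotangent = "'a tangent \<Rightarrow> real"

definition germs :: "'a manifold \<Rightarrow> 'a \<Rightarrow> ('a \<Rightarrow> real) set" where
  "germs M x = {f. \<exists>W. openin (mtop M) W \<and> x \<in> W \<and> smooth_fun_on M W f}"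

definition tangent_space :: "'a manifold \<Rightarrow> 'a \<Rightarrow> 'a tangent set" where
  "tangent_space M x =
     {v. (\<forall>f. f \<notin> germs M x \<longrightarrow> v f = 0) \<and>
         (\<forall>f\<in>germs M x. \<forall>g\<in>germs M x.
            (\<forall>a b. v (\<lambda>z. a * f z + b * g z) = a * v f + b * v g) \<and>
            v (\<lambda>z. f z * g z) = v f * g x + f x * v g)}"

definition cotangent_space :: "'a manifold \<Rightarrow> 'a \<Rightarrow> 'a cotangent set" where
  "cotangent_space M x =
     {\<xi>. (\<forall>v. v \<notin> tangent_space M x \<longrightarrow> \<xi> v = 0) \<and>
         (\<forall>v\<in>tangent_space M x. \<forall>w\<in>tangent_space M x. \<forall>a b.
            \<xi> (\<lambda>f. a * v f + b * w f) = a * \<xi> v + b * \<xi> w)}"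

definition differential :: "'a manifold \<Rightarrow> ('a \<Rightarrow> real) \<Rightarrow> 'a \<Rightarrow> 'a cotangent" where
  "differential M f x = (\<lambda>v. if v \<in> tangent_space M x then v f else 0)"

definition pushforward :: "'b manifold \<Rightarrow> ('a \<Rightarrow> 'b) \<Rightarrow> 'a \<Rightarrow> 'a tangent \<Rightarrow> 'b tangent" where
  "pushforward N \<Phi> x v = (\<lambda>h. if h \<in> germs N (\<Phi> x) then v (h \<circ> \<Phi>) else 0)"

definition pullback ::
    "'a manifold \<Rightarrow> 'b manifold \<Rightarrow> ('a \<Rightarrow> 'b) \<Rightarrow> 'a \<Rightarrow> 'b cotangent \<Rightarrow> 'a cotangent" where
  "pullback M N \<Phi> x \<xi> = (\<lambda>v. if v \<in> tangent_space M x then \<xi> (pushforward N \<Phi> x v) else 0)"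

definition submersion :: "'a manifold \<Rightarrow> 'b manifold \<Rightarrow> ('a \<Rightarrow> 'b) \<Rightarrow> bool" where
  "submersion M N \<Phi> \<longleftrightarrow>
     smooth_map M N \<Phi> \<and>
     (\<forall>x\<in>points M. pushforward N \<Phi> x ` tangent_space M x = tangent_space N (\<Phi> x))"

definition vertical :: "'a manifold \<Rightarrow> 'b manifold \<Rightarrow> ('a \<Rightarrow> 'b) \<Rightarrow> 'a \<Rightarrow> 'a tangent set" where
  "vertical M N \<Phi> x = {v\<in>tangent_space M x. pushforward N \<Phi> x v = (\<lambda>_. 0)}"


section \<open>Bivector fields and Poisson structures\<close>

text \<open>A bivector at \<open>x\<close>, i.e. an element of $\wedge^2 T_xM$, is a skew-symmetric bilinear form on the
  cotangent space at \<open>x\<close>. The values of a bivector field at other arguments are irrelevant.\<close>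

type_synonym 'a bivector = "'a \<Rightarrow> 'a cotangent \<Rightarrow> 'a cotangent \<Rightarrow> real"

definition bracket :: "'a manifold \<Rightarrow> 'a bivector \<Rightarrow> ('a \<Rightarrow> real) \<Rightarrow> ('a \<Rightarrow> real) \<Rightarrow> 'a \<Rightarrow> real" where
  "bracket M \<pi> f g = (\<lambda>x. \<pi> x (differential M f x) (differential M g x))"

definition smooth_bivector :: "'a manifold \<Rightarrow> 'a bivector \<Rightarrow> bool" where
  "smooth_bivector M \<pi> \<longleftrightarrow>
     (\<forall>x\<in>points M. \<forall>\<xi>\<in>cotangent_space M x. \<forall>\<eta>\<in>cotangent_space M x.
        \<pi> x \<xi> \<eta> = - \<pi> x \<eta> \<xi> \<and>
        (\<forall>\<zeta>\<in>cotangent_space M x. \<forall>a b.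
           \<pi> x (\<lambda>v. a * \<xi> v + b * \<eta> v) \<zeta> = a * \<pi> x \<xi> \<zeta> + b * \<pi> x \<eta> \<zeta>)) \<and>
     (\<forall>W f g. openin (mtop M) W \<and> smooth_fun_on M W f \<and> smooth_fun_on M W g \<longrightarrow>
        smooth_fun_on M W (bracket M \<pi> f g))"

definition sharp :: "'a manifold \<Rightarrow> 'a bivector \<Rightarrow> 'a \<Rightarrow> 'a cotangent \<Rightarrow> 'a tangent" where
  "sharp M \<pi> x \<xi> = (\<lambda>f. if f \<in> germs M x then \<pi> x \<xi> (differential M f x) else 0)"

text \<open>The Schouten bracket of two bivector fields, a trivector field, evaluated on the differentials
  of three functions (up to the overall sign, which depends on conventions). In particular
  \<open>schouten M \<pi> \<pi>\<close> is twice the Jacobiator of \<open>bracket M \<pi>\<close>.\<close>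

definition schouten ::
    "'a manifold \<Rightarrow> 'a bivector \<Rightarrow> 'a bivector \<Rightarrow>
     ('a \<Rightarrow> real) \<Rightarrow> ('a \<Rightarrow> real) \<Rightarrow> ('a \<Rightarrow> real) \<Rightarrow> 'a \<Rightarrow> real" where
  "schouten M \<pi> \<rho> f g h x =
     (let B = bracket M \<pi>; C = bracket M \<rho> in
        C (B f g) h x + C (B g h) f x + C (B h f) g x +
        B (C f g) h x + B (C g h) f x + B (C h f) g x)"

definition schouten_commute :: "'a manifold \<Rightarrow> 'a bivector \<Rightarrow> 'a bivector \<Rightarrow> bool" where
  "schouten_commute M \<pi> \<rho> \<longleftrightarrow>
     (\<forall>x\<in>points M. \<forall>f\<in>germs M x. \<forall>g\<in>germs M x. \<forall>h\<in>germs M x. schouten M \<pi> \<rho> f g h x = 0)"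

definition poisson_structure :: "'a manifold \<Rightarrow> 'a bivector \<Rightarrow> bool" where
  "poisson_structure M \<pi> \<longleftrightarrow> smooth_bivector M \<pi> \<and> schouten_commute M \<pi> \<pi>"

definition poisson_manifold :: "'a manifold \<Rightarrow> 'a bivector \<Rightarrow> bool" where
  "poisson_manifold M \<pi> \<longleftrightarrow> smooth_manifold M \<and> poisson_structure M \<pi>"

definition poisson_map ::
    "'a manifold \<Rightarrow> 'a bivector \<Rightarrow> 'b manifold \<Rightarrow> 'b bivector \<Rightarrow> ('a \<Rightarrow> 'b) \<Rightarrow> bool" where
  "poisson_map M \<pi> N \<rho> \<Phi> \<longleftrightarrow>
     smooth_map M N \<Phi> \<and>
     (\<forall>x\<in>points M. \<forall>\<xi>\<in>cotangent_space N (\<Phi> x). \<forall>\<eta>\<in>cotangent_space N (\<Phi> x).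
        \<rho> (\<Phi> x) \<xi> \<eta> = \<pi> x (pullback M N \<Phi> x \<xi>) (pullback M N \<Phi> x \<eta>))"

definition poisson_submersion ::
    "'a manifold \<Rightarrow> 'a bivector \<Rightarrow> 'b manifold \<Rightarrow> 'b bivector \<Rightarrow> ('a \<Rightarrow> 'b) \<Rightarrow> bool" where
  "poisson_submersion M \<pi> N \<rho> \<Phi> \<longleftrightarrow>
     poisson_manifold M \<pi> \<and> poisson_manifold N \<rho> \<and>
     submersion M N \<Phi> \<and> poisson_map M \<pi> N \<rho> \<Phi>"

text \<open>The product structure at \<open>(x, y)\<close> is the sum of the push-forwards of the two bivectors along the
  inclusions of the slices through \<open>(x, y)\<close>.\<close>

definition prod_bivector ::
    "'a manifold \<Rightarrow> 'a bivector \<Rightarrow> 'b manifold \<Rightarrow> 'b bivector \<Rightarrow> ('a \<times> 'b) bivector" where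
  "prod_bivector M \<pi> N \<rho> = (\<lambda>(x, y) \<xi> \<eta>.
     (let M_incl = pullback M (prod_manifold M N) (\<lambda>x'. (x', y)) x;
          N_incl = pullback N (prod_manifold M N) (\<lambda>y'. (x, y')) y
      in \<pi> x (M_incl \<xi>) (M_incl \<eta>) + \<rho> y (N_incl \<xi>) (N_incl \<eta>)))"

definition poisson_dirac :: "'a manifold \<Rightarrow> 'a bivector \<Rightarrow> nat \<Rightarrow> 'a set \<Rightarrow> bool" where
  "poisson_dirac M \<pi> k S \<longleftrightarrow>
     embedded_submanifold M k S \<and>
     (let F = submanifold M k S in
      \<exists>\<pi>F. smooth_bivector F \<pi>F \<and>
        (\<forall>x\<in>S.
           {(u, pullback F M id x \<xi>) | u \<xi>.
              u \<in> tangent_space F x \<and> \<xi> \<in> cotangent_space M x \<and>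
              pushforward M id x u = sharp M \<pi> x \<xi>} =
           {(sharp F \<pi>F x \<eta>, \<eta>) | \<eta>. \<eta> \<in> cotangent_space F x}))"

definition has_poisson_fibres ::
    "'a manifold \<Rightarrow> 'a bivector \<Rightarrow> 'b manifold \<Rightarrow> ('a \<Rightarrow> 'b) \<Rightarrow> bool" where
  "has_poisson_fibres M \<pi> N \<Phi> \<longleftrightarrow>
     (\<forall>m \<in> \<Phi> ` points M. poisson_dirac M \<pi> (mdim M - mdim N) {x\<in>points M. \<Phi> x = m})"

text \<open>\<open>\<pi>V x\<close> lies in $\wedge^2 V_x$: as a form on $T_x^*$ it is induced from a form on $V_x^*$ along
  the restriction map $T_x^* \to V_x^*$.\<close>

definition vertical_bivector ::
    "'a manifold \<Rightarrow> 'b manifold \<Rightarrow> ('a \<Rightarrow> 'b) \<Rightarrow> 'a bivector \<Rightarrow> bool" where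
  "vertical_bivector M N \<Phi> \<pi>V \<longleftrightarrow>
     (\<forall>x\<in>points M. \<forall>\<xi>\<in>cotangent_space M x. \<forall>\<xi>'\<in>cotangent_space M x.
        \<forall>\<eta>\<in>cotangent_space M x. \<forall>\<eta>'\<in>cotangent_space M x.
          (\<forall>v\<in>vertical M N \<Phi> x. \<xi> v = \<xi>' v \<and> \<eta> v = \<eta>' v) \<longrightarrow> \<pi>V x \<xi> \<eta> = \<pi>V x \<xi>' \<eta>')"

definition orthogonal_pencil ::
    "'a manifold \<Rightarrow> 'a bivector \<Rightarrow> 'b manifold \<Rightarrow> 'b bivector \<Rightarrow> ('a \<Rightarrow> 'b) \<Rightarrow> bool" where
  "orthogonal_pencil M \<pi> N \<rho> \<Phi> \<longleftrightarrow>
     poisson_submersion M \<pi> N \<rho> \<Phi> \<and>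
     (\<exists>\<pi>V \<pi>H. poisson_structure M \<pi>V \<and> poisson_structure M \<pi>H \<and> schouten_commute M \<pi>V \<pi>H \<and>
        (\<forall>x\<in>points M. \<forall>\<xi>\<in>cotangent_space M x. \<forall>\<eta>\<in>cotangent_space M x.
           \<pi> x \<xi> \<eta> = \<pi>V x \<xi> \<eta> + \<pi>H x \<xi> \<eta>) \<and>
        vertical_bivector M N \<Phi> \<pi>V \<and>
        (\<forall>x\<in>points M. sharp M \<pi>H x ` cotangent_space M x \<inter> vertical M N \<Phi> x = {\<lambda>_. 0}))"


section \<open>Lie groups, principal bundles and associated bundles\<close>

definition lie_group :: "'g monoid \<Rightarrow> 'g manifold \<Rightarrow> bool" where
  "lie_group G Gm \<longleftrightarrow>
     group G \<and> smooth_manifold Gm \<and> points Gm = carrier G \<and>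
     smooth_map (prod_manifold Gm Gm) Gm (\<lambda>(g, h). g \<otimes>\<^bsub>G\<^esub> h) \<and>
     smooth_map Gm Gm (\<lambda>g. inv\<^bsub>G\<^esub> g)"

definition smooth_left_action ::
    "'g monoid \<Rightarrow> 'g manifold \<Rightarrow> 'x manifold \<Rightarrow> ('g \<Rightarrow> 'x \<Rightarrow> 'x) \<Rightarrow> bool" where
  "smooth_left_action G Gm X l \<longleftrightarrow>
     group_action G (points X) l \<and> smooth_map (prod_manifold Gm X) X (\<lambda>(g, x). l g x)"

definition smooth_right_action ::
    "'g monoid \<Rightarrow> 'g manifold \<Rightarrow> 'p manifold \<Rightarrow> ('p \<Rightarrow> 'g \<Rightarrow> 'p) \<Rightarrow> bool" where
  "smooth_right_action G Gm P r \<longleftrightarrow>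
     (\<forall>y\<in>points P. r y \<one>\<^bsub>G\<^esub> = y \<and>
        (\<forall>g\<in>carrier G. r y g \<in> points P \<and>
           (\<forall>h\<in>carrier G. r (r y g) h = r y (g \<otimes>\<^bsub>G\<^esub> h)))) \<and>
     smooth_map (prod_manifold P Gm) P (\<lambda>(y, g). r y g)"

definition principal_bundle ::
    "'g monoid \<Rightarrow> 'g manifold \<Rightarrow> 'p manifold \<Rightarrow> ('p \<Rightarrow> 'g \<Rightarrow> 'p) \<Rightarrow> 'm manifold \<Rightarrow> ('p \<Rightarrow> 'm) \<Rightarrow> bool"
where
  "principal_bundle G Gm P r M p \<longleftrightarrow>
     lie_group G Gm \<and> smooth_manifold P \<and> smooth_manifold M \<and>
     smooth_right_action G Gm P r \<and> smooth_map P M p \<and>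
     (\<forall>y\<in>points P. \<forall>g\<in>carrier G. p (r y g) = p y) \<and>
     (\<forall>m\<in>points M. \<exists>U \<Phi>.
        openin (mtop M) U \<and> m \<in> U \<and>
        diffeo (open_submanifold P {y\<in>points P. p y \<in> U})
               (prod_manifold (open_submanifold M U) Gm) \<Phi> \<and>
        (\<forall>y\<in>points P. p y \<in> U \<longrightarrow> fst (\<Phi> y) = p y \<and>
           (\<forall>g\<in>carrier G. \<Phi> (r y g) = (p y, snd (\<Phi> y) \<otimes>\<^bsub>G\<^esub> g))))"

text \<open>The quotient map \<open>q\<close> sends \<open>(y, x)\<close> to its orbit under
  $g \cdot (y, x) = (y g^{-1}, g x)$, written $[y, x]$.\<close>

definition assoc_quot ::
    "'g monoid \<Rightarrow> ('p \<Rightarrow> 'g \<Rightarrow> 'p) \<Rightarrow> ('g \<Rightarrow> 'x \<Rightarrow> 'x) \<Rightarrow> 'p \<times> 'x \<Rightarrow> ('p \<times> 'x) set" where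
  "assoc_quot G r l = orbit G (\<lambda>g (y, x). (r y (inv\<^bsub>G\<^esub> g), l g x))"

definition assoc_bundle ::
    "'g monoid \<Rightarrow> 'g manifold \<Rightarrow> 'p manifold \<Rightarrow> ('p \<Rightarrow> 'g \<Rightarrow> 'p) \<Rightarrow> 'x manifold \<Rightarrow> ('g \<Rightarrow> 'x \<Rightarrow> 'x) \<Rightarrow>
     ('p \<times> 'x) set manifold" where
  "assoc_bundle G Gm P r X l =
     quotient_manifold (prod_manifold P X) (assoc_quot G r l) (mdim P + mdim X - mdim Gm)"

text \<open>The projection $[y, x] \mapsto p(y)$; the map \<open>p \<circ> fst\<close> is constant on each orbit.\<close>

definition assoc_proj :: "('p \<Rightarrow> 'm) \<Rightarrow> ('p \<times> 'x) set \<Rightarrow> 'm" where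
  "assoc_proj p z = the_elem ((\<lambda>(y, x). p y) ` z)"

end

theory Submission
  imports Defs "HOL-Library.Function_Algebras"
begin

text \<open>
  Every covector on a manifold is the differential of a germ, so statements about bivectors become
  statements about brackets of germs. A bivector that is invariant along the fibres of a surjective map
  with smooth local sections descends along it, and the descended brackets satisfy the identities of the
  original ones. Here \<open>\<pi>P\<close> descends along \<open>p\<close>, and \<open>\<pi>P + \<pi>X\<close> descends along the quotient map \<open>q\<close>.

  Poisson fibres: for \<open>y0\<close> over \<open>m\<close>, the fibre of \<open>\<Sigma>\<close> over \<open>m\<close> is \<open>{[y0, x]. x \<in> X}\<close>. Its bivector is the
  sum of the push-forward of the bivector of the fibre \<open>P\<^sub>m\<close> along \<open>y \<mapsto> [y, x]\<close> and the push-forward of \<open>\<pi>X\<close>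
  along \<open>x \<mapsto> [y0, x]\<close>.

  Pencils: since the image of \<open>\<pi>\<^sub>H\<^sup>\<sharp>\<close> meets the vertical space trivially, every covector agrees on that image
  with one pulled back from \<open>M\<close>. Hence \<open>\<pi>\<^sub>H\<close> is determined by \<open>\<pi>P\<close>, so it is \<open>G\<close>-invariant, and both
  \<open>\<pi>\<^sub>V + \<pi>X\<close> and \<open>\<pi>\<^sub>H + 0\<close> descend along \<open>q\<close>.
\<close>

section \<open>Calculus on coordinate space\<close>

text \<open>Derivations on germs form a finite-dimensional space by Hadamard's lemma; this is what
  makes every covector a differential. The charts of \<Sigma> are prescribed by a universal
  property, so the work lies in showing that enough charts have it: each is built together with a
  smooth section of \<open>q\<close> in its coordinates, and such sections also carry the descent.
  The dimension of \<Sigma> is a truncated difference, which forces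
  \<open>mdim P = mdim M + mdim Gm\<close> to be derived from a diffeomorphism. For Poisson fibres
  the obstacle is to lift a covector of the fibre to \<Sigma> so that its image under the bivector
  is tangent to the fibre. The contribution of \<open>\<pi>X\<close> is always tangent. That of
  \<open>\<pi>P\<close> is tangent if the lift pulls back along the orbit map to the covector that
  the Poisson-Dirac condition on the fibre of \<open>P\<close> provides. The lift is therefore
  prescribed on the fibre of \<Sigma> by the given covector and along a local section of
  \<open>P\<close> by the provided one. For pencils, \<open>\<pi>X\<close> joins the vertical
  summand because \<open>x \<mapsto> [y, x]\<close> stays in one fibre.\<close>

abbreviation E :: "nat \<Rightarrow> (nat \<Rightarrow> real) set" where
  "E n \<equiv> topspace (Euclidean_space n)"

lemma E_iff: "x \<in> E n \<longleftrightarrow> (\<forall>i\<ge>n. x i = 0)"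
  by (simp add: topspace_Euclidean_space)

lemma subtopology_E:
  assumes "U \<subseteq> E n"
  shows "subtopology (Euclidean_space n) U = top_of_set U"
proof -
  have "{x. \<forall>i\<ge>n. x i = 0} \<inter> U = U" using assms by (auto simp: topspace_Euclidean_space)
  then show ?thesis
    by (simp add: Euclidean_space_def subtopology_subtopology euclidean_product_topology)
qed

lemma openin_E_iff: "openin (Euclidean_space n) U \<longleftrightarrow> (\<exists>V. open V \<and> U = E n \<inter> V)"
  by (auto simp: Euclidean_space_def topspace_Euclidean_space euclidean_product_topology openin_open)

lemma E_upd: "x \<in> E n \<Longrightarrow> i < n \<Longrightarrow> x(i := t) \<in> E n"
  by (auto simp: E_iff)

lemma openE_subset: "openin (Euclidean_space n) U \<Longrightarrow> U \<subseteq> E n"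
  by (rule openin_subset)

lemma continuous_map_E_iff:
  assumes "U \<subseteq> E n"
  shows "continuous_map (subtopology (Euclidean_space n) U) euclideanreal f \<longleftrightarrow> continuous_on U f"
  by (simp add: subtopology_E[OF assms])

text \<open>The ambient product topology has infinitely many coordinates, but two points of
  \<open>E n\<close> agree from index \<open>n\<close> on, so only \<open>n\<close> radii matter.
  This turns openness into a usable statement with one radius.\<close>

lemma openE_box:
  assumes "openin (Euclidean_space n) U" "x \<in> U"
  obtains e where "e > 0" "\<And>y. y \<in> E n \<Longrightarrow> (\<And>i. i < n \<Longrightarrow> \<bar>y i - x i\<bar> < e) \<Longrightarrow> y \<in> U"
proof -
  obtain V where V: "openin (powertop_real UNIV) V" "U = V \<inter> E n"
    using assms(1) unfolding Euclidean_space_def openin_subtopology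
    by (auto simp: topspace_Euclidean_space)
  then have "x \<in> V" using assms(2) by auto
  from product_topology_open_contains_basis[OF V(1) this] obtain X where
    X: "x \<in> (\<Pi>\<^sub>E i\<in>UNIV. X i)" "\<And>i. open (X i)" "(\<Pi>\<^sub>E i\<in>UNIV. X i) \<subseteq> V"
    by auto
  have "\<exists>d>0. ball (x i) d \<subseteq> X i" for i
    using X(1,2) open_contains_ball by (metis PiE_mem UNIV_I)
  then obtain d where d: "\<And>i. d i > 0" "\<And>i. ball (x i) (d i) \<subseteq> X i" by metis
  \<comment> \<open>The inserted \<open>1\<close> keeps the minimum defined and positive when
    \<open>n = 0\<close>.\<close>
  define e where "e = Min (insert 1 (d ` {..<n}))"
  have e: "e > 0" "\<And>i. i < n \<Longrightarrow> e \<le> d i"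
    unfolding e_def using d(1) by (auto simp: Min_gr_iff)
  show thesis
  proof (rule that[OF e(1)])
    fix y assume y: "y \<in> E n" "\<And>i. i < n \<Longrightarrow> \<bar>y i - x i\<bar> < e"
    have "y i \<in> X i" for i
    proof (cases "i < n")
      case True
      then have "y i \<in> ball (x i) (d i)" using y(2)[OF True] e(2)[OF True] by (simp add: dist_real_def)
      then show ?thesis using d(2) by blast
    next
      case False
      then have "y i = x i" using y(1) assms openE_subset[OF assms(1)] by (auto simp: E_iff subset_iff)
      then show ?thesis using X(1) by (metis PiE_mem UNIV_I)
    qed
    then show "y \<in> U" using V(2) X(3) y(1) by (auto simp: PiE_def)
  qed
qed

lemma openE_boxI:
  "openin (Euclidean_space n) {y \<in> E n. \<forall>i<n. \<bar>y i - a i\<bar> < (e::real)}"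
proof -
  have "open {y. \<bar>y i - a i\<bar> < e}" for i :: nat
    by (intro open_Collect_less continuous_intros continuous_on_product_coordinates)
  then have "open (\<Inter>i<n. {y. \<bar>y i - a i\<bar> < e})" by (intro open_INT) auto
  moreover have "{y \<in> E n. \<forall>i<n. \<bar>y i - a i\<bar> < e} = E n \<inter> (\<Inter>i<n. {y. \<bar>y i - a i\<bar> < e})" by auto
  ultimately show ?thesis unfolding openin_E_iff by blast
qed

lemma openE_line:
  assumes "openin (Euclidean_space n) U" "x \<in> U" "i < n"
  shows "\<exists>e>0. \<forall>t. \<bar>t - x i\<bar> < e \<longrightarrow> x(i := t) \<in> U"
proof -
  obtain e where e: "e > 0" "\<And>y. y \<in> E n \<Longrightarrow> (\<And>i. i < n \<Longrightarrow> \<bar>y i - x i\<bar> < e) \<Longrightarrow> y \<in> U"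
    using openE_box[OF assms(1,2)] by blast
  have "x \<in> E n" using assms openE_subset by blast
  then show ?thesis using e assms(3) by (intro exI[of _ e]) (auto intro!: e(2) E_upd)
qed

lemma eventually_openE_line:
  assumes "openin (Euclidean_space n) U" "x \<in> U" "i < n"
  shows "eventually (\<lambda>t. x(i := t) \<in> U) (nhds (x i))"
  using openE_line[OF assms] unfolding eventually_nhds_metric by (auto simp: dist_real_def)

lemma continuous_on_E_eps:
  assumes "openin (Euclidean_space n) U" "x \<in> U" "continuous_on U f" "e > 0"
  obtains d where "d > 0"
    "\<And>y. y \<in> E n \<Longrightarrow> (\<And>i. i < n \<Longrightarrow> \<bar>y i - x i\<bar> < d) \<Longrightarrow> y \<in> U \<and> \<bar>f y - f x\<bar> < (e::real)"
proof -
  have "openin (top_of_set U) (U \<inter> f -` ball (f x) e)"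
    using assms(3) continuous_openin_preimage_gen open_ball by blast
  moreover have "top_of_set U = subtopology (Euclidean_space n) U"
    by (rule subtopology_E[OF openE_subset[OF assms(1)], symmetric])
  ultimately have "openin (Euclidean_space n) (U \<inter> f -` ball (f x) e)"
    using assms(1) by (simp add: openin_open_subtopology)
  moreover have "x \<in> U \<inter> f -` ball (f x) e" using assms by auto
  ultimately obtain d where "d > 0" "\<And>y. y \<in> E n \<Longrightarrow> (\<And>i. i < n \<Longrightarrow> \<bar>y i - x i\<bar> < d) \<Longrightarrow> y \<in> U \<inter> f -` ball (f x) e"
    using openE_box by blast
  then show thesis by (intro that[of d]) (auto simp: dist_real_def abs_minus_commute)
qed

lemma continuous_on_E_local:
  assumes "\<And>x. x \<in> U \<Longrightarrow> \<exists>V. openin (Euclidean_space n) V \<and> x \<in> V \<and> V \<subseteq> U \<and> continuous_on V f"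
  shows "continuous_on U f"
  unfolding continuous_on_eq_continuous_within
proof
  fix x assume "x \<in> U"
  then obtain V where V: "openin (Euclidean_space n) V" "x \<in> V" "V \<subseteq> U" "continuous_on V f"
    using assms by blast
  obtain O' where O': "open O'" "V = E n \<inter> O'"
    using V(1) unfolding openin_E_iff by blast
  have "U \<subseteq> E n" using assms openE_subset by blast
  then have "at x within V = at x within U"
    using O' V(2,3) by (intro at_within_nhd[of x O']) auto
  then show "continuous (at x within U) f"
    using V(2,4) by (metis continuous_on_eq_continuous_within)
qed

section \<open>Locality and algebra of functions of class C^k\<close>

lemma Ck_on_cont: "Ck_on k n U f \<Longrightarrow> U \<subseteq> E n \<Longrightarrow> continuous_on U f"
  by (cases k) (simp_all add: continuous_map_E_iff)

lemma partial_cong: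
  assumes "openin (Euclidean_space n) U" "x \<in> U" "i < n" "\<And>y. y \<in> U \<Longrightarrow> f y = g y"
  shows "partial i f x = partial i g x"
  unfolding partial_def
  by (rule deriv_cong_ev) (use eventually_openE_line[OF assms(1-3)] assms(4) in \<open>auto elim: eventually_mono\<close>)

lemma field_differentiable_line_cong:
  assumes "openin (Euclidean_space n) U" "x \<in> U" "i < n" "\<And>y. y \<in> U \<Longrightarrow> f y = g y"
    and "(\<lambda>t. f (x(i := t))) field_differentiable at (x i)"
  shows "(\<lambda>t. g (x(i := t))) field_differentiable at (x i)"
proof -
  have "eventually (\<lambda>t. f (x(i := t)) = g (x(i := t))) (nhds (x i))"
    using eventually_openE_line[OF assms(1-3)] assms(4) by (auto elim: eventually_mono)
  from DERIV_cong_ev[OF refl this refl] show ?thesis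
    using assms(5) unfolding field_differentiable_def by blast
qed

lemma Ck_on_SucI:
  assumes "U \<subseteq> E n" "continuous_on U f"
    and "\<And>i x. i < n \<Longrightarrow> x \<in> U \<Longrightarrow> (\<lambda>t. f (x(i := t))) field_differentiable at (x i)"
    and "\<And>i. i < n \<Longrightarrow> Ck_on k n U (partial i f)"
  shows "Ck_on (Suc k) n U f"
  using assms(2-4) by (simp add: continuous_map_E_iff[OF assms(1)])

lemma Ck_on_Suc_diff:
  "Ck_on (Suc k) n U f \<Longrightarrow> i < n \<Longrightarrow> x \<in> U \<Longrightarrow> (\<lambda>t. f (x(i := t))) field_differentiable at (x i)"
  by simp

lemma Ck_on_Suc_partial: "Ck_on (Suc k) n U f \<Longrightarrow> i < n \<Longrightarrow> Ck_on k n U (partial i f)"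
  by simp

text \<open>\<open>partial\<close> evaluates a function along whole coordinate lines, which may
  leave \<open>U\<close>. Openness of \<open>U\<close> makes the part of the line near the point
  stay inside, and a derivative sees only that part.\<close>

lemma Ck_on_cong:
  assumes "openin (Euclidean_space n) U" "\<And>y. y \<in> U \<Longrightarrow> f y = g y" "Ck_on k n U f"
  shows "Ck_on k n U g"
  using assms(2,3)
proof (induction k arbitrary: f g)
  case 0
  have "continuous_on U f" using "0.prems"(2) openE_subset[OF assms(1)] by (rule Ck_on_cont)
  then have "continuous_on U g"
    by (rule continuous_on_eq) (rule "0.prems"(1))
  then show ?case using continuous_map_E_iff[OF openE_subset[OF assms(1)]] by simp
next
  case (Suc k)
  show ?case
  proof (rule Ck_on_SucI)
    show "U \<subseteq> E n" by (rule openE_subset[OF assms(1)])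
    have "continuous_on U f" using Suc.prems(2) openE_subset[OF assms(1)] by (rule Ck_on_cont)
    then show "continuous_on U g" by (rule continuous_on_eq) (rule Suc.prems(1))
    fix i assume i: "i < n"
    show "(\<lambda>t. g (x(i := t))) field_differentiable at (x i)" if "x \<in> U" for x
      by (rule field_differentiable_line_cong[OF assms(1) that i Suc.prems(1) Ck_on_Suc_diff[OF Suc.prems(2) i that]])
    show "Ck_on k n U (partial i g)"
      by (rule Suc.IH[OF partial_cong[OF assms(1) _ i Suc.prems(1)] Ck_on_Suc_partial[OF Suc.prems(2) i]])
  qed
qed

lemma Ck_on_SucD: "Ck_on (Suc k) n U f \<Longrightarrow> Ck_on k n U f"
  by (induction k arbitrary: f) auto

lemma Ck_on_subset:
  assumes "V \<subseteq> U" "Ck_on k n U f"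
  shows "Ck_on k n V f"
  using assms(2)
proof (induction k arbitrary: f)
  case 0
  then show ?case using assms(1) continuous_map_from_subtopology_mono by (metis Ck_on.simps(1))
next
  case (Suc k)
  have "continuous_map (subtopology (Euclidean_space n) V) euclideanreal f"
    using Suc.prems assms(1) continuous_map_from_subtopology_mono by (metis Ck_on.simps(2))
  moreover have "Ck_on k n V (partial i f)" if "i < n" for i
    by (rule Suc.IH[OF Ck_on_Suc_partial[OF Suc.prems that]])
  ultimately show ?case using Ck_on_Suc_diff[OF Suc.prems] assms(1) unfolding Ck_on.simps by blast
qed

lemma Ck_on_local:
  assumes "\<And>x. x \<in> U \<Longrightarrow> \<exists>V. openin (Euclidean_space n) V \<and> x \<in> V \<and> V \<subseteq> U \<and> Ck_on k n V f"
  shows "Ck_on k n U f"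
proof -
  have U: "U \<subseteq> E n" using assms openE_subset by blast
  show ?thesis using assms
  proof (induction k arbitrary: f)
    case 0
    have "continuous_on U f"
      by (rule continuous_on_E_local[where n=n]) (use "0.prems" Ck_on_cont openE_subset in meson)
    then show ?case using U by (simp add: continuous_map_E_iff)
  next
    case (Suc k)
    show ?case
    proof (rule Ck_on_SucI[OF U])
      show "continuous_on U f"
        by (rule continuous_on_E_local[where n=n]) (use Suc.prems Ck_on_cont openE_subset in meson)
      fix i assume i: "i < n"
      show "Ck_on k n U (partial i f)"
        by (rule Suc.IH) (use Suc.prems Ck_on_Suc_partial i in meson)
      show "(\<lambda>t. f (x(i := t))) field_differentiable at (x i)" if "x \<in> U" for x
        using Suc.prems[OF that] Ck_on_Suc_diff[OF _ i] by meson
    qed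
  qed
qed

lemma Ck_on_const: "U \<subseteq> E n \<Longrightarrow> Ck_on k n U (\<lambda>x. c)"
proof (induction k arbitrary: c)
  case (Suc k)
  have "partial i (\<lambda>x. c) = (\<lambda>x. 0)" for i by (auto simp: partial_def fun_eq_iff)
  then show ?case using Suc by simp
qed simp

lemma partial_coord: "partial i (\<lambda>x. x j) = (\<lambda>x. if i = j then 1 else 0)"
  by (auto simp: partial_def fun_eq_iff)

lemma Ck_on_coord:
  assumes "U \<subseteq> E n"
  shows "Ck_on k n U (\<lambda>x. x j)"
proof -
  have c: "continuous_on U (\<lambda>x. x j)"
    by (rule continuous_on_subset[OF continuous_on_product_coordinates]) auto
  show ?thesis
  proof (cases k)
    case (Suc m)
    have "(\<lambda>t. (x(i := t)) j) field_differentiable at (x i)" for x :: "nat \<Rightarrow> real" and i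
      by (cases "i = j") simp_all
    then show ?thesis unfolding Suc
      by (intro Ck_on_SucI[OF assms c]) (simp_all add: partial_coord Ck_on_const[OF assms])
  qed (use assms c in \<open>simp add: continuous_map_E_iff\<close>)
qed

lemma partial_add:
  assumes "(\<lambda>t. f (x(i := t))) field_differentiable at (x i)"
    "(\<lambda>t. g (x(i := t))) field_differentiable at (x i)"
  shows "partial i (\<lambda>x. f x + g x) x = partial i f x + partial i g x"
  unfolding partial_def using assms by (rule deriv_add)

lemma partial_mult:
  assumes "(\<lambda>t. f (x(i := t))) field_differentiable at (x i)"
    "(\<lambda>t. g (x(i := t))) field_differentiable at (x i)"
  shows "partial i (\<lambda>x. f x * g x) x = f x * partial i g x + partial i f x * g x"
  unfolding partial_def using deriv_mult[OF assms] by simp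

lemma Ck_on_add:
  assumes "openin (Euclidean_space n) U" "Ck_on k n U f" "Ck_on k n U g"
  shows "Ck_on k n U (\<lambda>x. f x + g x)"
  using assms(2,3)
proof (induction k arbitrary: f g)
  case 0
  then show ?case by (simp add: continuous_map_add)
next
  case (Suc k)
  note D = Ck_on_Suc_diff[OF Suc.prems(1)] Ck_on_Suc_diff[OF Suc.prems(2)]
  show ?case
  proof (rule Ck_on_SucI[OF openE_subset[OF assms(1)]])
    show "continuous_on U (\<lambda>x. f x + g x)"
      using Suc.prems openE_subset[OF assms(1)] by (intro continuous_on_add Ck_on_cont)
    fix i assume i: "i < n"
    show "(\<lambda>t. f (x(i := t)) + g (x(i := t))) field_differentiable at (x i)" if "x \<in> U" for x
      by (intro field_differentiable_add D i that)
    show "Ck_on k n U (partial i (\<lambda>x. f x + g x))"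
      by (rule Ck_on_cong[OF assms(1) partial_add[symmetric] Suc.IH])
        (use Ck_on_Suc_partial Suc.prems D i in blast)+
  qed
qed

lemma Ck_on_mult:
  assumes "openin (Euclidean_space n) U" "Ck_on k n U f" "Ck_on k n U g"
  shows "Ck_on k n U (\<lambda>x. f x * g x)"
  using assms(2,3)
proof (induction k arbitrary: f g)
  case 0
  then show ?case by (simp add: continuous_map_real_mult)
next
  case (Suc k)
  note D = Ck_on_Suc_diff[OF Suc.prems(1)] Ck_on_Suc_diff[OF Suc.prems(2)]
  show ?case
  proof (rule Ck_on_SucI[OF openE_subset[OF assms(1)]])
    show "continuous_on U (\<lambda>x. f x * g x)"
      using Suc.prems openE_subset[OF assms(1)] by (intro continuous_on_mult Ck_on_cont)
    fix i assume i: "i < n"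
    show "(\<lambda>t. f (x(i := t)) * g (x(i := t))) field_differentiable at (x i)" if "x \<in> U" for x
      by (intro field_differentiable_mult D i that)
    show "Ck_on k n U (partial i (\<lambda>x. f x * g x))"
    proof (rule Ck_on_cong[OF assms(1) partial_mult[symmetric]])
      show "Ck_on k n U (\<lambda>x. f x * partial i g x + partial i f x * g x)"
        using Suc.prems[THEN Ck_on_SucD] Suc.prems[THEN Ck_on_Suc_partial, OF i]
        by (intro Ck_on_add[OF assms(1)] Suc.IH)
    qed (use D i in blast)+
  qed
qed

lemma Ck_on_sum:
  assumes "openin (Euclidean_space n) U" "\<And>j. j \<in> A \<Longrightarrow> Ck_on k n U (f j)"
  shows "Ck_on k n U (\<lambda>x. \<Sum>j\<in>A. f j x)"
  using assms(2)
proof (induction A rule: infinite_finite_induct)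
  case (insert a A)
  then show ?case
    using Ck_on_add[OF assms(1), of k "f a" "\<lambda>x. \<Sum>j\<in>A. f j x"] by simp
qed (simp_all add: Ck_on_const[OF openE_subset[OF assms(1)]])

text \<open>Along a curve with differentiable coordinates the increment of \<open>f\<close> telescopes over the
  coordinates, and the mean value theorem applies to each summand.\<close>

lemma chain_curve:
  assumes U: "openin (Euclidean_space n) U" and c0: "c t0 \<in> U"
    and f1: "\<And>i x. i < n \<Longrightarrow> x \<in> U \<Longrightarrow> (\<lambda>t. f (x(i := t))) field_differentiable at (x i)"
    and f2: "\<And>i. i < n \<Longrightarrow> continuous_on U (partial i f)"
    and cE: "eventually (\<lambda>t. c t \<in> E n) (nhds t0)"
    and c': "\<And>i. i < n \<Longrightarrow> ((\<lambda>t. c t i) has_field_derivative c' i) (at t0)"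
  shows "((\<lambda>t. f (c t)) has_field_derivative (\<Sum>i<n. partial i f (c t0) * c' i)) (at t0)"
proof -
  define x where "x = c t0"
  have xE: "x \<in> E n" "x \<in> U" using c0 openE_subset[OF U] by (auto simp: x_def)
  define z where "z k t = (\<lambda>i. if i < k then c t i else x i)" for k :: nat and t :: real
  have zSuc: "z (Suc k) t = (z k t)(k := c t k)" for k t by (auto simp: z_def less_Suc_eq)
  have z_id: "z k t k = x k" for k t by (auto simp: z_def)
  have zE: "z k t \<in> E n" if "k \<le> n" for k t using xE that by (auto simp: z_def E_iff)
  have near: "eventually (\<lambda>t. \<forall>i<n. \<bar>c t i - x i\<bar> < d) (nhds t0)" if "d > 0" for d
  proof -
    have "eventually (\<lambda>t. \<bar>c t i - x i\<bar> < d) (nhds t0)" if "i < n" for i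
    proof -
      have "isCont (\<lambda>t. c t i) t0" using c'[OF that] DERIV_isCont by blast
      then have "((\<lambda>t. c t i) \<longlongrightarrow> c t0 i) (nhds t0)" unfolding isCont_def using tendsto_at_iff_tendsto_nhds[of "\<lambda>t. c t i" t0] by simp
      then show ?thesis using tendstoD[OF _ \<open>d > 0\<close>] by (fastforce simp: dist_real_def x_def)
    qed
    then have "eventually (\<lambda>t. \<forall>i\<in>{..<n}. \<bar>c t i - x i\<bar> < d) (nhds t0)"
      by (intro eventually_ball_finite) auto
    then show ?thesis by (rule eventually_mono) auto
  qed
  have step: "((\<lambda>t. f (z (Suc k) t) - f (z k t)) has_field_derivative partial k f x * c' k) (at t0)"
    if k: "k < n" for k
  proof -
    \<comment> \<open>Caratheodory's form of the derivative: the difference quotient in the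
      \<open>k\<close>-th coordinate, completed by its expected limit. The increment then equals
      \<open>A t * (c t k - x k)\<close> also where the curve returns to \<open>x k\<close>, and
      only continuity of \<open>A\<close> at \<open>t0\<close> remains to be shown.\<close>
    define A where "A t = (if c t k = x k then partial k f x
        else (f (z (Suc k) t) - f (z k t)) / (c t k - x k))" for t
    have A: "f (z (Suc k) t) - f (z k t) = A t * (c t k - x k)" for t
      by (auto simp: A_def zSuc z_id[of k t, symmetric] simp del: fun_upd_apply)
    have "(A \<longlongrightarrow> partial k f x) (nhds t0)"
    proof (rule tendstoI)
      fix e :: real assume "e > 0"
      obtain d where d: "d > 0" "\<And>y. y \<in> E n \<Longrightarrow> (\<And>i. i < n \<Longrightarrow> \<bar>y i - x i\<bar> < d) \<Longrightarrow>
          y \<in> U \<and> \<bar>partial k f y - partial k f x\<bar> < e"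
        using continuous_on_E_eps[OF U xE(2) f2[OF k] \<open>e > 0\<close>] by blast
      have "dist (A t) (partial k f x) < e" if t: "\<forall>i<n. \<bar>c t i - x i\<bar> < d" for t
      proof (cases "c t k = x k")
        case True
        then show ?thesis using \<open>e > 0\<close> by (simp add: A_def)
      next
        case False
        define F where "F s = f ((z k t)(k := s))" for s
        have ball: "(z k t)(k := s) \<in> U \<and> \<bar>partial k f ((z k t)(k := s)) - partial k f x\<bar> < e"
          if "\<bar>s - x k\<bar> < d" for s
          by (rule d(2)) (use zE[of k t] k t that d(1) in \<open>auto simp: E_upd z_def\<close>)
        have "(F has_field_derivative partial k f ((z k t)(k := s))) (at s)" if "\<bar>s - x k\<bar> < d" for s
          using f1[OF k conjunct1[OF ball[OF that]]]
          unfolding F_def partial_def by (simp add: DERIV_deriv_iff_field_differentiable)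
        moreover have "\<bar>s - x k\<bar> < d" if "s \<in> closed_segment (x k) (c t k)" for s
          using that t k by (auto simp: closed_segment_eq_real_ivl split: if_splits)
        ultimately obtain s where s: "\<bar>s - x k\<bar> < d" "F (c t k) - F (x k) = (c t k - x k) * partial k f ((z k t)(k := s))"
        proof -
          assume D: "\<And>s. \<bar>s - x k\<bar> < d \<Longrightarrow> (F has_field_derivative partial k f ((z k t)(k := s))) (at s)"
            and B: "\<And>s. s \<in> closed_segment (x k) (c t k) \<Longrightarrow> \<bar>s - x k\<bar> < d"
          consider "x k < c t k" | "c t k < x k" using False by linarith
          then show thesis
          proof cases
            case 1
            have "(F has_field_derivative partial k f ((z k t)(k := s))) (at s)"
              if "x k \<le> s" "s \<le> c t k" for s using D B that 1 by (auto simp: closed_segment_eq_real_ivl)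
            from MVT2[OF 1 this] obtain s where "x k < s" "s < c t k"
              "F (c t k) - F (x k) = (c t k - x k) * partial k f ((z k t)(k := s))" by blast
            then show thesis using that[of s] B[of s] 1 by (auto simp: closed_segment_eq_real_ivl)
          next
            case 2
            have "(F has_field_derivative partial k f ((z k t)(k := s))) (at s)"
              if "c t k \<le> s" "s \<le> x k" for s using D B that 2 by (auto simp: closed_segment_eq_real_ivl)
            from MVT2[OF 2 this] obtain s where "c t k < s" "s < x k"
              "F (x k) - F (c t k) = (x k - c t k) * partial k f ((z k t)(k := s))" by blast
            then show thesis using that[of s] B[of s] 2 by (auto simp: closed_segment_eq_real_ivl algebra_simps)
          qed
        qed
        have "F (x k) = f (z k t)" unfolding F_def by (simp add: z_id[of k t, symmetric])
        then have "A t = partial k f ((z k t)(k := s))"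
          using s(2) False by (simp add: A_def zSuc F_def)
        then show ?thesis using ball[OF s(1)] by (simp add: dist_real_def)
      qed
      then show "eventually (\<lambda>t. dist (A t) (partial k f x) < e) (nhds t0)"
        using near[OF d(1)] by (auto elim: eventually_mono)
    qed
    moreover have "A t0 = partial k f x" by (simp add: A_def x_def)
    ultimately have Ac: "isCont A t0"
      by (simp add: isCont_def tendsto_nhds_iff)
    \<comment> \<open>\<open>A\<close> is only continuous at \<open>t0\<close>, so the product rule
      does not apply; the second factor vanishes at \<open>t0\<close>, and the difference quotient
      is computed directly.\<close>
    have "((\<lambda>t. (A t * (c t k - x k) - A t0 * (c t0 k - x k)) / (t - t0)) \<longlongrightarrow> A t0 * c' k) (at t0)"
    proof -
      have "((\<lambda>t. (c t k - c t0 k) / (t - t0)) \<longlongrightarrow> c' k) (at t0)"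
        using c'[OF k] by (simp add: has_field_derivative_iff)
      from tendsto_mult[OF Ac[unfolded isCont_def] this]
      show ?thesis by (simp add: x_def)
    qed
    then have "((\<lambda>t. A t * (c t k - x k)) has_field_derivative A t0 * c' k) (at t0)"
      by (simp add: has_field_derivative_iff)
    then show ?thesis by (simp add: A \<open>A t0 = partial k f x\<close>)
  qed
  have "((\<lambda>t. f (z k t)) has_field_derivative (\<Sum>i<k. partial i f x * c' i)) (at t0)" if "k \<le> n" for k
    using that
  proof (induction k)
    case 0
    then show ?case by (simp add: z_def)
  next
    case (Suc k)
    then have "((\<lambda>t. f (z k t) + (f (z (Suc k) t) - f (z k t))) has_field_derivative
        ((\<Sum>i<k. partial i f x * c' i) + partial k f x * c' k)) (at t0)"
      by (intro DERIV_add step) auto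
    then show ?case by simp
  qed
  from this[of n] have "((\<lambda>t. f (z n t)) has_field_derivative (\<Sum>i<n. partial i f x * c' i)) (at t0)" by simp
  moreover have *: "eventually (\<lambda>t. f (z n t) = f (c t)) (nhds t0)"
  proof (rule eventually_mono[OF cE])
    fix t assume "c t \<in> E n"
    then have "z n t = c t" using xE by (auto simp: z_def E_iff fun_eq_iff)
    then show "f (z n t) = f (c t)" by simp
  qed
  ultimately show ?thesis unfolding x_def using DERIV_cong_ev[OF refl * refl] by blast
qed

lemma chain_curve_C1:
  assumes U: "openin (Euclidean_space n) U" and c0: "c t0 \<in> U"
    and f: "Ck_on (Suc k) n U f"
    and cE: "eventually (\<lambda>t. c t \<in> E n) (nhds t0)"
    and c': "\<And>i. i < n \<Longrightarrow> ((\<lambda>t. c t i) has_field_derivative c' i) (at t0)"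
  shows "((\<lambda>t. f (c t)) has_field_derivative (\<Sum>i<n. partial i f (c t0) * c' i)) (at t0)"
proof (rule chain_curve[OF U c0 _ _ cE c'])
  show "continuous_on U (partial i f)" if "i < n" for i
    by (rule Ck_on_cont[OF Ck_on_Suc_partial[OF f that] openE_subset[OF U]])
qed (use Ck_on_Suc_diff[OF f] in blast)

text \<open>Induction on the order: by the chain rule a partial derivative of the composite is a sum
  of products of a partial derivative of \<open>f\<close> composed with \<open>g\<close>, which the
  induction hypothesis covers, and a partial derivative of a component of \<open>g\<close>.\<close>

lemma Ck_on_compose:
  assumes U: "openin (Euclidean_space n) U" and V: "openin (Euclidean_space m) V"
    and gV: "\<And>x. x \<in> U \<Longrightarrow> g x \<in> V"
    and g: "\<And>j. j < m \<Longrightarrow> Ck_on k n U (\<lambda>x. g x j)" and f: "Ck_on k m V f"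
  shows "Ck_on k n U (\<lambda>x. f (g x))"
  using g f
proof (induction k arbitrary: f)
  case (0 f)
  note UE = openE_subset[OF U] and VE = openE_subset[OF V]
  have "continuous_on U g"
  proof (rule continuous_on_coordinatewise_then_product)
    fix j
    show "continuous_on U (\<lambda>x. g x j)"
    proof (cases "j < m")
      case True
      show ?thesis by (rule Ck_on_cont[OF "0.prems"(1)[OF True] UE])
    next
      case False
      then have "\<And>x. x \<in> U \<Longrightarrow> 0 = g x j" using gV VE by (force simp: E_iff)
      then show ?thesis by (rule continuous_on_eq[OF continuous_on_const])
    qed
  qed
  then have "continuous_on U (\<lambda>x. f (g x))"
    by (rule continuous_on_compose2[OF Ck_on_cont[OF "0.prems"(2) VE]]) (use gV in blast)
  then show ?case by (simp add: continuous_map_E_iff[OF UE])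
next
  case (Suc k f)
  note UE = openE_subset[OF U] and VE = openE_subset[OF V]
  have gk: "\<And>j. j < m \<Longrightarrow> Ck_on k n U (\<lambda>x. g x j)" using Suc.prems(1) Ck_on_SucD by blast
  have comp: "Ck_on k n U (\<lambda>x. h (g x))" if "Ck_on k m V h" for h
    by (rule Suc.IH[OF gk that])
  have D: "((\<lambda>t. f (g (x(i := t)))) has_field_derivative
      (\<Sum>j<m. partial j f (g x) * partial i (\<lambda>x. g x j) x)) (at (x i))" if x: "x \<in> U" and i: "i < n" for x i
  proof -
    have "((\<lambda>t. f (g (x(i := t)))) has_field_derivative
        (\<Sum>j<m. partial j f (g (x(i := x i))) * partial i (\<lambda>x. g x j) x)) (at (x i))"
    proof (rule chain_curve_C1[OF V _ Suc.prems(2)])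
      show "g (x(i := x i)) \<in> V" using gV x by simp
      show "eventually (\<lambda>t. g (x(i := t)) \<in> E m) (nhds (x i))"
        by (rule eventually_mono[OF eventually_openE_line[OF U x i]]) (use gV VE in blast)
      show "((\<lambda>t. g (x(i := t)) j) has_field_derivative partial i (\<lambda>x. g x j) x) (at (x i))" if "j < m" for j
        using Ck_on_Suc_diff[OF Suc.prems(1)[OF that] i x]
        unfolding partial_def by (simp add: DERIV_deriv_iff_field_differentiable del: fun_upd_apply)
    qed
    then show ?thesis by simp
  qed
  show ?case
  proof (rule Ck_on_SucI[OF UE])
    show "continuous_on U (\<lambda>x. f (g x))"
      by (rule Ck_on_cont[OF comp[OF Ck_on_SucD[OF Suc.prems(2)]] UE])
    fix i assume i: "i < n"
    show "(\<lambda>t. f (g (x(i := t)))) field_differentiable at (x i)" if "x \<in> U" for x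
      using D[OF that i] unfolding field_differentiable_def by blast
    show "Ck_on k n U (partial i (\<lambda>x. f (g x)))"
    proof (rule Ck_on_cong[OF U])
      show "Ck_on k n U (\<lambda>x. \<Sum>j<m. partial j f (g x) * partial i (\<lambda>x. g x j) x)"
      proof (rule Ck_on_sum[OF U])
        fix j assume "j \<in> {..<m}"
        then have j: "j < m" by simp
        show "Ck_on k n U (\<lambda>x. partial j f (g x) * partial i (\<lambda>x. g x j) x)"
          by (rule Ck_on_mult[OF U comp[OF Ck_on_Suc_partial[OF Suc.prems(2) j]]
                Ck_on_Suc_partial[OF Suc.prems(1)[OF j] i]])
      qed
      show "(\<Sum>j<m. partial j f (g x) * partial i (\<lambda>x. g x j) x) = partial i (\<lambda>x. f (g x)) x"
        if "x \<in> U" for x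
        unfolding partial_def[of i "\<lambda>x. f (g x)"] by (rule DERIV_imp_deriv[OF D[OF that i], symmetric])
    qed
  qed
qed

section \<open>Smooth functions: the closure properties for all orders at once\<close>

lemma Cinf_on_partial: "Cinf_on n U f \<Longrightarrow> i < n \<Longrightarrow> Cinf_on n U (partial i f)"
  unfolding Cinf_on_def using Ck_on_Suc_partial by blast

lemma Cinf_on_diff:
  "Cinf_on n U f \<Longrightarrow> i < n \<Longrightarrow> x \<in> U \<Longrightarrow> (\<lambda>t. f (x(i := t))) field_differentiable at (x i)"
  by (rule Ck_on_Suc_diff[of 0]) (simp_all only: Cinf_on_def)

lemma Cinf_on_cont: "Cinf_on n U f \<Longrightarrow> U \<subseteq> E n \<Longrightarrow> continuous_on U f"
  unfolding Cinf_on_def using Ck_on_cont by blast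

lemma Cinf_on_cong:
  "openin (Euclidean_space n) U \<Longrightarrow> (\<And>y. y \<in> U \<Longrightarrow> f y = g y) \<Longrightarrow> Cinf_on n U f \<Longrightarrow> Cinf_on n U g"
  unfolding Cinf_on_def using Ck_on_cong by blast

lemma Cinf_on_subset: "V \<subseteq> U \<Longrightarrow> Cinf_on n U f \<Longrightarrow> Cinf_on n V f"
  unfolding Cinf_on_def using Ck_on_subset by blast

lemma Cinf_on_local:
  "(\<And>x. x \<in> U \<Longrightarrow> \<exists>V. openin (Euclidean_space n) V \<and> x \<in> V \<and> V \<subseteq> U \<and> Cinf_on n V f) \<Longrightarrow> Cinf_on n U f"
  unfolding Cinf_on_def by (meson Ck_on_local)

lemma Cinf_on_const: "U \<subseteq> E n \<Longrightarrow> Cinf_on n U (\<lambda>x. c)"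
  unfolding Cinf_on_def using Ck_on_const by blast

lemma Cinf_on_coord: "U \<subseteq> E n \<Longrightarrow> Cinf_on n U (\<lambda>x. x j)"
  unfolding Cinf_on_def using Ck_on_coord by blast

lemma Cinf_on_add:
  "openin (Euclidean_space n) U \<Longrightarrow> Cinf_on n U f \<Longrightarrow> Cinf_on n U g \<Longrightarrow> Cinf_on n U (\<lambda>x. f x + g x)"
  unfolding Cinf_on_def using Ck_on_add by blast

lemma Cinf_on_mult:
  "openin (Euclidean_space n) U \<Longrightarrow> Cinf_on n U f \<Longrightarrow> Cinf_on n U g \<Longrightarrow> Cinf_on n U (\<lambda>x. f x * g x)"
  unfolding Cinf_on_def using Ck_on_mult by blast

lemma Cinf_on_compose:
  assumes "openin (Euclidean_space n) U" "openin (Euclidean_space m) V"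
    and "\<And>x. x \<in> U \<Longrightarrow> g x \<in> V" "\<And>j. j < m \<Longrightarrow> Cinf_on n U (\<lambda>x. g x j)" "Cinf_on m V f"
  shows "Cinf_on n U (\<lambda>x. f (g x))"
  unfolding Cinf_on_def
proof
  fix k
  show "Ck_on k n U (\<lambda>x. f (g x))"
    by (rule Ck_on_compose[OF assms(1-3)]) (use assms(4,5) in \<open>auto simp: Cinf_on_def\<close>)
qed

lemma partial_lin:
  assumes "Cinf_on n U f" "Cinf_on n U g" "x \<in> U" "i < n" "openin (Euclidean_space n) U"
  shows "partial i (\<lambda>x. a * f x + b * g x) x = a * partial i f x + b * partial i g x"
proof -
  note D = Cinf_on_diff[OF assms(1,4,3)] Cinf_on_diff[OF assms(2,4,3)]
  have C: "(\<lambda>t. c * h (x(i := t))) field_differentiable at (x i)"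
    "partial i (\<lambda>x. c * h x) x = c * partial i h x"
    if "(\<lambda>t. h (x(i := t))) field_differentiable at (x i)" for c h
    using that partial_mult[of "\<lambda>_. c" x i h]
    by (auto intro!: field_differentiable_mult simp: partial_def)
  show ?thesis
    by (subst partial_add) (use C D in auto)
qed

text \<open>The coefficients of Hadamard's lemma are \<open>seg_int a 0\<close> of the partial derivatives; the
  weights \<open>t ^ m\<close> make the family closed under partial differentiation.\<close>

definition seg :: "(nat \<Rightarrow> real) \<Rightarrow> (nat \<Rightarrow> real) \<Rightarrow> real \<Rightarrow> nat \<Rightarrow> real" where
  "seg a u t = (\<lambda>i. a i + t * (u i - a i))"

definition seg_int :: "(nat \<Rightarrow> real) \<Rightarrow> nat \<Rightarrow> ((nat \<Rightarrow> real) \<Rightarrow> real) \<Rightarrow> (nat \<Rightarrow> real) \<Rightarrow> real" where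
  "seg_int a m h u = integral {0..1} (\<lambda>t. t ^ m * h (seg a u t))"

lemma seg_upd: "seg a (u(j := s)) t = (seg a u t)(j := a j + t * (s - a j))"
  by (auto simp: seg_def)

lemma continuous_on_seg:
  assumes "\<And>i. continuous_on S (\<lambda>z. F z i)" "continuous_on S T"
  shows "continuous_on S (\<lambda>z. seg a (F z) (T z))"
  unfolding seg_def
  by (rule continuous_on_coordinatewise_then_product) (intro continuous_intros assms)

section \<open>Hadamard's lemma on a box, where all segments to the centre stay inside\<close>

context
  fixes n :: nat and a :: "nat \<Rightarrow> real" and e :: real and B
  assumes aE: "a \<in> E n" and e0: "e > 0"
  defines "B \<equiv> {y \<in> E n. \<forall>i<n. \<bar>y i - a i\<bar> < e}"
begin

lemma box_open: "openin (Euclidean_space n) B"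
  unfolding B_def by (rule openE_boxI)

lemma seg_in_box:
  assumes "u \<in> B" "t \<in> {0..1}"
  shows "seg a u t \<in> B"
proof -
  have "\<bar>t * (u i - a i)\<bar> < e" if "i < n" for i
  proof -
    have "\<bar>t * (u i - a i)\<bar> \<le> 1 * \<bar>u i - a i\<bar>"
      unfolding abs_mult using assms(2) by (intro mult_right_mono) auto
    also have "\<dots> < e" using assms(1) that by (simp add: B_def)
    finally show ?thesis .
  qed
  then show ?thesis using assms(1) aE by (auto simp: B_def seg_def E_iff)
qed

lemma continuous_on_seg_B:
  assumes "continuous_on B h" "\<And>i. continuous_on S (\<lambda>z. F z i)" "continuous_on S T"
    "\<And>z. z \<in> S \<Longrightarrow> F z \<in> B" "\<And>z. z \<in> S \<Longrightarrow> T z \<in> {0..1}"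
  shows "continuous_on S (\<lambda>z. T z ^ m * h (seg a (F z) (T z)))"
  by (intro continuous_on_mult continuous_on_power assms(3)
      continuous_on_compose2[OF assms(1) continuous_on_seg[OF assms(2,3)]])
    (use seg_in_box assms(4,5) in blast)

lemma continuous_on_seg_int:
  assumes "continuous_on B h"
  shows "continuous_on B (seg_int a m h)"
proof -
  have "continuous_on (B \<times> cbox 0 1) (\<lambda>z. snd z ^ m * h (seg a (fst z) (snd z)))"
    by (rule continuous_on_seg_B[OF assms])
      (auto intro!: continuous_intros continuous_on_subset[OF continuous_on_product_then_coordinatewise[OF continuous_on_fst[OF continuous_on_id]]])
  then have "continuous_on B (\<lambda>u. integral (cbox 0 1) (\<lambda>t. t ^ m * h (seg a u t)))"
    by (intro integral_continuous_on_param) (simp add: split_beta)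
  then show ?thesis by (simp add: seg_int_def[abs_def])
qed

text \<open>Differentiation under the integral sign. Moving the \<open>j\<close>-th coordinate of
  the end point by \<open>s\<close> moves the point at time \<open>t\<close> by
  \<open>t * s\<close>; this inner derivative is the factor that raises the weight.\<close>

lemma seg_int_deriv:
  assumes h: "Ck_on (Suc k) n B h" and u: "u \<in> B" and j: "j < n"
  shows "((\<lambda>s. seg_int a m h (u(j := s))) has_field_derivative seg_int a (Suc m) (partial j h) u) (at (u j))"
proof -
  note BE = openE_subset[OF box_open]
  \<comment> \<open>The values of the \<open>j\<close>-th coordinate for which the point stays in
    the box. The Leibniz rule wants a convex set of parameters, and openness turns the derivative
    within \<open>J\<close> into an ordinary one.\<close>
  define J where "J = {s. \<bar>s - a j\<bar> < e}"
  have J: "u j \<in> J" "open J" "convex J"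
  proof -
    have "J = ball (a j) e" by (auto simp: J_def dist_real_def)
    then show "open J" "convex J" by auto
    show "u j \<in> J" using u j by (simp add: J_def B_def)
  qed
  have uB: "u(j := s) \<in> B" if "s \<in> J" for s
    using u j that by (auto simp: B_def J_def E_iff)
  have cont: "continuous_on (J \<times> cbox 0 1) (\<lambda>(s, t). t ^ Suc m * partial j h (seg a (u(j := s)) t))"
  proof -
    have "continuous_on (J \<times> cbox 0 1) (\<lambda>z. snd z ^ Suc m * partial j h (seg a (u(j := fst z)) (snd z)))"
    proof (rule continuous_on_seg_B[OF Ck_on_cont[OF Ck_on_Suc_partial[OF h j] BE]])
      show "continuous_on (J \<times> cbox 0 1) (\<lambda>z. (u(j := fst z)) i)" for i
        by (cases "i = j") (auto intro!: continuous_intros)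
    qed (use uB in \<open>auto intro!: continuous_intros simp del: fun_upd_apply\<close>)
    then show ?thesis by (simp add: split_beta)
  qed
  have "((\<lambda>s. integral (cbox 0 1) (\<lambda>t. t ^ m * h (seg a (u(j := s)) t))) has_field_derivative
      integral (cbox 0 1) (\<lambda>t. t ^ Suc m * partial j h (seg a (u(j := u j)) t))) (at (u j) within J)"
  proof (rule leibniz_rule_field_derivative[OF _ _ cont J(1,3)])
    fix s t :: real assume s: "s \<in> J" and t: "t \<in> cbox 0 1"
    define y where "y = seg a (u(j := s)) t"
    have y: "y \<in> B" using seg_in_box[OF uB[OF s]] t by (simp add: y_def)
    have yj: "y j = a j + t * (s - a j)" by (simp add: y_def seg_def)
    have upd: "y(j := v) = (seg a u t)(j := v)" for v by (simp add: y_def seg_upd)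
    have "((\<lambda>v. h (y(j := v))) has_field_derivative partial j h y) (at (a j + t * (s - a j)))"
      using Ck_on_Suc_diff[OF h j y] unfolding partial_def yj
      by (simp add: DERIV_deriv_iff_field_differentiable)
    moreover have "((\<lambda>s. a j + t * (s - a j)) has_field_derivative t) (at s)"
      by (auto intro!: derivative_eq_intros)
    ultimately have "((\<lambda>s. h (y(j := a j + t * (s - a j)))) has_field_derivative partial j h y * t) (at s)"
      by (rule DERIV_chain2)
    then have D: "((\<lambda>s. t ^ m * h (y(j := a j + t * (s - a j)))) has_field_derivative t ^ m * (partial j h y * t)) (at s)"
      by (rule DERIV_cmult)
    have e1: "t ^ m * h (y(j := a j + t * (s - a j))) = t ^ m * h (seg a (u(j := s)) t)" for s
      by (simp only: upd seg_upd)
    have e2: "t ^ m * (partial j h y * t) = t ^ Suc m * partial j h (seg a (u(j := s)) t)"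
      by (simp add: y_def del: fun_upd_apply)
    show "((\<lambda>s. t ^ m * h (seg a (u(j := s)) t)) has_field_derivative
        t ^ Suc m * partial j h (seg a (u(j := s)) t)) (at s within J)"
      by (rule has_field_derivative_at_within[OF D[unfolded e1 e2]])
  next
    fix s assume s: "s \<in> J"
    have "continuous_on {0..1} (\<lambda>t. t ^ m * h (seg a (u(j := s)) t))"
      by (rule continuous_on_seg_B[OF Ck_on_cont[OF h BE]]) (use uB[OF s] in \<open>auto intro!: continuous_intros simp del: fun_upd_apply\<close>)
    then show "(\<lambda>t. t ^ m * h (seg a (u(j := s)) t)) integrable_on cbox 0 1"
      by (simp add: integrable_continuous_interval)
  qed
  then show ?thesis
    by (simp only: seg_int_def at_within_open[OF J(1,2)] cbox_interval fun_upd_triv)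
qed

lemma Ck_on_seg_int:
  assumes "\<And>k. Ck_on k n B h"
  shows "Ck_on k n B (seg_int a m h)"
  using assms
proof (induction k arbitrary: h m)
  case 0
  then show ?case
    using continuous_on_seg_int[OF Ck_on_cont[OF "0.prems" openE_subset[OF box_open]]]
    by (simp add: continuous_map_E_iff[OF openE_subset[OF box_open]])
next
  case (Suc k)
  show ?case
  proof (rule Ck_on_SucI[OF openE_subset[OF box_open]])
    show "continuous_on B (seg_int a m h)"
      by (rule continuous_on_seg_int[OF Ck_on_cont[OF Suc.prems openE_subset[OF box_open]]])
    fix i assume i: "i < n"
    show "(\<lambda>t. seg_int a m h (x(i := t))) field_differentiable at (x i)" if "x \<in> B" for x
      using seg_int_deriv[OF Suc.prems that i] unfolding field_differentiable_def by blast
    show "Ck_on k n B (partial i (seg_int a m h))"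
    proof (rule Ck_on_cong[OF box_open])
      show "Ck_on k n B (seg_int a (Suc m) (partial i h))"
        by (rule Suc.IH) (rule Ck_on_Suc_partial[OF Suc.prems i])
      show "seg_int a (Suc m) (partial i h) y = partial i (seg_int a m h) y" if "y \<in> B" for y
        unfolding partial_def[of i "seg_int a m h"]
        by (rule DERIV_imp_deriv[OF seg_int_deriv[OF Suc.prems that i], symmetric])
    qed
  qed
qed

text \<open>The fundamental theorem of calculus along the segment from \<open>a\<close> to
  \<open>u\<close>, with the derivative of \<open>f\<close> along the segment given by the chain
  rule.\<close>

lemma Hadamard_box:
  assumes f: "Cinf_on n B f" and u: "u \<in> B"
  shows "f u = f a + (\<Sum>i<n. (u i - a i) * seg_int a 0 (partial i f) u)"
proof -
  have D: "((\<lambda>t. f (seg a u t)) has_field_derivative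
      (\<Sum>i<n. partial i f (seg a u t) * (u i - a i))) (at t)" if "t \<in> {0..1}" for t
  proof (rule chain_curve_C1[OF box_open])
    show "seg a u t \<in> B" by (rule seg_in_box[OF u that])
    show "Ck_on (Suc 0) n B f" using f by (simp only: Cinf_on_def)
    show "eventually (\<lambda>t. seg a u t \<in> E n) (nhds t)"
      using u aE by (intro always_eventually) (auto simp: seg_def E_iff B_def)
    show "((\<lambda>t. seg a u t i) has_field_derivative u i - a i) (at t)" for i
      unfolding seg_def by (auto intro!: derivative_eq_intros)
  qed
  have int: "(\<lambda>t. partial i f (seg a u t) * (u i - a i)) integrable_on {0..1}" if "i < n" for i
  proof (rule integrable_continuous_interval)
    have "continuous_on {0..1} (\<lambda>t. t ^ 0 * partial i f (seg a u t))"
      by (rule continuous_on_seg_B[OF Cinf_on_cont[OF Cinf_on_partial[OF f that] openE_subset[OF box_open]]])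
        (use u in \<open>auto intro!: continuous_intros\<close>)
    then show "continuous_on {0..1} (\<lambda>t. partial i f (seg a u t) * (u i - a i))"
      by (auto intro!: continuous_intros)
  qed
  have "((\<lambda>t. \<Sum>i<n. partial i f (seg a u t) * (u i - a i)) has_integral f (seg a u 1) - f (seg a u 0)) {0..1}"
    by (rule fundamental_theorem_of_calculus)
      (use D in \<open>auto simp: has_real_derivative_iff_has_vector_derivative[symmetric] intro: has_field_derivative_at_within\<close>)
  moreover have "seg a u 1 = u" "seg a u 0 = a" by (auto simp: seg_def)
  ultimately have "f u - f a = integral {0..1} (\<lambda>t. \<Sum>i<n. partial i f (seg a u t) * (u i - a i))"
    by (simp add: integral_unique)
  also have "\<dots> = (\<Sum>i<n. integral {0..1} (\<lambda>t. partial i f (seg a u t) * (u i - a i)))"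
    by (rule integral_sum) (use int in auto)
  also have "\<dots> = (\<Sum>i<n. (u i - a i) * seg_int a 0 (partial i f) u)"
    by (rule sum.cong) (auto simp: seg_int_def mult.commute)
  finally show ?thesis by simp
qed

end

text \<open>The coefficients take the right value at \<open>a\<close> because the segment from
  \<open>a\<close> to \<open>a\<close> is constant, so that the integrand is the partial derivative
  at \<open>a\<close> for every \<open>t\<close>.\<close>

lemma Hadamard:
  assumes U: "openin (Euclidean_space n) U" and a: "a \<in> U" and f: "Cinf_on n U f"
  shows "\<exists>B g. openin (Euclidean_space n) B \<and> a \<in> B \<and> B \<subseteq> U \<and>
    (\<forall>i<n. Cinf_on n B (g i) \<and> g i a = partial i f a) \<and>
    (\<forall>u\<in>B. f u = f a + (\<Sum>i<n. (u i - a i) * g i u))"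
proof -
  have aE: "a \<in> E n" using openE_subset[OF U] a by blast
  obtain e where e: "e > 0" "\<And>y. y \<in> E n \<Longrightarrow> (\<And>i. i < n \<Longrightarrow> \<bar>y i - a i\<bar> < e) \<Longrightarrow> y \<in> U"
    using openE_box[OF U a] by blast
  define B where "B = {y \<in> E n. \<forall>i<n. \<bar>y i - a i\<bar> < e}"
  have BU: "B \<subseteq> U" using e(2) by (auto simp: B_def)
  have fB: "Cinf_on n B f" by (rule Cinf_on_subset[OF BU f])
  have saa: "seg a a t = a" for t by (simp add: seg_def)
  show ?thesis
  proof (intro exI conjI allI impI ballI)
    show "openin (Euclidean_space n) B" unfolding B_def by (rule openE_boxI)
    show "a \<in> B" using aE e(1) by (simp add: B_def)
    show "Cinf_on n B (seg_int a 0 (partial i f))" if "i < n" for i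
      unfolding Cinf_on_def
      using Ck_on_seg_int[OF aE e(1)] Cinf_on_partial[OF fB that]
      unfolding Cinf_on_def B_def by blast
    show "seg_int a 0 (partial i f) a = partial i f a" for i
      by (simp add: seg_int_def saa)
    show "f u = f a + (\<Sum>i<n. (u i - a i) * seg_int a 0 (partial i f) u)" if "u \<in> B" for u
      by (rule Hadamard_box[OF aE e(1)]) (use fB that in \<open>auto simp: B_def\<close>)
  qed (rule BU)
qed

section \<open>Germs and smooth maps\<close>

lemma atlasD:
  assumes "smooth_manifold M" "(U, \<phi>) \<in> atlas M"
  shows "openin (mtop M) U" "openin (Euclidean_space (mdim M)) (\<phi> ` U)"
    "homeomorphic_map (subtopology (mtop M) U) (subtopology (Euclidean_space (mdim M)) (\<phi> ` U)) \<phi>"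
    "inj_on \<phi> U" "U \<subseteq> points M" "\<phi> ` U \<subseteq> E (mdim M)"
proof -
  have c: "is_chart (mtop M) (mdim M) (U, \<phi>)"
    using assms unfolding smooth_manifold_def by blast
  then show *: "openin (mtop M) U" "openin (Euclidean_space (mdim M)) (\<phi> ` U)"
    "homeomorphic_map (subtopology (mtop M) U) (subtopology (Euclidean_space (mdim M)) (\<phi> ` U)) \<phi>"
    by auto
  from *(1,2) show U: "U \<subseteq> points M" "\<phi> ` U \<subseteq> E (mdim M)" using openin_subset by auto
  have "topspace (subtopology (mtop M) U) = U" using U by auto
  then show "inj_on \<phi> U" using homeomorphic_imp_injective_map[OF *(3)] by simp
qed

lemma chart_image_open:
  assumes c: "is_chart T n (U, \<phi>)" and W: "openin T W"
  shows "openin (Euclidean_space n) (\<phi> ` (U \<inter> W))"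
proof -
  have *: "openin T U" "openin (Euclidean_space n) (\<phi> ` U)"
    "homeomorphic_map (subtopology T U) (subtopology (Euclidean_space n) (\<phi> ` U)) \<phi>"
    using c by auto
  have "openin (subtopology T U) (U \<inter> W)" using W by (simp add: openin_subtopology_Int2)
  then have "openin (subtopology (Euclidean_space n) (\<phi> ` U)) (\<phi> ` (U \<inter> W))"
    using homeomorphic_imp_open_map[OF *(3)] by (simp add: open_map_def)
  then show ?thesis using *(2) openin_open_subtopology by blast
qed

lemma chart_preimage_open:
  assumes c: "is_chart T n (U, \<phi>)" and W: "openin (Euclidean_space n) W"
  shows "openin T {x \<in> U. \<phi> x \<in> W}"
proof -
  have *: "openin T U"
    "homeomorphic_map (subtopology T U) (subtopology (Euclidean_space n) (\<phi> ` U)) \<phi>"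
    using c by auto
  have "continuous_map (subtopology T U) (Euclidean_space n) \<phi>"
    using homeomorphic_imp_continuous_map[OF *(2)] by (simp add: continuous_map_in_subtopology)
  from openin_continuous_map_preimage[OF this W]
  have "openin (subtopology T U) {x \<in> U. \<phi> x \<in> W}"
    using openin_subset[OF *(1)] by (simp add: Int_absorb1)
  then show ?thesis using *(1) openin_open_subtopology by blast
qed

lemma atlas_is_chart:
  "smooth_manifold M \<Longrightarrow> c \<in> atlas M \<Longrightarrow> is_chart (mtop M) (mdim M) c"
  unfolding smooth_manifold_def by blast

lemma atlas_transition:
  "smooth_manifold M \<Longrightarrow> c \<in> atlas M \<Longrightarrow> c' \<in> atlas M \<Longrightarrow> smooth_transition (mdim M) c c'"
  unfolding smooth_manifold_def by blast

lemma chart_at: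
  assumes "smooth_manifold M" "x \<in> points M"
  obtains U \<phi> where "(U, \<phi>) \<in> atlas M" "x \<in> U"
proof -
  have "x \<in> (\<Union>c\<in>atlas M. fst c)" using assms by (simp add: smooth_manifold_def)
  then obtain c where "c \<in> atlas M" "x \<in> fst c" by blast
  then show thesis using that[of "fst c" "snd c"] by simp
qed

lemma smooth_fun_onI:
  assumes "\<And>U \<phi>. (U, \<phi>) \<in> atlas M \<Longrightarrow> Cinf_on (mdim M) (\<phi> ` (U \<inter> W)) (\<lambda>u. f (inv_into U \<phi> u))"
  shows "smooth_fun_on M W f"
  unfolding smooth_fun_on_def using assms by (intro ballI) (simp add: split_beta)

lemma smooth_fun_onD:
  assumes "smooth_fun_on M W f" "(U, \<phi>) \<in> atlas M"
  shows "Cinf_on (mdim M) (\<phi> ` (U \<inter> W)) (\<lambda>u. f (inv_into U \<phi> u))"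
  using bspec[OF assms(1)[unfolded smooth_fun_on_def] assms(2)] by simp

lemma smooth_mapD:
  assumes "smooth_map M N F" "(U, \<phi>) \<in> atlas M" "(V, \<psi>) \<in> atlas N" "i < mdim N"
  shows "Cinf_on (mdim M) (\<phi> ` {x\<in>U. F x \<in> V}) (\<lambda>u. \<psi> (F (inv_into U \<phi> u)) i)"
proof -
  have "\<forall>(U, \<phi>)\<in>atlas M. \<forall>(V, \<psi>)\<in>atlas N. \<forall>i<mdim N.
      Cinf_on (mdim M) (\<phi> ` {x\<in>U. F x \<in> V}) (\<lambda>u. \<psi> (F (inv_into U \<phi> u)) i)"
    using assms(1) by (simp add: smooth_map_def)
  from bspec[OF bspec[OF this assms(2), simplified] assms(3)] assms(4) show ?thesis by simp
qed

lemma smooth_mapI: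
  assumes "continuous_map (mtop M) (mtop N) F"
    and "\<And>U \<phi> V \<psi> i. (U, \<phi>) \<in> atlas M \<Longrightarrow> (V, \<psi>) \<in> atlas N \<Longrightarrow> i < mdim N \<Longrightarrow>
      Cinf_on (mdim M) (\<phi> ` {x\<in>U. F x \<in> V}) (\<lambda>u. \<psi> (F (inv_into U \<phi> u)) i)"
  shows "smooth_map M N F"
  unfolding smooth_map_def using assms by (auto simp: split_beta)

lemma smooth_transitionD:
  "smooth_transition n (U, \<phi>) (V, \<psi>) \<Longrightarrow> i < n \<Longrightarrow> Cinf_on n (\<phi> ` (U \<inter> V)) (\<lambda>u. \<psi> (inv_into U \<phi> u) i)"
  by simp

lemma smooth_fun_on_subset: "W' \<subseteq> W \<Longrightarrow> smooth_fun_on M W f \<Longrightarrow> smooth_fun_on M W' f"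
  by (rule smooth_fun_onI, rule Cinf_on_subset[OF _ smooth_fun_onD]) auto

lemma smooth_fun_on_germs: "openin (mtop M) W \<Longrightarrow> x \<in> W \<Longrightarrow> smooth_fun_on M W f \<Longrightarrow> f \<in> germs M x"
  unfolding germs_def by blast

lemma germ_chartD:
  assumes M: "smooth_manifold M" and c: "(U, \<phi>) \<in> atlas M" "x \<in> U" and f: "f \<in> germs M x"
  obtains B where "openin (Euclidean_space (mdim M)) B" "\<phi> x \<in> B" "B \<subseteq> \<phi> ` U"
    "Cinf_on (mdim M) B (\<lambda>u. f (inv_into U \<phi> u))"
proof -
  obtain W where W: "openin (mtop M) W" "x \<in> W" "smooth_fun_on M W f"
    using f unfolding germs_def by blast
  show thesis
  proof (rule that)
    show "openin (Euclidean_space (mdim M)) (\<phi> ` (U \<inter> W))"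
      by (rule chart_image_open[OF atlas_is_chart[OF M c(1)] W(1)])
    show "Cinf_on (mdim M) (\<phi> ` (U \<inter> W)) (\<lambda>u. f (inv_into U \<phi> u))"
      by (rule smooth_fun_onD[OF W(3) c(1)])
  qed (use W c in auto)
qed

text \<open>One chart suffices: in any other chart the function is represented by its expression in
  the given chart composed with a transition map.\<close>

lemma germ_chartI:
  assumes M: "smooth_manifold M" and c: "(U, \<phi>) \<in> atlas M" "x \<in> U"
    and B: "openin (Euclidean_space (mdim M)) B" "\<phi> x \<in> B" "B \<subseteq> \<phi> ` U"
      "Cinf_on (mdim M) B (\<lambda>u. f (inv_into U \<phi> u))"
  shows "f \<in> germs M x"
proof (rule smooth_fun_on_germs)
  define W where "W = {z \<in> U. \<phi> z \<in> B}"
  show W: "openin (mtop M) W" unfolding W_def by (rule chart_preimage_open[OF atlas_is_chart[OF M c(1)] B(1)])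
  show "x \<in> W" using B c by (simp add: W_def)
  have "Cinf_on (mdim M) (\<psi> ` (V \<inter> W)) (\<lambda>u. f (inv_into V \<psi> u))" if d: "(V, \<psi>) \<in> atlas M" for V \<psi>
  proof -
    have op: "openin (Euclidean_space (mdim M)) (\<psi> ` (V \<inter> W))"
      by (rule chart_image_open[OF atlas_is_chart[OF M d] W])
    note injs = atlasD(4)[OF M c(1)] atlasD(4)[OF M d]
    have "Cinf_on (mdim M) (\<psi> ` (V \<inter> W)) (\<lambda>u. f (inv_into U \<phi> (\<phi> (inv_into V \<psi> u))))"
    proof (rule Cinf_on_compose[OF op B(1) _ _ B(4)])
      show "\<phi> (inv_into V \<psi> u) \<in> B" if "u \<in> \<psi> ` (V \<inter> W)" for u
        using that injs by (auto simp: W_def)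
      show "Cinf_on (mdim M) (\<psi> ` (V \<inter> W)) (\<lambda>u. \<phi> (inv_into V \<psi> u) j)" if "j < mdim M" for j
        by (rule Cinf_on_subset[of _ "\<psi> ` (V \<inter> U)"])
          (auto simp: W_def intro: smooth_transitionD[OF atlas_transition[OF M d c(1)] that])
    qed
    then show ?thesis
      by (rule Cinf_on_cong[OF op, rotated]) (use injs in \<open>auto simp: W_def\<close>)
  qed
  then show "smooth_fun_on M W f" by (rule smooth_fun_onI)
qed

text \<open>Smoothness is local. From here on, smoothness on an open set is proved one point at a
  time, with a neighbourhood that may depend on the point.\<close>

lemma smooth_fun_on_iff_germs:
  assumes M: "smooth_manifold M" and W: "openin (mtop M) W"
  shows "smooth_fun_on M W f \<longleftrightarrow> (\<forall>x\<in>W. f \<in> germs M x)"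
proof
  assume *: "\<forall>x\<in>W. f \<in> germs M x"
  have "Cinf_on (mdim M) (\<phi> ` (U \<inter> W)) (\<lambda>u. f (inv_into U \<phi> u))" if c: "(U, \<phi>) \<in> atlas M" for U \<phi>
  proof (rule Cinf_on_local)
    fix u assume "u \<in> \<phi> ` (U \<inter> W)"
    then obtain x where x: "x \<in> U" "x \<in> W" "u = \<phi> x" by blast
    obtain B where B: "openin (Euclidean_space (mdim M)) B" "\<phi> x \<in> B" "B \<subseteq> \<phi> ` U"
      "Cinf_on (mdim M) B (\<lambda>u. f (inv_into U \<phi> u))"
      using germ_chartD[OF M c x(1)] * x(2) by blast
    have "openin (Euclidean_space (mdim M)) (\<phi> ` (U \<inter> W) \<inter> B)"
      by (rule openin_Int[OF chart_image_open[OF atlas_is_chart[OF M c] W] B(1)])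
    then show "\<exists>V. openin (Euclidean_space (mdim M)) V \<and> u \<in> V \<and> V \<subseteq> \<phi> ` (U \<inter> W) \<and>
        Cinf_on (mdim M) V (\<lambda>u. f (inv_into U \<phi> u))"
      using x B(2) Cinf_on_subset[OF _ B(4), of "\<phi> ` (U \<inter> W) \<inter> B"] by (intro exI[of _ "\<phi> ` (U \<inter> W) \<inter> B"]) auto
  qed
  then show "smooth_fun_on M W f" by (rule smooth_fun_onI)
qed (simp add: smooth_fun_on_germs[OF W])

lemma smooth_fun_on_cong:
  assumes M: "smooth_manifold M" and W: "openin (mtop M) W"
    and f: "smooth_fun_on M W f" "\<And>x. x \<in> W \<Longrightarrow> f x = g x"
  shows "smooth_fun_on M W g"
proof (rule smooth_fun_onI)
  fix U \<phi> assume c: "(U, \<phi>) \<in> atlas M"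
  show "Cinf_on (mdim M) (\<phi> ` (U \<inter> W)) (\<lambda>u. g (inv_into U \<phi> u))"
    by (rule Cinf_on_cong[OF chart_image_open[OF atlas_is_chart[OF M c] W], of "\<lambda>u. f (inv_into U \<phi> u)"])
      (use f smooth_fun_onD[OF f(1) c] atlasD(4)[OF M c] in auto)
qed

lemma germ_cong:
  assumes M: "smooth_manifold M" and W: "openin (mtop M) W" "x \<in> W"
    and f: "f \<in> germs M x" "\<And>y. y \<in> W \<Longrightarrow> f y = g y"
  shows "g \<in> germs M x"
proof -
  obtain V where V: "openin (mtop M) V" "x \<in> V" "smooth_fun_on M V f"
    using f unfolding germs_def by blast
  have "smooth_fun_on M (V \<inter> W) g"
    by (rule smooth_fun_on_cong[OF M _ smooth_fun_on_subset[OF _ V(3)]]) (use V W f in auto)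
  then show ?thesis using V W by (intro smooth_fun_on_germs[of M "V \<inter> W"]) auto
qed

lemma germs_const:
  assumes M: "smooth_manifold M" and "x \<in> points M"
  shows "(\<lambda>_. c) \<in> germs M x"
proof -
  obtain U \<phi> where c: "(U, \<phi>) \<in> atlas M" "x \<in> U" using chart_at[OF assms] by blast
  show ?thesis
    by (rule germ_chartI[OF M c atlasD(2)[OF M c(1)]]) (use c Cinf_on_const[OF atlasD(6)[OF M c(1)]] in auto)
qed

lemma germs_coord:
  assumes M: "smooth_manifold M" and c: "(U, \<phi>) \<in> atlas M" "x \<in> U"
  shows "(\<lambda>z. \<phi> z i) \<in> germs M x"
proof (rule germ_chartI[OF M c atlasD(2)[OF M c(1)]])
  have "Cinf_on (mdim M) (\<phi> ` U) (\<lambda>u. u i)" by (rule Cinf_on_coord[OF atlasD(6)[OF M c(1)]])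
  then show "Cinf_on (mdim M) (\<phi> ` U) (\<lambda>u. \<phi> (inv_into U \<phi> u) i)"
    by (rule Cinf_on_cong[OF atlasD(2)[OF M c(1)], rotated]) (simp add: f_inv_into_f)
qed (use c in auto)

lemma germs_points: "f \<in> germs M x \<Longrightarrow> x \<in> points M"
  unfolding germs_def using openin_subset by blast

lemma germs_common:
  assumes "finite A" "x \<in> points M" "\<And>a. a \<in> A \<Longrightarrow> f a \<in> germs M x"
  shows "\<exists>W. openin (mtop M) W \<and> x \<in> W \<and> (\<forall>a\<in>A. smooth_fun_on M W (f a))"
  using assms(1,3)
proof (induction A rule: finite_induct)
  case empty
  then show ?case using assms(2) by (intro exI[of _ "points M"]) auto
next
  case (insert a A)
  obtain W V where "openin (mtop M) W" "x \<in> W" "\<forall>a\<in>A. smooth_fun_on M W (f a)"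
    "openin (mtop M) V" "x \<in> V" "smooth_fun_on M V (f a)"
    using insert unfolding germs_def by blast
  then show ?case
    by (intro exI[of _ "W \<inter> V"]) (auto intro: smooth_fun_on_subset[rotated])
qed

text \<open>The source of all closure properties of germs: the coordinates of \<open>F\<close> are
  finitely many germs, and a smooth function of them is a germ. \<open>F\<close> has to land in the
  domain of \<open>h\<close> only near the point.\<close>

lemma germs_compose:
  assumes M: "smooth_manifold M" and B: "openin (Euclidean_space m) B" and h: "Cinf_on m B h"
    and F: "\<And>i. i < m \<Longrightarrow> (\<lambda>z. F z i) \<in> germs M x"
    and W: "openin (mtop M) W" "x \<in> W" "\<And>z. z \<in> W \<Longrightarrow> F z \<in> B"
  shows "(\<lambda>z. h (F z)) \<in> germs M x"
proof -
  have xM: "x \<in> points M" using W openin_subset by blast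
  obtain U \<phi> where c: "(U, \<phi>) \<in> atlas M" "x \<in> U" using chart_at[OF M xM] by blast
  obtain V where V: "openin (mtop M) V" "x \<in> V" "\<forall>i\<in>{..<m}. smooth_fun_on M V (\<lambda>z. F z i)"
    using germs_common[of "{..<m}" x M "\<lambda>i z. F z i"] F xM by auto
  have op: "openin (mtop M) (V \<inter> W)" using V W by blast
  note op' = chart_image_open[OF atlas_is_chart[OF M c(1)] op]
  have "Cinf_on (mdim M) (\<phi> ` (U \<inter> (V \<inter> W))) (\<lambda>u. h (F (inv_into U \<phi> u)))"
  proof (rule Cinf_on_compose[OF op' B _ _ h])
    show "F (inv_into U \<phi> u) \<in> B" if "u \<in> \<phi> ` (U \<inter> (V \<inter> W))" for u
      using that W(3) atlasD(4)[OF M c(1)] by auto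
    show "Cinf_on (mdim M) (\<phi> ` (U \<inter> (V \<inter> W))) (\<lambda>u. F (inv_into U \<phi> u) j)" if "j < m" for j
    proof (rule Cinf_on_subset)
      show "Cinf_on (mdim M) (\<phi> ` (U \<inter> V)) (\<lambda>u. F (inv_into U \<phi> u) j)"
        by (rule smooth_fun_onD[OF _ c(1)]) (use V(3) that in blast)
    qed auto
  qed
  then show ?thesis
    by (rule germ_chartI[OF M c op', rotated 2]) (use V W c in auto)
qed

section \<open>Sums and products of germs\<close>

lemma openin_E_UNIV: "openin (Euclidean_space n) (E n)"
  by simp

lemma germs_lin:
  assumes M: "smooth_manifold M" and f: "f \<in> germs M x" and g: "g \<in> germs M x"
  shows "(\<lambda>z. a * f z + b * g z) \<in> germs M x"
proof -
  \<comment> \<open>The two germs become the coordinates of one map into two-dimensional space, so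
    that \<open>germs_compose\<close> applies to a polynomial in two variables.\<close>
  define F where "F z = (\<lambda>i::nat. if i = 0 then f z else if i = 1 then g z else 0)" for z
  note C = Cinf_on_mult[OF openin_E_UNIV Cinf_on_const Cinf_on_coord]
  have "(\<lambda>z. (\<lambda>u. a * u 0 + b * u 1) (F z)) \<in> germs M x"
  proof (rule germs_compose[where h = "\<lambda>u. a * u 0 + b * u 1" and F = F and W = "points M", OF M openin_E_UNIV[of 2]])
    show "Cinf_on 2 (E 2) (\<lambda>u. a * u 0 + b * u 1)"
      by (intro Cinf_on_add[OF openin_E_UNIV] C) auto
    show "(\<lambda>z. F z i) \<in> germs M x" if "i < 2" for i
      using that f g by (cases "i = 0") (auto simp: F_def less_2_cases_iff)
  qed (use germs_points[OF f] in \<open>auto simp: F_def E_iff\<close>)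
  then show ?thesis by (simp add: F_def)
qed

lemma germs_mult:
  assumes M: "smooth_manifold M" and f: "f \<in> germs M x" and g: "g \<in> germs M x"
  shows "(\<lambda>z. f z * g z) \<in> germs M x"
proof -
  define F where "F z = (\<lambda>i::nat. if i = 0 then f z else if i = 1 then g z else 0)" for z
  have "(\<lambda>z. (\<lambda>u. u 0 * u 1) (F z)) \<in> germs M x"
  proof (rule germs_compose[where h = "\<lambda>u. u 0 * u 1" and F = F and W = "points M", OF M openin_E_UNIV[of 2]])
    show "Cinf_on 2 (E 2) (\<lambda>u. u 0 * u 1)"
      by (intro Cinf_on_mult[OF openin_E_UNIV] Cinf_on_coord) auto
    show "(\<lambda>z. F z i) \<in> germs M x" if "i < 2" for i
      using that f g by (cases "i = 0") (auto simp: F_def less_2_cases_iff)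
  qed (use germs_points[OF f] in \<open>auto simp: F_def E_iff\<close>)
  then show ?thesis by (simp add: F_def)
qed

lemma germs_add:
  "smooth_manifold M \<Longrightarrow> f \<in> germs M x \<Longrightarrow> g \<in> germs M x \<Longrightarrow> (\<lambda>z. f z + g z) \<in> germs M x"
  using germs_lin[of M f x g 1 1] by simp

lemma germs_cmult:
  "smooth_manifold M \<Longrightarrow> f \<in> germs M x \<Longrightarrow> (\<lambda>z. c * f z) \<in> germs M x"
  using germs_lin[of M f x f c 0] by simp

lemma germs_sum:
  assumes "smooth_manifold M" "x \<in> points M" "\<And>i. i \<in> A \<Longrightarrow> f i \<in> germs M x"
  shows "(\<lambda>z. \<Sum>i\<in>A. f i z) \<in> germs M x"
  using assms(3)
proof (induction A rule: infinite_finite_induct)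
  case (insert a A)
  then show ?case using germs_add[OF assms(1), of "f a" x "\<lambda>z. \<Sum>i\<in>A. f i z"] by simp
qed (simp_all add: germs_const assms(1,2))

text \<open>Sections, retractions and group coordinates are smooth only near certain points and
  arbitrary elsewhere. Smoothness at one point lets such total functions be composed without
  restricting domains; \<open>smooth_map_iff\<close> leads back to
  \<open>smooth_map\<close>.\<close>

definition smooth_at :: "'a manifold \<Rightarrow> 'b manifold \<Rightarrow> ('a \<Rightarrow> 'b) \<Rightarrow> 'a \<Rightarrow> bool" where
  "smooth_at M N F x \<longleftrightarrow> x \<in> points M \<and> F x \<in> points N \<and>
     (\<forall>V. openin (mtop N) V \<and> F x \<in> V \<longrightarrow> (\<exists>W. openin (mtop M) W \<and> x \<in> W \<and> F ` W \<subseteq> V)) \<and>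
     (\<forall>h\<in>germs N (F x). h \<circ> F \<in> germs M x)"

lemma smooth_at_points: "smooth_at M N F x \<Longrightarrow> x \<in> points M" "smooth_at M N F x \<Longrightarrow> F x \<in> points N"
  by (auto simp: smooth_at_def)

lemma smooth_at_open:
  assumes "smooth_at M N F x" "openin (mtop N) V" "F x \<in> V"
  obtains W where "openin (mtop M) W" "x \<in> W" "F ` W \<subseteq> V"
  using assms unfolding smooth_at_def by blast

lemma smooth_at_germ: "smooth_at M N F x \<Longrightarrow> h \<in> germs N (F x) \<Longrightarrow> h \<circ> F \<in> germs M x"
  by (simp add: smooth_at_def)

lemma smooth_at_germ': "smooth_at M N F x \<Longrightarrow> h \<in> germs N (F x) \<Longrightarrow> (\<lambda>z. h (F z)) \<in> germs M x"
  using smooth_at_germ[of M N F x h] by (simp add: comp_def)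

lemma smooth_at_id: "x \<in> points M \<Longrightarrow> smooth_at M M (\<lambda>z. z) x"
  by (auto simp: smooth_at_def comp_def)

lemma smooth_at_const: "smooth_manifold M \<Longrightarrow> x \<in> points M \<Longrightarrow> c \<in> points N \<Longrightarrow> smooth_at M N (\<lambda>_. c) x"
  unfolding smooth_at_def by (auto simp: comp_def germs_const intro!: exI[of _ "points M"])

lemma smooth_at_compose:
  assumes F: "smooth_at M N F x" and G: "smooth_at N K G (F x)"
  shows "smooth_at M K (\<lambda>z. G (F z)) x"
  unfolding smooth_at_def
proof (intro conjI allI impI ballI)
  fix V assume V: "openin (mtop K) V \<and> G (F x) \<in> V"
  obtain W where W: "openin (mtop N) W" "F x \<in> W" "G ` W \<subseteq> V"
    using smooth_at_open[OF G] V by blast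
  obtain W' where "openin (mtop M) W'" "x \<in> W'" "F ` W' \<subseteq> W"
    using smooth_at_open[OF F W(1,2)] by blast
  then show "\<exists>W. openin (mtop M) W \<and> x \<in> W \<and> (\<lambda>z. G (F z)) ` W \<subseteq> V" using W by blast
next
  fix h assume "h \<in> germs K (G (F x))"
  then show "h \<circ> (\<lambda>z. G (F z)) \<in> germs M x"
    using smooth_at_germ[OF F smooth_at_germ[OF G]] by (simp add: comp_def)
qed (rule smooth_at_points(1)[OF F] smooth_at_points(2)[OF G])+

lemma smooth_at_cong:
  assumes M: "smooth_manifold M" and F: "smooth_at M N F x"
    and W: "openin (mtop M) W" "x \<in> W" "\<And>z. z \<in> W \<Longrightarrow> F z = G z"
  shows "smooth_at M N G x"
  unfolding smooth_at_def
proof (intro conjI allI impI ballI)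
  have Fx: "F x = G x" using W by blast
  fix V assume V: "openin (mtop N) V \<and> G x \<in> V"
  obtain W' where "openin (mtop M) W'" "x \<in> W'" "F ` W' \<subseteq> V"
    using smooth_at_open[OF F] V Fx by metis
  then show "\<exists>W. openin (mtop M) W \<and> x \<in> W \<and> G ` W \<subseteq> V" using W by (intro exI[of _ "W \<inter> W'"]) force
next
  fix h assume "h \<in> germs N (G x)"
  then show "h \<circ> G \<in> germs M x"
    using germ_cong[OF M W(1,2) smooth_at_germ[OF F]] W by force
qed (use F W smooth_at_points in metis)+

text \<open>A single chart of the target is enough, because every germ at \<open>F x\<close> is a
  smooth function of its coordinates. Continuity ensures that nearby points are mapped to where that
  function is defined.\<close>

lemma smooth_atI:
  assumes M: "smooth_manifold M" and N: "smooth_manifold N" and x: "x \<in> points M"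
    and c: "(V, \<psi>) \<in> atlas N" "F x \<in> V"
    and cont: "\<And>O'. openin (mtop N) O' \<Longrightarrow> F x \<in> O' \<Longrightarrow> \<exists>W. openin (mtop M) W \<and> x \<in> W \<and> F ` W \<subseteq> O'"
    and F: "\<And>i. i < mdim N \<Longrightarrow> (\<lambda>z. \<psi> (F z) i) \<in> germs M x"
  shows "smooth_at M N F x"
  unfolding smooth_at_def
proof (intro conjI allI impI ballI)
  show "F x \<in> points N" using atlasD(5)[OF N c(1)] c(2) by blast
  fix h assume h: "h \<in> germs N (F x)"
  obtain B where B: "openin (Euclidean_space (mdim N)) B" "\<psi> (F x) \<in> B" "B \<subseteq> \<psi> ` V"
    "Cinf_on (mdim N) B (\<lambda>u. h (inv_into V \<psi> u))"
    using germ_chartD[OF N c h] by blast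
  have "openin (mtop N) {y \<in> V. \<psi> y \<in> B}"
    by (rule chart_preimage_open[OF atlas_is_chart[OF N c(1)] B(1)])
  from cont[OF this] obtain W where W: "openin (mtop M) W" "x \<in> W" "F ` W \<subseteq> {y \<in> V. \<psi> y \<in> B}"
    using c B by blast
  have "(\<lambda>z. h (inv_into V \<psi> (\<psi> (F z)))) \<in> germs M x"
    by (rule germs_compose[OF M B(1,4) F W(1,2)]) (use W in auto)
  then show "h \<circ> F \<in> germs M x"
    by (rule germ_cong[OF M W(1,2)]) (use W(3) atlasD(4)[OF N c(1)] in \<open>auto simp: subset_iff\<close>)
qed (use x cont in auto)

lemma smooth_map_iff:
  assumes M: "smooth_manifold M" and N: "smooth_manifold N"
  shows "smooth_map M N F \<longleftrightarrow> (\<forall>x\<in>points M. smooth_at M N F x)"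
proof
  assume F: "smooth_map M N F"
  show "\<forall>x\<in>points M. smooth_at M N F x"
  proof
    fix x assume x: "x \<in> points M"
    have cont: "continuous_map (mtop M) (mtop N) F" using F by (simp add: smooth_map_def)
    then have Fx: "F x \<in> points N" using x by (auto simp: continuous_map_def)
    obtain V \<psi> where d: "(V, \<psi>) \<in> atlas N" "F x \<in> V" using chart_at[OF N Fx] by blast
    obtain U \<phi> where c: "(U, \<phi>) \<in> atlas M" "x \<in> U" using chart_at[OF M x] by blast
    have pre: "openin (mtop M) {z \<in> points M. F z \<in> O'}" if "openin (mtop N) O'" for O'
      by (rule openin_continuous_map_preimage[OF cont that])
    show "smooth_at M N F x"
    proof (rule smooth_atI[where F = F, OF M N x d])
      show "\<exists>W. openin (mtop M) W \<and> x \<in> W \<and> F ` W \<subseteq> O'" if "openin (mtop N) O'" "F x \<in> O'" for O'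
        using pre[OF that(1)] that x by (intro exI[of _ "{z \<in> points M. F z \<in> O'}"]) auto
      fix i assume i: "i < mdim N"
      show "(\<lambda>z. \<psi> (F z) i) \<in> germs M x"
      proof (rule germ_chartI[OF M c])
        have eq: "{z \<in> U. F z \<in> V} = U \<inter> {z \<in> points M. F z \<in> V}" using atlasD(5)[OF M c(1)] by auto
        show "openin (Euclidean_space (mdim M)) (\<phi> ` {z \<in> U. F z \<in> V})"
          unfolding eq by (rule chart_image_open[OF atlas_is_chart[OF M c(1)] pre[OF atlasD(1)[OF N d(1)]]])
        show "Cinf_on (mdim M) (\<phi> ` {z \<in> U. F z \<in> V}) (\<lambda>u. \<psi> (F (inv_into U \<phi> u)) i)"
          by (rule smooth_mapD[OF F c(1) d(1) i])
      qed (use c d in auto)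
    qed
  qed
next
  assume F: "\<forall>x\<in>points M. smooth_at M N F x"
  have cont: "continuous_map (mtop M) (mtop N) F"
    unfolding continuous_map_def
  proof (intro conjI allI impI)
    show "F \<in> points M \<rightarrow> points N" using smooth_at_points(2)[of M N F] F by auto
    fix V assume V: "openin (mtop N) V"
    show "openin (mtop M) {x \<in> points M. F x \<in> V}"
      unfolding openin_subopen[of "mtop M" "{x \<in> points M. F x \<in> V}"]
    proof
      fix x assume "x \<in> {x \<in> points M. F x \<in> V}"
      then have "smooth_at M N F x" "F x \<in> V" using F by auto
      then obtain W where W: "openin (mtop M) W" "x \<in> W" "F ` W \<subseteq> V"
        using smooth_at_open[OF _ V] by metis
      then show "\<exists>T. openin (mtop M) T \<and> x \<in> T \<and> T \<subseteq> {x \<in> points M. F x \<in> V}"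
        using openin_subset[OF W(1)] by (intro exI[of _ W]) auto
    qed
  qed
  have "Cinf_on (mdim M) (\<phi> ` {x\<in>U. F x \<in> V}) (\<lambda>u. \<psi> (F (inv_into U \<phi> u)) i)"
    if c: "(U, \<phi>) \<in> atlas M" and d: "(V, \<psi>) \<in> atlas N" and i: "i < mdim N" for U \<phi> V \<psi> i
  proof -
    have eq: "{z \<in> U. F z \<in> V} = U \<inter> {z \<in> points M. F z \<in> V}" using atlasD(5)[OF M c(1)] by auto
    have W: "openin (mtop M) {z \<in> points M. F z \<in> V}"
      by (rule openin_continuous_map_preimage[OF cont atlasD(1)[OF N d]])
    have "smooth_fun_on M {z \<in> points M. F z \<in> V} (\<lambda>z. \<psi> (F z) i)"
      unfolding smooth_fun_on_iff_germs[OF M W]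
      using F by (intro ballI smooth_at_germ'[where F = F and N = N] germs_coord[OF N d]) auto
    from smooth_fun_onD[OF this c] show ?thesis unfolding eq .
  qed
  with cont show "smooth_map M N F" by (rule smooth_mapI)
qed

section \<open>Tangent and cotangent vectors\<close>

lemma tangentD:
  assumes "v \<in> tangent_space M x"
  shows "f \<notin> germs M x \<Longrightarrow> v f = 0"
    and "f \<in> germs M x \<Longrightarrow> g \<in> germs M x \<Longrightarrow> v (\<lambda>z. a * f z + b * g z) = a * v f + b * v g"
    and "f \<in> germs M x \<Longrightarrow> g \<in> germs M x \<Longrightarrow> v (\<lambda>z. f z * g z) = v f * g x + f x * v g"
  using assms by (simp_all add: tangent_space_def)

lemma tangentI:
  assumes "\<And>f. f \<notin> germs M x \<Longrightarrow> v f = 0"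
    and "\<And>f g a b. f \<in> germs M x \<Longrightarrow> g \<in> germs M x \<Longrightarrow> v (\<lambda>z. a * f z + b * g z) = a * v f + b * v g"
    and "\<And>f g. f \<in> germs M x \<Longrightarrow> g \<in> germs M x \<Longrightarrow> v (\<lambda>z. f z * g z) = v f * g x + f x * v g"
  shows "v \<in> tangent_space M x"
  using assms by (simp add: tangent_space_def)

lemma cotangentD:
  assumes "\<xi> \<in> cotangent_space M x"
  shows "v \<notin> tangent_space M x \<Longrightarrow> \<xi> v = 0"
    and "v \<in> tangent_space M x \<Longrightarrow> w \<in> tangent_space M x \<Longrightarrow> \<xi> (\<lambda>f. a * v f + b * w f) = a * \<xi> v + b * \<xi> w"
  using assms by (simp_all add: cotangent_space_def)

lemma cotangentI:
  assumes "\<And>v. v \<notin> tangent_space M x \<Longrightarrow> \<xi> v = 0"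
    and "\<And>v w a b. v \<in> tangent_space M x \<Longrightarrow> w \<in> tangent_space M x \<Longrightarrow> \<xi> (\<lambda>f. a * v f + b * w f) = a * \<xi> v + b * \<xi> w"
  shows "\<xi> \<in> cotangent_space M x"
  using assms by (simp add: cotangent_space_def)

lemma tangent_germ_eq:
  assumes M: "smooth_manifold M" and v: "v \<in> tangent_space M x"
    and W: "openin (mtop M) W" "x \<in> W" "\<And>y. y \<in> W \<Longrightarrow> f y = g y"
  shows "v f = v g"
proof (cases "f \<in> germs M x")
  case True
  then have g: "g \<in> germs M x" using germ_cong[OF M W(1,2) True W(3)] by blast
  have xM: "x \<in> points M" by (rule germs_points[OF True])
  define h where "h = (\<lambda>z. 1 * f z + (-1) * g z)"
  \<comment> \<open>A germ is constrained only near \<open>x\<close>, so this discontinuous function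
    is one. The difference \<open>h\<close> vanishes on \<open>W\<close>, hence
    \<open>h = h * k\<close>, and the Leibniz rule gives zero because both factors vanish at
    \<open>x\<close>.\<close>
  define k where "k z = (if z \<in> W then 0 else 1 :: real)" for z
  have h: "h \<in> germs M x" unfolding h_def by (rule germs_lin[OF M True g])
  have k: "k \<in> germs M x"
    by (rule germ_cong[OF M W(1,2) germs_const[OF M xM, of 0]]) (simp add: k_def)
  have "h = (\<lambda>z. h z * k z)" using W(3) by (auto simp: h_def k_def)
  then have "v h = v h * k x + h x * v k" using tangentD(3)[OF v h k] by simp
  also have "\<dots> = 0" using W by (simp add: k_def h_def)
  finally show ?thesis using tangentD(2)[OF v True g, of 1 "-1"] by (simp add: h_def)
next
  case False
  then have "g \<notin> germs M x" using germ_cong[OF M W(1,2), of g f] W(3) by auto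
  then show ?thesis using tangentD(1)[OF v] False by simp
qed

lemma tangent_const:
  assumes M: "smooth_manifold M" and v: "v \<in> tangent_space M x" and x: "x \<in> points M"
  shows "v (\<lambda>_. c) = 0"
proof -
  note g = germs_const[OF M x]
  have "v (\<lambda>_. 1) = 0" using tangentD(3)[OF v g g, of 1 1] by simp
  then show ?thesis using tangentD(2)[OF v g g, of c 1 0 1] by simp
qed

lemma tangent_add:
  "v \<in> tangent_space M x \<Longrightarrow> f \<in> germs M x \<Longrightarrow> g \<in> germs M x \<Longrightarrow> v (\<lambda>z. f z + g z) = v f + v g"
  using tangentD(2)[of v M x f g 1 1] by simp

lemma tangent_sum:
  assumes M: "smooth_manifold M" and v: "v \<in> tangent_space M x" and x: "x \<in> points M"
    and f: "\<And>i. i \<in> A \<Longrightarrow> f i \<in> germs M x"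
  shows "v (\<lambda>z. \<Sum>i\<in>A. f i z) = (\<Sum>i\<in>A. v (f i))"
  using f
proof (induction A rule: infinite_finite_induct)
  case (insert a A)
  have "(\<lambda>z. \<Sum>i\<in>A. f i z) \<in> germs M x" by (rule germs_sum[OF M x]) (use insert in auto)
  then show ?case using insert tangent_add[OF v, of "f a" "\<lambda>z. \<Sum>i\<in>A. f i z"] by simp
qed (simp_all add: tangent_const[OF M v x])

text \<open>The coordinate vector \<partial>/\<partial>\<phi>_i at \<open>x\<close>, with the value
  \<open>0\<close> off the germs that tangent vectors are required to have.\<close>

definition chart_vec :: "'a manifold \<Rightarrow> 'a set \<Rightarrow> ('a \<Rightarrow> nat \<Rightarrow> real) \<Rightarrow> 'a \<Rightarrow> nat \<Rightarrow> 'a tangent" where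
  "chart_vec M U \<phi> x i = (\<lambda>f. if f \<in> germs M x then partial i (\<lambda>u. f (inv_into U \<phi> u)) (\<phi> x) else 0)"

lemma chart_vec_tangent:
  assumes M: "smooth_manifold M" and c: "(U, \<phi>) \<in> atlas M" "x \<in> U" and i: "i < mdim M"
  shows "chart_vec M U \<phi> x i \<in> tangent_space M x"
proof (rule tangentI)
  fix f g assume f: "f \<in> germs M x" and g: "g \<in> germs M x"
  obtain B where B: "openin (Euclidean_space (mdim M)) B" "\<phi> x \<in> B"
    "Cinf_on (mdim M) B (\<lambda>u. f (inv_into U \<phi> u))"
    using germ_chartD[OF M c f] by metis
  obtain B' where B': "openin (Euclidean_space (mdim M)) B'" "\<phi> x \<in> B'"
    "Cinf_on (mdim M) B' (\<lambda>u. g (inv_into U \<phi> u))"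
    using germ_chartD[OF M c g] by metis
  have BB: "openin (Euclidean_space (mdim M)) (B \<inter> B')" "\<phi> x \<in> B \<inter> B'" using B B' by auto
  note C = Cinf_on_subset[OF Int_lower1 B(3), of B'] Cinf_on_subset[OF Int_lower2 B'(3), of B]
  have inv: "inv_into U \<phi> (\<phi> x) = x" using c atlasD(4)[OF M c(1)] by simp
  show "chart_vec M U \<phi> x i (\<lambda>z. a * f z + b * g z) = a * chart_vec M U \<phi> x i f + b * chart_vec M U \<phi> x i g" for a b
    using partial_lin[OF C BB(2) i BB(1), of a b] germs_lin[OF M f g, of a b] f g
    by (simp add: chart_vec_def)
  show "chart_vec M U \<phi> x i (\<lambda>z. f z * g z) = chart_vec M U \<phi> x i f * g x + f x * chart_vec M U \<phi> x i g"
    using partial_mult[OF Cinf_on_diff[OF C(1) i BB(2)] Cinf_on_diff[OF C(2) i BB(2)]] germs_mult[OF M f g] f g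
    by (simp add: chart_vec_def inv)
qed (simp add: chart_vec_def)

text \<open>Hadamard's lemma writes \<open>f\<close> near \<open>x\<close> as a constant plus
  products of centred coordinates with smooth coefficients. A derivation kills the constant, and
  since the centred coordinates vanish at \<open>x\<close>, the Leibniz rule sees only the values of
  the coefficients at \<open>x\<close>, which are the partial derivatives.\<close>

lemma tangent_expand:
  assumes M: "smooth_manifold M" and v: "v \<in> tangent_space M x" and c: "(U, \<phi>) \<in> atlas M" "x \<in> U"
    and f: "f \<in> germs M x"
  shows "v f = (\<Sum>i<mdim M. v (\<lambda>z. \<phi> z i) * chart_vec M U \<phi> x i f)"
proof -
  define n where "n = mdim M"
  have x: "x \<in> points M" by (rule germs_points[OF f])
  obtain B where B: "openin (Euclidean_space n) B" "\<phi> x \<in> B" "B \<subseteq> \<phi> ` U"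
    "Cinf_on n B (\<lambda>u. f (inv_into U \<phi> u))"
    using germ_chartD[OF M c f] unfolding n_def by metis
  obtain B' g where B'0: "openin (Euclidean_space n) B'" "\<phi> x \<in> B'" "B' \<subseteq> B"
    and B'1: "\<forall>i<n. Cinf_on n B' (g i) \<and> g i (\<phi> x) = partial i (\<lambda>u. f (inv_into U \<phi> u)) (\<phi> x)"
    and B'2: "\<forall>u\<in>B'. f (inv_into U \<phi> u) = f (inv_into U \<phi> (\<phi> x)) + (\<Sum>i<n. (u i - \<phi> x i) * g i u)"
    using Hadamard[OF B(1,2,4)] by (elim exE conjE)
  note B' = B'0 B'1[rule_format, THEN conjunct1] B'1[rule_format, THEN conjunct2] B'2[rule_format]
  note inj = atlasD(4)[OF M c(1)]
  define W where "W = {z \<in> U. \<phi> z \<in> B'}"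
  have W: "openin (mtop M) W" "x \<in> W"
    using chart_preimage_open[OF atlas_is_chart[OF M c(1)] B'(1)[unfolded n_def]] c B' by (auto simp: W_def)
  \<comment> \<open>The coordinates centred at \<open>x\<close>, spelt as a linear combination to
    fit the linearity rules for germs and tangent vectors.\<close>
  define p where "p i = (\<lambda>z. 1 * \<phi> z i + (- \<phi> x i) * 1)" for i
  define G where "G i = (\<lambda>z. g i (\<phi> z))" for i
  have p: "p i \<in> germs M x" "v (p i) = v (\<lambda>z. \<phi> z i)" for i
    using germs_lin[OF M germs_coord[OF M c] germs_const[OF M x], of 1 i "- \<phi> x i" 1]
      tangentD(2)[OF v germs_coord[OF M c] germs_const[OF M x], of 1 i "- \<phi> x i" 1] tangent_const[OF M v x]
    by (simp_all add: p_def)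
  have G: "G i \<in> germs M x" if "i < n" for i
    unfolding G_def
    by (rule germs_compose[OF M B'(1) B'(4)[OF that] germs_coord[OF M c] W]) (simp add: W_def)
  have pG: "(\<lambda>z. p i z * G i z) \<in> germs M x" if "i < n" for i
    by (rule germs_mult[OF M p(1) G[OF that]])
  have vpG: "v (\<lambda>z. p i z * G i z) = v (\<lambda>z. \<phi> z i) * chart_vec M U \<phi> x i f" if "i < n" for i
    using tangentD(3)[OF v p(1) G[OF that]] p(2) B'(5)[OF that] f
    by (simp add: p_def G_def chart_vec_def)
  have sum: "(\<lambda>z. \<Sum>i<n. p i z * G i z) \<in> germs M x"
    by (rule germs_sum[OF M x]) (use pG in auto)
  have "v f = v (\<lambda>z. f x + (\<Sum>i<n. p i z * G i z))"
  proof (rule tangent_germ_eq[OF M v W])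
    fix z assume "z \<in> W"
    then have "inv_into U \<phi> (\<phi> z) = z" "\<phi> z \<in> B'" "inv_into U \<phi> (\<phi> x) = x" using inj c by (auto simp: W_def)
    then show "f z = f x + (\<Sum>i<n. p i z * G i z)" using B'(6)[of "\<phi> z"] by (simp add: p_def G_def)
  qed
  also have "\<dots> = (\<Sum>i<n. v (\<lambda>z. p i z * G i z))"
    using tangent_add[OF v germs_const[OF M x] sum] tangent_sum[OF M v x, of "{..<n}" "\<lambda>i z. p i z * G i z"] pG
      tangent_const[OF M v x] by simp
  also have "\<dots> = (\<Sum>i<n. v (\<lambda>z. \<phi> z i) * chart_vec M U \<phi> x i f)"
    by (rule sum.cong) (use vpG in auto)
  finally show ?thesis by (simp add: n_def)
qed

section \<open>Linear algebra of tangent vectors and covectors\<close>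

lemma tangent_zero: "(\<lambda>_. 0) \<in> tangent_space M x"
  by (rule tangentI) auto

lemma tangent_lin:
  assumes v: "v \<in> tangent_space M x" and w: "w \<in> tangent_space M x"
  shows "(\<lambda>f. a * v f + b * w f) \<in> tangent_space M x"
  by (rule tangentI) (simp_all add: tangentD[OF v] tangentD[OF w] algebra_simps)

lemma tangent_eqI:
  assumes v: "v \<in> tangent_space M x" and w: "w \<in> tangent_space M x"
    and "\<And>f. f \<in> germs M x \<Longrightarrow> v f = w f"
  shows "v = w"
proof
  fix f show "v f = w f"
    by (cases "f \<in> germs M x") (simp_all add: assms(3) tangentD(1)[OF v] tangentD(1)[OF w])
qed

lemma tangent_eq_coord:
  assumes M: "smooth_manifold M" and v: "v \<in> tangent_space M x" and w: "w \<in> tangent_space M x"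
    and c: "(U, \<phi>) \<in> atlas M" "x \<in> U" and eq: "\<And>i. i < mdim M \<Longrightarrow> v (\<lambda>z. \<phi> z i) = w (\<lambda>z. \<phi> z i)"
  shows "v = w"
proof (rule tangent_eqI[OF v w])
  fix f assume f: "f \<in> germs M x"
  have "v f = (\<Sum>i<mdim M. w (\<lambda>z. \<phi> z i) * chart_vec M U \<phi> x i f)"
    by (rule trans[OF tangent_expand[OF M v c f] sum.cong]) (simp_all add: eq)
  then show "v f = w f" by (rule trans[OF _ tangent_expand[OF M w c f, symmetric]])
qed

lemma tangent_sum_closed:
  assumes "\<And>i. i \<in> A \<Longrightarrow> v i \<in> tangent_space M x"
  shows "(\<lambda>f. \<Sum>i\<in>A. c i * v i f) \<in> tangent_space M x"
  using assms
proof (induction A rule: infinite_finite_induct)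
  case (insert a A)
  then show ?case using tangent_lin[of "v a" M x "\<lambda>f. \<Sum>i\<in>A. c i * v i f" "c a" 1] by simp
qed (simp_all add: tangent_zero)

lemma cotangent_zero_vec: "\<xi> \<in> cotangent_space M x \<Longrightarrow> \<xi> (\<lambda>_. 0) = 0"
  using cotangentD(2)[of \<xi> M x "\<lambda>_. 0" "\<lambda>_. 0" 0 0] by (simp add: tangent_zero)

lemma cotangent_sum:
  assumes \<xi>: "\<xi> \<in> cotangent_space M x" and "\<And>i. i \<in> A \<Longrightarrow> v i \<in> tangent_space M x"
  shows "\<xi> (\<lambda>f. \<Sum>i\<in>A. c i * v i f) = (\<Sum>i\<in>A. c i * \<xi> (v i))"
  using assms(2)
proof (induction A rule: infinite_finite_induct)
  case (insert a A)
  then show ?case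
    using cotangentD(2)[OF \<xi>, of "v a" "\<lambda>f. \<Sum>i\<in>A. c i * v i f" "c a" 1]
      tangent_sum_closed[of A v M x c] by simp
qed (simp_all add: cotangent_zero_vec[OF \<xi>])

lemma differential_apply: "v \<in> tangent_space M x \<Longrightarrow> differential M f x v = v f"
  by (simp add: differential_def)

lemma differential_cotangent: "differential M f x \<in> cotangent_space M x"
  by (rule cotangentI) (simp_all add: differential_def tangent_lin)

lemma cotangent_lin:
  assumes \<xi>: "\<xi> \<in> cotangent_space M x" and \<eta>: "\<eta> \<in> cotangent_space M x"
  shows "(\<lambda>v. a * \<xi> v + b * \<eta> v) \<in> cotangent_space M x"
  by (rule cotangentI) (simp_all add: cotangentD[OF \<xi>] cotangentD[OF \<eta>] algebra_simps)

lemma cotangent_zero: "(\<lambda>_. 0) \<in> cotangent_space M x"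
  by (rule cotangentI) auto

lemma cotangent_eqI:
  assumes \<xi>: "\<xi> \<in> cotangent_space M x" and \<eta>: "\<eta> \<in> cotangent_space M x"
    and "\<And>v. v \<in> tangent_space M x \<Longrightarrow> \<xi> v = \<eta> v"
  shows "\<xi> = \<eta>"
proof
  fix v show "\<xi> v = \<eta> v"
    by (cases "v \<in> tangent_space M x") (simp_all add: assms(3) cotangentD(1)[OF \<xi>] cotangentD(1)[OF \<eta>])
qed

lemma differential_eqI:
  assumes "\<And>v. v \<in> tangent_space M x \<Longrightarrow> v f = v g"
  shows "differential M f x = differential M g x"
  unfolding differential_def using assms by auto

text \<open>In a chart, \<open>\<xi>\<close> is the differential of the coordinate combination with coefficients \<open>\<xi> (\<partial>/\<partial>\<phi>\<^sub>i)\<close>.\<close>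

lemma cotangent_differential:
  assumes M: "smooth_manifold M" and x: "x \<in> points M" and \<xi>: "\<xi> \<in> cotangent_space M x"
  obtains f where "f \<in> germs M x" "\<xi> = differential M f x"
proof -
  obtain U \<phi> where c: "(U, \<phi>) \<in> atlas M" "x \<in> U" using chart_at[OF M x] by metis
  define n where "n = mdim M"
  define d where "d = chart_vec M U \<phi> x"
  have d: "d i \<in> tangent_space M x" if "i < n" for i
    unfolding d_def by (rule chart_vec_tangent[OF M c]) (use that n_def in simp)
  define f where "f = (\<lambda>z. \<Sum>i<n. \<xi> (d i) * \<phi> z i)"
  have t: "(\<lambda>z. \<xi> (d i) * \<phi> z i) \<in> germs M x" for i by (rule germs_cmult[OF M germs_coord[OF M c]])
  have f: "f \<in> germs M x" unfolding f_def by (rule germs_sum[OF M x t])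
  have "\<xi> v = differential M f x v" if v: "v \<in> tangent_space M x" for v
  proof -
    have "v = (\<lambda>g. \<Sum>i<n. v (\<lambda>z. \<phi> z i) * d i g)"
    proof (rule tangent_eqI[OF v tangent_sum_closed])
      show "v g = (\<Sum>i<n. v (\<lambda>z. \<phi> z i) * d i g)" if "g \<in> germs M x" for g
        unfolding d_def n_def by (rule tangent_expand[OF M v c that])
    qed (use d in auto)
    then have "\<xi> v = \<xi> (\<lambda>g. \<Sum>i<n. v (\<lambda>z. \<phi> z i) * d i g)" by (rule arg_cong)
    also have "\<dots> = (\<Sum>i<n. v (\<lambda>z. \<phi> z i) * \<xi> (d i))"
      by (rule cotangent_sum[OF \<xi>]) (use d in auto)
    also have "\<dots> = (\<Sum>i<n. v (\<lambda>z. \<xi> (d i) * \<phi> z i))"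
    proof (rule sum.cong[OF refl])
      fix i
      show "v (\<lambda>z. \<phi> z i) * \<xi> (d i) = v (\<lambda>z. \<xi> (d i) * \<phi> z i)"
        using tangentD(2)[OF v germs_coord[OF M c] germs_coord[OF M c], of "\<xi> (d i)" i 0 i] by simp
    qed
    also have "\<dots> = v f" unfolding f_def by (rule tangent_sum[OF M v x t, symmetric])
    finally show ?thesis by (simp add: differential_apply[OF v])
  qed
  then have "\<xi> = differential M f x" by (rule cotangent_eqI[OF \<xi> differential_cotangent])
  with f show thesis by (rule that)
qed

lemma differential_lin:
  assumes "f \<in> germs M x" "g \<in> germs M x"
  shows "differential M (\<lambda>z. a * f z + b * g z) x = (\<lambda>v. a * differential M f x v + b * differential M g x v)"
  using tangentD(2)[OF _ assms] by (auto simp: differential_def fun_eq_iff)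

lemma differential_mult:
  assumes "f \<in> germs M x" "g \<in> germs M x"
  shows "differential M (\<lambda>z. f z * g z) x = (\<lambda>v. g x * differential M f x v + f x * differential M g x v)"
  using tangentD(3)[OF _ assms] by (auto simp: differential_def fun_eq_iff mult.commute)

lemma differential_cong:
  assumes "smooth_manifold M" "openin (mtop M) W" "x \<in> W" "\<And>y. y \<in> W \<Longrightarrow> f y = g y"
  shows "differential M f x = differential M g x"
  by (rule differential_eqI, rule tangent_germ_eq[OF assms(1) _ assms(2-4)])

lemma differential_const:
  assumes "smooth_manifold M" "x \<in> points M"
  shows "differential M (\<lambda>_. c) x = (\<lambda>_. 0)"
  using tangent_const[OF assms(1) _ assms(2)] by (auto simp: differential_def)

section \<open>Push-forward of vectors and pull-back of covectors\<close>

lemma pushforward_apply: "h \<in> germs N (F x) \<Longrightarrow> pushforward N F x v h = v (\<lambda>z. h (F z))"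
  by (simp add: pushforward_def comp_def)

lemma pushforward_tangent:
  assumes F: "smooth_at M N F x" and N: "smooth_manifold N" and v: "v \<in> tangent_space M x"
  shows "pushforward N F x v \<in> tangent_space N (F x)"
proof (rule tangentI)
  fix f g assume f: "f \<in> germs N (F x)" and g: "g \<in> germs N (F x)"
  note fg = smooth_at_germ'[OF F f] smooth_at_germ'[OF F g]
  show "pushforward N F x v (\<lambda>z. a * f z + b * g z) = a * pushforward N F x v f + b * pushforward N F x v g" for a b
    using tangentD(2)[OF v fg, of a b] germs_lin[OF N f g] by (simp add: pushforward_apply f g)
  show "pushforward N F x v (\<lambda>z. f z * g z) = pushforward N F x v f * g (F x) + f (F x) * pushforward N F x v g"
    using tangentD(3)[OF v fg] germs_mult[OF N f g] by (simp add: pushforward_apply f g)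
qed (simp add: pushforward_def)

lemma pushforward_lin: "pushforward N F x (\<lambda>f. a * v f + b * w f) = (\<lambda>f. a * pushforward N F x v f + b * pushforward N F x w f)"
  by (auto simp: pushforward_def)

lemma pullback_cotangent:
  assumes F: "smooth_at M N F x" and N: "smooth_manifold N" and \<xi>: "\<xi> \<in> cotangent_space N (F x)"
  shows "pullback M N F x \<xi> \<in> cotangent_space M x"
  by (rule cotangentI)
    (simp_all add: pullback_def tangent_lin pushforward_lin cotangentD(2)[OF \<xi>] pushforward_tangent[OF F N])

text \<open>Together with \<open>cotangent_differential\<close> this reduces every pull-back of
  covectors to composition of functions.\<close>

lemma pullback_differential:
  assumes F: "smooth_at M N F x" and N: "smooth_manifold N" and f: "f \<in> germs N (F x)"
  shows "pullback M N F x (differential N f (F x)) = differential M (\<lambda>z. f (F z)) x"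
  by (auto simp: pullback_def differential_def pushforward_tangent[OF F N] pushforward_apply f)

lemma pullback_lin:
  "pullback M N F x (\<lambda>v. a * \<xi> v + b * \<eta> v) = (\<lambda>v. a * pullback M N F x \<xi> v + b * pullback M N F x \<eta> v)"
  by (auto simp: pullback_def)

section \<open>Bivectors and their brackets\<close>

lemma smooth_bivectorD:
  assumes "smooth_bivector M \<pi>"
  shows "x \<in> points M \<Longrightarrow> \<xi> \<in> cotangent_space M x \<Longrightarrow> \<eta> \<in> cotangent_space M x \<Longrightarrow> \<pi> x \<xi> \<eta> = - \<pi> x \<eta> \<xi>"
    and "x \<in> points M \<Longrightarrow> \<xi> \<in> cotangent_space M x \<Longrightarrow> \<eta> \<in> cotangent_space M x \<Longrightarrow> \<zeta> \<in> cotangent_space M x \<Longrightarrow>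
      \<pi> x (\<lambda>v. a * \<xi> v + b * \<eta> v) \<zeta> = a * \<pi> x \<xi> \<zeta> + b * \<pi> x \<eta> \<zeta>"
    and "openin (mtop M) W \<Longrightarrow> smooth_fun_on M W f \<Longrightarrow> smooth_fun_on M W g \<Longrightarrow> smooth_fun_on M W (bracket M \<pi> f g)"
  using assms unfolding smooth_bivector_def by blast+

lemma smooth_bivectorI:
  assumes "\<And>x \<xi> \<eta>. x \<in> points M \<Longrightarrow> \<xi> \<in> cotangent_space M x \<Longrightarrow> \<eta> \<in> cotangent_space M x \<Longrightarrow> \<pi> x \<xi> \<eta> = - \<pi> x \<eta> \<xi>"
    and "\<And>x \<xi> \<eta> \<zeta> a b. x \<in> points M \<Longrightarrow> \<xi> \<in> cotangent_space M x \<Longrightarrow> \<eta> \<in> cotangent_space M x \<Longrightarrow> \<zeta> \<in> cotangent_space M x \<Longrightarrow>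
      \<pi> x (\<lambda>v. a * \<xi> v + b * \<eta> v) \<zeta> = a * \<pi> x \<xi> \<zeta> + b * \<pi> x \<eta> \<zeta>"
    and "\<And>W f g. openin (mtop M) W \<Longrightarrow> smooth_fun_on M W f \<Longrightarrow> smooth_fun_on M W g \<Longrightarrow> smooth_fun_on M W (bracket M \<pi> f g)"
  shows "smooth_bivector M \<pi>"
  unfolding smooth_bivector_def
  by (intro conjI ballI allI impI; (elim conjE)?) (fact assms)+

lemma bivector_lin_right:
  assumes \<pi>: "smooth_bivector M \<pi>" and "x \<in> points M" "\<xi> \<in> cotangent_space M x" "\<eta> \<in> cotangent_space M x" "\<zeta> \<in> cotangent_space M x"
  shows "\<pi> x \<zeta> (\<lambda>v. a * \<xi> v + b * \<eta> v) = a * \<pi> x \<zeta> \<xi> + b * \<pi> x \<zeta> \<eta>"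
proof -
  note s = smooth_bivectorD(1)[OF \<pi> assms(2) assms(5)]
  show ?thesis
    unfolding s[OF cotangent_lin[OF assms(3,4)]] s[OF assms(3)] s[OF assms(4)]
      smooth_bivectorD(2)[OF \<pi> assms(2-5)] by simp
qed

lemma bivector_zero:
  assumes \<pi>: "smooth_bivector M \<pi>" and "x \<in> points M" "\<xi> \<in> cotangent_space M x"
  shows "\<pi> x (\<lambda>_. 0) \<xi> = 0" "\<pi> x \<xi> (\<lambda>_. 0) = 0"
  using smooth_bivectorD(2)[OF \<pi> assms(2,3,3,3), of 0 0] bivector_lin_right[OF \<pi> assms(2,3,3,3), of 0 0] by simp_all

lemma bracket_skew:
  assumes "smooth_bivector M \<pi>" "x \<in> points M"
  shows "bracket M \<pi> f g x = - bracket M \<pi> g f x"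
  unfolding bracket_def by (rule smooth_bivectorD(1)[OF assms differential_cotangent differential_cotangent])

lemma bracket_lin:
  assumes "smooth_bivector M \<pi>" "f \<in> germs M x" "g \<in> germs M x"
  shows "bracket M \<pi> (\<lambda>z. a * f z + b * g z) h x = a * bracket M \<pi> f h x + b * bracket M \<pi> g h x"
    "bracket M \<pi> h (\<lambda>z. a * f z + b * g z) x = a * bracket M \<pi> h f x + b * bracket M \<pi> h g x"
  unfolding bracket_def differential_lin[OF assms(2,3)]
  by (rule smooth_bivectorD(2)[OF assms(1) germs_points[OF assms(2)]] bivector_lin_right[OF assms(1) germs_points[OF assms(2)]];
      rule differential_cotangent)+

lemma bracket_mult:
  assumes "smooth_bivector M \<pi>" "f \<in> germs M x" "g \<in> germs M x"
  shows "bracket M \<pi> (\<lambda>z. f z * g z) h x = g x * bracket M \<pi> f h x + f x * bracket M \<pi> g h x"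
    "bracket M \<pi> h (\<lambda>z. f z * g z) x = g x * bracket M \<pi> h f x + f x * bracket M \<pi> h g x"
  unfolding bracket_def differential_mult[OF assms(2,3)]
  by (rule smooth_bivectorD(2)[OF assms(1) germs_points[OF assms(2)]] bivector_lin_right[OF assms(1) germs_points[OF assms(2)]];
      rule differential_cotangent)+

lemma bracket_cong:
  assumes "smooth_manifold M" "openin (mtop M) W" "x \<in> W" "\<And>y. y \<in> W \<Longrightarrow> f y = f' y" "\<And>y. y \<in> W \<Longrightarrow> g y = g' y"
  shows "bracket M \<pi> f g x = bracket M \<pi> f' g' x"
  unfolding bracket_def using differential_cong[OF assms(1-4)] differential_cong[OF assms(1-3,5)] by simp

lemma bracket_const:
  assumes "smooth_manifold M" "smooth_bivector M \<pi>" "x \<in> points M"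
  shows "bracket M \<pi> (\<lambda>_. c) g x = 0" "bracket M \<pi> g (\<lambda>_. c) x = 0"
  unfolding bracket_def differential_const[OF assms(1,3)]
  by (rule bivector_zero[OF assms(2,3) differential_cotangent])+

lemma bracket_germ:
  assumes "smooth_bivector M \<pi>" "f \<in> germs M x" "g \<in> germs M x"
  shows "bracket M \<pi> f g \<in> germs M x"
proof -
  obtain W where W: "openin (mtop M) W" "x \<in> W" "smooth_fun_on M W f" using assms(2) unfolding germs_def by blast
  obtain V where V: "openin (mtop M) V" "x \<in> V" "smooth_fun_on M V g" using assms(3) unfolding germs_def by blast
  have WV: "openin (mtop M) (W \<inter> V)" using W V by blast
  show ?thesis
    by (rule smooth_fun_on_germs[OF WV _ smooth_bivectorD(3)[OF assms(1) WV smooth_fun_on_subset[OF _ W(3)] smooth_fun_on_subset[OF _ V(3)]]])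
      (use W V in auto)
qed

lemma sharp_apply: "f \<in> germs M x \<Longrightarrow> sharp M \<pi> x \<xi> f = \<pi> x \<xi> (differential M f x)"
  by (simp add: sharp_def)

lemma sharp_tangent:
  assumes M: "smooth_manifold M" and \<pi>: "smooth_bivector M \<pi>" and x: "x \<in> points M" and \<xi>: "\<xi> \<in> cotangent_space M x"
  shows "sharp M \<pi> x \<xi> \<in> tangent_space M x"
proof (rule tangentI)
  fix f g assume fg: "f \<in> germs M x" "g \<in> germs M x"
  note R = bivector_lin_right[OF \<pi> x differential_cotangent differential_cotangent \<xi>]
  show "sharp M \<pi> x \<xi> (\<lambda>z. a * f z + b * g z) = a * sharp M \<pi> x \<xi> f + b * sharp M \<pi> x \<xi> g" for a b
    using germs_lin[OF M fg] by (simp add: sharp_apply fg differential_lin R)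
  show "sharp M \<pi> x \<xi> (\<lambda>z. f z * g z) = sharp M \<pi> x \<xi> f * g x + f x * sharp M \<pi> x \<xi> g"
    using germs_mult[OF M fg] by (simp add: sharp_apply fg differential_mult R)
qed (simp add: sharp_def)

text \<open>\<open>sharp\<close> is defined by its values on functions, that is, by pairing with
  differentials. Every covector being a differential, the pairing formula extends to all of
  them.\<close>

lemma cotangent_sharp:
  assumes M: "smooth_manifold M" and \<pi>: "smooth_bivector M \<pi>" and x: "x \<in> points M"
    and \<xi>: "\<xi> \<in> cotangent_space M x" and \<zeta>: "\<zeta> \<in> cotangent_space M x"
  shows "\<zeta> (sharp M \<pi> x \<xi>) = \<pi> x \<xi> \<zeta>"
proof -
  obtain f where f: "f \<in> germs M x" "\<zeta> = differential M f x"
    by (rule cotangent_differential[OF M x \<zeta>])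
  show ?thesis
    unfolding f(2) differential_apply[OF sharp_tangent[OF M \<pi> x \<xi>]] by (rule sharp_apply[OF f(1)])
qed

text \<open>Both covectors are differentials of germs at \<open>F x\<close>, and their pull-backs
  are the differentials of the composites. Poisson maps are checked in this form from here on,
  except where covectors are the natural arguments.\<close>

lemma poisson_map_iff:
  assumes M: "smooth_manifold M" and N: "smooth_manifold N"
  shows "poisson_map M \<pi> N \<rho> F \<longleftrightarrow> smooth_map M N F \<and>
    (\<forall>x\<in>points M. \<forall>f\<in>germs N (F x). \<forall>g\<in>germs N (F x).
      bracket N \<rho> f g (F x) = bracket M \<pi> (\<lambda>z. f (F z)) (\<lambda>z. g (F z)) x)"
proof (cases "smooth_map M N F")
  case True
  have Fx: "smooth_at M N F x" if "x \<in> points M" for x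
    using True that by (simp add: smooth_map_iff[OF M N])
  have pd: "pullback M N F x (differential N f (F x)) = differential M (\<lambda>z. f (F z)) x"
    if "x \<in> points M" "f \<in> germs N (F x)" for x f
    by (rule pullback_differential[OF Fx[OF that(1)] N that(2)])
  have "(\<forall>\<xi>\<in>cotangent_space N (F x). \<forall>\<eta>\<in>cotangent_space N (F x).
        \<rho> (F x) \<xi> \<eta> = \<pi> x (pullback M N F x \<xi>) (pullback M N F x \<eta>)) \<longleftrightarrow>
      (\<forall>f\<in>germs N (F x). \<forall>g\<in>germs N (F x).
      bracket N \<rho> f g (F x) = bracket M \<pi> (\<lambda>z. f (F z)) (\<lambda>z. g (F z)) x)" if x: "x \<in> points M" for x
  proof (intro iffI ballI)
    fix f g assume fg: "f \<in> germs N (F x)" "g \<in> germs N (F x)"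
      and *: "\<forall>\<xi>\<in>cotangent_space N (F x). \<forall>\<eta>\<in>cotangent_space N (F x).
        \<rho> (F x) \<xi> \<eta> = \<pi> x (pullback M N F x \<xi>) (pullback M N F x \<eta>)"
    show "bracket N \<rho> f g (F x) = bracket M \<pi> (\<lambda>z. f (F z)) (\<lambda>z. g (F z)) x"
      unfolding bracket_def pd[OF x fg(1), symmetric] pd[OF x fg(2), symmetric]
      by (rule *[rule_format, OF differential_cotangent differential_cotangent])
  next
    fix \<xi> \<eta> assume \<xi>: "\<xi> \<in> cotangent_space N (F x)" and \<eta>: "\<eta> \<in> cotangent_space N (F x)"
      and *: "\<forall>f\<in>germs N (F x). \<forall>g\<in>germs N (F x).
      bracket N \<rho> f g (F x) = bracket M \<pi> (\<lambda>z. f (F z)) (\<lambda>z. g (F z)) x"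
    have FN: "F x \<in> points N" using smooth_at_points(2)[OF Fx[OF x]] .
    obtain f where f: "f \<in> germs N (F x)" "\<xi> = differential N f (F x)" by (rule cotangent_differential[OF N FN \<xi>])
    obtain g where g: "g \<in> germs N (F x)" "\<eta> = differential N g (F x)" by (rule cotangent_differential[OF N FN \<eta>])
    show "\<rho> (F x) \<xi> \<eta> = \<pi> x (pullback M N F x \<xi>) (pullback M N F x \<eta>)"
      unfolding f(2) g(2) pd[OF x f(1)] pd[OF x g(1)]
      by (rule *[rule_format, OF f(1) g(1), unfolded bracket_def])
  qed
  then show ?thesis using True by (simp add: poisson_map_def)
qed (simp add: poisson_map_def)

section \<open>The Schouten bracket as a derivation in each argument\<close>

lemma bracket_bracket_lin:
  assumes M: "smooth_manifold M" and \<pi>: "smooth_bivector M \<pi>" and \<rho>: "smooth_bivector M \<rho>"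
    and f: "f \<in> germs M x" and g: "g \<in> germs M x" and h: "h \<in> germs M x" and k: "k \<in> germs M x"
  shows "bracket M \<rho> (bracket M \<pi> g (\<lambda>z. a * h z + b * k z)) f x =
    a * bracket M \<rho> (bracket M \<pi> g h) f x + b * bracket M \<rho> (bracket M \<pi> g k) f x"
proof -
  obtain W where W: "openin (mtop M) W" "x \<in> W" "\<forall>l\<in>{h, k}. smooth_fun_on M W l"
    using germs_common[of "{h, k}" x M "\<lambda>l. l"] h k germs_points[OF h] by auto
  have "bracket M \<rho> (bracket M \<pi> g (\<lambda>z. a * h z + b * k z)) f x =
      bracket M \<rho> (\<lambda>z. a * bracket M \<pi> g h z + b * bracket M \<pi> g k z) f x"
    by (rule bracket_cong[OF M W(1,2) bracket_lin(2)[OF \<pi>]]) (use W smooth_fun_on_germs[OF W(1)] in auto)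
  also have "\<dots> = a * bracket M \<rho> (bracket M \<pi> g h) f x + b * bracket M \<rho> (bracket M \<pi> g k) f x"
    by (rule bracket_lin(1)[OF \<rho> bracket_germ[OF \<pi> g h] bracket_germ[OF \<pi> g k]])
  finally show ?thesis .
qed

lemma bracket_bracket_mult:
  assumes M: "smooth_manifold M" and \<pi>: "smooth_bivector M \<pi>" and \<rho>: "smooth_bivector M \<rho>"
    and f: "f \<in> germs M x" and g: "g \<in> germs M x" and h: "h \<in> germs M x" and k: "k \<in> germs M x"
  shows "bracket M \<rho> (bracket M \<pi> g (\<lambda>z. h z * k z)) f x =
    k x * bracket M \<rho> (bracket M \<pi> g h) f x + bracket M \<pi> g h x * bracket M \<rho> k f x +
    h x * bracket M \<rho> (bracket M \<pi> g k) f x + bracket M \<pi> g k x * bracket M \<rho> h f x"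
proof -
  note gh = bracket_germ[OF \<pi> g h] and gk = bracket_germ[OF \<pi> g k]
  obtain W where W: "openin (mtop M) W" "x \<in> W" "\<forall>l\<in>{h, k}. smooth_fun_on M W l"
    using germs_common[of "{h, k}" x M "\<lambda>l. l"] h k germs_points[OF h] by auto
  have "bracket M \<rho> (bracket M \<pi> g (\<lambda>z. h z * k z)) f x =
      bracket M \<rho> (\<lambda>z. k z * bracket M \<pi> g h z + h z * bracket M \<pi> g k z) f x"
    by (rule bracket_cong[OF M W(1,2) bracket_mult(2)[OF \<pi>]]) (use W smooth_fun_on_germs[OF W(1)] in auto)
  also have "\<dots> = bracket M \<rho> (\<lambda>z. k z * bracket M \<pi> g h z) f x + bracket M \<rho> (\<lambda>z. h z * bracket M \<pi> g k z) f x"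
    using bracket_lin(1)[OF \<rho> germs_mult[OF M k gh] germs_mult[OF M h gk], of 1 1 f] by simp
  finally show ?thesis
    by (simp add: bracket_mult(1)[OF \<rho> k gh] bracket_mult(1)[OF \<rho> h gk] algebra_simps)
qed

lemma schouten_cyclic: "schouten M \<pi> \<rho> f g h x = schouten M \<pi> \<rho> g h f x"
  by (simp add: schouten_def Let_def)

text \<open>Skew-symmetry of the inner brackets brings \<open>h\<close> into second slots only,
  where the rules \<open>bracket_bracket_lin\<close> and \<open>bracket_bracket_mult\<close> and the
  second-slot rules for the outer brackets apply.\<close>

lemma schouten_alt:
  assumes M: "smooth_manifold M" and \<pi>: "smooth_bivector M \<pi>" and \<rho>: "smooth_bivector M \<rho>"
    and f: "f \<in> germs M x" and h: "h \<in> germs M x"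
  shows "schouten M \<pi> \<rho> f g h x =
    bracket M \<rho> (bracket M \<pi> f g) h x + bracket M \<rho> (bracket M \<pi> g h) f x - bracket M \<rho> (bracket M \<pi> f h) g x +
    bracket M \<pi> (bracket M \<rho> f g) h x + bracket M \<pi> (bracket M \<rho> g h) f x - bracket M \<pi> (bracket M \<rho> f h) g x"
proof -
  have x: "x \<in> points M" by (rule germs_points[OF f])
  have *: "bracket M \<rho> (bracket M \<pi> h f) g x = - bracket M \<rho> (bracket M \<pi> f h) g x"
    if \<pi>: "smooth_bivector M \<pi>" and \<rho>: "smooth_bivector M \<rho>" for \<pi> \<rho>
  proof -
    have sk: "bracket M \<pi> h f y = (-1) * bracket M \<pi> f h y + 0 * bracket M \<pi> f h y" if "y \<in> points M" for y
      using bracket_skew[OF \<pi> that, of h f] by linarith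
    have "bracket M \<rho> (bracket M \<pi> h f) g x = bracket M \<rho> (\<lambda>z. (-1) * bracket M \<pi> f h z + 0 * bracket M \<pi> f h z) g x"
      by (rule bracket_cong[OF M openin_topspace x sk refl])
    also have "\<dots> = - bracket M \<rho> (bracket M \<pi> f h) g x"
      using bracket_lin(1)[OF \<rho> bracket_germ[OF \<pi> f h] bracket_germ[OF \<pi> f h], of "-1" 0 g] by simp
    finally show ?thesis .
  qed
  show ?thesis by (simp add: schouten_def Let_def *[OF \<pi> \<rho>] *[OF \<rho> \<pi>])
qed

text \<open>Applied to a product \<open>h * k\<close>, each half of the formula produces mixed
  terms, such as the bracket of \<open>g\<close> and \<open>h\<close> by one bivector times that of
  \<open>k\<close> and \<open>f\<close> by the other. By skew-symmetry they cancel against those of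
  the other half, so the expression is tensorial in the last argument.\<close>

lemma schouten_tangent:
  assumes M: "smooth_manifold M" and \<pi>: "smooth_bivector M \<pi>" and \<rho>: "smooth_bivector M \<rho>"
    and f: "f \<in> germs M x" and g: "g \<in> germs M x"
  shows "(\<lambda>h. if h \<in> germs M x then schouten M \<pi> \<rho> f g h x else 0) \<in> tangent_space M x"
proof (rule tangentI)
  fix h k assume h: "h \<in> germs M x" and k: "k \<in> germs M x"
  have x: "x \<in> points M" by (rule germs_points[OF f])
  note alt = schouten_alt[OF M \<pi> \<rho> f]
  note BB = bracket_bracket_lin[OF M \<pi> \<rho> _ _ h k] bracket_bracket_lin[OF M \<rho> \<pi> _ _ h k]
    bracket_bracket_mult[OF M \<pi> \<rho> _ _ h k] bracket_bracket_mult[OF M \<rho> \<pi> _ _ h k]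
  note L = bracket_lin(2)[OF \<pi> h k] bracket_lin(2)[OF \<rho> h k] bracket_mult(2)[OF \<pi> h k] bracket_mult(2)[OF \<rho> h k]
  note sk = bracket_skew[OF \<pi> x, of h] bracket_skew[OF \<pi> x, of k] bracket_skew[OF \<rho> x, of h] bracket_skew[OF \<rho> x, of k]
  show "(if (\<lambda>z. a * h z + b * k z) \<in> germs M x then schouten M \<pi> \<rho> f g (\<lambda>z. a * h z + b * k z) x else 0) =
    a * (if h \<in> germs M x then schouten M \<pi> \<rho> f g h x else 0) + b * (if k \<in> germs M x then schouten M \<pi> \<rho> f g k x else 0)" for a b
    unfolding if_P[OF germs_lin[OF M h k]] if_P[OF h] if_P[OF k]
      alt[OF germs_lin[OF M h k]] alt[OF h] alt[OF k] BB(1,2)[OF f g] BB(1,2)[OF g f] L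
    by (simp add: algebra_simps)
  show "(if (\<lambda>z. h z * k z) \<in> germs M x then schouten M \<pi> \<rho> f g (\<lambda>z. h z * k z) x else 0) =
    (if h \<in> germs M x then schouten M \<pi> \<rho> f g h x else 0) * k x + h x * (if k \<in> germs M x then schouten M \<pi> \<rho> f g k x else 0)"
    unfolding if_P[OF germs_mult[OF M h k]] if_P[OF h] if_P[OF k]
      alt[OF germs_mult[OF M h k]] alt[OF h] alt[OF k] BB(3,4)[OF f g] BB(3,4)[OF g f] L sk(1-4)[of f] sk(1-4)[of g]
    by (simp add: algebra_simps)
qed simp

text \<open>A derivation that vanishes on a set of germs separating tangent vectors is zero. This is
  applied to the last argument three times, and cyclic symmetry brings each argument into that
  place.\<close>

lemma schouten_generators:
  assumes M: "smooth_manifold M" and \<pi>: "smooth_bivector M \<pi>" and \<rho>: "smooth_bivector M \<rho>"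
    and A: "A \<subseteq> germs M x"
    and sep: "\<And>v. v \<in> tangent_space M x \<Longrightarrow> (\<And>a. a \<in> A \<Longrightarrow> v a = 0) \<Longrightarrow> v = (\<lambda>_. 0)"
    and zero: "\<And>f g h. f \<in> A \<Longrightarrow> g \<in> A \<Longrightarrow> h \<in> A \<Longrightarrow> schouten M \<pi> \<rho> f g h x = 0"
    and f: "f \<in> germs M x" and g: "g \<in> germs M x" and h: "h \<in> germs M x"
  shows "schouten M \<pi> \<rho> f g h x = 0"
proof -
  have step: "schouten M \<pi> \<rho> f g h x = 0"
    if fg: "f \<in> germs M x" "g \<in> germs M x" and z: "\<And>a. a \<in> A \<Longrightarrow> schouten M \<pi> \<rho> f g a x = 0" and h: "h \<in> germs M x"
    for f g h
  proof -
    have "(\<lambda>h. if h \<in> germs M x then schouten M \<pi> \<rho> f g h x else 0) = (\<lambda>_. 0)"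
      by (rule sep[OF schouten_tangent[OF M \<pi> \<rho> fg]]) (use z in simp)
    from fun_cong[OF this, of h] show ?thesis using h by simp
  qed
  have A': "a \<in> germs M x" if "a \<in> A" for a using A that by blast
  have 1: "schouten M \<pi> \<rho> a b h x = 0" if "a \<in> A" "b \<in> A" "h \<in> germs M x" for a b h
    by (rule step) (use that A' zero in auto)
  have 2: "schouten M \<pi> \<rho> k a h x = 0" if "a \<in> A" "h \<in> germs M x" "k \<in> germs M x" for a h k
  proof (rule step[OF that(3) A'[OF that(1)] _ that(2)])
    fix b assume "b \<in> A"
    then show "schouten M \<pi> \<rho> k a b x = 0" using 1[OF that(1) _ that(3), of b] by (subst schouten_cyclic)
  qed
  show ?thesis
  proof (rule step[OF f g _ h])
    fix b assume "b \<in> A"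
    then show "schouten M \<pi> \<rho> f g b x = 0" using 2[OF _ f g, of b] schouten_cyclic[of M \<pi> \<rho> f g b x] by simp
  qed
qed

section \<open>Open submanifolds and products\<close>

lemma is_chartI:
  assumes U: "openin T U" and B: "openin (Euclidean_space n) B"
    and \<phi>: "continuous_map (subtopology T U) (Euclidean_space n) \<phi>"
    and \<psi>: "continuous_map (subtopology (Euclidean_space n) B) T \<psi>"
    and inv: "\<And>x. x \<in> U \<Longrightarrow> \<phi> x \<in> B \<and> \<psi> (\<phi> x) = x" "\<And>u. u \<in> B \<Longrightarrow> \<psi> u \<in> U \<and> \<phi> (\<psi> u) = u"
  shows "is_chart T n (U, \<phi>)" "\<phi> ` U = B"
proof -
  show im: "\<phi> ` U = B"
  proof
    show "B \<subseteq> \<phi> ` U" using inv(2) by (metis image_eqI subsetI)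
  qed (use inv(1) in auto)
  have "homeomorphic_maps (subtopology T U) (subtopology (Euclidean_space n) B) \<phi> \<psi>"
    unfolding homeomorphic_maps_def
    using \<phi> \<psi> inv by (auto simp: continuous_map_in_subtopology)
  then show "is_chart T n (U, \<phi>)" using U B by (auto simp: im homeomorphic_map_maps)
qed

lemma chart_continuous:
  assumes "is_chart T n (U, \<phi>)"
  shows "continuous_map (subtopology T U) (Euclidean_space n) \<phi>"
    "continuous_map (subtopology (Euclidean_space n) (\<phi> ` U)) T (inv_into U \<phi>)"
    "inj_on \<phi> U"
proof -
  have *: "openin T U" "homeomorphic_map (subtopology T U) (subtopology (Euclidean_space n) (\<phi> ` U)) \<phi>"
    "openin (Euclidean_space n) (\<phi> ` U)"
    using assms by auto
  have U: "topspace (subtopology T U) = U" using openin_subset[OF *(1)] by auto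
  have I: "topspace (subtopology (Euclidean_space n) (\<phi> ` U)) = \<phi> ` U" using openin_subset[OF *(3)] by auto
  show inj: "inj_on \<phi> U" using homeomorphic_imp_injective_map[OF *(2)] unfolding U .
  show "continuous_map (subtopology T U) (Euclidean_space n) \<phi>"
    using homeomorphic_imp_continuous_map[OF *(2)] by (simp add: continuous_map_in_subtopology)
  obtain g where g: "homeomorphic_maps (subtopology T U) (subtopology (Euclidean_space n) (\<phi> ` U)) \<phi> g"
    using *(2) unfolding homeomorphic_map_maps by blast
  have gc: "continuous_map (subtopology (Euclidean_space n) (\<phi> ` U)) T g"
    using g unfolding homeomorphic_maps_def by (simp add: continuous_map_in_subtopology)
  have gi: "g (\<phi> x) = x" if "x \<in> U" for x using g that U unfolding homeomorphic_maps_def by blast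
  show "continuous_map (subtopology (Euclidean_space n) (\<phi> ` U)) T (inv_into U \<phi>)"
    by (rule continuous_map_eq[OF gc]) (use inj gi I in auto)
qed

lemma is_chart_restrict:
  assumes c: "is_chart T n (U, \<phi>)" and W: "openin T W"
  shows "is_chart (subtopology T W) n (U \<inter> W, \<phi>)"
proof (rule is_chartI(1)[where B = "\<phi> ` (U \<inter> W)" and \<psi> = "inv_into U \<phi>"])
  note cc = chart_continuous[OF c]
  have U: "openin T U" using c by simp
  show "openin (subtopology T W) (U \<inter> W)" by (rule openin_subtopology_Int[OF U])
  show "openin (Euclidean_space n) (\<phi> ` (U \<inter> W))" by (rule chart_image_open[OF c W])
  have eq: "subtopology (subtopology T W) (U \<inter> W) = subtopology T (U \<inter> W)"
    by (simp add: subtopology_subtopology Int_absorb1)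
  show "continuous_map (subtopology (subtopology T W) (U \<inter> W)) (Euclidean_space n) \<phi>"
    unfolding eq by (rule continuous_map_from_subtopology_mono[OF cc(1)]) blast
  have "continuous_map (subtopology (Euclidean_space n) (\<phi> ` (U \<inter> W))) T (inv_into U \<phi>)"
    by (rule continuous_map_from_subtopology_mono[OF cc(2)]) blast
  then show "continuous_map (subtopology (Euclidean_space n) (\<phi> ` (U \<inter> W))) (subtopology T W) (inv_into U \<phi>)"
    using cc(3) by (auto simp: continuous_map_in_subtopology)
qed (use chart_continuous(3)[OF c] in auto)

lemma smooth_manifoldI:
  assumes "Hausdorff_space (mtop M)" "second_countable (mtop M)"
    and "\<And>U \<phi>. (U, \<phi>) \<in> atlas M \<Longrightarrow> is_chart (mtop M) (mdim M) (U, \<phi>)"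
    and "\<And>x. x \<in> points M \<Longrightarrow> \<exists>U \<phi>. (U, \<phi>) \<in> atlas M \<and> x \<in> U"
    and "\<And>U \<phi> V \<psi> i. (U, \<phi>) \<in> atlas M \<Longrightarrow> (V, \<psi>) \<in> atlas M \<Longrightarrow> i < mdim M \<Longrightarrow>
      Cinf_on (mdim M) (\<phi> ` (U \<inter> V)) (\<lambda>u. \<psi> (inv_into U \<phi> u) i)"
  shows "smooth_manifold M"
  unfolding smooth_manifold_def
proof (intro conjI assms(1,2) ballI)
  show "is_chart (mtop M) (mdim M) c" if "c \<in> atlas M" for c
    using assms(3)[of "fst c" "snd c"] that by (metis prod.collapse)
  show "(\<Union>c\<in>atlas M. fst c) = points M"
  proof
    show "(\<Union>c\<in>atlas M. fst c) \<subseteq> points M"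
    proof
      fix x assume "x \<in> (\<Union>c\<in>atlas M. fst c)"
      then obtain U \<phi> where c: "(U, \<phi>) \<in> atlas M" "x \<in> U" by auto
      show "x \<in> points M" using assms(3)[OF c(1)] openin_subset c(2) by fastforce
    qed
    show "points M \<subseteq> (\<Union>c\<in>atlas M. fst c)"
    proof
      fix x assume "x \<in> points M"
      from assms(4)[OF this] show "x \<in> (\<Union>c\<in>atlas M. fst c)" by force
    qed
  qed
  show "smooth_transition (mdim M) c c'" if "c \<in> atlas M" "c' \<in> atlas M" for c c'
    using assms(5)[of "fst c" "snd c" "fst c'" "snd c'"] that by (cases c; cases c') simp
qed

text \<open>Coordinate space as a manifold with one global chart. Charts, their inverses and
  sections written in coordinates thus become maps to which \<open>smooth_at\<close> and its
  composition rule apply.\<close>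

definition euclid :: "nat \<Rightarrow> (nat \<Rightarrow> real) manifold" where
  "euclid n = \<lparr>mtop = Euclidean_space n, mdim = n, atlas = {(E n, \<lambda>x. x)}\<rparr>"

lemma euclid_simps [simp]: "mtop (euclid n) = Euclidean_space n" "mdim (euclid n) = n"
  "atlas (euclid n) = {(E n, \<lambda>x. x)}"
  by (simp_all add: euclid_def)

lemma second_countable_E: "second_countable (Euclidean_space n)"
proof -
  obtain \<B> :: "(nat \<Rightarrow> real) set set" where \<B>: "countable \<B>" "\<And>C. C \<in> \<B> \<Longrightarrow> open C"
    "\<And>S. open S \<Longrightarrow> \<exists>U. U \<subseteq> \<B> \<and> S = \<Union>U"
    using univ_second_countable by blast
  have "second_countable (euclidean :: (nat \<Rightarrow> real) topology)"
    unfolding second_countable_def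
  proof (intro exI[of _ \<B>] conjI ballI allI impI)
    fix U and x :: "nat \<Rightarrow> real" assume "openin euclidean U \<and> x \<in> U"
    then show "\<exists>V\<in>\<B>. x \<in> V \<and> V \<subseteq> U" using \<B>(3)[of U] by auto
  qed (use \<B> in auto)
  then show ?thesis
    unfolding Euclidean_space_def euclidean_product_topology by (rule second_countable_subtopology)
qed

lemma smooth_manifold_euclid: "smooth_manifold (euclid n)"
proof (rule smooth_manifoldI)
  show "Hausdorff_space (mtop (euclid n))" by (simp add: Hausdorff_Euclidean_space)
  show "second_countable (mtop (euclid n))" by (simp add: second_countable_E)
  fix U \<phi> assume c: "(U, \<phi>) \<in> atlas (euclid n)"
  then show "is_chart (mtop (euclid n)) (mdim (euclid n)) (U, \<phi>)"
    using homeomorphic_map_id[of "Euclidean_space n" "Euclidean_space n"] by (simp add: id_def)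
  fix V \<psi> i assume d: "(V, \<psi>) \<in> atlas (euclid n)"
  have "Cinf_on n (E n) (\<lambda>u. inv_into (E n) (\<lambda>x. x) u i)"
    by (rule Cinf_on_cong[OF openin_E_UNIV _ Cinf_on_coord[OF order_refl, of _ i]]) simp
  then show "Cinf_on (mdim (euclid n)) (\<phi> ` (U \<inter> V)) (\<lambda>u. \<psi> (inv_into U \<phi> u) i)"
    using c d by simp
qed auto

lemma germs_euclid:
  assumes "openin (Euclidean_space n) B" "u \<in> B" "Cinf_on n B f"
  shows "f \<in> germs (euclid n) u"
proof (rule germ_chartI[OF smooth_manifold_euclid])
  show "(E n, \<lambda>x. x) \<in> atlas (euclid n)" by simp
  show "openin (Euclidean_space (mdim (euclid n))) B" using assms(1) by simp
  show "u \<in> E n" "B \<subseteq> (\<lambda>x. x) ` E n" using openE_subset[OF assms(1)] assms(2) by auto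
  show "Cinf_on (mdim (euclid n)) B (\<lambda>u. f (inv_into (E n) (\<lambda>x. x) u))"
    using Cinf_on_cong[OF assms(1) _ assms(3), of "\<lambda>u. f (inv_into (E n) (\<lambda>x. x) u)"]
      openE_subset[OF assms(1)] by (simp add: subset_iff)
qed (rule assms(2))

lemma smooth_fun_on_euclid:
  assumes "openin (Euclidean_space n) B"
  shows "smooth_fun_on (euclid n) B f \<longleftrightarrow> Cinf_on n B f"
proof
  assume "smooth_fun_on (euclid n) B f"
  from smooth_fun_onD[OF this, of "E n" "\<lambda>x. x"]
  have "Cinf_on n B (\<lambda>u. f (inv_into (E n) (\<lambda>x. x) u))"
    using openE_subset[OF assms] by (simp add: Int_absorb1)
  then show "Cinf_on n B f"
    by (rule Cinf_on_cong[OF assms, rotated]) (use openE_subset[OF assms] in \<open>auto\<close>)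
next
  assume f: "Cinf_on n B f"
  show "smooth_fun_on (euclid n) B f"
    by (subst smooth_fun_on_iff_germs[OF smooth_manifold_euclid]) (use assms germs_euclid[OF assms _ f] in auto)
qed

lemma smooth_at_into_euclid:
  assumes M: "smooth_manifold M" and x: "x \<in> points M"
    and W: "openin (mtop M) W" "x \<in> W" "\<And>z. z \<in> W \<Longrightarrow> F z \<in> E n"
    and cont: "\<And>B. openin (Euclidean_space n) B \<Longrightarrow> F x \<in> B \<Longrightarrow> \<exists>W. openin (mtop M) W \<and> x \<in> W \<and> F ` W \<subseteq> B"
    and F: "\<And>i. i < n \<Longrightarrow> (\<lambda>z. F z i) \<in> germs M x"
  shows "smooth_at M (euclid n) F x"
  by (rule smooth_atI[where F = F and \<psi> = "\<lambda>x. x" and V = "E n", OF M smooth_manifold_euclid x]) (use W cont F in auto)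

lemma chart_smooth_at:
  assumes M: "smooth_manifold M" and c: "(U, \<phi>) \<in> atlas M" "x \<in> U"
  shows "smooth_at M (euclid (mdim M)) \<phi> x"
proof (rule smooth_at_into_euclid[where F = \<phi>, OF M _ atlasD(1)[OF M c(1)] c(2)])
  show "x \<in> points M" using c atlasD(5)[OF M c(1)] by blast
  show "\<phi> z \<in> E (mdim M)" if "z \<in> U" for z using that atlasD(6)[OF M c(1)] by blast
  show "\<exists>W. openin (mtop M) W \<and> x \<in> W \<and> \<phi> ` W \<subseteq> B"
    if "openin (Euclidean_space (mdim M)) B" "\<phi> x \<in> B" for B
  proof (intro exI[of _ "{x \<in> U. \<phi> x \<in> B}"] conjI)
    show "openin (mtop M) {x \<in> U. \<phi> x \<in> B}" by (rule chart_preimage_open[OF atlas_is_chart[OF M c(1)] that(1)])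
  qed (use that(2) c(2) in auto)
  show "(\<lambda>z. \<phi> z i) \<in> germs M x" for i by (rule germs_coord[OF M c])
qed

lemma chart_inv_smooth_at:
  assumes M: "smooth_manifold M" and c: "(U, \<phi>) \<in> atlas M" and u: "u \<in> \<phi> ` U"
  shows "smooth_at (euclid (mdim M)) M (inv_into U \<phi>) u"
proof (rule smooth_atI[where F = "inv_into U \<phi>", OF smooth_manifold_euclid M _ c])
  note op = atlasD(2)[OF M c]
  show "u \<in> points (euclid (mdim M))" using u atlasD(6)[OF M c] by auto
  show "inv_into U \<phi> u \<in> U" using u by (rule inv_into_into)
  show "\<exists>W. openin (mtop (euclid (mdim M))) W \<and> u \<in> W \<and> inv_into U \<phi> ` W \<subseteq> O'"
    if O': "openin (mtop M) O'" "inv_into U \<phi> u \<in> O'" for O'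
  proof (intro exI[of _ "\<phi> ` (U \<inter> O')"] conjI)
    show "openin (mtop (euclid (mdim M))) (\<phi> ` (U \<inter> O'))"
      using chart_image_open[OF atlas_is_chart[OF M c] O'(1)] by simp
    have "\<phi> (inv_into U \<phi> u) = u" "inv_into U \<phi> u \<in> U"
      by (rule f_inv_into_f[OF u], rule inv_into_into[OF u])
    then show "u \<in> \<phi> ` (U \<inter> O')" using O'(2) by force
    show "inv_into U \<phi> ` \<phi> ` (U \<inter> O') \<subseteq> O'" using atlasD(4)[OF M c] by auto
  qed
  show "(\<lambda>z. \<phi> (inv_into U \<phi> z) i) \<in> germs (euclid (mdim M)) u" for i
  proof (rule germs_euclid[OF op u])
    show "Cinf_on (mdim M) (\<phi> ` U) (\<lambda>z. \<phi> (inv_into U \<phi> z) i)"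
      by (rule Cinf_on_cong[OF op _ Cinf_on_coord[OF openE_subset[OF op], of i]]) (simp add: f_inv_into_f)
  qed
qed

section \<open>Open submanifolds: same germs, same smoothness at a point\<close>

context
  fixes M :: "'a manifold" and W
  assumes M: "smooth_manifold M" and W: "openin (mtop M) W"
begin

lemma open_sub_simps: "mtop (open_submanifold M W) = subtopology (mtop M) W" "mdim (open_submanifold M W) = mdim M"
  "points (open_submanifold M W) = W"
  "(V, \<phi>) \<in> atlas (open_submanifold M W) \<longleftrightarrow> (\<exists>U. V = U \<inter> W \<and> (U, \<phi>) \<in> atlas M)"
  using openin_subset[OF W] by (auto simp: open_submanifold_def)

lemma open_sub_inv:
  assumes "(U, \<phi>) \<in> atlas M" "u \<in> \<phi> ` (U \<inter> W)"
  shows "inv_into (U \<inter> W) \<phi> u = inv_into U \<phi> u"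
proof -
  note inj = atlasD(4)[OF M assms(1)]
  obtain x where x: "x \<in> U \<inter> W" "u = \<phi> x" using assms(2) by blast
  have "inj_on \<phi> (U \<inter> W)" using inj by (rule inj_on_subset) blast
  then show ?thesis using x inj by simp
qed

lemma smooth_manifold_open_sub: "smooth_manifold (open_submanifold M W)"
proof (rule smooth_manifoldI)
  show "Hausdorff_space (mtop (open_submanifold M W))" "second_countable (mtop (open_submanifold M W))"
    using M by (simp_all add: open_sub_simps smooth_manifold_def Hausdorff_space_subtopology second_countable_subtopology)
  fix U' \<phi> assume c': "(U', \<phi>) \<in> atlas (open_submanifold M W)"
  then obtain U where c: "U' = U \<inter> W" "(U, \<phi>) \<in> atlas M" by (auto simp: open_sub_simps)
  show "is_chart (mtop (open_submanifold M W)) (mdim (open_submanifold M W)) (U', \<phi>)"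
    unfolding open_sub_simps c(1) by (rule is_chart_restrict[OF atlas_is_chart[OF M c(2)] W])
  fix V' \<psi> i assume "(V', \<psi>) \<in> atlas (open_submanifold M W)" and i: "i < mdim (open_submanifold M W)"
  then obtain V where d: "V' = V \<inter> W" "(V, \<psi>) \<in> atlas M" by (auto simp: open_sub_simps)
  have op: "openin (Euclidean_space (mdim M)) (\<phi> ` (U \<inter> (V \<inter> W)))"
    by (rule chart_image_open[OF atlas_is_chart[OF M c(2)] openin_Int[OF atlasD(1)[OF M d(2)] W]])
  have "Cinf_on (mdim M) (\<phi> ` (U \<inter> (V \<inter> W))) (\<lambda>u. \<psi> (inv_into U \<phi> u) i)"
    by (rule Cinf_on_subset[OF _ smooth_transitionD[OF atlas_transition[OF M c(2) d(2)]]])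
      (use i in \<open>auto simp: open_sub_simps\<close>)
  then have "Cinf_on (mdim M) (\<phi> ` (U \<inter> (V \<inter> W))) (\<lambda>u. \<psi> (inv_into (U \<inter> W) \<phi> u) i)"
    by (rule Cinf_on_cong[OF op, rotated]) (use open_sub_inv[OF c(2)] in auto)
  moreover have "U \<inter> (V \<inter> W) = (U \<inter> W) \<inter> (V \<inter> W)" by blast
  ultimately show "Cinf_on (mdim (open_submanifold M W)) (\<phi> ` (U' \<inter> V')) (\<lambda>u. \<psi> (inv_into U' \<phi> u) i)"
    by (simp add: open_sub_simps c(1) d(1))
next
  fix x assume "x \<in> points (open_submanifold M W)"
  then have x: "x \<in> W" "x \<in> points M" using openin_subset[OF W] by (auto simp: open_sub_simps)
  obtain U \<phi> where "(U, \<phi>) \<in> atlas M" "x \<in> U" by (rule chart_at[OF M x(2)])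
  then show "\<exists>U \<phi>. (U, \<phi>) \<in> atlas (open_submanifold M W) \<and> x \<in> U"
    using x by (auto simp: open_sub_simps)
qed

lemma germs_open_sub:
  assumes x: "x \<in> W"
  shows "germs (open_submanifold M W) x = germs M x"
proof -
  have xM: "x \<in> points M" using openin_subset[OF W] x by auto
  obtain U \<phi> where c: "(U, \<phi>) \<in> atlas M" "x \<in> U" by (rule chart_at[OF M xM])
  then have c': "(U \<inter> W, \<phi>) \<in> atlas (open_submanifold M W)" "x \<in> U \<inter> W" using x by (auto simp: open_sub_simps)
  note M' = smooth_manifold_open_sub
  have op: "openin (Euclidean_space (mdim M)) (\<phi> ` (U \<inter> W))"
    by (rule chart_image_open[OF atlas_is_chart[OF M c(1)] W])
  show ?thesis
  proof (intro equalityI subsetI)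
    fix f assume "f \<in> germs (open_submanifold M W) x"
    then obtain B where B: "openin (Euclidean_space (mdim M)) B" "\<phi> x \<in> B" "B \<subseteq> \<phi> ` (U \<inter> W)"
      "Cinf_on (mdim M) B (\<lambda>u. f (inv_into (U \<inter> W) \<phi> u))"
      using germ_chartD[OF M' c'] unfolding open_sub_simps by metis
    have "Cinf_on (mdim M) B (\<lambda>u. f (inv_into U \<phi> u))"
      by (rule Cinf_on_cong[OF B(1) _ B(4)]) (use open_sub_inv[OF c(1)] B(3) in \<open>auto simp: subset_iff\<close>)
    then show "f \<in> germs M x" by (rule germ_chartI[OF M c B(1,2), rotated]) (use B(3) in blast)
  next
    fix f assume f: "f \<in> germs M x"
    obtain B where B: "openin (Euclidean_space (mdim M)) B" "\<phi> x \<in> B" "B \<subseteq> \<phi> ` U"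
      "Cinf_on (mdim M) B (\<lambda>u. f (inv_into U \<phi> u))"
      by (rule germ_chartD[OF M c f])
    define B' where "B' = B \<inter> \<phi> ` (U \<inter> W)"
    have B': "openin (Euclidean_space (mdim M)) B'" unfolding B'_def by (rule openin_Int[OF B(1) op])
    have "Cinf_on (mdim M) B' (\<lambda>u. f (inv_into (U \<inter> W) \<phi> u))"
      by (rule Cinf_on_cong[OF B' _ Cinf_on_subset[OF _ B(4)]]) (use open_sub_inv[OF c(1)] in \<open>auto simp: B'_def\<close>)
    then show "f \<in> germs (open_submanifold M W) x"
      by (intro germ_chartI[OF M' c', unfolded open_sub_simps, OF B']) (use B(2) c x in \<open>auto simp: B'_def\<close>)
  qed
qed

lemma smooth_at_from_open_sub:
  assumes x: "x \<in> W"
  shows "smooth_at (open_submanifold M W) N F x \<longleftrightarrow> smooth_at M N F x"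
proof -
  have "(\<exists>A. openin (subtopology (mtop M) W) A \<and> x \<in> A \<and> F ` A \<subseteq> V) \<longleftrightarrow>
      (\<exists>A. openin (mtop M) A \<and> x \<in> A \<and> F ` A \<subseteq> V)" for V
  proof
    assume "\<exists>A. openin (subtopology (mtop M) W) A \<and> x \<in> A \<and> F ` A \<subseteq> V"
    then show "\<exists>A. openin (mtop M) A \<and> x \<in> A \<and> F ` A \<subseteq> V" using W openin_open_subtopology by blast
  next
    assume "\<exists>A. openin (mtop M) A \<and> x \<in> A \<and> F ` A \<subseteq> V"
    then obtain A where "openin (mtop M) A" "x \<in> A" "F ` A \<subseteq> V" by blast
    then show "\<exists>A. openin (subtopology (mtop M) W) A \<and> x \<in> A \<and> F ` A \<subseteq> V"
      using x W by (intro exI[of _ "A \<inter> W"]) (auto simp: openin_open_subtopology[OF W])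
  qed
  then show ?thesis
    using openin_subset[OF W] x by (auto simp: smooth_at_def germs_open_sub open_sub_simps)
qed

lemma smooth_at_into_open_sub:
  assumes x: "F x \<in> W"
  shows "smooth_at N (open_submanifold M W) F x \<longleftrightarrow> smooth_at N M F x"
proof -
  have "(\<forall>V. openin (subtopology (mtop M) W) V \<and> F x \<in> V \<longrightarrow> (\<exists>A. openin (mtop N) A \<and> x \<in> A \<and> F ` A \<subseteq> V)) \<longleftrightarrow>
      (\<forall>V. openin (mtop M) V \<and> F x \<in> V \<longrightarrow> (\<exists>A. openin (mtop N) A \<and> x \<in> A \<and> F ` A \<subseteq> V))"
  proof (intro iffI allI impI)
    fix V assume *: "\<forall>V. openin (subtopology (mtop M) W) V \<and> F x \<in> V \<longrightarrow> (\<exists>A. openin (mtop N) A \<and> x \<in> A \<and> F ` A \<subseteq> V)"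
      and V: "openin (mtop M) V \<and> F x \<in> V"
    have "openin (subtopology (mtop M) W) (V \<inter> W)" using V openin_subtopology_Int by blast
    then obtain A where "openin (mtop N) A \<and> x \<in> A \<and> F ` A \<subseteq> V \<inter> W" using * V x by blast
    then show "\<exists>A. openin (mtop N) A \<and> x \<in> A \<and> F ` A \<subseteq> V" by blast
  next
    fix V assume *: "\<forall>V. openin (mtop M) V \<and> F x \<in> V \<longrightarrow> (\<exists>A. openin (mtop N) A \<and> x \<in> A \<and> F ` A \<subseteq> V)"
      and V: "openin (subtopology (mtop M) W) V \<and> F x \<in> V"
    then show "\<exists>A. openin (mtop N) A \<and> x \<in> A \<and> F ` A \<subseteq> V" using W openin_open_subtopology by blast
  qed
  then show ?thesis
    using openin_subset[OF W] x by (auto simp: smooth_at_def germs_open_sub open_sub_simps)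
qed

end

text \<open>\<open>lo m\<close> and \<open>hi m\<close> undo \<open>join_coords m\<close>. On
  coordinate space of higher dimension, \<open>lo m\<close> is at the same time the projection onto
  the subspace \<open>E m\<close>, which is how slice charts use it.\<close>

definition lo :: "nat \<Rightarrow> (nat \<Rightarrow> real) \<Rightarrow> nat \<Rightarrow> real" where
  "lo m u = (\<lambda>i. if i < m then u i else 0)"

definition hi :: "nat \<Rightarrow> (nat \<Rightarrow> real) \<Rightarrow> nat \<Rightarrow> real" where
  "hi m u = (\<lambda>i. u (i + m))"

lemma join_E: "a \<in> E m \<Longrightarrow> b \<in> E n \<Longrightarrow> join_coords m a b \<in> E (m + n)"
  by (auto simp: E_iff join_coords_def)

lemma lo_E: "lo m u \<in> E m"
  by (auto simp: E_iff lo_def)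

lemma hi_E: "u \<in> E (m + n) \<Longrightarrow> hi m u \<in> E n"
  by (auto simp: E_iff hi_def)

lemma lo_join: "a \<in> E m \<Longrightarrow> lo m (join_coords m a b) = a"
  by (auto simp: E_iff lo_def join_coords_def fun_eq_iff)

lemma hi_join: "hi m (join_coords m a b) = b"
  by (auto simp: hi_def join_coords_def fun_eq_iff)

lemma join_lo_hi: "join_coords m (lo m u) (hi m u) = u"
  by (auto simp: lo_def hi_def join_coords_def fun_eq_iff)

lemma continuous_map_coordE: "continuous_map (Euclidean_space n) euclideanreal (\<lambda>u. u i)"
  unfolding Euclidean_space_def
  by (rule continuous_map_from_subtopology[OF continuous_map_product_coordinates]) simp

lemma continuous_map_into_E:
  assumes "\<And>x. x \<in> topspace X \<Longrightarrow> f x \<in> E n" "\<And>i. i < n \<Longrightarrow> continuous_map X euclideanreal (\<lambda>x. f x i)"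
  shows "continuous_map X (Euclidean_space n) f"
proof (rule continuous_map_eq)
  show "continuous_map X (Euclidean_space n) (\<lambda>x i. if i < n then f x i else 0)"
    unfolding continuous_map_componentwise_Euclidean_space using assms(2) by blast
  show "(\<lambda>i. if i < n then f x i else 0) = f x" if "x \<in> topspace X" for x
    using assms(1)[OF that] by (auto simp: E_iff fun_eq_iff)
qed

lemma continuous_map_lo: "continuous_map (Euclidean_space n) (Euclidean_space m) (lo m)"
  by (rule continuous_map_into_E) (simp_all add: lo_E, simp add: lo_def continuous_map_coordE)

lemma continuous_map_hi: "continuous_map (Euclidean_space (m + n)) (Euclidean_space n) (hi m)"
  by (rule continuous_map_into_E) (simp_all add: hi_E, simp add: hi_def continuous_map_coordE)

lemma continuous_map_join:
  "continuous_map (prod_topology (Euclidean_space m) (Euclidean_space n)) (Euclidean_space (m + n))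
    (\<lambda>z. join_coords m (fst z) (snd z))"
proof (rule continuous_map_into_E)
  fix i
  have "continuous_map (prod_topology (Euclidean_space m) (Euclidean_space n)) euclideanreal (\<lambda>z. fst z i)"
    "continuous_map (prod_topology (Euclidean_space m) (Euclidean_space n)) euclideanreal (\<lambda>z. snd z (i - m))"
    using continuous_map_compose[OF continuous_map_fst continuous_map_coordE]
      continuous_map_compose[OF continuous_map_snd continuous_map_coordE] by (simp_all add: comp_def)
  then show "continuous_map (prod_topology (Euclidean_space m) (Euclidean_space n)) euclideanreal
      (\<lambda>z. join_coords m (fst z) (snd z) i)"
    by (cases "i < m") (simp_all add: join_coords_def)
qed (auto intro: join_E)

definition prod_coords :: "nat \<Rightarrow> ('a \<Rightarrow> nat \<Rightarrow> real) \<Rightarrow> ('b \<Rightarrow> nat \<Rightarrow> real) \<Rightarrow> 'a \<times> 'b \<Rightarrow> nat \<Rightarrow> real" where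
  "prod_coords m \<phi> \<psi> = (\<lambda>(x, y). join_coords m (\<phi> x) (\<psi> y))"

section \<open>Product charts and product manifolds\<close>

lemma prod_chart:
  assumes c: "is_chart T m (U, \<phi>)" and d: "is_chart S n (V, \<psi>)"
  shows "is_chart (prod_topology T S) (m + n) (U \<times> V, prod_coords m \<phi> \<psi>)"
    "prod_coords m \<phi> \<psi> ` (U \<times> V) = {u \<in> E (m + n). lo m u \<in> \<phi> ` U \<and> hi m u \<in> \<psi> ` V}"
    "u \<in> prod_coords m \<phi> \<psi> ` (U \<times> V) \<Longrightarrow>
      inv_into (U \<times> V) (prod_coords m \<phi> \<psi>) u = (inv_into U \<phi> (lo m u), inv_into V \<psi> (hi m u))"
proof -
  define B where "B = {u \<in> E (m + n). lo m u \<in> \<phi> ` U \<and> hi m u \<in> \<psi> ` V}"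
  define inv' where "inv' u = (inv_into U \<phi> (lo m u), inv_into V \<psi> (hi m u))" for u
  note cc = chart_continuous[OF c] and dc = chart_continuous[OF d]
  have U: "openin T U" "openin (Euclidean_space m) (\<phi> ` U)" using c by auto
  have V: "openin S V" "openin (Euclidean_space n) (\<psi> ` V)" using d by auto
  note UE = openE_subset[OF U(2)] and VE = openE_subset[OF V(2)]
  have B: "openin (Euclidean_space (m + n)) B"
  proof -
    have "B = {u \<in> E (m + n). lo m u \<in> \<phi> ` U} \<inter> {u \<in> E (m + n). hi m u \<in> \<psi> ` V}" by (auto simp: B_def)
    then show ?thesis
      using openin_continuous_map_preimage[OF continuous_map_lo U(2)] openin_continuous_map_preimage[OF continuous_map_hi V(2)]
      by (simp add: openin_Int)
  qed
  have to: "prod_coords m \<phi> \<psi> z \<in> B \<and> inv' (prod_coords m \<phi> \<psi> z) = z" if zUV: "z \<in> U \<times> V" for z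
  proof -
    obtain x y where z: "z = (x, y)" "x \<in> U" "y \<in> V" using zUV by blast
    have "\<phi> x \<in> E m" "\<psi> y \<in> E n" using z UE VE by auto
    then show ?thesis
      using z cc(3) dc(3) by (auto simp: prod_coords_def B_def inv'_def lo_join hi_join join_E)
  qed
  have from_B: "inv' u \<in> U \<times> V \<and> prod_coords m \<phi> \<psi> (inv' u) = u" if "u \<in> B" for u
    using that by (auto simp: B_def inv'_def prod_coords_def inv_into_into f_inv_into_f join_lo_hi)
  have c1: "continuous_map (subtopology (prod_topology T S) (U \<times> V)) (Euclidean_space (m + n)) (prod_coords m \<phi> \<psi>)"
  proof -
    have "continuous_map (prod_topology (subtopology T U) (subtopology S V)) (prod_topology (Euclidean_space m) (Euclidean_space n))
        (\<lambda>z. (\<phi> (fst z), \<psi> (snd z)))"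
      using continuous_map_compose[OF continuous_map_fst cc(1)] continuous_map_compose[OF continuous_map_snd dc(1)]
      by (intro continuous_map_pairedI) (simp_all add: comp_def)
    from continuous_map_compose[OF this continuous_map_join]
    show ?thesis by (simp add: subtopology_Times comp_def prod_coords_def split_beta')
  qed
  have c2: "continuous_map (subtopology (Euclidean_space (m + n)) B) (prod_topology T S) inv'"
  proof -
    have "continuous_map (subtopology (Euclidean_space (m + n)) B) (subtopology (Euclidean_space m) (\<phi> ` U)) (lo m)"
      "continuous_map (subtopology (Euclidean_space (m + n)) B) (subtopology (Euclidean_space n) (\<psi> ` V)) (hi m)"
      using continuous_map_from_subtopology[OF continuous_map_lo] continuous_map_from_subtopology[OF continuous_map_hi]
      by (auto simp: continuous_map_in_subtopology B_def)
    from continuous_map_compose[OF this(1) cc(2)] continuous_map_compose[OF this(2) dc(2)]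
    show ?thesis unfolding inv'_def by (intro continuous_map_pairedI) (simp_all add: comp_def)
  qed
  have UV: "openin (prod_topology T S) (U \<times> V)" using U V by (simp add: openin_prod_Times_iff)
  note chart = is_chartI[OF UV B c1 c2 to from_B]
  show "is_chart (prod_topology T S) (m + n) (U \<times> V, prod_coords m \<phi> \<psi>)" by (rule chart(1))
  show im: "prod_coords m \<phi> \<psi> ` (U \<times> V) = {u \<in> E (m + n). lo m u \<in> \<phi> ` U \<and> hi m u \<in> \<psi> ` V}"
    using chart(2) by (simp only: B_def)
  show "inv_into (U \<times> V) (prod_coords m \<phi> \<psi>) u = (inv_into U \<phi> (lo m u), inv_into V \<psi> (hi m u))"
    if u: "u \<in> prod_coords m \<phi> \<psi> ` (U \<times> V)"
  proof -
    have "u \<in> B" using u chart(2) by blast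
    then have "inv_into (U \<times> V) (prod_coords m \<phi> \<psi>) (prod_coords m \<phi> \<psi> (inv' u)) = inv' u"
      by (intro inv_into_f_f chart_continuous(3)[OF chart(1)] conjunct1[OF from_B])
    then show ?thesis using from_B[OF \<open>u \<in> B\<close>] by (simp add: inv'_def)
  qed
qed

lemma prod_coords_apply:
  "i < m \<Longrightarrow> prod_coords m \<phi> \<psi> z i = \<phi> (fst z) i"
  "\<not> i < m \<Longrightarrow> prod_coords m \<phi> \<psi> z i = \<psi> (snd z) (i - m)"
  "prod_coords m \<phi> \<psi> z (m + j) = \<psi> (snd z) j"
  by (simp_all add: prod_coords_def join_coords_def split_beta)

lemma prod_manifold_simps:
  "mtop (prod_manifold M N) = prod_topology (mtop M) (mtop N)"
  "mdim (prod_manifold M N) = mdim M + mdim N"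
  "points (prod_manifold M N) = points M \<times> points N"
  "atlas (prod_manifold M N) = {(U \<times> V, prod_coords (mdim M) \<phi> \<psi>) | U \<phi> V \<psi>. (U, \<phi>) \<in> atlas M \<and> (V, \<psi>) \<in> atlas N}"
  by (simp_all add: prod_manifold_def prod_coords_def)

lemma second_countable_prod:
  assumes X: "second_countable X" and Y: "second_countable Y"
  shows "second_countable (prod_topology X Y)"
proof -
  obtain \<B> where \<B>: "countable \<B>" "\<forall>V\<in>\<B>. openin X V" "\<forall>U x. openin X U \<and> x \<in> U \<longrightarrow> (\<exists>V\<in>\<B>. x \<in> V \<and> V \<subseteq> U)"
    using X unfolding second_countable_def by blast
  obtain \<C> where \<C>: "countable \<C>" "\<forall>V\<in>\<C>. openin Y V" "\<forall>U x. openin Y U \<and> x \<in> U \<longrightarrow> (\<exists>V\<in>\<C>. x \<in> V \<and> V \<subseteq> U)"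
    using Y unfolding second_countable_def by blast
  show ?thesis
    unfolding second_countable_def
  proof (intro exI[of _ "(\<lambda>(B, C). B \<times> C) ` (\<B> \<times> \<C>)"] conjI ballI allI impI)
    show "countable ((\<lambda>(B, C). B \<times> C) ` (\<B> \<times> \<C>))" using \<B>(1) \<C>(1) by simp
    show "openin (prod_topology X Y) V" if "V \<in> (\<lambda>(B, C). B \<times> C) ` (\<B> \<times> \<C>)" for V
      using that \<B>(2) \<C>(2) by (auto simp: openin_prod_Times_iff)
    fix U z assume U: "openin (prod_topology X Y) U \<and> z \<in> U"
    obtain x y where z: "z = (x, y)" by (cases z)
    obtain A B where AB: "openin X A" "openin Y B" "x \<in> A" "y \<in> B" "A \<times> B \<subseteq> U"
      using U z unfolding openin_prod_topology_alt by blast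
    obtain A' where A': "A' \<in> \<B>" "x \<in> A'" "A' \<subseteq> A" using \<B>(3) AB by blast
    obtain B' where B': "B' \<in> \<C>" "y \<in> B'" "B' \<subseteq> B" using \<C>(3) AB by blast
    have "A' \<times> B' \<in> (\<lambda>(B, C). B \<times> C) ` (\<B> \<times> \<C>)" using A' B' by auto
    then show "\<exists>V\<in>(\<lambda>(B, C). B \<times> C) ` (\<B> \<times> \<C>). z \<in> V \<and> V \<subseteq> U"
      using A' B' AB(5) z by (intro bexI[of _ "A' \<times> B'"]) auto
  qed
qed

context
  fixes M :: "'a manifold" and N :: "'b manifold"
  assumes M: "smooth_manifold M" and N: "smooth_manifold N"
begin

lemma prod_atlasE:
  assumes "(A, \<theta>) \<in> atlas (prod_manifold M N)"
  obtains U \<phi> V \<psi> where "A = U \<times> V" "\<theta> = prod_coords (mdim M) \<phi> \<psi>" "(U, \<phi>) \<in> atlas M" "(V, \<psi>) \<in> atlas N"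
  using assms unfolding prod_manifold_simps by auto

lemma smooth_manifold_prod: "smooth_manifold (prod_manifold M N)"
proof (rule smooth_manifoldI)
  show "Hausdorff_space (mtop (prod_manifold M N))" "second_countable (mtop (prod_manifold M N))"
    using M N by (auto simp: prod_manifold_simps smooth_manifold_def Hausdorff_space_prod_topology second_countable_prod)
  show "is_chart (mtop (prod_manifold M N)) (mdim (prod_manifold M N)) (A, \<theta>)"
    if "(A, \<theta>) \<in> atlas (prod_manifold M N)" for A \<theta>
    using that
  proof (rule prod_atlasE)
    fix U \<phi> V \<psi> assume *: "A = U \<times> V" "\<theta> = prod_coords (mdim M) \<phi> \<psi>" "(U, \<phi>) \<in> atlas M" "(V, \<psi>) \<in> atlas N"
    show ?thesis unfolding *(1,2) prod_manifold_simps
      by (rule prod_chart(1)[OF atlas_is_chart[OF M *(3)] atlas_is_chart[OF N *(4)]])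
  qed
  show "\<exists>A \<theta>. (A, \<theta>) \<in> atlas (prod_manifold M N) \<and> z \<in> A" if z: "z \<in> points (prod_manifold M N)" for z
  proof -
    obtain x y where xy: "z = (x, y)" "x \<in> points M" "y \<in> points N" using z by (auto simp: prod_manifold_simps)
    obtain U \<phi> where c: "(U, \<phi>) \<in> atlas M" "x \<in> U" by (rule chart_at[OF M xy(2)])
    obtain V \<psi> where d: "(V, \<psi>) \<in> atlas N" "y \<in> V" by (rule chart_at[OF N xy(3)])
    show ?thesis unfolding prod_manifold_simps using c d xy by blast
  qed
  fix A \<theta> A' \<theta>' i assume 1: "(A, \<theta>) \<in> atlas (prod_manifold M N)" and 2: "(A', \<theta>') \<in> atlas (prod_manifold M N)"
    and i: "i < mdim (prod_manifold M N)"
  obtain U \<phi> V \<psi> where c: "A = U \<times> V" "\<theta> = prod_coords (mdim M) \<phi> \<psi>" "(U, \<phi>) \<in> atlas M" "(V, \<psi>) \<in> atlas N"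
    by (rule prod_atlasE[OF 1])
  obtain U' \<phi>' V' \<psi>' where d: "A' = U' \<times> V'" "\<theta>' = prod_coords (mdim M) \<phi>' \<psi>'" "(U', \<phi>') \<in> atlas M" "(V', \<psi>') \<in> atlas N"
    by (rule prod_atlasE[OF 2])
  define m n where "m = mdim M" and "n = mdim N"
  note ic = atlas_is_chart[OF M c(3)] atlas_is_chart[OF N c(4)]
  note PC = prod_chart[OF ic, folded m_def n_def]
  have inj: "inj_on \<phi> U" "inj_on \<psi> V" by (rule atlasD(4)[OF M c(3)], rule atlasD(4)[OF N c(4)])
  define D where "D = \<theta> ` (A \<inter> A')"
  have opA': "openin (prod_topology (mtop M) (mtop N)) A'"
    unfolding d(1) using atlasD(1)[OF M d(3)] atlasD(1)[OF N d(4)] by (simp add: openin_prod_Times_iff)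
  have D: "openin (Euclidean_space (m + n)) D"
    unfolding D_def c(1,2) m_def[symmetric] by (rule chart_image_open[OF PC(1) opA'])
  note DE = openE_subset[OF D]
  have sub: "lo m u \<in> \<phi> ` (U \<inter> U') \<and> hi m u \<in> \<psi> ` (V \<inter> V')" if u: "u \<in> D" for u
  proof -
    obtain x y where xy: "x \<in> U \<inter> U'" "y \<in> V \<inter> V'" "u = join_coords m (\<phi> x) (\<psi> y)"
      using u unfolding D_def c(1,2) d(1) by (auto simp: prod_coords_def m_def)
    have "\<phi> x \<in> E m" using atlasD(6)[OF M c(3)] xy(1) by (auto simp: m_def)
    then show ?thesis using xy by (simp add: lo_join hi_join)
  qed
  have inv: "inv_into A \<theta> u = (inv_into U \<phi> (lo m u), inv_into V \<psi> (hi m u))" if u: "u \<in> D" for u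
    unfolding c(1,2) m_def[symmetric] by (rule PC(3)) (use u in \<open>auto simp: D_def c(1,2) m_def\<close>)
  have "Cinf_on (m + n) D (\<lambda>u. if i < m then \<phi>' (inv_into U \<phi> (lo m u)) i else \<psi>' (inv_into V \<psi> (hi m u)) (i - m))"
  proof (cases "i < m")
    case True
    have "Cinf_on (m + n) D (\<lambda>u. \<phi>' (inv_into U \<phi> (lo m u)) i)"
    proof (rule Cinf_on_compose[where g = "lo m" and f = "\<lambda>w. \<phi>' (inv_into U \<phi> w) i", OF D])
      show "openin (Euclidean_space m) (\<phi> ` (U \<inter> U'))"
        unfolding m_def by (rule chart_image_open[OF ic(1) atlasD(1)[OF M d(3)]])
      show "Cinf_on m (\<phi> ` (U \<inter> U')) (\<lambda>w. \<phi>' (inv_into U \<phi> w) i)"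
        using smooth_transitionD[OF atlas_transition[OF M c(3) d(3)]] True by (simp add: m_def)
      show "Cinf_on (m + n) D (\<lambda>x. lo m x j)" if "j < m" for j
        using Cinf_on_coord[OF DE] that by (simp add: lo_def)
    qed (use sub in blast)
    then show ?thesis using True by simp
  next
    case False
    have "Cinf_on (m + n) D (\<lambda>u. \<psi>' (inv_into V \<psi> (hi m u)) (i - m))"
    proof (rule Cinf_on_compose[where g = "hi m" and f = "\<lambda>w. \<psi>' (inv_into V \<psi> w) (i - m)", OF D])
      show "openin (Euclidean_space n) (\<psi> ` (V \<inter> V'))"
        unfolding n_def by (rule chart_image_open[OF ic(2) atlasD(1)[OF N d(4)]])
      show "Cinf_on n (\<psi> ` (V \<inter> V')) (\<lambda>w. \<psi>' (inv_into V \<psi> w) (i - m))"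
        using smooth_transitionD[OF atlas_transition[OF N c(4) d(4)], of "i - m"] False i
        by (simp add: m_def n_def prod_manifold_simps)
      show "Cinf_on (m + n) D (\<lambda>x. hi m x j)" for j
        using Cinf_on_coord[OF DE] by (simp add: hi_def)
    qed (use sub in blast)
    then show ?thesis using False by simp
  qed
  then have "Cinf_on (m + n) D (\<lambda>u. \<theta>' (inv_into A \<theta> u) i)"
    by (rule Cinf_on_cong[OF D, rotated]) (simp add: inv d(2) prod_coords_def join_coords_def m_def)
  then show "Cinf_on (mdim (prod_manifold M N)) (\<theta> ` (A \<inter> A')) (\<lambda>u. \<theta>' (inv_into A \<theta> u) i)"
    by (simp add: D_def prod_manifold_simps m_def n_def)
qed

lemma prod_chart_atlas:
  assumes "(U, \<phi>) \<in> atlas M" "(V, \<psi>) \<in> atlas N"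
  shows "(U \<times> V, prod_coords (mdim M) \<phi> \<psi>) \<in> atlas (prod_manifold M N)"
  using assms unfolding prod_manifold_simps by blast

lemma fst_smooth_at:
  assumes z: "z \<in> points (prod_manifold M N)"
  shows "smooth_at (prod_manifold M N) M fst z"
proof -
  have x: "fst z \<in> points M" and y: "snd z \<in> points N" using z by (auto simp: prod_manifold_simps)
  obtain U \<phi> where c: "(U, \<phi>) \<in> atlas M" "fst z \<in> U" by (rule chart_at[OF M x])
  obtain V \<psi> where d: "(V, \<psi>) \<in> atlas N" "snd z \<in> V" by (rule chart_at[OF N y])
  show ?thesis
  proof (rule smooth_atI[where F = fst, OF smooth_manifold_prod M z c])
    show "\<exists>W. openin (mtop (prod_manifold M N)) W \<and> z \<in> W \<and> fst ` W \<subseteq> O'" if "openin (mtop M) O'" "fst z \<in> O'" for O'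
    proof (intro exI[of _ "O' \<times> points N"] conjI)
      show "openin (mtop (prod_manifold M N)) (O' \<times> points N)"
        using that by (simp add: prod_manifold_simps openin_prod_Times_iff)
      show "z \<in> O' \<times> points N" using that y by (simp add: mem_Times_iff)
    qed auto
    have "z \<in> U \<times> V" using c d by (simp add: mem_Times_iff)
    note co = germs_coord[OF smooth_manifold_prod prod_chart_atlas[OF c(1) d(1)] this]
    show "(\<lambda>z. \<phi> (fst z) i) \<in> germs (prod_manifold M N) z" if "i < mdim M" for i
      using co[of i] by (simp only: prod_coords_apply(1)[OF that])
  qed
qed

lemma snd_smooth_at:
  assumes z: "z \<in> points (prod_manifold M N)"
  shows "smooth_at (prod_manifold M N) N snd z"
proof -
  have x: "fst z \<in> points M" and y: "snd z \<in> points N" using z by (auto simp: prod_manifold_simps)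
  obtain U \<phi> where c: "(U, \<phi>) \<in> atlas M" "fst z \<in> U" by (rule chart_at[OF M x])
  obtain V \<psi> where d: "(V, \<psi>) \<in> atlas N" "snd z \<in> V" by (rule chart_at[OF N y])
  show ?thesis
  proof (rule smooth_atI[where F = snd, OF smooth_manifold_prod N z d])
    show "\<exists>W. openin (mtop (prod_manifold M N)) W \<and> z \<in> W \<and> snd ` W \<subseteq> O'" if "openin (mtop N) O'" "snd z \<in> O'" for O'
    proof (intro exI[of _ "points M \<times> O'"] conjI)
      show "openin (mtop (prod_manifold M N)) (points M \<times> O')"
        using that by (simp add: prod_manifold_simps openin_prod_Times_iff)
      show "z \<in> points M \<times> O'" using that x by (simp add: mem_Times_iff)
    qed auto
    have "z \<in> U \<times> V" using c d by (simp add: mem_Times_iff)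
    note co = germs_coord[OF smooth_manifold_prod prod_chart_atlas[OF c(1) d(1)] this]
    show "(\<lambda>z. \<psi> (snd z) i) \<in> germs (prod_manifold M N) z" for i
      using co[of "mdim M + i"] by (simp only: prod_coords_apply(3))
  qed
qed

lemma pair_smooth_at:
  assumes K: "smooth_manifold K" and F: "smooth_at K M F x" and G: "smooth_at K N G x"
  shows "smooth_at K (prod_manifold M N) (\<lambda>z. (F z, G z)) x"
proof -
  have Fx: "F x \<in> points M" and Gx: "G x \<in> points N"
    by (rule smooth_at_points(2)[OF F], rule smooth_at_points(2)[OF G])
  obtain U \<phi> where c: "(U, \<phi>) \<in> atlas M" "F x \<in> U" by (rule chart_at[OF M Fx])
  obtain V \<psi> where d: "(V, \<psi>) \<in> atlas N" "G x \<in> V" by (rule chart_at[OF N Gx])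
  show ?thesis
  proof (rule smooth_atI[where F = "\<lambda>z. (F z, G z)", OF K smooth_manifold_prod smooth_at_points(1)[OF F] prod_chart_atlas[OF c(1) d(1)]])
    show "(F x, G x) \<in> U \<times> V" using c d by simp
    show "\<exists>W. openin (mtop K) W \<and> x \<in> W \<and> (\<lambda>z. (F z, G z)) ` W \<subseteq> O'"
      if O': "openin (mtop (prod_manifold M N)) O'" "(F x, G x) \<in> O'" for O'
    proof -
      obtain A B where AB: "openin (mtop M) A" "openin (mtop N) B" "F x \<in> A" "G x \<in> B" "A \<times> B \<subseteq> O'"
        using O'(1)[unfolded prod_manifold_simps openin_prod_topology_alt, rule_format, OF O'(2)] by blast
      obtain W where W: "openin (mtop K) W" "x \<in> W" "F ` W \<subseteq> A" by (rule smooth_at_open[OF F AB(1,3)])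
      obtain W' where W': "openin (mtop K) W'" "x \<in> W'" "G ` W' \<subseteq> B" by (rule smooth_at_open[OF G AB(2,4)])
      show ?thesis using W W' AB(5) by (intro exI[of _ "W \<inter> W'"]) auto
    qed
    show "(\<lambda>z. prod_coords (mdim M) \<phi> \<psi> (F z, G z) i) \<in> germs K x" for i
      using smooth_at_germ'[OF F germs_coord[OF M c]] smooth_at_germ'[OF G germs_coord[OF N d]]
      by (cases "i < mdim M") (simp_all add: prod_coords_apply(1,2))
  qed
qed

text \<open>Each coordinate of a product chart is a function of one factor alone, and a tangent
  vector is determined by its values on coordinates.\<close>

lemma prod_tangent_eqI:
  assumes z: "z \<in> points (prod_manifold M N)"
    and v: "v \<in> tangent_space (prod_manifold M N) z" and w: "w \<in> tangent_space (prod_manifold M N) z"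
    and 1: "\<And>f. f \<in> germs M (fst z) \<Longrightarrow> v (\<lambda>z. f (fst z)) = w (\<lambda>z. f (fst z))"
    and 2: "\<And>f. f \<in> germs N (snd z) \<Longrightarrow> v (\<lambda>z. f (snd z)) = w (\<lambda>z. f (snd z))"
  shows "v = w"
proof -
  have x: "fst z \<in> points M" and y: "snd z \<in> points N" using z by (auto simp: prod_manifold_simps)
  obtain U \<phi> where c: "(U, \<phi>) \<in> atlas M" "fst z \<in> U" by (rule chart_at[OF M x])
  obtain V \<psi> where d: "(V, \<psi>) \<in> atlas N" "snd z \<in> V" by (rule chart_at[OF N y])
  have zUV: "z \<in> U \<times> V" using c d by (simp add: mem_Times_iff)
  show ?thesis
  proof (rule tangent_eq_coord[OF smooth_manifold_prod v w prod_chart_atlas[OF c(1) d(1)] zUV])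
    fix i
    show "v (\<lambda>z. prod_coords (mdim M) \<phi> \<psi> z i) = w (\<lambda>z. prod_coords (mdim M) \<phi> \<psi> z i)"
      using 1[OF germs_coord[OF M c]] 2[OF germs_coord[OF N d]]
      by (cases "i < mdim M") (simp_all add: prod_coords_apply(1,2))
  qed
qed

text \<open>The Leibniz rule for a function of two variables along a pair of maps. The three terms
  are values of push-forwards to the product, which by \<open>prod_tangent_eqI\<close> need
  comparing only on functions of one factor; there one of the two right-hand terms differentiates a
  constant.\<close>

lemma tangent_pair:
  assumes K: "smooth_manifold K" and F: "smooth_at K M F x" and G: "smooth_at K N G x"
    and h: "h \<in> germs (prod_manifold M N) (F x, G x)" and v: "v \<in> tangent_space K x"
  shows "v (\<lambda>z. h (F z, G z)) = v (\<lambda>z. h (F z, G x)) + v (\<lambda>z. h (F x, G z))"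
proof -
  let ?P = "prod_manifold M N"
  note x = smooth_at_points(1)[OF F]
  have FG: "smooth_at K ?P (\<lambda>z. (F z, G z)) x" by (rule pair_smooth_at[OF K F G])
  have F1: "smooth_at K ?P (\<lambda>z. (F z, G x)) x"
    by (rule pair_smooth_at[OF K F smooth_at_const[OF K x smooth_at_points(2)[OF G]]])
  have G1: "smooth_at K ?P (\<lambda>z. (F x, G z)) x"
    by (rule pair_smooth_at[OF K smooth_at_const[OF K x smooth_at_points(2)[OF F]] G])
  note z = smooth_at_points(2)[OF FG]
  define p where "p = pushforward ?P (\<lambda>z. (F z, G z)) x v"
  define p1 where "p1 = pushforward ?P (\<lambda>z. (F z, G x)) x v"
  define p2 where "p2 = pushforward ?P (\<lambda>z. (F x, G z)) x v"
  have T: "p \<in> tangent_space ?P (F x, G x)" "p1 \<in> tangent_space ?P (F x, G x)" "p2 \<in> tangent_space ?P (F x, G x)"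
    unfolding p_def p1_def p2_def
    by (rule pushforward_tangent[OF FG smooth_manifold_prod v] pushforward_tangent[OF F1 smooth_manifold_prod v]
        pushforward_tangent[OF G1 smooth_manifold_prod v])+
  have ap: "p k = v (\<lambda>z. k (F z, G z))" "p1 k = v (\<lambda>z. k (F z, G x))" "p2 k = v (\<lambda>z. k (F x, G z))"
    if "k \<in> germs ?P (F x, G x)" for k
    using that by (simp_all add: p_def p1_def p2_def pushforward_apply)
  have fs: "(\<lambda>z. f (fst z)) \<in> germs ?P (F x, G x)" if "f \<in> germs M (F x)" for f
    by (rule smooth_at_germ'[OF fst_smooth_at[OF z]]) (use that in simp)
  have sn: "(\<lambda>z. f (snd z)) \<in> germs ?P (F x, G x)" if "f \<in> germs N (G x)" for f
    by (rule smooth_at_germ'[OF snd_smooth_at[OF z]]) (use that in simp)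
  have "p = (\<lambda>f. 1 * p1 f + 1 * p2 f)"
  proof (rule prod_tangent_eqI[OF z T(1) tangent_lin[OF T(2,3)]])
    show "p (\<lambda>z. f (fst z)) = 1 * p1 (\<lambda>z. f (fst z)) + 1 * p2 (\<lambda>z. f (fst z))" if "f \<in> germs M (fst (F x, G x))" for f
      using ap[OF fs[of f]] that tangent_const[OF K v x] by simp
    show "p (\<lambda>z. f (snd z)) = 1 * p1 (\<lambda>z. f (snd z)) + 1 * p2 (\<lambda>z. f (snd z))" if "f \<in> germs N (snd (F x, G x))" for f
      using ap[OF sn[of f]] that tangent_const[OF K v x] by simp
  qed
  from fun_cong[OF this, of h] show ?thesis using ap[OF h] by simp
qed

end

section \<open>Product Poisson structures\<close>

lemma chart_vec_coord:
  assumes M: "smooth_manifold M" and c: "(U, \<phi>) \<in> atlas M" "x \<in> U" and i: "i < mdim M"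
  shows "chart_vec M U \<phi> x i (\<lambda>z. \<phi> z j) = (if i = j then 1 else 0)"
proof -
  have "partial i (\<lambda>u. \<phi> (inv_into U \<phi> u) j) (\<phi> x) = partial i (\<lambda>u. u j) (\<phi> x)"
    by (rule partial_cong[OF atlasD(2)[OF M c(1)] _ i]) (use c in \<open>auto simp: f_inv_into_f\<close>)
  then show ?thesis by (simp add: chart_vec_def germs_coord[OF M c] partial_coord)
qed

lemma chart_vec_germ:
  assumes M: "smooth_manifold M" and c: "(U, \<phi>) \<in> atlas M" "x \<in> U" and i: "i < mdim M" and f: "f \<in> germs M x"
  shows "(\<lambda>z. chart_vec M U \<phi> z i f) \<in> germs M x"
proof -
  obtain B where B: "openin (Euclidean_space (mdim M)) B" "\<phi> x \<in> B" "B \<subseteq> \<phi> ` U"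
    "Cinf_on (mdim M) B (\<lambda>u. f (inv_into U \<phi> u))"
    by (rule germ_chartD[OF M c f])
  define W where "W = {z \<in> U. \<phi> z \<in> B}"
  have W: "openin (mtop M) W" "x \<in> W"
    using chart_preimage_open[OF atlas_is_chart[OF M c(1)] B(1)] c B by (auto simp: W_def)
  have "(\<lambda>z. partial i (\<lambda>u. f (inv_into U \<phi> u)) (\<phi> z)) \<in> germs M x"
    by (rule germs_compose[OF M B(1) Cinf_on_partial[OF B(4) i] germs_coord[OF M c] W]) (simp add: W_def)
  then show ?thesis
  proof (rule germ_cong[OF M W])
    fix z assume z: "z \<in> W"
    have "f \<in> germs M z" by (rule germ_chartI[OF M c(1) _ B(1) _ B(3,4)]) (use z in \<open>auto simp: W_def\<close>)
    then show "partial i (\<lambda>u. f (inv_into U \<phi> u)) (\<phi> z) = chart_vec M U \<phi> z i f"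
      by (simp add: chart_vec_def)
  qed
qed

lemma differential_expand:
  assumes M: "smooth_manifold M" and c: "(U, \<phi>) \<in> atlas M" "x \<in> U" and f: "f \<in> germs M x"
  shows "differential M f x = (\<lambda>v. \<Sum>i<mdim M. chart_vec M U \<phi> x i f * differential M (\<lambda>z. \<phi> z i) x v)"
proof
  fix v
  show "differential M f x v = (\<Sum>i<mdim M. chart_vec M U \<phi> x i f * differential M (\<lambda>z. \<phi> z i) x v)"
  proof (cases "v \<in> tangent_space M x")
    case True
    show ?thesis
      unfolding differential_apply[OF True] by (rule trans[OF tangent_expand[OF M True c f] sum.cong]) simp_all
  qed (simp add: differential_def)
qed

text \<open>The algebraic half of \<open>smooth_bivector\<close> at a single point, separated so
  that coordinate expansions are available before smoothness has been proved.\<close>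

definition bilin_at :: "'a manifold \<Rightarrow> 'a bivector \<Rightarrow> 'a \<Rightarrow> bool" where
  "bilin_at M \<pi> x \<longleftrightarrow> (\<forall>\<xi>\<in>cotangent_space M x. \<forall>\<eta>\<in>cotangent_space M x.
     \<pi> x \<xi> \<eta> = - \<pi> x \<eta> \<xi> \<and>
     (\<forall>\<zeta>\<in>cotangent_space M x. \<forall>a b. \<pi> x (\<lambda>v. a * \<xi> v + b * \<eta> v) \<zeta> = a * \<pi> x \<xi> \<zeta> + b * \<pi> x \<eta> \<zeta>))"

lemma bilin_atD:
  assumes "bilin_at M \<pi> x" "\<xi> \<in> cotangent_space M x" "\<eta> \<in> cotangent_space M x"
  shows "\<pi> x \<xi> \<eta> = - \<pi> x \<eta> \<xi>"
    and "\<zeta> \<in> cotangent_space M x \<Longrightarrow> \<pi> x (\<lambda>v. a * \<xi> v + b * \<eta> v) \<zeta> = a * \<pi> x \<xi> \<zeta> + b * \<pi> x \<eta> \<zeta>"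
  using assms unfolding bilin_at_def by blast+

lemma bilin_atI:
  assumes "\<And>\<xi> \<eta>. \<xi> \<in> cotangent_space M x \<Longrightarrow> \<eta> \<in> cotangent_space M x \<Longrightarrow> \<pi> x \<xi> \<eta> = - \<pi> x \<eta> \<xi>"
    and "\<And>\<xi> \<eta> \<zeta> a b. \<xi> \<in> cotangent_space M x \<Longrightarrow> \<eta> \<in> cotangent_space M x \<Longrightarrow> \<zeta> \<in> cotangent_space M x \<Longrightarrow>
      \<pi> x (\<lambda>v. a * \<xi> v + b * \<eta> v) \<zeta> = a * \<pi> x \<xi> \<zeta> + b * \<pi> x \<eta> \<zeta>"
  shows "bilin_at M \<pi> x"
  unfolding bilin_at_def by (intro ballI conjI allI) (fact assms)+

lemma smooth_bivector_bilin_at: "smooth_bivector M \<pi> \<Longrightarrow> x \<in> points M \<Longrightarrow> bilin_at M \<pi> x"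
  by (rule bilin_atI) (fact smooth_bivectorD)+

lemma bilin_at_sum:
  assumes b: "bilin_at M \<pi> x" and \<xi>: "\<And>i. i \<in> A \<Longrightarrow> \<xi> i \<in> cotangent_space M x" and \<zeta>: "\<zeta> \<in> cotangent_space M x"
  shows "(\<lambda>v. \<Sum>i\<in>A. c i * \<xi> i v) \<in> cotangent_space M x \<and>
    \<pi> x (\<lambda>v. \<Sum>i\<in>A. c i * \<xi> i v) \<zeta> = (\<Sum>i\<in>A. c i * \<pi> x (\<xi> i) \<zeta>)"
  using \<xi>
proof (induction A rule: infinite_finite_induct)
  case (insert a A)
  have IH: "(\<lambda>v. \<Sum>i\<in>A. c i * \<xi> i v) \<in> cotangent_space M x"
    "\<pi> x (\<lambda>v. \<Sum>i\<in>A. c i * \<xi> i v) \<zeta> = (\<Sum>i\<in>A. c i * \<pi> x (\<xi> i) \<zeta>)" and a: "\<xi> a \<in> cotangent_space M x"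
    using insert by auto
  from bilin_atD(2)[OF b a IH(1) \<zeta>, of "c a" 1] cotangent_lin[OF a IH(1), of "c a" 1]
  show ?case using insert(1,2) IH(2) by simp
qed (use bilin_atD(2)[OF b \<zeta> \<zeta> \<zeta>, of 0 0] cotangent_zero in auto)

text \<open>The local formula for a bivector in terms of its coordinate brackets. It holds at one
  point from bilinearity there, which serves two ends: proving smoothness, and controlling a
  bivector frozen at a point while the functions vary.\<close>

lemma bracket_expand:
  assumes M: "smooth_manifold M" and c: "(U, \<phi>) \<in> atlas M" "x \<in> U" and b: "bilin_at M \<pi> x"
    and f: "f \<in> germs M x" and g: "g \<in> germs M x"
  shows "bracket M \<pi> f g x = (\<Sum>i<mdim M. \<Sum>j<mdim M.
    chart_vec M U \<phi> x i f * (chart_vec M U \<phi> x j g * bracket M \<pi> (\<lambda>z. \<phi> z i) (\<lambda>z. \<phi> z j) x))"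
proof -
  have left: "bracket M \<pi> f g x = (\<Sum>i<mdim M. chart_vec M U \<phi> x i f * bracket M \<pi> (\<lambda>z. \<phi> z i) g x)"
    if f: "f \<in> germs M x" for f g
    unfolding bracket_def by (subst differential_expand[OF M c f])
      (rule conjunct2[OF bilin_at_sum[OF b differential_cotangent differential_cotangent]])
  have right: "bracket M \<pi> f g x = (\<Sum>j<mdim M. chart_vec M U \<phi> x j g * bracket M \<pi> f (\<lambda>z. \<phi> z j) x)" for f
  proof -
    have sk: "bracket M \<pi> h k x = - bracket M \<pi> k h x" for h k
      unfolding bracket_def by (rule bilin_atD(1)[OF b differential_cotangent differential_cotangent])
    have "bracket M \<pi> f g x = - (\<Sum>j<mdim M. chart_vec M U \<phi> x j g * bracket M \<pi> (\<lambda>z. \<phi> z j) f x)"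
      by (rule trans[OF sk[of f g] arg_cong[OF left[OF g], of uminus]])
    also have "\<dots> = (\<Sum>j<mdim M. chart_vec M U \<phi> x j g * bracket M \<pi> f (\<lambda>z. \<phi> z j) x)"
      unfolding sum_negf[symmetric] by (rule sum.cong[OF refl]) (subst sk, simp)
    finally show ?thesis .
  qed
  show ?thesis
    by (rule trans[OF left[OF f] sum.cong[OF refl]], subst right, rule sum_distrib_left)
qed

text \<open>By \<open>bracket_expand\<close> a bracket is, near each point, a polynomial in
  coordinate brackets and coordinate derivatives, and the latter are smooth by
  \<open>chart_vec_germ\<close>.\<close>

lemma smooth_bivector_chartI:
  assumes M: "smooth_manifold M" and b: "\<And>x. x \<in> points M \<Longrightarrow> bilin_at M \<pi> x"
    and ch: "\<And>x. x \<in> points M \<Longrightarrow> \<exists>U \<phi>. (U, \<phi>) \<in> atlas M \<and> x \<in> U \<and>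
      (\<forall>i<mdim M. \<forall>j<mdim M. bracket M \<pi> (\<lambda>z. \<phi> z i) (\<lambda>z. \<phi> z j) \<in> germs M x)"
  shows "smooth_bivector M \<pi>"
proof (rule smooth_bivectorI)
  fix W f g assume W: "openin (mtop M) W" and f: "smooth_fun_on M W f" and g: "smooth_fun_on M W g"
  show "smooth_fun_on M W (bracket M \<pi> f g)"
    unfolding smooth_fun_on_iff_germs[OF M W]
  proof
    fix x assume x: "x \<in> W"
    then have xM: "x \<in> points M" using openin_subset[OF W] by blast
    obtain U \<phi> where c: "(U, \<phi>) \<in> atlas M" "x \<in> U"
      and co: "\<forall>i<mdim M. \<forall>j<mdim M. bracket M \<pi> (\<lambda>z. \<phi> z i) (\<lambda>z. \<phi> z j) \<in> germs M x"
      using ch[OF xM] by blast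
    have WU: "openin (mtop M) (W \<inter> U)" "x \<in> W \<inter> U" using W atlasD(1)[OF M c(1)] c x by auto
    note fg = smooth_fun_on_germs[OF W _ f] smooth_fun_on_germs[OF W _ g]
    have "(\<lambda>z. \<Sum>i<mdim M. \<Sum>j<mdim M. chart_vec M U \<phi> z i f *
        (chart_vec M U \<phi> z j g * bracket M \<pi> (\<lambda>z. \<phi> z i) (\<lambda>z. \<phi> z j) z)) \<in> germs M x"
    proof (intro germs_sum[OF M xM])
      fix i j assume "i \<in> {..<mdim M}" "j \<in> {..<mdim M}"
      then have ij: "i < mdim M" "j < mdim M" by auto
      show "(\<lambda>z. chart_vec M U \<phi> z i f * (chart_vec M U \<phi> z j g * bracket M \<pi> (\<lambda>z. \<phi> z i) (\<lambda>z. \<phi> z j) z)) \<in> germs M x"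
        by (rule germs_mult[OF M chart_vec_germ[OF M c ij(1) fg(1)[OF x]]
              germs_mult[OF M chart_vec_germ[OF M c ij(2) fg(2)[OF x]] co[rule_format, OF ij]]])
    qed
    then show "bracket M \<pi> f g \<in> germs M x"
    proof (rule germ_cong[OF M WU])
      fix z assume z: "z \<in> W \<inter> U"
      have zM: "z \<in> points M" using z atlasD(5)[OF M c(1)] by blast
      show "(\<Sum>i<mdim M. \<Sum>j<mdim M. chart_vec M U \<phi> z i f *
        (chart_vec M U \<phi> z j g * bracket M \<pi> (\<lambda>z. \<phi> z i) (\<lambda>z. \<phi> z j) z)) = bracket M \<pi> f g z"
        by (rule bracket_expand[OF M c(1) _ b[OF zM], symmetric]) (use z fg in auto)
    qed
  qed
qed (fact bilin_atD[OF b])+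

section \<open>Brackets on a product\<close>

context
  fixes M :: "'a manifold" and N :: "'b manifold"
  assumes M: "smooth_manifold M" and N: "smooth_manifold N"
begin

lemma slice1_smooth_at:
  "x \<in> points M \<Longrightarrow> y \<in> points N \<Longrightarrow> smooth_at M (prod_manifold M N) (\<lambda>x'. (x', y)) x"
  by (rule pair_smooth_at[OF M N M smooth_at_id smooth_at_const[OF M]])

lemma slice2_smooth_at:
  "x \<in> points M \<Longrightarrow> y \<in> points N \<Longrightarrow> smooth_at N (prod_manifold M N) (\<lambda>y'. (x, y')) y"
  by (rule pair_smooth_at[OF M N N smooth_at_const[OF N] smooth_at_id])

text \<open>The vector \<open>\<partial>/\<partial>\<phi>\<^sub>i\<close> at \<open>a\<close>, moved to the slice through \<open>b'\<close>, is a coordinate vector of the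
  product chart, whose dependence on \<open>b'\<close> is smooth.\<close>

lemma germ_partial_vector:
  assumes k: "k \<in> germs (prod_manifold M N) (a, b)" and v: "v \<in> tangent_space M a"
  shows "(\<lambda>b'. v (\<lambda>a'. k (a', b'))) \<in> germs N b"
proof -
  let ?P = "prod_manifold M N"
  note P = smooth_manifold_prod[OF M N]
  have ab: "a \<in> points M" "b \<in> points N" using germs_points[OF k] by (auto simp: prod_manifold_simps)
  obtain U \<phi> where c: "(U, \<phi>) \<in> atlas M" "a \<in> U" by (rule chart_at[OF M ab(1)])
  obtain V \<psi> where d: "(V, \<psi>) \<in> atlas N" "b \<in> V" by (rule chart_at[OF N ab(2)])
  define \<theta> where "\<theta> = prod_coords (mdim M) \<phi> \<psi>"
  have e: "(U \<times> V, \<theta>) \<in> atlas ?P" unfolding \<theta>_def by (rule prod_chart_atlas[OF M N c(1) d(1)])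
  obtain W where W: "openin (mtop ?P) W" "(a, b) \<in> W" "smooth_fun_on ?P W k" using k unfolding germs_def by blast
  obtain W' where W': "openin (mtop N) W'" "b \<in> W'" "(\<lambda>y'. (a, y')) ` W' \<subseteq> W"
    by (rule smooth_at_open[OF slice2_smooth_at[OF ab] W(1,2)])
  have WV: "openin (mtop N) (W' \<inter> V)" "b \<in> W' \<inter> V" using W' d atlasD(1)[OF N d(1)] by auto
  have cv: "chart_vec M U \<phi> a i (\<lambda>a'. k (a', b')) = chart_vec ?P (U \<times> V) \<theta> (a, b') i k"
    if i: "i < mdim M" and b': "b' \<in> W' \<inter> V" for i b'
  proof -
    have b'N: "b' \<in> points N" using b' atlasD(5)[OF N d(1)] by blast
    note sl = slice1_smooth_at[OF ab(1) b'N]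
    have ab': "(a, b') \<in> U \<times> V" using c b' by simp
    have i': "i < mdim ?P" using i by (simp add: prod_manifold_simps)
    note cvt = chart_vec_tangent[OF M c i]
    have "pushforward ?P (\<lambda>x'. (x', b')) a (chart_vec M U \<phi> a i) = chart_vec ?P (U \<times> V) \<theta> (a, b') i"
    proof (rule tangent_eq_coord[OF P pushforward_tangent[OF sl P cvt] chart_vec_tangent[OF P e ab' i'] e ab'])
      fix j
      have "pushforward ?P (\<lambda>x'. (x', b')) a (chart_vec M U \<phi> a i) (\<lambda>z. \<theta> z j) = chart_vec M U \<phi> a i (\<lambda>x'. \<theta> (x', b') j)"
        by (rule pushforward_apply) (rule germs_coord[OF P e ab'])
      also have "\<dots> = (if i = j then 1 else 0)"
        using i chart_vec_coord[OF M c i, of j] tangent_const[OF M cvt ab(1)]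
        by (cases "j < mdim M") (simp_all add: \<theta>_def prod_coords_apply(1,2))
      also have "\<dots> = chart_vec ?P (U \<times> V) \<theta> (a, b') i (\<lambda>z. \<theta> z j)"
        by (rule chart_vec_coord[OF P e ab' i', symmetric])
      finally show "pushforward ?P (\<lambda>x'. (x', b')) a (chart_vec M U \<phi> a i) (\<lambda>z. \<theta> z j) =
        chart_vec ?P (U \<times> V) \<theta> (a, b') i (\<lambda>z. \<theta> z j)" .
    qed
    moreover have "k \<in> germs ?P (a, b')" by (rule smooth_fun_on_germs[OF W(1) _ W(3)]) (use W' b' in auto)
    ultimately show ?thesis using pushforward_apply[of k ?P "\<lambda>x'. (x', b')" a "chart_vec M U \<phi> a i"] by simp
  qed
  have "(\<lambda>b'. chart_vec ?P (U \<times> V) \<theta> (a, b') i k) \<in> germs N b" if "i < mdim M" for i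
    by (rule smooth_at_germ'[OF slice2_smooth_at[OF ab], OF chart_vec_germ[OF P e _ _ k]])
      (use c d that in \<open>auto simp: prod_manifold_simps\<close>)
  then have "(\<lambda>b'. \<Sum>i<mdim M. v (\<lambda>z. \<phi> z i) * chart_vec ?P (U \<times> V) \<theta> (a, b') i k) \<in> germs N b"
    by (intro germs_sum[OF N ab(2)] germs_cmult[OF N]) simp
  then show ?thesis
  proof (rule germ_cong[OF N WV])
    fix b' assume b': "b' \<in> W' \<inter> V"
    have b'N: "b' \<in> points N" using b' atlasD(5)[OF N d(1)] by blast
    have "k \<in> germs ?P (a, b')" by (rule smooth_fun_on_germs[OF W(1) _ W(3)]) (use W' b' in auto)
    then have k': "(\<lambda>a'. k (a', b')) \<in> germs M a" by (rule smooth_at_germ'[OF slice1_smooth_at[OF ab(1) b'N]])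
    show "(\<Sum>i<mdim M. v (\<lambda>z. \<phi> z i) * chart_vec ?P (U \<times> V) \<theta> (a, b') i k) = v (\<lambda>a'. k (a', b'))"
      by (rule trans[OF sum.cong[OF refl] tangent_expand[OF M v c k', symmetric]]) (simp only: lessThan_iff cv[OF _ b'])
  qed
qed

lemma bracket_prod:
  assumes f: "f \<in> germs (prod_manifold M N) (x, y)" and g: "g \<in> germs (prod_manifold M N) (x, y)"
  shows "bracket (prod_manifold M N) (prod_bivector M \<pi> N \<rho>) f g (x, y) =
    bracket M \<pi> (\<lambda>x'. f (x', y)) (\<lambda>x'. g (x', y)) x + bracket N \<rho> (\<lambda>y'. f (x, y')) (\<lambda>y'. g (x, y')) y"
proof -
  have xy: "x \<in> points M" "y \<in> points N" using germs_points[OF f] by (auto simp: prod_manifold_simps)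
  note P = smooth_manifold_prod[OF M N]
  note p1 = pullback_differential[OF slice1_smooth_at[OF xy] P] and p2 = pullback_differential[OF slice2_smooth_at[OF xy] P]
  show ?thesis
    by (simp add: bracket_def prod_bivector_def Let_def p1[OF f] p1[OF g] p2[OF f] p2[OF g])
qed

lemma bilin_at_prod:
  assumes \<pi>: "smooth_bivector M \<pi>" and \<rho>: "smooth_bivector N \<rho>" and z: "z \<in> points (prod_manifold M N)"
  shows "bilin_at (prod_manifold M N) (prod_bivector M \<pi> N \<rho>) z"
proof -
  obtain x y where xy: "z = (x, y)" "x \<in> points M" "y \<in> points N" using z by (auto simp: prod_manifold_simps)
  note P = smooth_manifold_prod[OF M N]
  note p1 = pullback_cotangent[OF slice1_smooth_at[OF xy(2,3)] P] and p2 = pullback_cotangent[OF slice2_smooth_at[OF xy(2,3)] P]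
  show ?thesis unfolding xy(1)
  proof (rule bilin_atI)
    fix \<xi> \<eta> assume *: "\<xi> \<in> cotangent_space (prod_manifold M N) (x, y)" "\<eta> \<in> cotangent_space (prod_manifold M N) (x, y)"
    show "prod_bivector M \<pi> N \<rho> (x, y) \<xi> \<eta> = - prod_bivector M \<pi> N \<rho> (x, y) \<eta> \<xi>"
      using smooth_bivectorD(1)[OF \<pi> xy(2) p1[OF *(1)] p1[OF *(2)]] smooth_bivectorD(1)[OF \<rho> xy(3) p2[OF *(1)] p2[OF *(2)]]
      unfolding prod_bivector_def Let_def prod.case by linarith
    fix \<zeta> a b assume \<zeta>: "\<zeta> \<in> cotangent_space (prod_manifold M N) (x, y)"
    show "prod_bivector M \<pi> N \<rho> (x, y) (\<lambda>v. a * \<xi> v + b * \<eta> v) \<zeta> =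
      a * prod_bivector M \<pi> N \<rho> (x, y) \<xi> \<zeta> + b * prod_bivector M \<pi> N \<rho> (x, y) \<eta> \<zeta>"
      unfolding prod_bivector_def Let_def prod.case pullback_lin
        smooth_bivectorD(2)[OF \<pi> xy(2) p1[OF *(1)] p1[OF *(2)] p1[OF \<zeta>]]
        smooth_bivectorD(2)[OF \<rho> xy(3) p2[OF *(1)] p2[OF *(2)] p2[OF \<zeta>]]
      by (simp add: algebra_simps)
  qed
qed

lemma germs_fst: "z \<in> points (prod_manifold M N) \<Longrightarrow> f \<in> germs M (fst z) \<Longrightarrow> (\<lambda>z. f (fst z)) \<in> germs (prod_manifold M N) z"
  by (rule smooth_at_germ'[OF fst_smooth_at[OF M N]])

lemma germs_snd: "z \<in> points (prod_manifold M N) \<Longrightarrow> f \<in> germs N (snd z) \<Longrightarrow> (\<lambda>z. f (snd z)) \<in> germs (prod_manifold M N) z"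
  by (rule smooth_at_germ'[OF snd_smooth_at[OF M N]])

lemma bracket_prod_pure:
  assumes \<pi>: "smooth_bivector M \<pi>" and \<rho>: "smooth_bivector N \<rho>" and z: "z \<in> points (prod_manifold M N)"
  shows "f \<in> germs M (fst z) \<Longrightarrow> g \<in> germs M (fst z) \<Longrightarrow>
      bracket (prod_manifold M N) (prod_bivector M \<pi> N \<rho>) (\<lambda>z. f (fst z)) (\<lambda>z. g (fst z)) z = bracket M \<pi> f g (fst z)"
    and "f' \<in> germs N (snd z) \<Longrightarrow> g' \<in> germs N (snd z) \<Longrightarrow>
      bracket (prod_manifold M N) (prod_bivector M \<pi> N \<rho>) (\<lambda>z. f' (snd z)) (\<lambda>z. g' (snd z)) z = bracket N \<rho> f' g' (snd z)"
    and "f \<in> germs M (fst z) \<Longrightarrow> g' \<in> germs N (snd z) \<Longrightarrow>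
      bracket (prod_manifold M N) (prod_bivector M \<pi> N \<rho>) (\<lambda>z. f (fst z)) (\<lambda>z. g' (snd z)) z = 0"
    and "f' \<in> germs N (snd z) \<Longrightarrow> g \<in> germs M (fst z) \<Longrightarrow>
      bracket (prod_manifold M N) (prod_bivector M \<pi> N \<rho>) (\<lambda>z. f' (snd z)) (\<lambda>z. g (fst z)) z = 0"
proof -
  obtain x y where xy: "z = (x, y)" "x \<in> points M" "y \<in> points N" using z by (auto simp: prod_manifold_simps)
  note F = germs_fst[OF z, unfolded xy(1) fst_conv] and S = germs_snd[OF z, unfolded xy(1) snd_conv]
  note B = bracket_prod[where \<pi> = \<pi> and \<rho> = \<rho>]
  note C = bracket_const[OF M \<pi> xy(2)] bracket_const[OF N \<rho> xy(3)]
  show "f \<in> germs M (fst z) \<Longrightarrow> g \<in> germs M (fst z) \<Longrightarrow>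
      bracket (prod_manifold M N) (prod_bivector M \<pi> N \<rho>) (\<lambda>z. f (fst z)) (\<lambda>z. g (fst z)) z = bracket M \<pi> f g (fst z)"
    using B[OF F F, of f g] C unfolding xy(1) by simp
  show "f' \<in> germs N (snd z) \<Longrightarrow> g' \<in> germs N (snd z) \<Longrightarrow>
      bracket (prod_manifold M N) (prod_bivector M \<pi> N \<rho>) (\<lambda>z. f' (snd z)) (\<lambda>z. g' (snd z)) z = bracket N \<rho> f' g' (snd z)"
    using B[OF S S, of f' g'] C unfolding xy(1) by simp
  show "f \<in> germs M (fst z) \<Longrightarrow> g' \<in> germs N (snd z) \<Longrightarrow>
      bracket (prod_manifold M N) (prod_bivector M \<pi> N \<rho>) (\<lambda>z. f (fst z)) (\<lambda>z. g' (snd z)) z = 0"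
    using B[OF F S, of f g'] C unfolding xy(1) by simp
  show "f' \<in> germs N (snd z) \<Longrightarrow> g \<in> germs M (fst z) \<Longrightarrow>
      bracket (prod_manifold M N) (prod_bivector M \<pi> N \<rho>) (\<lambda>z. f' (snd z)) (\<lambda>z. g (fst z)) z = 0"
    using B[OF S F, of f' g] C unfolding xy(1) by simp
qed

lemma smooth_bivector_prod:
  assumes \<pi>: "smooth_bivector M \<pi>" and \<rho>: "smooth_bivector N \<rho>"
  shows "smooth_bivector (prod_manifold M N) (prod_bivector M \<pi> N \<rho>)"
proof (rule smooth_bivector_chartI[OF smooth_manifold_prod[OF M N] bilin_at_prod[OF \<pi> \<rho>]])
  let ?P = "prod_manifold M N" and ?\<Pi> = "prod_bivector M \<pi> N \<rho>"
  note P = smooth_manifold_prod[OF M N]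
  fix z assume z: "z \<in> points ?P"
  then have xy: "fst z \<in> points M" "snd z \<in> points N" by (auto simp: prod_manifold_simps)
  obtain U \<phi> where c: "(U, \<phi>) \<in> atlas M" "fst z \<in> U" by (rule chart_at[OF M xy(1)])
  obtain V \<psi> where d: "(V, \<psi>) \<in> atlas N" "snd z \<in> V" by (rule chart_at[OF N xy(2)])
  define \<theta> where "\<theta> = prod_coords (mdim M) \<phi> \<psi>"
  have e: "(U \<times> V, \<theta>) \<in> atlas ?P" unfolding \<theta>_def by (rule prod_chart_atlas[OF M N c(1) d(1)])
  have zUV: "z \<in> U \<times> V" using c d by (simp add: mem_Times_iff)
  note UV = atlasD(1,5)[OF P e]
  have pure: "bracket ?P ?\<Pi> (\<lambda>z. \<theta> z i) (\<lambda>z. \<theta> z j) \<in> germs ?P z" for i j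
  proof -
    define m where "m = mdim M"
    \<comment> \<open>Every coordinate of the product chart belongs to one factor, so a coordinate
      bracket is one of the first factor, one of the second, or zero in the mixed cases.\<close>
    define B where "B = (if i < m then if j < m then (\<lambda>w. bracket M \<pi> (\<lambda>z. \<phi> z i) (\<lambda>z. \<phi> z j) (fst w)) else (\<lambda>_. 0)
      else if j < m then (\<lambda>_. 0) else (\<lambda>w. bracket N \<rho> (\<lambda>z. \<psi> z (i - m)) (\<lambda>z. \<psi> z (j - m)) (snd w)))"
    have "B \<in> germs ?P z"
      unfolding B_def
      using germs_fst[OF z bracket_germ[OF \<pi> germs_coord[OF M c] germs_coord[OF M c]]]
        germs_snd[OF z bracket_germ[OF \<rho> germs_coord[OF N d] germs_coord[OF N d]]]
        germs_const[OF P z] by simp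
    then show ?thesis
    proof (rule germ_cong[OF P UV(1) zUV])
      fix w assume w: "w \<in> U \<times> V"
      then have w': "w \<in> points ?P" "fst w \<in> U" "snd w \<in> V" using UV(2) by auto
      note co = germs_coord[OF M c(1) w'(2)] germs_coord[OF N d(1) w'(3)]
      note pp = bracket_prod_pure[OF \<pi> \<rho> w'(1)]
      note pure = pp(1)[OF co(1) co(1)] pp(2)[OF co(2) co(2)] pp(3)[OF co] pp(4)[OF co(2,1)]
      show "B w = bracket ?P ?\<Pi> (\<lambda>z. \<theta> z i) (\<lambda>z. \<theta> z j) w"
        by (cases "i < m"; cases "j < m")
          (simp_all add: B_def \<theta>_def m_def prod_coords_apply(1,2) pure)
    qed
  qed
  show "\<exists>U \<phi>. (U, \<phi>) \<in> atlas ?P \<and> z \<in> U \<and>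
      (\<forall>i<mdim ?P. \<forall>j<mdim ?P. bracket ?P ?\<Pi> (\<lambda>z. \<phi> z i) (\<lambda>z. \<phi> z j) \<in> germs ?P z)"
    using e zUV pure by blast
qed

text \<open>Functions of one factor separate tangent vectors of the product, so
  \<open>schouten_generators\<close> reduces the claim to them. Mixed brackets vanish, brackets
  within a factor are again functions of that factor, and what remains is the Schouten bracket of
  one factor or zero.\<close>

lemma schouten_commute_prod:
  assumes \<pi>: "smooth_bivector M \<pi>" and \<rho>: "smooth_bivector N \<rho>"
    and \<pi>': "smooth_bivector M \<pi>'" and \<rho>': "smooth_bivector N \<rho>'"
    and 1: "schouten_commute M \<pi> \<pi>'" and 2: "schouten_commute N \<rho> \<rho>'"
  shows "schouten_commute (prod_manifold M N) (prod_bivector M \<pi> N \<rho>) (prod_bivector M \<pi>' N \<rho>')"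
  unfolding schouten_commute_def
proof (intro ballI)
  let ?P = "prod_manifold M N"
  note P = smooth_manifold_prod[OF M N]
  fix z f g h assume z: "z \<in> points ?P" and fgh: "f \<in> germs ?P z" "g \<in> germs ?P z" "h \<in> germs ?P z"
  let ?F = "(\<lambda>f z. f (fst z)) ` germs M (fst z)" and ?S = "(\<lambda>f z. f (snd z)) ` germs N (snd z)"
  \<comment> \<open>The outer bracket differentiates the inner one, so a formula for the inner
    bracket at \<open>z\<close> alone is not enough. It is needed on a neighbourhood of
    \<open>z\<close>, which \<open>n11\<close>, \<open>n22\<close> and \<open>n12\<close>
    supply.\<close>
  have nest: "bracket ?P (prod_bivector M \<sigma> N \<tau>) (bracket ?P (prod_bivector M \<pi> N \<rho>) a b) c z =
      bracket ?P (prod_bivector M \<sigma> N \<tau>) k c z"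
    if ex: "\<exists>W. openin (mtop ?P) W \<and> z \<in> W \<and> (\<forall>w\<in>W. bracket ?P (prod_bivector M \<pi> N \<rho>) a b w = k w)" for \<sigma> \<tau> \<pi> \<rho> a b c k
  proof -
    obtain W where W: "openin (mtop ?P) W" "z \<in> W" "\<forall>w\<in>W. bracket ?P (prod_bivector M \<pi> N \<rho>) a b w = k w"
      using ex by (elim exE conjE)
    show ?thesis by (rule bracket_cong[OF P W(1,2)]) (simp_all add: W(3))
  qed
  have near: "\<exists>W. openin (mtop ?P) W \<and> z \<in> W \<and> (\<forall>w\<in>W. w \<in> points ?P \<and> Q (fst w) (snd w))"
    if A: "openin (mtop M) A" "fst z \<in> A" and B: "openin (mtop N) B" "snd z \<in> B" and Q: "\<And>x y. x \<in> A \<Longrightarrow> y \<in> B \<Longrightarrow> Q x y" for A B Q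
  proof (intro exI[of _ "A \<times> B"] conjI ballI)
    show "openin (mtop ?P) (A \<times> B)" using A B by (simp add: prod_manifold_simps openin_prod_Times_iff)
    show "z \<in> A \<times> B" using A B by (simp add: mem_Times_iff)
    show "w \<in> points ?P" "Q (fst w) (snd w)" if "w \<in> A \<times> B" for w
      using that Q openin_subset[OF A(1)] openin_subset[OF B(1)] by (auto simp: prod_manifold_simps)
  qed
  have zz: "fst z \<in> points M" "snd z \<in> points N" using z by (auto simp: prod_manifold_simps)
  have gM: "\<exists>A. openin (mtop M) A \<and> fst z \<in> A \<and> (\<forall>x\<in>A. a \<in> germs M x)" if "a \<in> germs M (fst z)" for a
    using that smooth_fun_on_germs[of M] unfolding germs_def[of M "fst z"] by auto
  have gN: "\<exists>A. openin (mtop N) A \<and> snd z \<in> A \<and> (\<forall>x\<in>A. a \<in> germs N x)" if "a \<in> germs N (snd z)" for a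
    using that smooth_fun_on_germs[of N] unfolding germs_def[of N "snd z"] by auto
  have n11: "\<exists>W. openin (mtop ?P) W \<and> z \<in> W \<and> (\<forall>w\<in>W. bracket ?P (prod_bivector M \<pi> N \<rho>) (\<lambda>z. a (fst z)) (\<lambda>z. b (fst z)) w = bracket M \<pi> a b (fst w))"
    if \<pi>: "smooth_bivector M \<pi>" and \<rho>: "smooth_bivector N \<rho>" and ab: "a \<in> germs M (fst z)" "b \<in> germs M (fst z)" for \<pi> \<rho> a b
  proof -
    obtain A where A: "openin (mtop M) A" "fst z \<in> A" "\<forall>x\<in>A. a \<in> germs M x" using gM[OF ab(1)] by blast
    obtain B where B: "openin (mtop M) B" "fst z \<in> B" "\<forall>x\<in>B. b \<in> germs M x" using gM[OF ab(2)] by blast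
    have "\<exists>W. openin (mtop ?P) W \<and> z \<in> W \<and> (\<forall>w\<in>W. w \<in> points ?P \<and> (a \<in> germs M (fst w) \<and> b \<in> germs M (fst w)))"
      by (rule near[of "A \<inter> B" "points N" "\<lambda>x y. a \<in> germs M x \<and> b \<in> germs M x"]) (use A B zz in auto)
    then show ?thesis using bracket_prod_pure(1)[OF \<pi> \<rho>] by meson
  qed
  have n22: "\<exists>W. openin (mtop ?P) W \<and> z \<in> W \<and> (\<forall>w\<in>W. bracket ?P (prod_bivector M \<pi> N \<rho>) (\<lambda>z. a (snd z)) (\<lambda>z. b (snd z)) w = bracket N \<rho> a b (snd w))"
    if \<pi>: "smooth_bivector M \<pi>" and \<rho>: "smooth_bivector N \<rho>" and ab: "a \<in> germs N (snd z)" "b \<in> germs N (snd z)" for \<pi> \<rho> a b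
  proof -
    obtain A where A: "openin (mtop N) A" "snd z \<in> A" "\<forall>x\<in>A. a \<in> germs N x" using gN[OF ab(1)] by blast
    obtain B where B: "openin (mtop N) B" "snd z \<in> B" "\<forall>x\<in>B. b \<in> germs N x" using gN[OF ab(2)] by blast
    have "\<exists>W. openin (mtop ?P) W \<and> z \<in> W \<and> (\<forall>w\<in>W. w \<in> points ?P \<and> (a \<in> germs N (snd w) \<and> b \<in> germs N (snd w)))"
      by (rule near[of "points M" "A \<inter> B" "\<lambda>x y. a \<in> germs N y \<and> b \<in> germs N y"]) (use A B zz in auto)
    then show ?thesis using bracket_prod_pure(2)[OF \<pi> \<rho>] by meson
  qed
  have n12: "\<exists>W. openin (mtop ?P) W \<and> z \<in> W \<and> (\<forall>w\<in>W. bracket ?P (prod_bivector M \<pi> N \<rho>) (\<lambda>z. a (fst z)) (\<lambda>z. b (snd z)) w = (\<lambda>_. 0) w)"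
    "\<exists>W. openin (mtop ?P) W \<and> z \<in> W \<and> (\<forall>w\<in>W. bracket ?P (prod_bivector M \<pi> N \<rho>) (\<lambda>z. b (snd z)) (\<lambda>z. a (fst z)) w = (\<lambda>_. 0) w)"
    if \<pi>: "smooth_bivector M \<pi>" and \<rho>: "smooth_bivector N \<rho>" and ab: "a \<in> germs M (fst z)" "b \<in> germs N (snd z)" for \<pi> \<rho> a b
  proof -
    obtain A where A: "openin (mtop M) A" "fst z \<in> A" "\<forall>x\<in>A. a \<in> germs M x" using gM[OF ab(1)] by blast
    obtain B where B: "openin (mtop N) B" "snd z \<in> B" "\<forall>x\<in>B. b \<in> germs N x" using gN[OF ab(2)] by blast
    have *: "\<exists>W. openin (mtop ?P) W \<and> z \<in> W \<and> (\<forall>w\<in>W. w \<in> points ?P \<and> (a \<in> germs M (fst w) \<and> b \<in> germs N (snd w)))"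
      by (rule near[of A B "\<lambda>x y. a \<in> germs M x \<and> b \<in> germs N y"]) (use A B in auto)
    from * show "\<exists>W. openin (mtop ?P) W \<and> z \<in> W \<and> (\<forall>w\<in>W. bracket ?P (prod_bivector M \<pi> N \<rho>) (\<lambda>z. a (fst z)) (\<lambda>z. b (snd z)) w = (\<lambda>_. 0) w)"
      using bracket_prod_pure(3)[OF \<pi> \<rho>] by meson
    from * show "\<exists>W. openin (mtop ?P) W \<and> z \<in> W \<and> (\<forall>w\<in>W. bracket ?P (prod_bivector M \<pi> N \<rho>) (\<lambda>z. b (snd z)) (\<lambda>z. a (fst z)) w = (\<lambda>_. 0) w)"
      using bracket_prod_pure(4)[OF \<pi> \<rho>] by meson
  qed
  note SB = smooth_bivector_prod[OF \<pi> \<rho>] and SB' = smooth_bivector_prod[OF \<pi>' \<rho>']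
  note simps = schouten_def Let_def
    nest[OF n11[OF \<pi> \<rho>]] nest[OF n11[OF \<pi>' \<rho>']] nest[OF n22[OF \<pi> \<rho>]] nest[OF n22[OF \<pi>' \<rho>']]
    nest[OF n12(1)[OF \<pi> \<rho>]] nest[OF n12(1)[OF \<pi>' \<rho>']] nest[OF n12(2)[OF \<pi> \<rho>]] nest[OF n12(2)[OF \<pi>' \<rho>']]
    bracket_const(1)[OF P SB z] bracket_const(1)[OF P SB' z]
    bracket_prod_pure[OF \<pi> \<rho> z] bracket_prod_pure[OF \<pi>' \<rho>' z]
    bracket_germ[OF \<pi>] bracket_germ[OF \<pi>'] bracket_germ[OF \<rho>] bracket_germ[OF \<rho>']
  have S1: "schouten M \<pi> \<pi>' a b c (fst z) = 0" if "a \<in> germs M (fst z)" "b \<in> germs M (fst z)" "c \<in> germs M (fst z)" for a b c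
    using 1 zz that unfolding schouten_commute_def by simp
  have S2: "schouten N \<rho> \<rho>' a b c (snd z) = 0" if "a \<in> germs N (snd z)" "b \<in> germs N (snd z)" "c \<in> germs N (snd z)" for a b c
    using 2 zz that unfolding schouten_commute_def by simp
  note S = S1[unfolded schouten_def Let_def] S2[unfolded schouten_def Let_def]
  show "schouten ?P (prod_bivector M \<pi> N \<rho>) (prod_bivector M \<pi>' N \<rho>') f g h z = 0"
  proof (rule schouten_generators[OF P SB SB' _ _ _ fgh, of "?F \<union> ?S"])
    show "?F \<union> ?S \<subseteq> germs ?P z" using germs_fst[OF z] germs_snd[OF z] by auto
    show "v = (\<lambda>_. 0)" if v: "v \<in> tangent_space ?P z" and A: "\<And>a. a \<in> ?F \<union> ?S \<Longrightarrow> v a = 0" for v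
      by (rule prod_tangent_eqI[OF M N z v tangent_zero]) (rule A, blast)+
    show "schouten ?P (prod_bivector M \<pi> N \<rho>) (prod_bivector M \<pi>' N \<rho>') f g h z = 0"
      if "f \<in> ?F \<union> ?S" "g \<in> ?F \<union> ?S" "h \<in> ?F \<union> ?S" for f g h
      using that by (elim UnE imageE) (simp_all add: simps S)
  qed
qed

end

lemma poisson_structure_prod:
  assumes "smooth_manifold M" "smooth_manifold N" "poisson_structure M \<pi>" "poisson_structure N \<rho>"
  shows "poisson_structure (prod_manifold M N) (prod_bivector M \<pi> N \<rho>)"
  using assms smooth_bivector_prod schouten_commute_prod unfolding poisson_structure_def by metis

section \<open>Descent of Poisson structures\<close>

text \<open>Local sections through every point are part of the notion, because descent consists in
  composing with them: a statement about a function pulled back to \<open>N\<close> becomes one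
  about the function itself on \<open>Q\<close>.\<close>

definition has_sections :: "'a manifold \<Rightarrow> 'b manifold \<Rightarrow> ('a \<Rightarrow> 'b) \<Rightarrow> bool" where
  "has_sections N Q q \<longleftrightarrow> (\<forall>z\<in>points N. smooth_at N Q q z) \<and> q ` points N = points Q \<and>
     (\<forall>z\<in>points N. \<exists>s W. openin (mtop Q) W \<and> q z \<in> W \<and> s (q z) = z \<and>
        (\<forall>w\<in>W. smooth_at Q N s w \<and> q (s w) = w))"

text \<open>The differential of a section through \<open>z\<close> is a right inverse of the
  differential of \<open>q\<close> at \<open>z\<close>.\<close>

lemma submersion_local_sections:
  assumes N: "smooth_manifold N" and Q: "smooth_manifold Q" and q: "\<And>z. z \<in> points N \<Longrightarrow> smooth_at N Q q z"
    and sec: "\<And>z. z \<in> points N \<Longrightarrow> \<exists>s W. openin (mtop Q) W \<and> q z \<in> W \<and> s (q z) = z \<and>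
        (\<forall>w\<in>W. smooth_at Q N s w \<and> q (s w) = w)"
  shows "submersion N Q q"
  unfolding submersion_def
proof (intro conjI ballI equalityI subsetI)
  show "smooth_map N Q q" unfolding smooth_map_iff[OF N Q] by (intro ballI q)
  fix z w assume z: "z \<in> points N"
  note qz = q[OF z]
  { assume "w \<in> pushforward Q q z ` tangent_space N z"
    then show "w \<in> tangent_space Q (q z)" using pushforward_tangent[OF qz Q] by blast }
  assume w: "w \<in> tangent_space Q (q z)"
  obtain s W where W: "openin (mtop Q) W" "q z \<in> W" "s (q z) = z" "\<forall>w\<in>W. smooth_at Q N s w \<and> q (s w) = w"
    using sec[OF z] by (elim exE conjE)
  define v where "v = pushforward N s (q z) w"
  have v: "v \<in> tangent_space N z"
    using pushforward_tangent[OF W(4)[rule_format, OF W(2), THEN conjunct1] N w] by (simp add: v_def W(3))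
  have "pushforward Q q z v = w"
  proof (rule tangent_eqI[OF pushforward_tangent[OF qz Q v] w])
    fix f assume f: "f \<in> germs Q (q z)"
    have "pushforward Q q z v f = w (\<lambda>x. f (q (s x)))"
      using f smooth_at_germ'[OF qz f] by (simp add: pushforward_apply v_def W(3))
    also have "\<dots> = w f" by (rule tangent_germ_eq[OF Q w W(1,2)]) (simp add: W(4))
    finally show "pushforward Q q z v f = w f" .
  qed
  then show "w \<in> pushforward Q q z ` tangent_space N z" using v by blast
qed

text \<open>Invariance is asked only of brackets of functions pulled back from the base, which are
  exactly the values that the descended bivector has to have.\<close>

definition fibre_invariant :: "'a manifold \<Rightarrow> 'b manifold \<Rightarrow> ('a \<Rightarrow> 'b) \<Rightarrow> 'a bivector \<Rightarrow> bool" where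
  "fibre_invariant N Q q \<pi> \<longleftrightarrow> (\<forall>z\<in>points N. \<forall>z'\<in>points N. q z = q z' \<longrightarrow>
     (\<forall>f\<in>germs Q (q z). \<forall>g\<in>germs Q (q z).
        bracket N \<pi> (\<lambda>z. f (q z)) (\<lambda>z. g (q z)) z = bracket N \<pi> (\<lambda>z. f (q z)) (\<lambda>z. g (q z)) z'))"

text \<open>The point of the fibre is chosen arbitrarily; for a \<open>fibre_invariant\<close>
  bivector, \<open>descend_apply\<close> shows that any other point gives the same value.\<close>

definition descend :: "'a manifold \<Rightarrow> 'b manifold \<Rightarrow> ('a \<Rightarrow> 'b) \<Rightarrow> 'a bivector \<Rightarrow> 'b bivector" where
  "descend N Q q \<pi> x \<xi> \<eta> = (let z = (SOME z. z \<in> points N \<and> q z = x) in \<pi> z (pullback N Q q z \<xi>) (pullback N Q q z \<eta>))"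

section \<open>Descent along a map with local sections\<close>

context
  fixes N :: "'a manifold" and Q :: "'b manifold" and q :: "'a \<Rightarrow> 'b"
  assumes N: "smooth_manifold N" and Q: "smooth_manifold Q" and S: "has_sections N Q q"
begin

lemma has_sections_smooth_at: "z \<in> points N \<Longrightarrow> smooth_at N Q q z"
  using S by (simp add: has_sections_def)

lemma has_sections_surj:
  assumes "x \<in> points Q"
  obtains z where "z \<in> points N" "q z = x"
proof -
  have "q ` points N = points Q" using S by (simp add: has_sections_def)
  then obtain z where "z \<in> points N" "x = q z" using assms by blast
  then show thesis using that[of z] by simp
qed

lemma has_sectionsE:
  assumes "z \<in> points N"
  obtains s W where "openin (mtop Q) W" "q z \<in> W" "s (q z) = z" "\<forall>w\<in>W. smooth_at Q N s w"
    "\<forall>w\<in>W. q (s w) = w"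
proof -
  have "\<exists>s W. openin (mtop Q) W \<and> q z \<in> W \<and> s (q z) = z \<and> (\<forall>w\<in>W. smooth_at Q N s w \<and> q (s w) = w)"
    using S assms by (simp add: has_sections_def)
  then obtain s W where W: "openin (mtop Q) W" "q z \<in> W" "s (q z) = z" "\<forall>w\<in>W. smooth_at Q N s w \<and> q (s w) = w"
    by (elim exE conjE)
  show thesis by (rule that[of W s]) (use W in auto)
qed

lemma smooth_map_has_sections: "smooth_map N Q q"
  unfolding smooth_map_iff[OF N Q] by (intro ballI has_sections_smooth_at)

lemma submersion_has_sections: "submersion N Q q"
  using S by (intro submersion_local_sections[OF N Q]) (simp_all add: has_sections_def)

text \<open>Near \<open>q z\<close> the function \<open>f\<close> is its own pull-back composed with
  a smooth local section through \<open>z\<close>.\<close>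

lemma germ_descends:
  assumes z: "z \<in> points N" and f: "(\<lambda>z. f (q z)) \<in> germs N z"
  shows "f \<in> germs Q (q z)"
proof -
  obtain s W where W: "openin (mtop Q) W" "q z \<in> W" "s (q z) = z" "\<forall>w\<in>W. smooth_at Q N s w"
    "\<forall>w\<in>W. q (s w) = w" by (rule has_sectionsE[OF z])
  have "(\<lambda>x. f (q (s x))) \<in> germs Q (q z)"
    by (rule smooth_at_germ'[OF W(4)[rule_format, OF W(2)], of "\<lambda>z. f (q z)"]) (simp add: W(3) f)
  then show ?thesis by (rule germ_cong[OF Q W(1,2)]) (simp add: W(5))
qed

lemma smooth_at_descends:
  assumes z: "z \<in> points N" and F: "smooth_at N K (\<lambda>z. F (q z)) z"
  shows "smooth_at Q K F (q z)"
proof -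
  obtain s W where W: "openin (mtop Q) W" "q z \<in> W" "s (q z) = z" "\<forall>w\<in>W. smooth_at Q N s w"
    "\<forall>w\<in>W. q (s w) = w" by (rule has_sectionsE[OF z])
  have "smooth_at Q K (\<lambda>x. F (q (s x))) (q z)"
    by (rule smooth_at_compose[OF W(4)[rule_format, OF W(2)], where G = "\<lambda>z. F (q z)"]) (simp add: W(3) F)
  then show ?thesis by (rule smooth_at_cong[OF Q _ W(1,2)]) (simp add: W(5))
qed

lemma near_fibre:
  assumes z: "z \<in> points N" and W: "openin (mtop Q) W" "q z \<in> W"
  obtains V where "openin (mtop N) V" "z \<in> V" "\<forall>v\<in>V. v \<in> points N \<and> q v \<in> W"
proof -
  obtain V where V: "openin (mtop N) V" "z \<in> V" "q ` V \<subseteq> W"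
    by (rule smooth_at_open[OF has_sections_smooth_at[OF z] W])
  show thesis by (rule that[OF V(1,2)]) (use V(3) openin_subset[OF V(1)] in auto)
qed

text \<open>Both covectors are differentials of germs on \<open>Q\<close>, so the two values to be
  compared are brackets of pulled-back functions at two points of one fibre.\<close>

lemma descend_apply:
  assumes inv: "fibre_invariant N Q q \<pi>" and z: "z \<in> points N"
    and \<xi>: "\<xi> \<in> cotangent_space Q (q z)" and \<eta>: "\<eta> \<in> cotangent_space Q (q z)"
  shows "descend N Q q \<pi> (q z) \<xi> \<eta> = \<pi> z (pullback N Q q z \<xi>) (pullback N Q q z \<eta>)"
proof -
  define z' where "z' = (SOME z'. z' \<in> points N \<and> q z' = q z)"
  have z': "z' \<in> points N" "q z' = q z"
    using someI[of "\<lambda>z'. z' \<in> points N \<and> q z' = q z" z] z by (auto simp: z'_def)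
  have qz: "q z \<in> points Q" by (rule smooth_at_points(2)[OF has_sections_smooth_at[OF z]])
  obtain f where f: "f \<in> germs Q (q z)" "\<xi> = differential Q f (q z)" by (rule cotangent_differential[OF Q qz \<xi>])
  obtain g where g: "g \<in> germs Q (q z)" "\<eta> = differential Q g (q z)" by (rule cotangent_differential[OF Q qz \<eta>])
  note p = pullback_differential[OF has_sections_smooth_at[OF z] Q]
    pullback_differential[OF has_sections_smooth_at[OF z'(1)] Q, unfolded z'(2)]
  have "bracket N \<pi> (\<lambda>z. f (q z)) (\<lambda>z. g (q z)) z = bracket N \<pi> (\<lambda>z. f (q z)) (\<lambda>z. g (q z)) z'"
    by (rule inv[unfolded fibre_invariant_def, rule_format, OF z z'(1) z'(2)[symmetric] f(1) g(1)])
  then show ?thesis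
    unfolding descend_def z'_def[symmetric] Let_def f(2) g(2)
    by (simp add: p f(1) g(1) bracket_def)
qed

lemma descend_bracket:
  assumes inv: "fibre_invariant N Q q \<pi>" and z: "z \<in> points N" and f: "f \<in> germs Q (q z)" and g: "g \<in> germs Q (q z)"
  shows "bracket Q (descend N Q q \<pi>) f g (q z) = bracket N \<pi> (\<lambda>z. f (q z)) (\<lambda>z. g (q z)) z"
  unfolding bracket_def descend_apply[OF inv z differential_cotangent differential_cotangent]
  by (simp add: pullback_differential[OF has_sections_smooth_at[OF z] Q] f g)

lemma descend_smooth:
  assumes inv: "fibre_invariant N Q q \<pi>" and \<pi>: "smooth_bivector N \<pi>"
  shows "smooth_bivector Q (descend N Q q \<pi>)"
proof (rule smooth_bivectorI)
  fix x \<xi> \<eta> assume x: "x \<in> points Q" and \<xi>: "\<xi> \<in> cotangent_space Q x" and \<eta>: "\<eta> \<in> cotangent_space Q x"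
  obtain z where z: "z \<in> points N" "q z = x" by (rule has_sections_surj[OF x])
  note d = descend_apply[OF inv z(1), unfolded z(2)]
  note p = pullback_cotangent[OF has_sections_smooth_at[OF z(1)] Q, unfolded z(2)]
  show "descend N Q q \<pi> x \<xi> \<eta> = - descend N Q q \<pi> x \<eta> \<xi>"
    unfolding d[OF \<xi> \<eta>] d[OF \<eta> \<xi>] by (rule smooth_bivectorD(1)[OF \<pi> z(1) p[OF \<xi>] p[OF \<eta>]])
  fix \<zeta> a b assume \<zeta>: "\<zeta> \<in> cotangent_space Q x"
  show "descend N Q q \<pi> x (\<lambda>v. a * \<xi> v + b * \<eta> v) \<zeta> = a * descend N Q q \<pi> x \<xi> \<zeta> + b * descend N Q q \<pi> x \<eta> \<zeta>"
    unfolding d[OF \<xi> \<zeta>] d[OF \<eta> \<zeta>] d[OF cotangent_lin[OF \<xi> \<eta>] \<zeta>] pullback_lin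
    by (rule smooth_bivectorD(2)[OF \<pi> z(1) p[OF \<xi>] p[OF \<eta>] p[OF \<zeta>]])
next
  fix W f g assume W: "openin (mtop Q) W" and f: "smooth_fun_on Q W f" and g: "smooth_fun_on Q W g"
  show "smooth_fun_on Q W (bracket Q (descend N Q q \<pi>) f g)"
    unfolding smooth_fun_on_iff_germs[OF Q W]
  proof
    fix x assume x: "x \<in> W"
    then have xQ: "x \<in> points Q" using openin_subset[OF W] by blast
    obtain z where z: "z \<in> points N" "q z = x" by (rule has_sections_surj[OF xQ])
    have qzW: "q z \<in> W" using x z(2) by simp
    obtain V where V: "openin (mtop N) V" "z \<in> V" "\<forall>v\<in>V. v \<in> points N \<and> q v \<in> W"
      by (rule near_fibre[OF z(1) W qzW])
    note fg = smooth_fun_on_germs[OF W _ f] smooth_fun_on_germs[OF W _ g]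
    have "bracket N \<pi> (\<lambda>z. f (q z)) (\<lambda>z. g (q z)) \<in> germs N z"
      by (rule bracket_germ[OF \<pi>]; rule smooth_at_germ'[OF has_sections_smooth_at[OF z(1)]]) (use fg qzW in auto)
    then have "(\<lambda>z. bracket Q (descend N Q q \<pi>) f g (q z)) \<in> germs N z"
      by (rule germ_cong[OF N V(1,2)]) (use descend_bracket[OF inv] V(3) fg in simp)
    then have "bracket Q (descend N Q q \<pi>) f g \<in> germs Q (q z)" by (rule germ_descends[OF z(1)])
    then show "bracket Q (descend N Q q \<pi>) f g \<in> germs Q x" by (simp add: z(2))
  qed
qed

text \<open>The pull-back of a descended bracket is the bracket of the pull-backs on a whole
  neighbourhood of \<open>z\<close>, so it may be substituted into an outer bracket. Iterated
  brackets on \<open>Q\<close> are thus iterated brackets on \<open>N\<close>, and the Schouten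
  bracket follows term by term.\<close>

lemma descend_schouten_commute:
  assumes inv: "fibre_invariant N Q q \<pi>" and \<pi>: "smooth_bivector N \<pi>"
    and inv': "fibre_invariant N Q q \<rho>" and \<rho>: "smooth_bivector N \<rho>" and c: "schouten_commute N \<pi> \<rho>"
  shows "schouten_commute Q (descend N Q q \<pi>) (descend N Q q \<rho>)"
  unfolding schouten_commute_def
proof (intro ballI)
  fix x f g h assume x: "x \<in> points Q" and fgh: "f \<in> germs Q x" "g \<in> germs Q x" "h \<in> germs Q x"
  obtain z where z: "z \<in> points N" "q z = x" by (rule has_sections_surj[OF x])
  obtain W where W: "openin (mtop Q) W" "x \<in> W" "\<forall>l\<in>{f, g, h}. smooth_fun_on Q W l"
    using germs_common[of "{f, g, h}" x Q "\<lambda>l. l"] fgh x by auto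
  have qzW: "q z \<in> W" using W(2) z(2) by simp
  obtain V where V: "openin (mtop N) V" "z \<in> V" "\<forall>v\<in>V. v \<in> points N \<and> q v \<in> W"
    by (rule near_fibre[OF z(1) W(1) qzW])
  have br: "bracket Q (descend N Q q \<sigma>) (bracket Q (descend N Q q \<tau>) a b) c x =
      bracket N \<sigma> (bracket N \<tau> (\<lambda>z. a (q z)) (\<lambda>z. b (q z))) (\<lambda>z. c (q z)) z"
    if i: "fibre_invariant N Q q \<sigma>" "smooth_bivector N \<sigma>" "fibre_invariant N Q q \<tau>" "smooth_bivector N \<tau>"
      and abc: "a \<in> {f, g, h}" "b \<in> {f, g, h}" "c \<in> {f, g, h}" for a b c \<sigma> \<tau>
  proof -
    have ger: "a \<in> germs Q y" "b \<in> germs Q y" "c \<in> germs Q y" if "y \<in> W" for y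
      using smooth_fun_on_germs[OF W(1) that] W(3) abc by auto
    note ge = ger[OF qzW]
    have "bracket Q (descend N Q q \<sigma>) (bracket Q (descend N Q q \<tau>) a b) c (q z) =
        bracket N \<sigma> (\<lambda>z. bracket Q (descend N Q q \<tau>) a b (q z)) (\<lambda>z. c (q z)) z"
      by (rule descend_bracket[OF i(1) z(1) bracket_germ[OF descend_smooth[OF i(3,4)] ge(1,2)] ge(3)])
    also have "\<dots> = bracket N \<sigma> (bracket N \<tau> (\<lambda>z. a (q z)) (\<lambda>z. b (q z))) (\<lambda>z. c (q z)) z"
      by (rule bracket_cong[OF N V(1,2)]) (use descend_bracket[OF i(3)] V(3) ger in simp_all)
    finally show ?thesis by (simp add: z(2))
  qed
  have "schouten Q (descend N Q q \<pi>) (descend N Q q \<rho>) f g h x =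
      schouten N \<pi> \<rho> (\<lambda>z. f (q z)) (\<lambda>z. g (q z)) (\<lambda>z. h (q z)) z"
    unfolding schouten_def Let_def by (simp add: br[OF inv \<pi> inv' \<rho>] br[OF inv' \<rho> inv \<pi>])
  also have "\<dots> = 0"
  proof -
    have "(\<lambda>z. l (q z)) \<in> germs N z" if "l \<in> germs Q x" for l
      by (rule smooth_at_germ'[OF has_sections_smooth_at[OF z(1)]]) (simp add: z(2) that)
    then show ?thesis using c z(1) fgh unfolding schouten_commute_def by simp
  qed
  finally show "schouten Q (descend N Q q \<pi>) (descend N Q q \<rho>) f g h x = 0" .
qed

lemma descend_poisson_structure:
  assumes "fibre_invariant N Q q \<pi>" "poisson_structure N \<pi>"
  shows "poisson_structure Q (descend N Q q \<pi>)"
  using assms descend_smooth descend_schouten_commute unfolding poisson_structure_def by blast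

lemma descend_poisson_submersion:
  assumes inv: "fibre_invariant N Q q \<pi>" and \<pi>: "poisson_structure N \<pi>"
  shows "poisson_submersion N \<pi> Q (descend N Q q \<pi>) q"
  unfolding poisson_submersion_def poisson_manifold_def poisson_map_def
  using N Q \<pi> descend_poisson_structure[OF assms] submersion_has_sections smooth_map_has_sections descend_apply[OF inv]
  by blast

end

section \<open>Quotient manifolds\<close>

lemma smooth_at_continuous_on:
  assumes D: "openin (mtop A) D" and F: "\<And>x. x \<in> D \<Longrightarrow> smooth_at A B F x"
  shows "continuous_map (subtopology (mtop A) D) (mtop B) F"
  unfolding continuous_map_def
proof (intro conjI allI impI)
  have top: "topspace (subtopology (mtop A) D) = D" using openin_subset[OF D] by auto
  show "F \<in> topspace (subtopology (mtop A) D) \<rightarrow> points B" using F smooth_at_points(2)[of A B F] top by auto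
  fix U assume U: "openin (mtop B) U"
  show "openin (subtopology (mtop A) D) {x \<in> topspace (subtopology (mtop A) D). F x \<in> U}"
    unfolding top openin_open_subtopology[OF D]
  proof
    show "openin (mtop A) {x \<in> D. F x \<in> U}"
      unfolding openin_subopen[of "mtop A" "{x \<in> D. F x \<in> U}"]
    proof
      fix x assume "x \<in> {x \<in> D. F x \<in> U}"
      then have x: "x \<in> D" "F x \<in> U" by auto
      obtain W where W: "openin (mtop A) W" "x \<in> W" "F ` W \<subseteq> U" by (rule smooth_at_open[OF F[OF x(1)] U x(2)])
      show "\<exists>T. openin (mtop A) T \<and> x \<in> T \<and> T \<subseteq> {x \<in> D. F x \<in> U}"
        using W D x by (intro exI[of _ "W \<inter> D"]) auto
    qed
  qed auto
qed

definition quotient_top :: "'a manifold \<Rightarrow> ('a \<Rightarrow> 'b) \<Rightarrow> 'b topology" where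
  "quotient_top N q = topology (\<lambda>W. W \<subseteq> q ` points N \<and> openin (mtop N) {z\<in>points N. q z \<in> W})"

lemma openin_quotient_top:
  "openin (quotient_top N q) W \<longleftrightarrow> W \<subseteq> q ` points N \<and> openin (mtop N) {z\<in>points N. q z \<in> W}"
proof -
  have "istopology (\<lambda>W. W \<subseteq> q ` points N \<and> openin (mtop N) {z\<in>points N. q z \<in> W})"
    unfolding istopology_def
  proof (intro conjI allI impI; (elim conjE)?)
    fix S T assume "S \<subseteq> q ` points N" "T \<subseteq> q ` points N"
      and *: "openin (mtop N) {z\<in>points N. q z \<in> S}" "openin (mtop N) {z\<in>points N. q z \<in> T}"
    then show "S \<inter> T \<subseteq> q ` points N" by blast
    have "{z\<in>points N. q z \<in> S \<inter> T} = {z\<in>points N. q z \<in> S} \<inter> {z\<in>points N. q z \<in> T}" by blast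
    then show "openin (mtop N) {z\<in>points N. q z \<in> S \<inter> T}" using openin_Int[OF *] by simp
  next
    fix K assume *: "\<forall>S\<in>K. S \<subseteq> q ` points N \<and> openin (mtop N) {z\<in>points N. q z \<in> S}"
    then show "\<Union>K \<subseteq> q ` points N" by blast
    have "openin (mtop N) (\<Union>S\<in>K. {z\<in>points N. q z \<in> S})" using * by (intro openin_Union) auto
    moreover have "{z\<in>points N. q z \<in> \<Union>K} = (\<Union>S\<in>K. {z\<in>points N. q z \<in> S})" by blast
    ultimately show "openin (mtop N) {z\<in>points N. q z \<in> \<Union>K}" by simp
  qed
  then show ?thesis unfolding quotient_top_def by (simp add: topology_inverse')
qed

lemma topspace_quotient_top: "topspace (quotient_top N q) = q ` points N"
proof
  show "topspace (quotient_top N q) \<subseteq> q ` points N"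
    using openin_quotient_top[of N q "topspace (quotient_top N q)"] by simp
  have "{z\<in>points N. q z \<in> q ` points N} = points N" by auto
  then have "openin (quotient_top N q) (q ` points N)" by (simp add: openin_quotient_top)
  then show "q ` points N \<subseteq> topspace (quotient_top N q)" by (rule openin_subset)
qed

lemma quotient_manifold_simps:
  "mtop (quotient_manifold N q n) = quotient_top N q" "mdim (quotient_manifold N q n) = n"
  "points (quotient_manifold N q n) = q ` points N"
  "(U, \<phi>) \<in> atlas (quotient_manifold N q n) \<longleftrightarrow> is_chart (quotient_top N q) n (U, \<phi>) \<and>
     (\<forall>W h. openin (quotient_top N q) W \<and> W \<subseteq> U \<longrightarrow>
        (Cinf_on n (\<phi> ` W) h \<longleftrightarrow> smooth_fun_on N {z\<in>points N. q z \<in> W} (\<lambda>z. h (\<phi> (q z)))))"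
  by (simp_all add: quotient_manifold_def quotient_top_def[symmetric] Let_def topspace_quotient_top)

text \<open>A quotient chart comes with a smooth local section of the quotient map, written in the chart.\<close>

definition quotient_chart :: "'a manifold \<Rightarrow> ('a \<Rightarrow> 'b) \<Rightarrow> nat \<Rightarrow> 'b set \<Rightarrow> ('b \<Rightarrow> nat \<Rightarrow> real) \<Rightarrow> ((nat \<Rightarrow> real) \<Rightarrow> 'a) \<Rightarrow> bool" where
  "quotient_chart N q n U \<phi> \<tau> \<longleftrightarrow> openin (quotient_top N q) U \<and> openin (Euclidean_space n) (\<phi> ` U) \<and>
     (\<forall>z\<in>points N. q z \<in> U \<longrightarrow> smooth_at N (euclid n) (\<lambda>z. \<phi> (q z)) z) \<and>
     (\<forall>u\<in>\<phi> ` U. smooth_at (euclid n) N \<tau> u) \<and>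
     (\<forall>x\<in>U. q (\<tau> (\<phi> x)) = x)"

lemma quotient_chartD:
  assumes "quotient_chart N q n U \<phi> \<tau>"
  shows "openin (quotient_top N q) U" "openin (Euclidean_space n) (\<phi> ` U)"
    "z \<in> points N \<Longrightarrow> q z \<in> U \<Longrightarrow> smooth_at N (euclid n) (\<lambda>z. \<phi> (q z)) z"
    "x \<in> U \<Longrightarrow> smooth_at (euclid n) N \<tau> (\<phi> x)"
    "x \<in> U \<Longrightarrow> q (\<tau> (\<phi> x)) = x"
  using assms by (simp_all add: quotient_chart_def)

text \<open>The universal property in both directions: a smooth \<open>h\<close> is composed with
  the smooth map \<open>\<phi> \<circ> q\<close> to give a smooth pull-back, and a smooth pull-back
  is composed with the section \<tau> to give back \<open>h\<close>.\<close>

lemma quotient_chart_atlas: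
  assumes N: "smooth_manifold N" and C: "quotient_chart N q n U \<phi> \<tau>"
  shows "(U, \<phi>) \<in> atlas (quotient_manifold N q n)"
proof -
  note C1 = quotient_chartD(1,2)[OF C] and C2 = quotient_chartD(3-5)[OF C]
  have U: "U \<subseteq> q ` points N" "openin (mtop N) {z\<in>points N. q z \<in> U}" using C1(1) by (auto simp: openin_quotient_top)
  have contq: "continuous_map (mtop N) (quotient_top N q) q"
    unfolding continuous_map_def by (auto simp: topspace_quotient_top openin_quotient_top)
  have c2: "continuous_map (subtopology (Euclidean_space n) (\<phi> ` U)) (quotient_top N q) (\<lambda>u. q (\<tau> u))"
  proof -
    have "continuous_map (subtopology (mtop (euclid n)) (\<phi> ` U)) (mtop N) \<tau>"
      by (rule smooth_at_continuous_on) (use C1(2) C2(2) in auto)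
    from continuous_map_compose[OF this contq] show ?thesis by (simp add: comp_def)
  qed
  have c1: "continuous_map (subtopology (quotient_top N q) U) (Euclidean_space n) \<phi>"
    unfolding continuous_map_def
  proof (intro conjI allI impI)
    have top: "topspace (subtopology (quotient_top N q) U) = U" using openin_subset[OF C1(1)] by auto
    show "\<phi> \<in> topspace (subtopology (quotient_top N q) U) \<rightarrow> E n" using openE_subset[OF C1(2)] top by auto
    fix B assume B: "openin (Euclidean_space n) B"
    have "continuous_map (subtopology (mtop N) {z\<in>points N. q z \<in> U}) (mtop (euclid n)) (\<lambda>z. \<phi> (q z))"
      by (rule smooth_at_continuous_on[OF U(2)]) (use C2(1) in auto)
    then have "openin (subtopology (mtop N) {z\<in>points N. q z \<in> U})
        {z \<in> topspace (subtopology (mtop N) {z\<in>points N. q z \<in> U}). \<phi> (q z) \<in> B}"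
      by (rule openin_continuous_map_preimage) (simp add: B)
    then have "openin (mtop N) {z \<in> topspace (subtopology (mtop N) {z\<in>points N. q z \<in> U}). \<phi> (q z) \<in> B}"
      using openin_open_subtopology[OF U(2)] by blast
    moreover have "{z \<in> topspace (subtopology (mtop N) {z\<in>points N. q z \<in> U}). \<phi> (q z) \<in> B} =
        {z \<in> points N. q z \<in> {x \<in> U. \<phi> x \<in> B}}" by auto
    ultimately have "openin (quotient_top N q) {x \<in> U. \<phi> x \<in> B}" using U(1) by (auto simp: openin_quotient_top)
    then show "openin (subtopology (quotient_top N q) U) {x \<in> topspace (subtopology (quotient_top N q) U). \<phi> x \<in> B}"
      unfolding top openin_open_subtopology[OF C1(1)] by blast
  qed
  have chart: "is_chart (quotient_top N q) n (U, \<phi>)"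
    by (rule is_chartI(1)[OF C1 c1 c2]) (use C2(3) in auto)
  have "Cinf_on n (\<phi> ` W) h \<longleftrightarrow> smooth_fun_on N {z\<in>points N. q z \<in> W} (\<lambda>z. h (\<phi> (q z)))"
    if W: "openin (quotient_top N q) W" "W \<subseteq> U" for W h
  proof -
    have op: "openin (Euclidean_space n) (\<phi> ` W)"
      using chart_image_open[OF chart W(1)] W(2) by (simp add: Int_absorb1)
    have opN: "openin (mtop N) {z\<in>points N. q z \<in> W}" using W(1) by (simp add: openin_quotient_top)
    show ?thesis
    proof
      assume h: "Cinf_on n (\<phi> ` W) h"
      show "smooth_fun_on N {z\<in>points N. q z \<in> W} (\<lambda>z. h (\<phi> (q z)))"
        unfolding smooth_fun_on_iff_germs[OF N opN]
      proof
        fix z assume "z \<in> {z\<in>points N. q z \<in> W}"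
        then have z: "z \<in> points N" "q z \<in> W" by auto
        have "h \<in> germs (euclid n) (\<phi> (q z))" by (rule germs_euclid[OF op _ h]) (use z in auto)
        then show "(\<lambda>z. h (\<phi> (q z))) \<in> germs N z"
          by (rule smooth_at_germ'[OF C2(1)[OF z(1)], rotated]) (use z W in auto)
      qed
    next
      assume h: "smooth_fun_on N {z\<in>points N. q z \<in> W} (\<lambda>z. h (\<phi> (q z)))"
      show "Cinf_on n (\<phi> ` W) h"
        unfolding smooth_fun_on_euclid[OF op, symmetric]
      proof (subst smooth_fun_on_iff_germs[OF smooth_manifold_euclid])
        show "openin (mtop (euclid n)) (\<phi> ` W)" using op by simp
        show "\<forall>u\<in>\<phi> ` W. h \<in> germs (euclid n) u"
        proof
          fix u assume "u \<in> \<phi> ` W"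
          then obtain x where x: "x \<in> W" "x \<in> U" "u = \<phi> x" using W by auto
          note t = C2(2)[OF x(2)]
          have "\<tau> (\<phi> x) \<in> {z\<in>points N. q z \<in> W}" using smooth_at_points(2)[OF t] C2(3)[OF x(2)] x by simp
          then have "(\<lambda>z. h (\<phi> (q z))) \<in> germs N (\<tau> (\<phi> x))" by (rule smooth_fun_on_germs[OF opN _ h])
          then have "(\<lambda>u. h (\<phi> (q (\<tau> u)))) \<in> germs (euclid n) (\<phi> x)" by (rule smooth_at_germ'[OF t])
          then show "h \<in> germs (euclid n) u" unfolding x(3)
            by (rule germ_cong[where W = "\<phi> ` W", OF smooth_manifold_euclid, rotated 2]) (use op x C2(3) W in auto)
        qed
      qed
    qed
  qed
  then show ?thesis using chart by (simp only: quotient_manifold_simps) blast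
qed

context
  fixes N :: "'a manifold" and q :: "'a \<Rightarrow> 'b" and n :: nat
  assumes N: "smooth_manifold N"
    and loc: "\<And>z. z \<in> points N \<Longrightarrow> \<exists>U \<phi> \<tau>. quotient_chart N q n U \<phi> \<tau> \<and> q z \<in> U \<and> \<tau> (\<phi> (q z)) = z"
    and haus: "Hausdorff_space (quotient_top N q)"
begin

lemma quotient_open_map: "open_map (mtop N) (quotient_top N q) q"
  unfolding open_map_def
proof (intro allI impI)
  fix V assume V: "openin (mtop N) V"
  show "openin (quotient_top N q) (q ` V)"
    unfolding openin_subopen[of "quotient_top N q" "q ` V"]
  proof
    fix x assume "x \<in> q ` V"
    then obtain z where z: "z \<in> V" "x = q z" by blast
    then have zN: "z \<in> points N" using openin_subset[OF V] by blast
    obtain U \<phi> \<tau> where C: "quotient_chart N q n U \<phi> \<tau>" "q z \<in> U" "\<tau> (\<phi> (q z)) = z"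
      using loc[OF zN] by (elim exE conjE)
    have ch: "is_chart (quotient_top N q) n (U, \<phi>)"
      using quotient_chart_atlas[OF N C(1)] unfolding quotient_manifold_simps by blast
    have V': "\<tau> (\<phi> (q z)) \<in> V" using C(3) z by simp
    obtain B where B: "openin (mtop (euclid n)) B" "\<phi> (q z) \<in> B" "\<tau> ` B \<subseteq> V"
      by (rule smooth_at_open[where F = \<tau> and x = "\<phi> (q z)", OF quotient_chartD(4)[OF C(1,2)] V V'])
    have "openin (quotient_top N q) {y \<in> U. \<phi> y \<in> B}"
      by (rule chart_preimage_open[OF ch]) (use B(1) in simp)
    moreover have "{y \<in> U. \<phi> y \<in> B} \<subseteq> q ` V"
    proof
      fix y assume "y \<in> {y \<in> U. \<phi> y \<in> B}"
      then have "\<tau> (\<phi> y) \<in> V" "q (\<tau> (\<phi> y)) = y" using B(3) quotient_chartD(5)[OF C(1)] by auto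
      then show "y \<in> q ` V" by force
    qed
    ultimately show "\<exists>T. openin (quotient_top N q) T \<and> x \<in> T \<and> T \<subseteq> q ` V"
      using C(2) B(2) z(2) by (intro exI[of _ "{y \<in> U. \<phi> y \<in> B}"]) auto
  qed
qed

text \<open>The atlas consists of all charts with the universal property, so compatibility has to
  follow from that property: the coordinates of \<psi> pull back to smooth functions on
  \<open>N\<close> by the property of the second chart, and the property of the first reads them as
  smooth functions of \<phi>.\<close>

lemma smooth_manifold_quotient: "smooth_manifold (quotient_manifold N q n)"
proof (rule smooth_manifoldI)
  have contq: "continuous_map (mtop N) (quotient_top N q) q"
    unfolding continuous_map_def by (auto simp: topspace_quotient_top openin_quotient_top)
  show "Hausdorff_space (mtop (quotient_manifold N q n))" using haus by (simp add: quotient_manifold_simps)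
  show "second_countable (mtop (quotient_manifold N q n))"
    unfolding quotient_manifold_simps
    by (rule second_countable_open_map_image[OF contq quotient_open_map])
      (use N in \<open>auto simp: topspace_quotient_top smooth_manifold_def\<close>)
  show "is_chart (mtop (quotient_manifold N q n)) (mdim (quotient_manifold N q n)) (U, \<phi>)"
    if "(U, \<phi>) \<in> atlas (quotient_manifold N q n)" for U \<phi>
    using that by (simp only: quotient_manifold_simps)
  show "\<exists>U \<phi>. (U, \<phi>) \<in> atlas (quotient_manifold N q n) \<and> x \<in> U" if "x \<in> points (quotient_manifold N q n)" for x
  proof -
    have "x \<in> q ` points N" using that by (simp only: quotient_manifold_simps topspace_quotient_top)
    then obtain z where z: "z \<in> points N" "x = q z" by blast
    obtain U \<phi> \<tau> where C: "quotient_chart N q n U \<phi> \<tau>" "q z \<in> U"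
      using loc[OF z(1)] by (elim exE conjE)
    then show ?thesis using quotient_chart_atlas[OF N C(1)] z(2) by blast
  qed
  fix U \<phi> V \<psi> i assume "(U, \<phi>) \<in> atlas (quotient_manifold N q n)" "(V, \<psi>) \<in> atlas (quotient_manifold N q n)"
    and i: "i < mdim (quotient_manifold N q n)"
  then have c: "is_chart (quotient_top N q) n (U, \<phi>)" "is_chart (quotient_top N q) n (V, \<psi>)"
    and e: "\<And>W h. openin (quotient_top N q) W \<Longrightarrow> W \<subseteq> U \<Longrightarrow>
        (Cinf_on n (\<phi> ` W) h \<longleftrightarrow> smooth_fun_on N {z\<in>points N. q z \<in> W} (\<lambda>z. h (\<phi> (q z))))"
      "\<And>W h. openin (quotient_top N q) W \<Longrightarrow> W \<subseteq> V \<Longrightarrow>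
        (Cinf_on n (\<psi> ` W) h \<longleftrightarrow> smooth_fun_on N {z\<in>points N. q z \<in> W} (\<lambda>z. h (\<psi> (q z))))"
    unfolding quotient_manifold_simps by blast+
  have W: "openin (quotient_top N q) (U \<inter> V)" using c by auto
  then have opN: "openin (mtop N) {z\<in>points N. q z \<in> U \<inter> V}" by (simp add: openin_quotient_top)
  have "openin (Euclidean_space n) (\<psi> ` (V \<inter> U))" by (rule chart_image_open[OF c(2)]) (use c in simp)
  then have "Cinf_on n (\<psi> ` (U \<inter> V)) (\<lambda>u. u i)" using Cinf_on_coord openE_subset by (simp add: Int_commute)
  then have "smooth_fun_on N {z\<in>points N. q z \<in> U \<inter> V} (\<lambda>z. \<psi> (q z) i)"
    by (subst e(2)[OF W, symmetric, of "\<lambda>u. u i"]) auto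
  then have "smooth_fun_on N {z\<in>points N. q z \<in> U \<inter> V} (\<lambda>z. \<psi> (inv_into U \<phi> (\<phi> (q z))) i)"
    by (rule smooth_fun_on_cong[OF N opN]) (use chart_continuous(3)[OF c(1)] in auto)
  then have "Cinf_on n (\<phi> ` (U \<inter> V)) (\<lambda>u. \<psi> (inv_into U \<phi> u) i)"
    by (subst e(1)[OF W]) auto
  then show "Cinf_on (mdim (quotient_manifold N q n)) (\<phi> ` (U \<inter> V)) (\<lambda>u. \<psi> (inv_into U \<phi> u) i)"
    by (simp only: quotient_manifold_simps)
qed

lemma has_sections_quotient: "has_sections N (quotient_manifold N q n) q"
  unfolding has_sections_def
proof (intro conjI ballI)
  let ?Q = "quotient_manifold N q n"
  note Q = smooth_manifold_quotient
  show "q ` points N = points ?Q" by (simp only: quotient_manifold_simps topspace_quotient_top)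
  fix z assume z: "z \<in> points N"
  obtain U \<phi> \<tau> where C: "quotient_chart N q n U \<phi> \<tau>" "q z \<in> U" "\<tau> (\<phi> (q z)) = z"
    using loc[OF z] by (elim exE conjE)
  note at = quotient_chart_atlas[OF N C(1)]
  show "smooth_at N ?Q q z"
  proof (rule smooth_atI[where F = q, OF N Q z at C(2)])
    show "\<exists>W. openin (mtop N) W \<and> z \<in> W \<and> q ` W \<subseteq> O'" if "openin (mtop ?Q) O'" "q z \<in> O'" for O'
    proof -
      have "openin (mtop N) {z \<in> points N. q z \<in> O'}" using that(1) by (simp add: quotient_manifold_simps openin_quotient_top)
      then show ?thesis using z that(2) by (intro exI[of _ "{z \<in> points N. q z \<in> O'}"]) auto
    qed
    have "(\<lambda>u. u i) \<in> germs (euclid n) (\<phi> (q z))" for i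
      by (rule germs_euclid[OF quotient_chartD(2)[OF C(1)] _ Cinf_on_coord[OF openE_subset[OF quotient_chartD(2)[OF C(1)]]]])
        (use C(2) in blast)
    then show "(\<lambda>z. \<phi> (q z) i) \<in> germs N z" for i
      using smooth_at_germ'[OF quotient_chartD(3)[OF C(1) z C(2)], of "\<lambda>u. u i"] by blast
  qed
  show "\<exists>s W. openin (mtop ?Q) W \<and> q z \<in> W \<and> s (q z) = z \<and> (\<forall>w\<in>W. smooth_at ?Q N s w \<and> q (s w) = w)"
  proof (intro exI[of _ "\<lambda>x. \<tau> (\<phi> x)"] exI[of _ U] conjI ballI)
    show "openin (mtop ?Q) U" by (rule atlasD(1)[OF Q at])
    show "smooth_at ?Q N (\<lambda>x. \<tau> (\<phi> x)) w" if w: "w \<in> U" for w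
      by (rule smooth_at_compose[OF chart_smooth_at[OF Q at w, unfolded quotient_manifold_simps] quotient_chartD(4)[OF C(1) w]])
    show "q (\<tau> (\<phi> w)) = w" if "w \<in> U" for w by (rule quotient_chartD(5)[OF C(1) that])
  qed (rule C(2,3))+
qed

end

section \<open>Maps into coordinate space and centred coordinates\<close>

lemma smooth_at_preimage_open:
  assumes D: "openin (mtop A) D" and F: "\<And>x. x \<in> D \<Longrightarrow> smooth_at A B F x" and V: "openin (mtop B) V"
  shows "openin (mtop A) {x \<in> D. F x \<in> V}"
proof -
  have top: "topspace (subtopology (mtop A) D) = D" using openin_subset[OF D] by auto
  from openin_continuous_map_preimage[OF smooth_at_continuous_on[OF D F] V]
  show ?thesis unfolding top openin_open_subtopology[OF D] by blast
qed

lemma germ_continuous: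
  assumes M: "smooth_manifold M" and f: "f \<in> germs M x" and e: "e > 0"
  shows "\<exists>W. openin (mtop M) W \<and> x \<in> W \<and> (\<forall>z\<in>W. \<bar>f z - f x\<bar> < e)"
proof -
  define n where "n = mdim M"
  obtain U \<phi> where c: "(U, \<phi>) \<in> atlas M" "x \<in> U" by (rule chart_at[OF M germs_points[OF f]])
  obtain B where B: "openin (Euclidean_space n) B" "\<phi> x \<in> B" "B \<subseteq> \<phi> ` U"
    "Cinf_on n B (\<lambda>u. f (inv_into U \<phi> u))"
    using germ_chartD[OF M c f] unfolding n_def by metis
  obtain d where d: "d > 0" "\<And>y. y \<in> E n \<Longrightarrow> (\<And>i. i < n \<Longrightarrow> \<bar>y i - \<phi> x i\<bar> < d) \<Longrightarrow>
      y \<in> B \<and> \<bar>f (inv_into U \<phi> y) - f (inv_into U \<phi> (\<phi> x))\<bar> < e"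
    using continuous_on_E_eps[OF B(1,2) Cinf_on_cont[OF B(4) openE_subset[OF B(1)]] e] by blast
  define W where "W = {z \<in> U. \<phi> z \<in> {y \<in> E n. \<forall>i<n. \<bar>y i - \<phi> x i\<bar> < d}}"
  have "openin (mtop M) W" unfolding W_def n_def by (rule chart_preimage_open[OF atlas_is_chart[OF M c(1)] openE_boxI])
  moreover have "x \<in> W" using c(2) d(1) atlasD(6)[OF M c(1)] by (auto simp: W_def n_def)
  moreover have "\<bar>f z - f x\<bar> < e" if "z \<in> W" for z
    using d(2)[of "\<phi> z"] that c(2) atlasD(4)[OF M c(1)] by (auto simp: W_def)
  ultimately show ?thesis by blast
qed

text \<open>Continuity comes for free here: germs are continuous, and by \<open>openE_box\<close>
  closeness in finitely many coordinates is closeness in \<open>E n\<close>.\<close>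

lemma smooth_at_euclidI:
  assumes M: "smooth_manifold M" and W: "openin (mtop M) W" "x \<in> W" "\<And>z. z \<in> W \<Longrightarrow> F z \<in> E n"
    and F: "\<And>i. i < n \<Longrightarrow> (\<lambda>z. F z i) \<in> germs M x"
  shows "smooth_at M (euclid n) F x"
proof (rule smooth_at_into_euclid[OF M _ W _ F])
  show x: "x \<in> points M" using W openin_subset by blast
  fix B assume B: "openin (Euclidean_space n) B" "F x \<in> B"
  obtain e where e: "e > 0" "\<And>y. y \<in> E n \<Longrightarrow> (\<And>i. i < n \<Longrightarrow> \<bar>y i - F x i\<bar> < e) \<Longrightarrow> y \<in> B"
    using openE_box[OF B] by blast
  have "\<forall>i\<in>{..<n}. \<exists>V. openin (mtop M) V \<and> x \<in> V \<and> (\<forall>z\<in>V. \<bar>F z i - F x i\<bar> < e)"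
    using germ_continuous[OF M F e(1)] by auto
  then obtain V where V: "\<And>i. i < n \<Longrightarrow> openin (mtop M) (V i)" "\<And>i. i < n \<Longrightarrow> x \<in> V i"
    "\<And>i z. i < n \<Longrightarrow> z \<in> V i \<Longrightarrow> \<bar>F z i - F x i\<bar> < e"
    by (subst (asm) bchoice_iff) auto
  have "openin (mtop M) (W \<inter> (\<Inter>i\<in>{..<n}. V i) \<inter> W)"
  \<comment> \<open>For \<open>n = 0\<close> the intersection is empty-indexed and equals the whole
    type, which need not be an open set of \<open>M\<close>.\<close>
  proof (cases "n = 0")
    case False
    then have "openin (mtop M) (\<Inter>i\<in>{..<n}. V i)" using V(1) by (intro openin_Inter) auto
    then show ?thesis using W(1) by (intro openin_Int)
  qed (use W in simp)
  moreover have "F ` (W \<inter> (\<Inter>i\<in>{..<n}. V i) \<inter> W) \<subseteq> B"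
    using e(2) W(3) V(3) by auto
  ultimately show "\<exists>W. openin (mtop M) W \<and> x \<in> W \<and> F ` W \<subseteq> B"
    using W V(2) by (intro exI[of _ "W \<inter> (\<Inter>i\<in>{..<n}. V i) \<inter> W"]) auto
qed

lemma germs_euclid_coord: "u \<in> E n \<Longrightarrow> (\<lambda>u. u i) \<in> germs (euclid n) u"
  by (rule germs_euclid[OF openin_E_UNIV _ Cinf_on_coord]) auto

lemma smooth_at_euclid_coord: "smooth_at M (euclid n) F x \<Longrightarrow> (\<lambda>z. F z i) \<in> germs M x"
  using smooth_at_germ'[of M "euclid n" F x "\<lambda>u. u i"] germs_euclid_coord[of "F x" n i]
    smooth_at_points(2)[of M "euclid n" F x] by simp

lemma join_smooth_at:
  assumes M: "smooth_manifold M" and F: "smooth_at M (euclid m) F x" and G: "smooth_at M (euclid n) G x"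
    and W: "openin (mtop M) W" "x \<in> W" "\<And>z. z \<in> W \<Longrightarrow> F z \<in> E m \<and> G z \<in> E n"
  shows "smooth_at M (euclid (m + n)) (\<lambda>z. join_coords m (F z) (G z)) x"
proof (rule smooth_at_euclidI[OF M W(1,2)])
  show "join_coords m (F z) (G z) \<in> E (m + n)" if "z \<in> W" for z using W(3)[OF that] by (simp add: join_E)
  show "(\<lambda>z. join_coords m (F z) (G z) i) \<in> germs M x" for i
    using smooth_at_euclid_coord[OF F] smooth_at_euclid_coord[OF G]
    by (cases "i < m") (simp_all add: join_coords_def)
qed

lemma lo_smooth_at: "u \<in> E (m + n) \<Longrightarrow> smooth_at (euclid (m + n)) (euclid m) (lo m) u"
  by (rule smooth_at_euclidI[OF smooth_manifold_euclid, where W = "E (m + n)"])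
    (auto simp: lo_E, simp add: lo_def germs_euclid_coord)

lemma hi_smooth_at: "u \<in> E (m + n) \<Longrightarrow> smooth_at (euclid (m + n)) (euclid n) (hi m) u"
  by (rule smooth_at_euclidI[OF smooth_manifold_euclid, where W = "E (m + n)"])
    (auto simp: hi_E, simp add: hi_def germs_euclid_coord)

text \<open>Coordinates described by smooth maps in both directions rather than by membership in an
  atlas, so that they can be restricted and translated at will.\<close>

definition local_coords :: "'a manifold \<Rightarrow> 'a set \<Rightarrow> ('a \<Rightarrow> nat \<Rightarrow> real) \<Rightarrow> ((nat \<Rightarrow> real) \<Rightarrow> 'a) \<Rightarrow> bool" where
  "local_coords M A \<alpha> \<tau> \<longleftrightarrow> openin (mtop M) A \<and> openin (Euclidean_space (mdim M)) (\<alpha> ` A) \<and>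
     (\<forall>x\<in>A. smooth_at M (euclid (mdim M)) \<alpha> x \<and> smooth_at (euclid (mdim M)) M \<tau> (\<alpha> x) \<and> \<tau> (\<alpha> x) = x)"

lemma local_coordsD:
  assumes "local_coords M A \<alpha> \<tau>"
  shows "openin (mtop M) A" "openin (Euclidean_space (mdim M)) (\<alpha> ` A)"
    "x \<in> A \<Longrightarrow> smooth_at M (euclid (mdim M)) \<alpha> x"
    "x \<in> A \<Longrightarrow> smooth_at (euclid (mdim M)) M \<tau> (\<alpha> x)" "x \<in> A \<Longrightarrow> \<tau> (\<alpha> x) = x"
  using assms by (auto simp: local_coords_def)

text \<open>A chart translated by \<open>\<phi> x\<close>. Centring makes the base coordinates
  vanish exactly at \<open>x\<close>, which is what turns a bundle chart into a slice chart of the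
  fibre over \<open>x\<close>.\<close>

lemma centred_coords:
  assumes M: "smooth_manifold M" and W: "openin (mtop M) W" "x \<in> W"
  obtains A \<alpha> \<tau> where "local_coords M A \<alpha> \<tau>" "A \<subseteq> W" "x \<in> A" "\<alpha> x = (\<lambda>_. 0)"
proof -
  define n where "n = mdim M"
  have xM: "x \<in> points M" using W openin_subset by blast
  obtain U \<phi> where c: "(U, \<phi>) \<in> atlas M" "x \<in> U" by (rule chart_at[OF M xM])
  define A where "A = U \<inter> W"
  define \<alpha> where "\<alpha> z = (\<lambda>i. \<phi> z i - \<phi> x i)" for z
  define sh where "sh u = (\<lambda>i. u i + \<phi> x i)" for u
  define \<tau> where "\<tau> u = inv_into U \<phi> (sh u)" for u
  have xE: "\<phi> x \<in> E n" and UE: "\<phi> ` U \<subseteq> E n" using atlasD(6)[OF M c(1)] c(2) by (auto simp: n_def)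
  have A: "openin (mtop M) A" using atlasD(1)[OF M c(1)] W(1) by (auto simp: A_def)
  have sh\<alpha>: "sh (\<alpha> z) = \<phi> z" for z by (simp add: sh_def \<alpha>_def)
  have shE: "sh u \<in> E n" if "u \<in> E n" for u using that xE by (auto simp: sh_def E_iff)
  have sh_smooth: "smooth_at (euclid n) (euclid n) sh u" if "u \<in> E n" for u
  proof (rule smooth_at_euclidI[OF smooth_manifold_euclid, where W = "E n"])
    show "(\<lambda>z. sh z i) \<in> germs (euclid n) u" for i
      unfolding sh_def
      by (rule germs_add[OF smooth_manifold_euclid germs_euclid_coord[OF that] germs_const[OF smooth_manifold_euclid]])
        (use that in simp)
  qed (use that shE in auto)
  have \<alpha>E: "\<alpha> z \<in> E n" if "z \<in> U" for z using that UE xE by (auto simp: \<alpha>_def E_iff)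
  have opA: "openin (Euclidean_space n) (\<alpha> ` A)"
  proof -
    have "openin (mtop (euclid n)) {u \<in> E n. sh u \<in> \<phi> ` A}"
      by (rule smooth_at_preimage_open[where B = "euclid n"])
        (use sh_smooth chart_image_open[OF atlas_is_chart[OF M c(1)] W(1)] in \<open>auto simp: A_def n_def\<close>)
    moreover have "{u \<in> E n. sh u \<in> \<phi> ` A} = \<alpha> ` A"
    proof (intro equalityI subsetI)
      fix u assume "u \<in> {u \<in> E n. sh u \<in> \<phi> ` A}"
      then obtain z where z: "z \<in> A" "sh u = \<phi> z" by auto
      have "\<alpha> z = u" unfolding \<alpha>_def z(2)[symmetric] by (simp add: sh_def)
      then show "u \<in> \<alpha> ` A" using z(1) by blast
    qed (auto simp: sh\<alpha> \<alpha>E A_def)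
    ultimately show ?thesis by simp
  qed
  show thesis
  proof (rule that)
    show "local_coords M A \<alpha> \<tau>"
      unfolding local_coords_def n_def[symmetric]
    proof (intro conjI ballI A opA)
      fix z assume "z \<in> A"
      then have z: "z \<in> U" "z \<in> points M" using atlasD(5)[OF M c(1)] by (auto simp: A_def)
      show "smooth_at M (euclid n) \<alpha> z"
      proof (rule smooth_at_euclidI[OF M atlasD(1)[OF M c(1)] z(1) \<alpha>E])
        show "(\<lambda>y. \<alpha> y i) \<in> germs M z" for i
          unfolding \<alpha>_def using germs_lin[OF M germs_coord[OF M c(1) z(1)] germs_const[OF M z(2)], of 1 i "- \<phi> x i" 1] by simp
      qed
      show "smooth_at (euclid n) M \<tau> (\<alpha> z)"
        unfolding \<tau>_def
        by (rule smooth_at_compose[OF sh_smooth[OF \<alpha>E[OF z(1)]]], unfold sh\<alpha> n_def, rule chart_inv_smooth_at[OF M c(1)])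
          (use z in blast)
      show "\<tau> (\<alpha> z) = z" using z(1) atlasD(4)[OF M c(1)] by (simp add: \<tau>_def sh\<alpha>)
    qed
  qed (use c W in \<open>auto simp: A_def \<alpha>_def\<close>)
qed

text \<open>The Jacobians of mutually inverse maps are inverse to each other, and the traces of their two
  products agree.\<close>

lemma mdim_eq:
  assumes M: "smooth_manifold M" and N: "smooth_manifold N" and x: "x \<in> points M"
    and F: "\<And>z. z \<in> points M \<Longrightarrow> smooth_at M N F z" and H: "\<And>w. w \<in> points N \<Longrightarrow> smooth_at N M H w"
    and HF: "\<And>z. z \<in> points M \<Longrightarrow> H (F z) = z" and FH: "\<And>w. w \<in> points N \<Longrightarrow> F (H w) = w"
  shows "mdim M = mdim N"
proof -
  \<comment> \<open>The diagonal entries of the product of the two Jacobians. The manifolds are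
    generalized because the statement is used once for each order of the two maps.\<close>
  have key: "(\<Sum>j<mdim N. chart_vec M U \<phi> x i (\<lambda>z. \<psi> (F z) j) * chart_vec N V \<psi> (F x) j (\<lambda>w. \<phi> (H w) i)) = 1"
    if M: "smooth_manifold M" and N: "smooth_manifold N" and x: "x \<in> points M"
      and F: "\<And>z. z \<in> points M \<Longrightarrow> smooth_at M N F z" and H: "\<And>w. w \<in> points N \<Longrightarrow> smooth_at N M H w"
      and HF: "\<And>z. z \<in> points M \<Longrightarrow> H (F z) = z"
      and c: "(U, \<phi>) \<in> atlas M" "x \<in> U" and d: "(V, \<psi>) \<in> atlas N" "F x \<in> V" and i: "i < mdim M"
    for M :: "'c manifold" and N :: "'d manifold" and x F H U \<phi> V \<psi> i
  proof -
    define v where "v = pushforward N F x (chart_vec M U \<phi> x i)"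
    note cv = chart_vec_tangent[OF M c i]
    have v: "v \<in> tangent_space N (F x)" unfolding v_def by (rule pushforward_tangent[OF F[OF x] N cv])
    have Hx: "H (F x) \<in> U" using HF[OF x] c(2) by simp
    have g: "(\<lambda>w. \<phi> (H w) i) \<in> germs N (F x)"
      by (rule smooth_at_germ'[OF H[OF smooth_at_points(2)[OF F[OF x]]] germs_coord[OF M c(1) Hx]])
    have "(\<Sum>j<mdim N. chart_vec M U \<phi> x i (\<lambda>z. \<psi> (F z) j) * chart_vec N V \<psi> (F x) j (\<lambda>w. \<phi> (H w) i)) = v (\<lambda>w. \<phi> (H w) i)"
      unfolding tangent_expand[OF N v d g]
      by (rule sum.cong[OF refl]) (simp add: v_def pushforward_apply germs_coord[OF N d])
    also have "\<dots> = chart_vec M U \<phi> x i (\<lambda>z. \<phi> (H (F z)) i)" unfolding v_def by (rule pushforward_apply) (rule g)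
    also have "\<dots> = chart_vec M U \<phi> x i (\<lambda>z. \<phi> z i)"
      by (rule tangent_germ_eq[OF M cv openin_topspace x]) (simp add: HF)
    also have "\<dots> = 1" by (simp add: chart_vec_coord[OF M c i])
    finally show ?thesis .
  qed
  note Fx = smooth_at_points(2)[OF F[OF x]]
  obtain U \<phi> where c: "(U, \<phi>) \<in> atlas M" "x \<in> U" by (rule chart_at[OF M x])
  obtain V \<psi> where d: "(V, \<psi>) \<in> atlas N" "F x \<in> V" by (rule chart_at[OF N Fx])
  have c': "H (F x) \<in> U" using c(2) HF[OF x] by simp
  define a where "a i j = chart_vec M U \<phi> x i (\<lambda>z. \<psi> (F z) j)" for i j
  define b where "b j i = chart_vec N V \<psi> (F x) j (\<lambda>w. \<phi> (H w) i)" for i j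
  have "real (mdim M) = (\<Sum>i<mdim M. \<Sum>j<mdim N. a i j * b j i)"
    using key[OF M N x F H HF c d] by (simp add: a_def b_def)
  also have "\<dots> = (\<Sum>j<mdim N. \<Sum>i<mdim M. b j i * a i j)"
    by (subst sum.swap) (simp add: mult.commute)
  also have "\<dots> = real (mdim N)"
    using key[OF N M Fx H F FH d c(1) c'] by (simp add: a_def b_def HF[OF x])
  finally show ?thesis by simp
qed

section \<open>Principal bundles\<close>

locale principal_action =
  fixes G :: "'g monoid" and Gm :: "'g manifold"
    and P :: "'p manifold" and M :: "'m manifold" and X :: "'x manifold"
    and r :: "'p \<Rightarrow> 'g \<Rightarrow> 'p" and p :: "'p \<Rightarrow> 'm" and l :: "'g \<Rightarrow> 'x \<Rightarrow> 'x"
  assumes principal: "principal_bundle G Gm P r M p" and X: "smooth_manifold X"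
    and action: "smooth_left_action G Gm X l"
begin

lemma bundle_facts:
  "group G" "smooth_manifold Gm" "points Gm = carrier G"
  "smooth_map (prod_manifold Gm Gm) Gm (\<lambda>(g, h). g \<otimes>\<^bsub>G\<^esub> h)" "smooth_manifold P" "smooth_manifold M"
  "smooth_map (prod_manifold P Gm) P (\<lambda>(y, g). r y g)" "smooth_map P M p"
  "smooth_map (prod_manifold Gm X) X (\<lambda>(g, x). l g x)" "group_action G (points X) l"
  using principal action unfolding principal_bundle_def lie_group_def smooth_right_action_def smooth_left_action_def
  by blast+

sublocale group G by (rule bundle_facts(1))

lemmas Gm = bundle_facts(2) and points_Gm = bundle_facts(3) and P = bundle_facts(5) and M = bundle_facts(6)

lemma r_facts:
  "y \<in> points P \<Longrightarrow> r y \<one>\<^bsub>G\<^esub> = y" "y \<in> points P \<Longrightarrow> g \<in> carrier G \<Longrightarrow> r y g \<in> points P"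
  "y \<in> points P \<Longrightarrow> g \<in> carrier G \<Longrightarrow> h \<in> carrier G \<Longrightarrow> r (r y g) h = r y (g \<otimes>\<^bsub>G\<^esub> h)"
  "y \<in> points P \<Longrightarrow> g \<in> carrier G \<Longrightarrow> p (r y g) = p y"
  using principal unfolding principal_bundle_def smooth_right_action_def by blast+

lemma l_facts:
  "x \<in> points X \<Longrightarrow> l \<one>\<^bsub>G\<^esub> x = x" "x \<in> points X \<Longrightarrow> g \<in> carrier G \<Longrightarrow> l g x \<in> points X"
  "x \<in> points X \<Longrightarrow> g \<in> carrier G \<Longrightarrow> h \<in> carrier G \<Longrightarrow> l g (l h x) = l (g \<otimes>\<^bsub>G\<^esub> h) x"
proof -
  interpret A: group_action G "points X" l by (rule bundle_facts(10))
  show "x \<in> points X \<Longrightarrow> l \<one>\<^bsub>G\<^esub> x = x" by (simp add: fun_cong[OF A.id_eq_one, symmetric])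
  show "x \<in> points X \<Longrightarrow> g \<in> carrier G \<Longrightarrow> l g x \<in> points X" using A.element_image by blast
  show "x \<in> points X \<Longrightarrow> g \<in> carrier G \<Longrightarrow> h \<in> carrier G \<Longrightarrow> l g (l h x) = l (g \<otimes>\<^bsub>G\<^esub> h) x"
    by (simp add: A.composition_rule)
qed

lemma smooth_at_binary:
  assumes "smooth_manifold K" "smooth_manifold A" "smooth_manifold B" "smooth_manifold C"
    and "smooth_map (prod_manifold A B) C (\<lambda>(x, y). f x y)" "smooth_at K A a z" "smooth_at K B b z"
  shows "smooth_at K C (\<lambda>z. f (a z) (b z)) z"
proof -
  note ab = pair_smooth_at[OF assms(2,3,1,6,7)]
  have "smooth_at (prod_manifold A B) C (\<lambda>(x, y). f x y) (a z, b z)"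
    using assms(5) smooth_at_points(2)[OF ab] unfolding smooth_map_iff[OF smooth_manifold_prod[OF assms(2,3)] assms(4)] by blast
  from smooth_at_compose[OF ab this] show ?thesis by simp
qed

lemmas mult_smooth_at = smooth_at_binary[OF _ Gm Gm Gm bundle_facts(4)]
  and r_smooth_at = smooth_at_binary[OF _ P Gm P bundle_facts(7)]
  and l_smooth_at = smooth_at_binary[OF _ Gm X X bundle_facts(9)]

lemma p_smooth_at: "y \<in> points P \<Longrightarrow> smooth_at P M p y"
  using bundle_facts(8) unfolding smooth_map_iff[OF P M] by blast

lemma p_points: "y \<in> points P \<Longrightarrow> p y \<in> points M"
  by (rule smooth_at_points(2)[OF p_smooth_at])

text \<open>Local triviality in terms of a section \<open>s\<close> and the group coordinate
  \<gamma> relative to it. This replaces the diffeomorphism onto a product by maps between the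
  manifolds themselves.\<close>

definition trivialization :: "'m set \<Rightarrow> ('m \<Rightarrow> 'p) \<Rightarrow> ('p \<Rightarrow> 'g) \<Rightarrow> bool" where
  "trivialization U s \<gamma> \<longleftrightarrow> openin (mtop M) U \<and>
     (\<forall>m\<in>U. smooth_at M P s m \<and> p (s m) = m) \<and>
     (\<forall>y\<in>points P. p y \<in> U \<longrightarrow> smooth_at P Gm \<gamma> y \<and> r (s (p y)) (\<gamma> y) = y \<and>
        (\<forall>g\<in>carrier G. \<gamma> (r y g) = \<gamma> y \<otimes>\<^bsub>G\<^esub> g))"

lemma trivializationD:
  assumes "trivialization U s \<gamma>"
  shows "openin (mtop M) U" "m \<in> U \<Longrightarrow> smooth_at M P s m" "m \<in> U \<Longrightarrow> p (s m) = m" "m \<in> U \<Longrightarrow> s m \<in> points P"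
    "y \<in> points P \<Longrightarrow> p y \<in> U \<Longrightarrow> smooth_at P Gm \<gamma> y"
    "y \<in> points P \<Longrightarrow> p y \<in> U \<Longrightarrow> \<gamma> y \<in> carrier G"
    "y \<in> points P \<Longrightarrow> p y \<in> U \<Longrightarrow> r (s (p y)) (\<gamma> y) = y"
    "y \<in> points P \<Longrightarrow> p y \<in> U \<Longrightarrow> g \<in> carrier G \<Longrightarrow> \<gamma> (r y g) = \<gamma> y \<otimes>\<^bsub>G\<^esub> g"
proof -
  show *: "openin (mtop M) U" "m \<in> U \<Longrightarrow> smooth_at M P s m" "m \<in> U \<Longrightarrow> p (s m) = m"
    "y \<in> points P \<Longrightarrow> p y \<in> U \<Longrightarrow> smooth_at P Gm \<gamma> y"
    "y \<in> points P \<Longrightarrow> p y \<in> U \<Longrightarrow> r (s (p y)) (\<gamma> y) = y"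
    "y \<in> points P \<Longrightarrow> p y \<in> U \<Longrightarrow> g \<in> carrier G \<Longrightarrow> \<gamma> (r y g) = \<gamma> y \<otimes>\<^bsub>G\<^esub> g"
    using assms by (auto simp: trivialization_def)
  show "m \<in> U \<Longrightarrow> s m \<in> points P" by (rule smooth_at_points(2)[OF *(2)])
  show "y \<in> points P \<Longrightarrow> p y \<in> U \<Longrightarrow> \<gamma> y \<in> carrier G"
    using smooth_at_points(2)[OF *(4)] points_Gm by simp
qed

text \<open>Since \<open>r (s m) (\<gamma> (s m))\<close> is \<open>s m\<close>, equivariance makes
  \<open>\<gamma> (s m)\<close> an idempotent of the group.\<close>

lemma trivialization_section:
  assumes t: "trivialization U s \<gamma>" and m: "m \<in> U"
  shows "\<gamma> (s m) = \<one>\<^bsub>G\<^esub>"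
proof -
  note sm = trivializationD(4)[OF t m] and pm = trivializationD(3)[OF t m]
  have pU: "p (s m) \<in> U" using m pm by simp
  note g = trivializationD(6)[OF t sm pU]
  have "r (s m) (\<gamma> (s m)) = s m" using trivializationD(7)[OF t sm pU] pm by simp
  then have "\<gamma> (s m) = \<gamma> (s m) \<otimes>\<^bsub>G\<^esub> \<gamma> (s m)" using trivializationD(8)[OF t sm pU g] by simp
  then show ?thesis using g by (metis l_cancel_one)
qed

text \<open>Smoothness at a point does not see the restriction to an open submanifold, so the
  diffeomorphism in \<open>principal_bundle\<close> can be restated on \<open>P\<close>,
  \<open>M\<close> and \<open>Gm\<close>. The dimension formula is read off from it by
  \<open>mdim_eq\<close>.\<close>

lemma local_trivial:
  assumes m: "m \<in> points M"
  obtains U \<Phi> \<Psi> where "openin (mtop M) U" "m \<in> U"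
    "\<forall>y\<in>points P. p y \<in> U \<longrightarrow> smooth_at P M (\<lambda>y. fst (\<Phi> y)) y \<and> smooth_at P Gm (\<lambda>y. snd (\<Phi> y)) y \<and> \<Psi> (\<Phi> y) = y \<and>
      fst (\<Phi> y) = p y \<and> (\<forall>g\<in>carrier G. \<Phi> (r y g) = (p y, snd (\<Phi> y) \<otimes>\<^bsub>G\<^esub> g))"
    "\<forall>m\<in>U. \<forall>g\<in>carrier G. \<Phi> (\<Psi> (m, g)) = (m, g) \<and> \<Psi> (m, g) \<in> points P \<and> p (\<Psi> (m, g)) = m \<and>
      smooth_at M P (\<lambda>m. \<Psi> (m, g)) m"
    "points P \<noteq> {} \<longrightarrow> mdim P = mdim M + mdim Gm"
proof -
  have "\<forall>m\<in>points M. \<exists>U \<Phi>. openin (mtop M) U \<and> m \<in> U \<and>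
        diffeo (open_submanifold P {y\<in>points P. p y \<in> U}) (prod_manifold (open_submanifold M U) Gm) \<Phi> \<and>
        (\<forall>y\<in>points P. p y \<in> U \<longrightarrow> fst (\<Phi> y) = p y \<and>
           (\<forall>g\<in>carrier G. \<Phi> (r y g) = (p y, snd (\<Phi> y) \<otimes>\<^bsub>G\<^esub> g)))"
    using principal by (simp add: principal_bundle_def)
  from bspec[OF this m] obtain U \<Phi> where U: "openin (mtop M) U" "m \<in> U"
    and diff: "diffeo (open_submanifold P {y\<in>points P. p y \<in> U}) (prod_manifold (open_submanifold M U) Gm) \<Phi>"
    and eq: "\<forall>y\<in>points P. p y \<in> U \<longrightarrow> fst (\<Phi> y) = p y \<and>
           (\<forall>g\<in>carrier G. \<Phi> (r y g) = (p y, snd (\<Phi> y) \<otimes>\<^bsub>G\<^esub> g))"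
    by (elim exE conjE)
  define D where "D = {y\<in>points P. p y \<in> U}"
  have D: "openin (mtop P) D" unfolding D_def by (rule smooth_at_preimage_open[OF openin_topspace p_smooth_at U(1)])
  note PD = smooth_manifold_open_sub[OF P D] and MU = smooth_manifold_open_sub[OF M U(1)]
  note MUG = smooth_manifold_prod[OF MU Gm]
  obtain \<Psi> where sm: "smooth_map (open_submanifold P D) (prod_manifold (open_submanifold M U) Gm) \<Phi>"
      "smooth_map (prod_manifold (open_submanifold M U) Gm) (open_submanifold P D) \<Psi>"
    and inv: "\<forall>y\<in>points (open_submanifold P D). \<Psi> (\<Phi> y) = y"
      "\<forall>w\<in>points (prod_manifold (open_submanifold M U) Gm). \<Phi> (\<Psi> w) = w"
    using diff unfolding D_def[symmetric] diffeo_def by (elim exE conjE)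
  have pts: "points (open_submanifold P D) = D" "points (prod_manifold (open_submanifold M U) Gm) = U \<times> carrier G"
    by (simp_all only: open_sub_simps(3)[OF P D] prod_manifold_simps(3) open_sub_simps(3)[OF M U(1)] points_Gm)
  have \<Phi>s: "smooth_at (open_submanifold P D) (prod_manifold (open_submanifold M U) Gm) \<Phi> y" if "y \<in> D" for y
    using sm(1) that unfolding smooth_map_iff[OF PD MUG] pts by blast
  have \<Psi>s: "smooth_at (prod_manifold (open_submanifold M U) Gm) (open_submanifold P D) \<Psi> w" if "w \<in> U \<times> carrier G" for w
    using sm(2) that unfolding smooth_map_iff[OF MUG PD] pts by blast
  have \<Phi>D: "\<Phi> y \<in> U \<times> carrier G" if "y \<in> D" for y using smooth_at_points(2)[OF \<Phi>s[OF that]] by (simp only: pts)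
  have \<Psi>D: "\<Psi> w \<in> D" if "w \<in> U \<times> carrier G" for w using smooth_at_points(2)[OF \<Psi>s[OF that]] by (simp only: pts)
  show thesis
  proof (rule that[OF U])
    show "\<forall>y\<in>points P. p y \<in> U \<longrightarrow> smooth_at P M (\<lambda>y. fst (\<Phi> y)) y \<and> smooth_at P Gm (\<lambda>y. snd (\<Phi> y)) y \<and> \<Psi> (\<Phi> y) = y \<and>
      fst (\<Phi> y) = p y \<and> (\<forall>g\<in>carrier G. \<Phi> (r y g) = (p y, snd (\<Phi> y) \<otimes>\<^bsub>G\<^esub> g))"
    proof (intro ballI impI conjI)
      fix y assume y: "y \<in> points P" "p y \<in> U"
      then have yD: "y \<in> D" by (simp add: D_def)
      note z = smooth_at_points(2)[OF \<Phi>s[OF yD]]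
      have "fst (\<Phi> y) \<in> U" using \<Phi>D[OF yD] by auto
      then have "smooth_at P M (\<lambda>y. fst (\<Phi> y)) y"
        using smooth_at_compose[OF \<Phi>s[OF yD] fst_smooth_at[OF MU Gm z]]
        unfolding smooth_at_from_open_sub[OF P D yD] by (subst (asm) smooth_at_into_open_sub[OF M U(1)])
      then show "smooth_at P M (\<lambda>y. fst (\<Phi> y)) y" .
      show "smooth_at P Gm (\<lambda>y. snd (\<Phi> y)) y"
        using smooth_at_compose[OF \<Phi>s[OF yD] snd_smooth_at[OF MU Gm z]]
        unfolding smooth_at_from_open_sub[OF P D yD] .
      show "\<Psi> (\<Phi> y) = y" using inv(1) yD unfolding pts by blast
    qed (use eq in auto)
    show "\<forall>m\<in>U. \<forall>g\<in>carrier G. \<Phi> (\<Psi> (m, g)) = (m, g) \<and> \<Psi> (m, g) \<in> points P \<and> p (\<Psi> (m, g)) = m \<and>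
      smooth_at M P (\<lambda>m. \<Psi> (m, g)) m"
    proof (intro ballI conjI)
      fix m g assume m: "m \<in> U" and g: "g \<in> carrier G"
      show \<Phi>\<Psi>: "\<Phi> (\<Psi> (m, g)) = (m, g)" using inv(2) m g unfolding pts by blast
      have d: "\<Psi> (m, g) \<in> D" using \<Psi>D m g by blast
      then show "\<Psi> (m, g) \<in> points P" by (simp add: D_def)
      then show "p (\<Psi> (m, g)) = m" using eq d \<Phi>\<Psi> by (force simp: D_def)
      have mM: "m \<in> points (open_submanifold M U)" using m by (simp only: open_sub_simps(3)[OF M U(1)])
      have gG: "g \<in> points Gm" using g points_Gm by simp
      have "smooth_at (open_submanifold M U) (prod_manifold (open_submanifold M U) Gm) (\<lambda>m. (m, g)) m"
        by (rule slice1_smooth_at[OF MU Gm mM gG])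
      from smooth_at_compose[OF this \<Psi>s] m g
      have "smooth_at (open_submanifold M U) (open_submanifold P D) (\<lambda>m. \<Psi> (m, g)) m" by simp
      then show "smooth_at M P (\<lambda>m. \<Psi> (m, g)) m"
        unfolding smooth_at_from_open_sub[OF M U(1) m] using smooth_at_into_open_sub[OF P D, of "\<lambda>m. \<Psi> (m, g)" m M] d by simp
    qed
    show "points P \<noteq> {} \<longrightarrow> mdim P = mdim M + mdim Gm"
    proof
      have w: "(m, \<one>\<^bsub>G\<^esub>) \<in> points (prod_manifold (open_submanifold M U) Gm)" using U(2) by (simp add: pts)
      have "mdim (prod_manifold (open_submanifold M U) Gm) = mdim (open_submanifold P D)"
        by (rule mdim_eq[OF MUG PD w]) (use \<Phi>s \<Psi>s inv pts in auto)
      then show "mdim P = mdim M + mdim Gm" by (simp add: prod_manifold_simps open_sub_simps[OF P D] open_sub_simps[OF M U(1)])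
    qed
  qed
qed

lemma mdim_P: "points P \<noteq> {} \<Longrightarrow> mdim P = mdim M + mdim Gm"
  using local_trivial[of "p (SOME y. y \<in> points P)"] p_points some_in_eq[of "points P"] by metis

text \<open>The section through \<open>y0\<close> is the unit section of a local trivialization
  translated by the group coordinate \<open>g0\<close> of \<open>y0\<close>; the new group
  coordinate is corrected by the inverse of \<open>g0\<close> on the left, which commutes with right
  translations.\<close>

lemma trivialization_at:
  assumes y0: "y0 \<in> points P"
  obtains U s \<gamma> where "trivialization U s \<gamma>" "p y0 \<in> U" "s (p y0) = y0" "\<gamma> y0 = \<one>\<^bsub>G\<^esub>"
proof -
  obtain U \<Phi> \<Psi> where U: "openin (mtop M) U" "p y0 \<in> U"
    and 1: "\<forall>y\<in>points P. p y \<in> U \<longrightarrow> smooth_at P M (\<lambda>y. fst (\<Phi> y)) y \<and> smooth_at P Gm (\<lambda>y. snd (\<Phi> y)) y \<and> \<Psi> (\<Phi> y) = y \<and>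
      fst (\<Phi> y) = p y \<and> (\<forall>g\<in>carrier G. \<Phi> (r y g) = (p y, snd (\<Phi> y) \<otimes>\<^bsub>G\<^esub> g))"
    and 2: "\<forall>m\<in>U. \<forall>g\<in>carrier G. \<Phi> (\<Psi> (m, g)) = (m, g) \<and> \<Psi> (m, g) \<in> points P \<and> p (\<Psi> (m, g)) = m \<and>
      smooth_at M P (\<lambda>m. \<Psi> (m, g)) m"
    by (rule local_trivial[OF p_points[OF y0]])
  define g0 where "g0 = snd (\<Phi> y0)"
  have car: "snd (\<Phi> y) \<in> carrier G" if "y \<in> points P" "p y \<in> U" for y
    using 1 that smooth_at_points(2)[of P Gm "\<lambda>y. snd (\<Phi> y)" y] points_Gm by auto
  have g0: "g0 \<in> carrier G" unfolding g0_def by (rule car[OF y0 U(2)])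
  define s where "s m = r (\<Psi> (m, \<one>\<^bsub>G\<^esub>)) g0" for m
  define \<gamma> where "\<gamma> y = inv\<^bsub>G\<^esub> g0 \<otimes>\<^bsub>G\<^esub> snd (\<Phi> y)" for y
  have 3: "r (\<Psi> (p y, \<one>\<^bsub>G\<^esub>)) (snd (\<Phi> y)) = y" if y: "y \<in> points P" "p y \<in> U" for y
  proof -
    have z: "\<Psi> (p y, \<one>\<^bsub>G\<^esub>) \<in> points P" "p (\<Psi> (p y, \<one>\<^bsub>G\<^esub>)) = p y" "\<Phi> (\<Psi> (p y, \<one>\<^bsub>G\<^esub>)) = (p y, \<one>\<^bsub>G\<^esub>)" using 2 y(2) by auto
    have "\<Phi> (r (\<Psi> (p y, \<one>\<^bsub>G\<^esub>)) (snd (\<Phi> y))) = (p y, \<one>\<^bsub>G\<^esub> \<otimes>\<^bsub>G\<^esub> snd (\<Phi> y))"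
      using 1 z y(2) car[OF y] by simp
    also have "\<dots> = \<Phi> y" using 1 y car[OF y] by (simp add: prod_eq_iff)
    finally have e: "\<Phi> (r (\<Psi> (p y, \<one>\<^bsub>G\<^esub>)) (snd (\<Phi> y))) = \<Phi> y" .
    have "r (\<Psi> (p y, \<one>\<^bsub>G\<^esub>)) (snd (\<Phi> y)) \<in> points P" "p (r (\<Psi> (p y, \<one>\<^bsub>G\<^esub>)) (snd (\<Phi> y))) \<in> U"
      using r_facts(2,4)[OF z(1) car[OF y]] z(2) y(2) by simp_all
    then have "r (\<Psi> (p y, \<one>\<^bsub>G\<^esub>)) (snd (\<Phi> y)) = \<Psi> (\<Phi> (r (\<Psi> (p y, \<one>\<^bsub>G\<^esub>)) (snd (\<Phi> y))))" using 1 by metis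
    also have "\<dots> = y" unfolding e using 1 y by blast
    finally show ?thesis .
  qed
  show thesis
  proof (rule that)
    show "trivialization U s \<gamma>"
      unfolding trivialization_def
    proof (intro conjI ballI impI U(1))
      fix m assume m: "m \<in> U"
      have z: "\<Psi> (m, \<one>\<^bsub>G\<^esub>) \<in> points P" "p (\<Psi> (m, \<one>\<^bsub>G\<^esub>)) = m" "smooth_at M P (\<lambda>m. \<Psi> (m, \<one>\<^bsub>G\<^esub>)) m" using 2 m by auto
      show "smooth_at M P s m" unfolding s_def
        by (rule r_smooth_at[OF M z(3) smooth_at_const[OF M smooth_at_points(1)[OF z(3)]]]) (simp add: points_Gm g0)
      show "p (s m) = m" unfolding s_def using r_facts(4)[OF z(1) g0] z(2) by simp
    next
      fix y assume y: "y \<in> points P" "p y \<in> U"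
      note cy = car[OF y]
      have sy: "smooth_at P Gm (\<lambda>y. snd (\<Phi> y)) y" using 1 y by blast
      show "smooth_at P Gm \<gamma> y" unfolding \<gamma>_def
        by (rule mult_smooth_at[OF P smooth_at_const[OF P y(1)] sy]) (simp add: points_Gm g0)
      have z: "\<Psi> (p y, \<one>\<^bsub>G\<^esub>) \<in> points P" using 2 y(2) by auto
      have "g0 \<otimes>\<^bsub>G\<^esub> (inv\<^bsub>G\<^esub> g0 \<otimes>\<^bsub>G\<^esub> snd (\<Phi> y)) = snd (\<Phi> y)" using g0 cy by (simp add: m_assoc[symmetric])
      then show "r (s (p y)) (\<gamma> y) = y"
        unfolding s_def \<gamma>_def using r_facts(3)[OF z g0, of "inv\<^bsub>G\<^esub> g0 \<otimes>\<^bsub>G\<^esub> snd (\<Phi> y)"] 3[OF y] g0 cy by simp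
      show "\<gamma> (r y g) = \<gamma> y \<otimes>\<^bsub>G\<^esub> g" if "g \<in> carrier G" for g
        unfolding \<gamma>_def using 1 y that g0 cy by (simp add: m_assoc)
    qed
    show "s (p y0) = y0" unfolding s_def g0_def by (rule 3[OF y0 U(2)])
    show "\<gamma> y0 = \<one>\<^bsub>G\<^esub>" unfolding \<gamma>_def g0_def[symmetric] using g0 by simp
  qed (rule U(2))
qed

lemma p_surj:
  assumes "m \<in> points M"
  obtains y where "y \<in> points P" "p y = m"
proof -
  obtain U \<Phi> \<Psi> where "m \<in> U" and 2: "\<forall>m\<in>U. \<forall>g\<in>carrier G. \<Phi> (\<Psi> (m, g)) = (m, g) \<and> \<Psi> (m, g) \<in> points P \<and> p (\<Psi> (m, g)) = m \<and>
      smooth_at M P (\<lambda>m. \<Psi> (m, g)) m"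
    by (rule local_trivial[OF assms])
  then show thesis using that[of "\<Psi> (m, \<one>\<^bsub>G\<^esub>)"] by auto
qed

lemma has_sections_p: "has_sections P M p"
  unfolding has_sections_def
proof (intro conjI ballI p_smooth_at)
  show "p ` points P = points M" using p_surj p_points by (metis image_subsetI subsetI subset_antisym image_eqI)
  fix y assume y: "y \<in> points P"
  obtain U s \<gamma> where t: "trivialization U s \<gamma>" "p y \<in> U" "s (p y) = y" by (rule trivialization_at[OF y])
  show "\<exists>s W. openin (mtop M) W \<and> p y \<in> W \<and> s (p y) = y \<and> (\<forall>w\<in>W. smooth_at M P s w \<and> p (s w) = w)"
    using t trivializationD(1-3)[OF t(1)] by (intro exI[of _ s] exI[of _ U]) auto
qed

end

text \<open>A Poisson map \<open>F\<close> with \<open>q \<circ> F = q\<close> carries the bracket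
  at \<open>z' = F z\<close> of two pulled-back functions to the bracket at \<open>z\<close> of the
  same functions.\<close>

lemma fibre_invariantI:
  assumes N: "smooth_manifold N" and Q: "smooth_manifold Q" and q: "\<And>z. z \<in> points N \<Longrightarrow> smooth_at N Q q z"
    and sym: "\<And>z z'. z \<in> points N \<Longrightarrow> z' \<in> points N \<Longrightarrow> q z = q z' \<Longrightarrow>
      \<exists>F. poisson_map N \<pi> N \<pi> F \<and> F z = z' \<and> (\<forall>w\<in>points N. q (F w) = q w)"
  shows "fibre_invariant N Q q \<pi>"
  unfolding fibre_invariant_def
proof (intro ballI impI)
  fix z z' f g assume z: "z \<in> points N" "z' \<in> points N" "q z = q z'" and f: "f \<in> germs Q (q z)" and g: "g \<in> germs Q (q z)"
  obtain F where F: "poisson_map N \<pi> N \<pi> F" "F z = z'" "\<forall>w\<in>points N. q (F w) = q w"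
    using sym[OF z] by (elim exE conjE)
  note * = F(1)[unfolded poisson_map_iff[OF N N], THEN conjunct2, rule_format, OF z(1), unfolded F(2)]
  have fg: "(\<lambda>z. f (q z)) \<in> germs N z'" "(\<lambda>z. g (q z)) \<in> germs N z'"
    by (rule smooth_at_germ'[OF q[OF z(2)]], simp add: z(3)[symmetric] f g)+
  have "bracket N \<pi> (\<lambda>z. f (q z)) (\<lambda>z. g (q z)) z' = bracket N \<pi> (\<lambda>z. f (q (F z))) (\<lambda>z. g (q (F z))) z"
    by (rule *[OF fg])
  also have "\<dots> = bracket N \<pi> (\<lambda>z. f (q z)) (\<lambda>z. g (q z)) z"
    by (rule bracket_cong[OF N openin_topspace z(1)]) (simp_all add: F(3))
  finally show "bracket N \<pi> (\<lambda>z. f (q z)) (\<lambda>z. g (q z)) z = bracket N \<pi> (\<lambda>z. f (q z)) (\<lambda>z. g (q z)) z'" by simp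
qed

lemma poisson_map_prod:
  assumes M: "smooth_manifold M" and N: "smooth_manifold N"
    and F: "poisson_map M \<pi> M \<pi> F" and H: "poisson_map N \<rho> N \<rho> H"
  shows "poisson_map (prod_manifold M N) (prod_bivector M \<pi> N \<rho>) (prod_manifold M N) (prod_bivector M \<pi> N \<rho>)
    (\<lambda>z. (F (fst z), H (snd z)))"
proof -
  let ?P = "prod_manifold M N"
  note P = smooth_manifold_prod[OF M N]
  note F' = F[unfolded poisson_map_iff[OF M M]] and H' = H[unfolded poisson_map_iff[OF N N]]
  have Fs: "smooth_at M M F x" if "x \<in> points M" for x using F' that unfolding smooth_map_iff[OF M M] by blast
  have Hs: "smooth_at N N H y" if "y \<in> points N" for y using H' that unfolding smooth_map_iff[OF N N] by blast
  have FH: "smooth_at ?P ?P (\<lambda>z. (F (fst z), H (snd z))) z" if z: "z \<in> points ?P" for z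
  proof -
    have xy: "fst z \<in> points M" "snd z \<in> points N" using z by (auto simp: prod_manifold_simps)
    show ?thesis
      by (rule pair_smooth_at[OF M N P smooth_at_compose[OF fst_smooth_at[OF M N z] Fs[OF xy(1)]]
            smooth_at_compose[OF snd_smooth_at[OF M N z] Hs[OF xy(2)]]])
  qed
  show ?thesis
    unfolding poisson_map_iff[OF P P]
  proof (intro conjI ballI)
    show "smooth_map ?P ?P (\<lambda>z. (F (fst z), H (snd z)))" unfolding smooth_map_iff[OF P P] using FH by blast
    fix z f g assume z: "z \<in> points ?P" and f: "f \<in> germs ?P (F (fst z), H (snd z))" and g: "g \<in> germs ?P (F (fst z), H (snd z))"
    obtain x y where xy: "z = (x, y)" "x \<in> points M" "y \<in> points N" using z by (auto simp: prod_manifold_simps)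
    have f': "f \<in> germs ?P (F x, H y)" and g': "g \<in> germs ?P (F x, H y)" using f g xy by auto
    note Fx = smooth_at_points(2)[OF Fs[OF xy(2)]] and Hy = smooth_at_points(2)[OF Hs[OF xy(3)]]
    note s1 = smooth_at_germ'[OF slice1_smooth_at[OF M N Fx Hy]] and s2 = smooth_at_germ'[OF slice2_smooth_at[OF M N Fx Hy]]
    have fz: "(\<lambda>z. f (F (fst z), H (snd z))) \<in> germs ?P (x, y)" "(\<lambda>z. g (F (fst z), H (snd z))) \<in> germs ?P (x, y)"
      using smooth_at_germ'[OF FH[OF z]] f g unfolding xy(1) by simp_all
    have "bracket ?P (prod_bivector M \<pi> N \<rho>) f g (F x, H y) =
        bracket M \<pi> (\<lambda>x'. f (x', H y)) (\<lambda>x'. g (x', H y)) (F x) + bracket N \<rho> (\<lambda>y'. f (F x, y')) (\<lambda>y'. g (F x, y')) (H y)"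
      by (rule bracket_prod[OF M N f' g'])
    also have "bracket M \<pi> (\<lambda>x'. f (x', H y)) (\<lambda>x'. g (x', H y)) (F x) =
        bracket M \<pi> (\<lambda>x'. f (F x', H y)) (\<lambda>x'. g (F x', H y)) x"
      by (rule F'[THEN conjunct2, rule_format, OF xy(2) s1[OF f'] s1[OF g']])
    also have "bracket N \<rho> (\<lambda>y'. f (F x, y')) (\<lambda>y'. g (F x, y')) (H y) =
        bracket N \<rho> (\<lambda>y'. f (F x, H y')) (\<lambda>y'. g (F x, H y')) y"
      by (rule H'[THEN conjunct2, rule_format, OF xy(3) s2[OF f'] s2[OF g']])
    finally show "bracket ?P (prod_bivector M \<pi> N \<rho>) f g (F (fst z), H (snd z)) =
        bracket ?P (prod_bivector M \<pi> N \<rho>) (\<lambda>z. f (F (fst z), H (snd z))) (\<lambda>z. g (F (fst z), H (snd z))) z"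
      unfolding xy(1) bracket_prod[OF M N fz] by simp
  qed
qed

section \<open>The associated bundle\<close>

context principal_action
begin

abbreviation "PX \<equiv> prod_manifold P X"
abbreviation "qt \<equiv> assoc_quot G r l"
abbreviation "\<Sigma> \<equiv> assoc_bundle G Gm P r X l"
abbreviation "p\<Sigma> \<equiv> (assoc_proj p :: ('p \<times> 'x) set \<Rightarrow> 'm)"

lemmas PX = smooth_manifold_prod[OF P X]

lemma points_PX: "points PX = points P \<times> points X"
  by (rule prod_manifold_simps(3))

lemma qt_eq: "qt (y, x) = (\<lambda>g. (r y (inv\<^bsub>G\<^esub> g), l g x)) ` carrier G"
  unfolding assoc_quot_def orbit_def by auto

lemma qt_iff:
  assumes y: "y \<in> points P" "y' \<in> points P" and x: "x \<in> points X" "x' \<in> points X"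
  shows "qt (y, x) = qt (y', x') \<longleftrightarrow> (\<exists>g\<in>carrier G. y' = r y (inv\<^bsub>G\<^esub> g) \<and> x' = l g x)"
proof
  assume eq: "qt (y, x) = qt (y', x')"
  have "(y', x') = (r y' (inv\<^bsub>G\<^esub> \<one>\<^bsub>G\<^esub>), l \<one>\<^bsub>G\<^esub> x')" using r_facts(1)[OF y(2)] l_facts(1)[OF x(2)] by simp
  then have "(y', x') \<in> qt (y', x')" unfolding qt_eq by (rule image_eqI) simp
  then have "(y', x') \<in> qt (y, x)" by (simp only: eq)
  then show "\<exists>g\<in>carrier G. y' = r y (inv\<^bsub>G\<^esub> g) \<and> x' = l g x" unfolding qt_eq by auto
next
  assume "\<exists>g\<in>carrier G. y' = r y (inv\<^bsub>G\<^esub> g) \<and> x' = l g x"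
  then obtain g where g: "g \<in> carrier G" "y' = r y (inv\<^bsub>G\<^esub> g)" "x' = l g x" by blast
  have *: "(r y' (inv\<^bsub>G\<^esub> h), l h x') = (r y (inv\<^bsub>G\<^esub> (h \<otimes>\<^bsub>G\<^esub> g)), l (h \<otimes>\<^bsub>G\<^esub> g) x)" if h: "h \<in> carrier G" for h
    using r_facts(3)[OF y(1), of "inv\<^bsub>G\<^esub> g" "inv\<^bsub>G\<^esub> h"] l_facts(3)[OF x(1) h g(1)] g h
    by (simp add: inv_mult_group)
  show "qt (y, x) = qt (y', x')"
    unfolding qt_eq
  proof (intro equalityI subsetI)
    fix w assume "w \<in> (\<lambda>g. (r y (inv\<^bsub>G\<^esub> g), l g x)) ` carrier G"
    then obtain k where k: "k \<in> carrier G" "w = (r y (inv\<^bsub>G\<^esub> k), l k x)" by blast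
    have "(k \<otimes>\<^bsub>G\<^esub> inv\<^bsub>G\<^esub> g) \<otimes>\<^bsub>G\<^esub> g = k" using k(1) g(1) by (simp add: m_assoc)
    then have "w = (r y' (inv\<^bsub>G\<^esub> (k \<otimes>\<^bsub>G\<^esub> inv\<^bsub>G\<^esub> g)), l (k \<otimes>\<^bsub>G\<^esub> inv\<^bsub>G\<^esub> g) x')"
      using *[of "k \<otimes>\<^bsub>G\<^esub> inv\<^bsub>G\<^esub> g"] k g(1) by simp
    then show "w \<in> (\<lambda>g. (r y' (inv\<^bsub>G\<^esub> g), l g x')) ` carrier G" by (rule image_eqI) (use k g in simp)
  next
    fix w assume "w \<in> (\<lambda>g. (r y' (inv\<^bsub>G\<^esub> g), l g x')) ` carrier G"
    then obtain h where h: "h \<in> carrier G" "w = (r y' (inv\<^bsub>G\<^esub> h), l h x')" by blast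
    show "w \<in> (\<lambda>g. (r y (inv\<^bsub>G\<^esub> g), l g x)) ` carrier G"
      unfolding h(2) *[OF h(1)] by (rule image_eqI[OF refl]) (use h g in simp)
  qed
qed

lemma qt_move:
  assumes "y \<in> points P" "x \<in> points X" "g \<in> carrier G"
  shows "qt (r y g, x) = qt (y, l g x)"
proof -
  have "y = r (r y g) (inv\<^bsub>G\<^esub> g)" using r_facts(1,3)[OF assms(1)] assms(3) by simp
  then show ?thesis
    using assms r_facts(2) l_facts(2) by (subst qt_iff) auto
qed

lemma p\<Sigma>_qt:
  assumes "y \<in> points P" "x \<in> points X"
  shows "p\<Sigma> (qt (y, x)) = p y"
proof -
  have "(\<lambda>(y, x). p y) ` qt (y, x) = {p y}"
    unfolding qt_eq using r_facts(4)[OF assms(1)] by (auto simp: image_iff) (rule exI, rule one_closed)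
  then show ?thesis by (simp add: assoc_proj_def)
qed

text \<open>The fibre component of \<open>[y, x]\<close> in a trivialization, namely
  \<open>l (\<gamma> y) x\<close>. Replacing \<open>(y, x)\<close> by \<open>(y g^{-1}, g x)\<close>
  does not change it, so the image of an orbit is a singleton from which the value is
  extracted.\<close>

definition fibre_coord :: "('p \<Rightarrow> 'g) \<Rightarrow> ('p \<times> 'x) set \<Rightarrow> 'x" where
  "fibre_coord \<gamma> z = the_elem ((\<lambda>(y, x). l (\<gamma> y) x) ` z)"

lemma fibre_coord_qt:
  assumes t: "trivialization U s \<gamma>" and y: "y \<in> points P" "p y \<in> U" and x: "x \<in> points X"
  shows "fibre_coord \<gamma> (qt (y, x)) = l (\<gamma> y) x"
proof -
  note gy = trivializationD(6)[OF t y]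
  have "l (\<gamma> (r y (inv\<^bsub>G\<^esub> g))) (l g x) = l (\<gamma> y) x" if g: "g \<in> carrier G" for g
    using trivializationD(8)[OF t y, of "inv\<^bsub>G\<^esub> g"] l_facts(3)[OF x, of "\<gamma> y \<otimes>\<^bsub>G\<^esub> inv\<^bsub>G\<^esub> g" g] g gy
    by (simp add: m_assoc)
  then have "(\<lambda>(y, x). l (\<gamma> y) x) ` qt (y, x) = {l (\<gamma> y) x}"
    unfolding qt_eq by (auto simp: image_iff) (rule exI, rule one_closed)
  then show ?thesis by (simp add: fibre_coord_def)
qed

text \<open>The group element \<open>\<gamma> y\<close> is moved across the pair. Each class over
  \<open>U\<close> thereby gets a representative on the section, so base point and fibre component
  determine the class.\<close>

lemma qt_normal:
  assumes t: "trivialization U s \<gamma>" and y: "y \<in> points P" "p y \<in> U" and x: "x \<in> points X"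
  shows "qt (s (p y), l (\<gamma> y) x) = qt (y, x)"
  using qt_move[OF trivializationD(4)[OF t y(2)] x trivializationD(6)[OF t y]] trivializationD(7)[OF t y] by simp

lemma qt_inject:
  assumes t: "trivialization U s \<gamma>" and y: "y \<in> points P" "p y \<in> U" "y' \<in> points P" and x: "x \<in> points X" "x' \<in> points X"
    and eq: "p y = p y'" "l (\<gamma> y) x = l (\<gamma> y') x'"
  shows "qt (y, x) = qt (y', x')"
  using qt_normal[OF t y(1,2) x(1)] qt_normal[OF t y(3) _ x(2)] eq y(2) by simp

lemma fst_smooth: "z \<in> points PX \<Longrightarrow> smooth_at PX P fst z"
  and snd_smooth: "z \<in> points PX \<Longrightarrow> smooth_at PX X snd z"
  by (fact fst_smooth_at[OF P X] snd_smooth_at[OF P X])+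

lemma p_fst_smooth: "z \<in> points PX \<Longrightarrow> smooth_at PX M (\<lambda>z. p (fst z)) z"
  by (rule smooth_at_compose[OF fst_smooth p_smooth_at]) (auto simp: points_PX)

lemma fibre_smooth:
  assumes t: "trivialization U s \<gamma>" and z: "z \<in> points PX" "p (fst z) \<in> U"
  shows "smooth_at PX X (\<lambda>z. l (\<gamma> (fst z)) (snd z)) z"
proof -
  have y: "fst z \<in> points P" using z(1) by (auto simp: points_PX)
  show ?thesis
    by (rule l_smooth_at[OF PX smooth_at_compose[OF fst_smooth[OF z(1)] trivializationD(5)[OF t y z(2)]] snd_smooth[OF z(1)]])
qed

text \<open>The preimage under the quotient map is cut out by the smooth maps
  \<open>p \<circ> fst\<close> and \<open>(y, x) \<mapsto> l (\<gamma> y) x\<close>. Sets of this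
  form separate points of \<Sigma> and serve as chart domains.\<close>

lemma openin_quotient:
  assumes t: "trivialization U s \<gamma>" and A: "openin (mtop M) A" "A \<subseteq> U" and B: "openin (mtop X) B"
  shows "openin (quotient_top PX qt) {\<sigma> \<in> qt ` points PX. p\<Sigma> \<sigma> \<in> A \<and> fibre_coord \<gamma> \<sigma> \<in> B}"
proof -
  define D where "D = {z \<in> points PX. p (fst z) \<in> A}"
  have D: "openin (mtop PX) D" unfolding D_def by (rule smooth_at_preimage_open[OF openin_topspace p_fst_smooth A(1)])
  have *: "openin (mtop PX) {z \<in> D. l (\<gamma> (fst z)) (snd z) \<in> B}"
    by (rule smooth_at_preimage_open[OF D fibre_smooth[OF t] B]) (use A(2) in \<open>auto simp: D_def\<close>)
  have "{z \<in> points PX. qt z \<in> {\<sigma> \<in> qt ` points PX. p\<Sigma> \<sigma> \<in> A \<and> fibre_coord \<gamma> \<sigma> \<in> B}} =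
      {z \<in> D. l (\<gamma> (fst z)) (snd z) \<in> B}"
  proof (rule Set.set_eqI)
    fix z
    show "z \<in> {z \<in> points PX. qt z \<in> {\<sigma> \<in> qt ` points PX. p\<Sigma> \<sigma> \<in> A \<and> fibre_coord \<gamma> \<sigma> \<in> B}} \<longleftrightarrow>
      z \<in> {z \<in> D. l (\<gamma> (fst z)) (snd z) \<in> B}"
    proof (cases "z \<in> points PX")
      case True
      then obtain y x where z: "z = (y, x)" "y \<in> points P" "x \<in> points X" by (auto simp: points_PX)
      show ?thesis
        using True A(2) fibre_coord_qt[OF t z(2) _ z(3)] by (auto simp: D_def z(1) p\<Sigma>_qt[OF z(2,3)])
    qed (auto simp: D_def)
  qed
  then show ?thesis using * by (simp add: openin_quotient_top) 
qed

lemma openin_quotient_base: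
  assumes A: "openin (mtop M) A"
  shows "openin (quotient_top PX qt) {\<sigma> \<in> qt ` points PX. p\<Sigma> \<sigma> \<in> A}"
proof -
  have "openin (mtop PX) {z \<in> points PX. p (fst z) \<in> A}" by (rule smooth_at_preimage_open[OF openin_topspace p_fst_smooth A])
  moreover have "{z \<in> points PX. qt z \<in> {\<sigma> \<in> qt ` points PX. p\<Sigma> \<sigma> \<in> A}} = {z \<in> points PX. p (fst z) \<in> A}"
    using p\<Sigma>_qt by (auto simp: points_PX)
  ultimately show ?thesis by (simp add: openin_quotient_top)
qed

text \<open>Points over different base points are separated already in \<open>M\<close>. Points over
  the same base point have different fibre components in a common trivialization and are separated
  in \<open>X\<close>.\<close>

lemma Hausdorff_quotient: "Hausdorff_space (quotient_top PX qt)"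
  unfolding Hausdorff_space_def topspace_quotient_top
proof (intro allI impI; elim conjE)
  fix \<sigma> \<sigma>' assume "\<sigma> \<in> qt ` points PX" "\<sigma>' \<in> qt ` points PX" and ne: "\<sigma> \<noteq> \<sigma>'"
  then obtain y x y' x' where z: "\<sigma> = qt (y, x)" "y \<in> points P" "x \<in> points X"
    "\<sigma>' = qt (y', x')" "y' \<in> points P" "x' \<in> points X" by (auto simp: points_PX)
  have HM: "Hausdorff_space (mtop M)" and HX: "Hausdorff_space (mtop X)" using M X by (auto simp: smooth_manifold_def)
  have in\<Sigma>: "\<sigma> \<in> qt ` points PX" "\<sigma>' \<in> qt ` points PX" using z by (auto simp: points_PX)
  show "\<exists>A B. openin (quotient_top PX qt) A \<and> openin (quotient_top PX qt) B \<and> \<sigma> \<in> A \<and> \<sigma>' \<in> B \<and> disjnt A B"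
  proof (cases "p y = p y'")
    case False
    then obtain A B where AB: "openin (mtop M) A" "openin (mtop M) B" "p y \<in> A" "p y' \<in> B" "disjnt A B"
      using HM p_points[OF z(2)] p_points[OF z(5)] unfolding Hausdorff_space_def by metis
    show ?thesis
    proof (intro exI conjI)
      show "openin (quotient_top PX qt) {\<sigma> \<in> qt ` points PX. p\<Sigma> \<sigma> \<in> A}"
        "openin (quotient_top PX qt) {\<sigma> \<in> qt ` points PX. p\<Sigma> \<sigma> \<in> B}"
        by (rule openin_quotient_base[OF AB(1)], rule openin_quotient_base[OF AB(2)])
      show "\<sigma> \<in> {\<sigma> \<in> qt ` points PX. p\<Sigma> \<sigma> \<in> A}" "\<sigma>' \<in> {\<sigma> \<in> qt ` points PX. p\<Sigma> \<sigma> \<in> B}"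
        using in\<Sigma> AB(3,4) z p\<Sigma>_qt by auto
    qed (use AB(5) in \<open>auto simp: disjnt_iff\<close>)
  next
    case True
    obtain U s \<gamma> where t: "trivialization U s \<gamma>" "p y \<in> U" by (rule trivialization_at[OF z(2)])
    have U': "p y' \<in> U" using t(2) True by simp
    have "l (\<gamma> y) x \<noteq> l (\<gamma> y') x'" using qt_inject[OF t(1) z(2) t(2) z(5,3,6) True] ne z by auto
    moreover have "l (\<gamma> y) x \<in> points X" "l (\<gamma> y') x' \<in> points X"
      using l_facts(2) trivializationD(6)[OF t(1)] z t(2) U' by auto
    ultimately obtain A B where AB: "openin (mtop X) A" "openin (mtop X) B" "l (\<gamma> y) x \<in> A" "l (\<gamma> y') x' \<in> B" "disjnt A B"
      using HX unfolding Hausdorff_space_def by metis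
    note op = openin_quotient[OF t(1) trivializationD(1)[OF t(1)] order_refl]
    show ?thesis
    proof (intro exI conjI)
      show "openin (quotient_top PX qt) {\<sigma> \<in> qt ` points PX. p\<Sigma> \<sigma> \<in> U \<and> fibre_coord \<gamma> \<sigma> \<in> A}"
        "openin (quotient_top PX qt) {\<sigma> \<in> qt ` points PX. p\<Sigma> \<sigma> \<in> U \<and> fibre_coord \<gamma> \<sigma> \<in> B}"
        by (rule op[OF AB(1)], rule op[OF AB(2)])
      show "\<sigma> \<in> {\<sigma> \<in> qt ` points PX. p\<Sigma> \<sigma> \<in> U \<and> fibre_coord \<gamma> \<sigma> \<in> A}"
        "\<sigma>' \<in> {\<sigma> \<in> qt ` points PX. p\<Sigma> \<sigma> \<in> U \<and> fibre_coord \<gamma> \<sigma> \<in> B}"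
        using in\<Sigma> AB(3,4) t(2) U' z(1,4) p\<Sigma>_qt[OF z(2,3)] p\<Sigma>_qt[OF z(5,6)]
          fibre_coord_qt[OF t(1) z(2) t(2) z(3)] fibre_coord_qt[OF t(1) z(5) U' z(6)] by auto
    qed (use AB(5) in \<open>auto simp: disjnt_iff\<close>)
  qed
qed

lemma mdim_\<Sigma>: "mdim \<Sigma> = mdim P + mdim X - mdim Gm"
  unfolding assoc_bundle_def by (simp only: quotient_manifold_simps)

lemma mdim_\<Sigma>': "points P \<noteq> {} \<Longrightarrow> mdim \<Sigma> = mdim X + mdim M"
  using mdim_P by (simp add: mdim_\<Sigma>)

text \<open>The fibre coordinates come first and the base coordinates are centred, so that these charts are
  slice charts of the fibre through the given point.\<close>

lemma bundle_chart:
  assumes y0: "y0 \<in> points P" and x0: "x0 \<in> points X"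
  obtains U \<phi> \<tau> where "quotient_chart PX qt (mdim P + mdim X - mdim Gm) U \<phi> \<tau>"
    "qt (y0, x0) \<in> U" "\<tau> (\<phi> (qt (y0, x0))) = (y0, x0)"
    "\<forall>\<sigma>\<in>U. p\<Sigma> \<sigma> = p y0 \<longleftrightarrow> \<phi> \<sigma> \<in> E (mdim X)"
proof -
  define k m where "k = mdim X" and "m = mdim M"
  \<comment> \<open>The difference of natural numbers is a true one only by \<open>mdim_P\<close>,
    which applies because \<open>y0\<close> shows that \<open>P\<close> is nonempty.\<close>
  have n: "mdim P + mdim X - mdim Gm = k + m" using mdim_P y0 by (force simp: k_def m_def)
  obtain U s \<gamma> where t: "trivialization U s \<gamma>" "p y0 \<in> U" "s (p y0) = y0" "\<gamma> y0 = \<one>\<^bsub>G\<^esub>" by (rule trivialization_at[OF y0])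
  obtain A \<alpha> \<tau>A where A: "local_coords M A \<alpha> \<tau>A" "A \<subseteq> U" "p y0 \<in> A" "\<alpha> (p y0) = (\<lambda>_. 0)"
    by (rule centred_coords[OF M trivializationD(1)[OF t(1)] t(2)])
  obtain B \<beta> \<tau>B where B: "local_coords X B \<beta> \<tau>B" "x0 \<in> B" by (rule centred_coords[OF X openin_topspace x0])
  note AD = local_coordsD[OF A(1), folded m_def] and BD = local_coordsD[OF B(1), folded k_def]
  have AE: "\<alpha> a \<in> E m" if "a \<in> A" for a using smooth_at_points(2)[OF AD(3)[OF that]] by simp
  have BE: "\<beta> b \<in> E k" if "b \<in> B" for b using smooth_at_points(2)[OF BD(3)[OF that]] by simp
  define V where "V = {\<sigma> \<in> qt ` points PX. p\<Sigma> \<sigma> \<in> A \<and> fibre_coord \<gamma> \<sigma> \<in> B}"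
  define \<phi> where "\<phi> \<sigma> = join_coords k (\<beta> (fibre_coord \<gamma> \<sigma>)) (\<alpha> (p\<Sigma> \<sigma>))" for \<sigma>
  define \<tau> where "\<tau> u = (s (\<tau>A (hi k u)), \<tau>B (lo k u))" for u
  have V: "openin (quotient_top PX qt) V" unfolding V_def by (rule openin_quotient[OF t(1) AD(1) A(2) BD(1)])
  have qV: "qt (y, x) \<in> V \<longleftrightarrow> p y \<in> A \<and> l (\<gamma> y) x \<in> B" if "y \<in> points P" "x \<in> points X" for y x
    using that A(2) fibre_coord_qt[OF t(1) that(1) _ that(2)] by (auto simp: V_def p\<Sigma>_qt points_PX)
  have q\<phi>: "\<phi> (qt (y, x)) = join_coords k (\<beta> (l (\<gamma> y) x)) (\<alpha> (p y))" if "y \<in> points P" "x \<in> points X" "p y \<in> A" for y x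
    using that A(2) fibre_coord_qt[OF t(1) that(1) _ that(2)] by (auto simp: \<phi>_def p\<Sigma>_qt)
  have \<phi>lo: "lo k (\<phi> \<sigma>) = \<beta> (fibre_coord \<gamma> \<sigma>)" and \<phi>hi: "hi k (\<phi> \<sigma>) = \<alpha> (p\<Sigma> \<sigma>)" and \<phi>E: "\<phi> \<sigma> \<in> E (k + m)" if "\<sigma> \<in> V" for \<sigma>
    using that AE BE by (auto simp: \<phi>_def V_def lo_join hi_join join_E)
  have im: "\<phi> ` V = {u \<in> E (k + m). lo k u \<in> \<beta> ` B \<and> hi k u \<in> \<alpha> ` A}"
  proof (intro equalityI subsetI)
    fix u assume "u \<in> {u \<in> E (k + m). lo k u \<in> \<beta> ` B \<and> hi k u \<in> \<alpha> ` A}"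
    then obtain a b where ab: "a \<in> A" "b \<in> B" "lo k u = \<beta> b" "hi k u = \<alpha> a" by auto
    have sa: "s a \<in> points P" "p (s a) = a" "\<gamma> (s a) = \<one>\<^bsub>G\<^esub>"
      using trivializationD(3,4)[OF t(1)] trivialization_section[OF t(1)] ab(1) A(2) by auto
    have bX: "b \<in> points X" using ab(2) openin_subset[OF BD(1)] by blast
    have "qt (s a, b) \<in> V" using qV[OF sa(1) bX] sa ab l_facts(1)[OF bX] by simp
    moreover have "\<phi> (qt (s a, b)) = u"
      using q\<phi>[OF sa(1) bX] sa ab l_facts(1)[OF bX] join_lo_hi[of k u] by simp
    ultimately show "u \<in> \<phi> ` V" by blast
  qed (use \<phi>lo \<phi>hi \<phi>E in \<open>auto simp: V_def\<close>)
  show thesis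
  proof (rule that)
    show "quotient_chart PX qt (mdim P + mdim X - mdim Gm) V \<phi> \<tau>"
      unfolding n quotient_chart_def
    proof (intro conjI ballI impI V)
      have "openin (Euclidean_space (k + m)) {u \<in> E (k + m). lo k u \<in> \<beta> ` B}"
        "openin (Euclidean_space (k + m)) {u \<in> E (k + m). hi k u \<in> \<alpha> ` A}"
        by (rule openin_continuous_map_preimage[OF continuous_map_lo BD(2)],
            rule openin_continuous_map_preimage[OF continuous_map_hi AD(2)])
      from openin_Int[OF this] show "openin (Euclidean_space (k + m)) (\<phi> ` V)"
        unfolding im by (rule back_subst[of "openin _"]) auto
    next
      fix z assume z: "z \<in> points PX" "qt z \<in> V"
      obtain y x where yx: "z = (y, x)" "y \<in> points P" "x \<in> points X" using z(1) by (auto simp: points_PX)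
      have AB: "p y \<in> A" "l (\<gamma> y) x \<in> B" using qV[OF yx(2,3)] z(2) yx(1) by auto
      have opV: "openin (mtop PX) {z \<in> points PX. qt z \<in> V}" using V by (simp add: openin_quotient_top)
      have zU: "p (fst z) \<in> U" using AB A(2) yx by auto
      have 1: "smooth_at PX (euclid k) (\<lambda>z. \<beta> (l (\<gamma> (fst z)) (snd z))) z"
        by (rule smooth_at_compose[OF fibre_smooth[OF t(1) z(1) zU] BD(3)]) (use AB yx in simp)
      have 2: "smooth_at PX (euclid m) (\<lambda>z. \<alpha> (p (fst z))) z"
        by (rule smooth_at_compose[OF p_fst_smooth[OF z(1)] AD(3)]) (use AB yx in simp)
      have near: "p (fst w) \<in> A \<and> l (\<gamma> (fst w)) (snd w) \<in> B" if "w \<in> {z \<in> points PX. qt z \<in> V}" for w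
        using that qV[of "fst w" "snd w"] by (auto simp: points_PX)
      have "smooth_at PX (euclid (k + m)) (\<lambda>z. join_coords k (\<beta> (l (\<gamma> (fst z)) (snd z))) (\<alpha> (p (fst z)))) z"
        by (rule join_smooth_at[OF PX 1 2 opV]) (use z near AE BE in auto)
      then show "smooth_at PX (euclid (k + m)) (\<lambda>z. \<phi> (qt z)) z"
        by (rule smooth_at_cong[OF PX _ opV]) (use z near q\<phi> in \<open>auto simp: points_PX\<close>)
    next
      fix u assume "u \<in> \<phi> ` V"
      then obtain a b where ab: "a \<in> A" "b \<in> B" "lo k u = \<beta> b" "hi k u = \<alpha> a" and uE: "u \<in> E (k + m)" unfolding im by auto
      have 1: "smooth_at (euclid (k + m)) X (\<lambda>u. \<tau>B (lo k u)) u"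
        by (rule smooth_at_compose[OF lo_smooth_at[OF uE]]) (use ab BD(4) in simp)
      have 2: "smooth_at (euclid (k + m)) M (\<lambda>u. \<tau>A (hi k u)) u"
        by (rule smooth_at_compose[OF hi_smooth_at[OF uE]]) (use ab AD(4) in simp)
      have 3: "smooth_at (euclid (k + m)) P (\<lambda>u. s (\<tau>A (hi k u))) u"
        by (rule smooth_at_compose[OF 2 trivializationD(2)[OF t(1)]]) (use ab AD(5) A(2) in auto)
      show "smooth_at (euclid (k + m)) PX \<tau> u"
        unfolding \<tau>_def by (rule pair_smooth_at[OF P X smooth_manifold_euclid 3 1])
    next
      fix \<sigma> assume \<sigma>: "\<sigma> \<in> V"
      then obtain y x where yx: "\<sigma> = qt (y, x)" "y \<in> points P" "x \<in> points X" by (auto simp: V_def points_PX)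
      have AB: "p y \<in> A" "l (\<gamma> y) x \<in> B" using qV[OF yx(2,3)] \<sigma> yx(1) by auto
      have fc: "fibre_coord \<gamma> \<sigma> = l (\<gamma> y) x" using fibre_coord_qt[OF t(1) yx(2) _ yx(3)] AB A(2) yx(1) by auto
      have "\<tau> (\<phi> \<sigma>) = (s (p y), l (\<gamma> y) x)"
        unfolding \<tau>_def \<phi>lo[OF \<sigma>] \<phi>hi[OF \<sigma>] fc using AB AD(5) BD(5) p\<Sigma>_qt[OF yx(2,3)] yx(1) by simp
      then show "qt (\<tau> (\<phi> \<sigma>)) = \<sigma>" using qt_normal[OF t(1) yx(2) _ yx(3)] AB A(2) yx(1) by auto
    qed
    \<comment> \<open>Because the trivialization is normalized at \<open>y0\<close>, the section
      \<tau> passes through \<open>(y0, x0)\<close> itself and not merely through another point of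
      its orbit.\<close>
    have lx: "l (\<gamma> y0) x0 = x0" using t(4) l_facts(1)[OF x0] by simp
    show in_V: "qt (y0, x0) \<in> V" using qV[OF y0 x0] A(3) B(2) lx by simp
    show "\<tau> (\<phi> (qt (y0, x0))) = (y0, x0)"
      unfolding \<tau>_def \<phi>lo[OF in_V] \<phi>hi[OF in_V] fibre_coord_qt[OF t(1) y0 t(2) x0] p\<Sigma>_qt[OF y0 x0] lx
      using AD(5)[OF A(3)] BD(5)[OF B(2)] t(3) by simp
    show "\<forall>\<sigma>\<in>V. p\<Sigma> \<sigma> = p y0 \<longleftrightarrow> \<phi> \<sigma> \<in> E (mdim X)"
    proof
      fix \<sigma> assume \<sigma>: "\<sigma> \<in> V"
      have \<sigma>A: "p\<Sigma> \<sigma> \<in> A" using \<sigma> by (simp add: V_def)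
      have "\<phi> \<sigma> \<in> E k \<longleftrightarrow> hi k (\<phi> \<sigma>) = (\<lambda>_. 0)"
        unfolding E_iff hi_def fun_eq_iff by (metis le_add_diff_inverse2 le_add2)
      also have "\<dots> \<longleftrightarrow> \<alpha> (p\<Sigma> \<sigma>) = \<alpha> (p y0)" unfolding \<phi>hi[OF \<sigma>] A(4) ..
      also have "\<dots> \<longleftrightarrow> p\<Sigma> \<sigma> = p y0" using AD(5)[OF \<sigma>A] AD(5)[OF A(3)] by metis
      finally show "p\<Sigma> \<sigma> = p y0 \<longleftrightarrow> \<phi> \<sigma> \<in> E (mdim X)" by (simp add: k_def)
    qed
  qed
qed

lemma bundle_chart':
  assumes "z \<in> points PX"
  shows "\<exists>U \<phi> \<tau>. quotient_chart PX qt (mdim P + mdim X - mdim Gm) U \<phi> \<tau> \<and> qt z \<in> U \<and> \<tau> (\<phi> (qt z)) = z"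
proof -
  obtain y x where z: "z = (y, x)" "y \<in> points P" "x \<in> points X" using assms by (auto simp: points_PX)
  show ?thesis unfolding z(1) by (rule bundle_chart[OF z(2,3)]) blast
qed

lemma \<Sigma>: "smooth_manifold \<Sigma>" and has_sections_qt: "has_sections PX \<Sigma> qt"
  unfolding assoc_bundle_def
  by (rule smooth_manifold_quotient[OF PX bundle_chart' Hausdorff_quotient] has_sections_quotient[OF PX bundle_chart' Hausdorff_quotient]; assumption)+

lemma points_\<Sigma>: "points \<Sigma> = qt ` points PX"
  unfolding assoc_bundle_def by (simp only: quotient_manifold_simps topspace_quotient_top)

lemma \<Sigma>_E:
  assumes "\<sigma> \<in> points \<Sigma>"
  obtains y x where "y \<in> points P" "x \<in> points X" "\<sigma> = qt (y, x)"
  using assms unfolding points_\<Sigma> points_PX by auto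

lemma qt_smooth_at: "z \<in> points PX \<Longrightarrow> smooth_at PX \<Sigma> qt z"
  by (rule has_sections_smooth_at[OF PX \<Sigma> has_sections_qt])

lemma p\<Sigma>_qt': "z \<in> points PX \<Longrightarrow> p\<Sigma> (qt z) = p (fst z)"
  by (auto simp: points_PX p\<Sigma>_qt)

section \<open>The projection of the associated bundle and invariance along fibres\<close>

lemma p\<Sigma>_smooth_at:
  assumes "\<sigma> \<in> points \<Sigma>"
  shows "smooth_at \<Sigma> M p\<Sigma> \<sigma>"
proof -
  obtain z where z: "z \<in> points PX" "\<sigma> = qt z" using assms unfolding points_\<Sigma> by blast
  have "smooth_at PX M (\<lambda>z. p\<Sigma> (qt z)) z"
    by (rule smooth_at_cong[OF PX p_fst_smooth[OF z(1)] openin_topspace z(1)]) (simp add: p\<Sigma>_qt')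
  then show ?thesis unfolding z(2) by (rule smooth_at_descends[OF PX \<Sigma> has_sections_qt z(1)])
qed

lemma smooth_at_qt_pair:
  assumes K: "smooth_manifold K" and a: "smooth_at K P a z" and b: "smooth_at K X b z"
  shows "smooth_at K \<Sigma> (\<lambda>z. qt (a z, b z)) z"
  using smooth_at_compose[OF pair_smooth_at[OF P X K a b] qt_smooth_at] smooth_at_points(2)[OF pair_smooth_at[OF P X K a b]] by simp

lemma submersion_p\<Sigma>: "submersion \<Sigma> M p\<Sigma>"
proof (rule submersion_local_sections[OF \<Sigma> M p\<Sigma>_smooth_at])
  fix \<sigma> assume "\<sigma> \<in> points \<Sigma>"
  then obtain y x where z: "y \<in> points P" "x \<in> points X" "\<sigma> = qt (y, x)" by (rule \<Sigma>_E)
  obtain U s \<gamma> where t: "trivialization U s \<gamma>" "p y \<in> U" "s (p y) = y" by (rule trivialization_at[OF z(1)])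
  show "\<exists>s W. openin (mtop M) W \<and> p\<Sigma> \<sigma> \<in> W \<and> s (p\<Sigma> \<sigma>) = \<sigma> \<and> (\<forall>w\<in>W. smooth_at M \<Sigma> s w \<and> p\<Sigma> (s w) = w)"
  proof (intro exI[of _ "\<lambda>m. qt (s m, x)"] exI[of _ U] conjI ballI)
    show "p\<Sigma> \<sigma> \<in> U" "qt (s (p\<Sigma> \<sigma>), x) = \<sigma>" using t z p\<Sigma>_qt by auto
    fix m assume m: "m \<in> U"
    note sm = trivializationD(2)[OF t(1) m]
    show "smooth_at M \<Sigma> (\<lambda>m. qt (s m, x)) m"
      by (rule smooth_at_qt_pair[OF M sm smooth_at_const[OF M smooth_at_points(1)[OF sm] z(2)]])
    show "p\<Sigma> (qt (s m, x)) = m" using p\<Sigma>_qt[OF trivializationD(4)[OF t(1) m] z(2)] trivializationD(3)[OF t(1) m] by simp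
  qed (rule trivializationD(1)[OF t(1)])
qed

lemma submersion_fst: "submersion PX P fst"
proof (rule submersion_local_sections[OF PX P fst_smooth])
  fix z assume z: "z \<in> points PX"
  then have yx: "fst z \<in> points P" "snd z \<in> points X" by (auto simp: points_PX)
  show "\<exists>s W. openin (mtop P) W \<and> fst z \<in> W \<and> s (fst z) = z \<and> (\<forall>w\<in>W. smooth_at P PX s w \<and> fst (s w) = w)"
    by (intro exI[of _ "\<lambda>y. (y, snd z)"] exI[of _ "points P"] conjI ballI slice1_smooth_at[OF P X] yx) (use yx in simp_all)
qed

lemma orbit_of_p:
  assumes y: "y \<in> points P" "y' \<in> points P" "p y = p y'"
  obtains g where "g \<in> carrier G" "y' = r y g"
proof -
  obtain U s \<gamma> where t: "trivialization U s \<gamma>" "p y \<in> U" "s (p y) = y" by (rule trivialization_at[OF y(1)])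
  show thesis by (rule that[of "\<gamma> y'"]) (use trivializationD(6,7)[OF t(1) y(2)] t y(3) in simp_all)
qed

lemma fibre_invariant_p:
  assumes "\<forall>g\<in>carrier G. poisson_map P \<pi> P \<pi> (\<lambda>y. r y g)"
  shows "fibre_invariant P M p \<pi>"
proof (rule fibre_invariantI[OF P M p_smooth_at])
  fix y y' assume y: "y \<in> points P" "y' \<in> points P" "p y = p y'"
  obtain g where g: "g \<in> carrier G" "y' = r y g" by (rule orbit_of_p[OF y])
  show "\<exists>F. poisson_map P \<pi> P \<pi> F \<and> F y = y' \<and> (\<forall>w\<in>points P. p (F w) = p w)"
    using assms g r_facts(4) by (intro exI[of _ "\<lambda>y. r y g"]) auto
qed

text \<open>The fibres of the quotient map are the orbits of the diagonal action, and each element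
  acts by a product of two Poisson maps.\<close>

lemma fibre_invariant_qt:
  assumes "\<forall>g\<in>carrier G. poisson_map P \<pi> P \<pi> (\<lambda>y. r y g)" "\<forall>g\<in>carrier G. poisson_map X \<rho> X \<rho> (l g)"
  shows "fibre_invariant PX \<Sigma> qt (prod_bivector P \<pi> X \<rho>)"
proof (rule fibre_invariantI[OF PX \<Sigma> qt_smooth_at])
  fix z z' assume "z \<in> points PX" "z' \<in> points PX" and eq: "qt z = qt z'"
  then obtain y x y' x' where z: "z = (y, x)" "z' = (y', x')" "y \<in> points P" "y' \<in> points P" "x \<in> points X" "x' \<in> points X"
    by (auto simp: points_PX)
  obtain g where g: "g \<in> carrier G" "y' = r y (inv\<^bsub>G\<^esub> g)" "x' = l g x" using eq qt_iff[OF z(3-6)] z(1,2) by auto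
  have g': "inv\<^bsub>G\<^esub> g \<in> carrier G" using g(1) by simp
  show "\<exists>F. poisson_map PX (prod_bivector P \<pi> X \<rho>) PX (prod_bivector P \<pi> X \<rho>) F \<and> F z = z' \<and> (\<forall>w\<in>points PX. qt (F w) = qt w)"
  proof (intro exI[of _ "\<lambda>z. (r (fst z) (inv\<^bsub>G\<^esub> g), l g (snd z))"] conjI ballI)
    show "poisson_map PX (prod_bivector P \<pi> X \<rho>) PX (prod_bivector P \<pi> X \<rho>) (\<lambda>z. (r (fst z) (inv\<^bsub>G\<^esub> g), l g (snd z)))"
      by (rule poisson_map_prod[OF P X assms(1)[rule_format, OF g'] assms(2)[rule_format, OF g(1)]])
    show "(r (fst z) (inv\<^bsub>G\<^esub> g), l g (snd z)) = z'" by (simp add: z(1,2) g)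
    fix w assume "w \<in> points PX"
    then obtain a b where w: "w = (a, b)" "a \<in> points P" "b \<in> points X" by (auto simp: points_PX)
    have "qt (a, b) = qt (r a (inv\<^bsub>G\<^esub> g), l g b)"
      by (subst qt_iff[OF w(2) r_facts(2)[OF w(2) g'] w(3) l_facts(2)[OF w(3) g(1)]]) (use g(1) in blast)
    then show "qt (r (fst w) (inv\<^bsub>G\<^esub> g), l g (snd w)) = qt w" by (simp add: w(1))
  qed
qed

end

section \<open>Orthogonal pencils\<close>

lemma pullback_compose:
  assumes F: "smooth_at M N F x" and N: "smooth_manifold N" and H: "smooth_at N K H (F x)" and K: "smooth_manifold K"
    and M: "smooth_manifold M" and \<xi>: "\<xi> \<in> cotangent_space K (H (F x))"
  shows "pullback M N F x (pullback N K H (F x) \<xi>) = pullback M K (\<lambda>z. H (F z)) x \<xi>"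
proof -
  obtain f where f: "f \<in> germs K (H (F x))" "\<xi> = differential K f (H (F x))"
    by (rule cotangent_differential[OF K smooth_at_points(2)[OF H] \<xi>])
  show ?thesis
    unfolding f(2) pullback_differential[OF H K f(1)] pullback_differential[OF F N smooth_at_germ'[OF H f(1)]]
    by (rule pullback_differential[OF smooth_at_compose[OF F H] K f(1), symmetric])
qed

lemma pullback_apply: "v \<in> tangent_space M x \<Longrightarrow> pullback M N F x \<xi> v = \<xi> (pushforward N F x v)"
  by (simp add: pullback_def)

lemma pushforward_zero: "pushforward N F x (\<lambda>_. 0) = (\<lambda>_. 0)"
  by (auto simp: pushforward_def)

lemma sharp_lin:
  assumes \<pi>: "smooth_bivector M \<pi>" and x: "x \<in> points M" and \<xi>: "\<xi> \<in> cotangent_space M x" and \<eta>: "\<eta> \<in> cotangent_space M x"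
  shows "sharp M \<pi> x (\<lambda>v. a * \<xi> v + b * \<eta> v) = (\<lambda>f. a * sharp M \<pi> x \<xi> f + b * sharp M \<pi> x \<eta> f)"
  by (auto simp: sharp_def smooth_bivectorD(2)[OF \<pi> x \<xi> \<eta> differential_cotangent])

lemma sharp_zero:
  assumes "smooth_bivector M \<pi>" "x \<in> points M"
  shows "sharp M \<pi> x (\<lambda>_. 0) = (\<lambda>_. 0)"
  by (auto simp: sharp_def bivector_zero(1)[OF assms differential_cotangent])

text \<open>Tangent vectors are functions and carry no scalar multiplication by type class; this
  opens general linear algebra to them, in particular left inverses of maps injective on a
  subspace.\<close>

lemma vector_space_fun: "vector_space (\<lambda>(a::real) (v :: 'a \<Rightarrow> real). (\<lambda>f. a * v f))"
  by unfold_locales (auto simp: fun_eq_iff algebra_simps)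

text \<open>If the image of \<open>\<pi>\<^sup>\<sharp>\<close> meets the vertical space trivially, then \<open>p\<^sub>*\<close> is injective on it, so every covector
  agrees on that image with one pulled back from the base.\<close>

lemma horizontal_covector:
  assumes N: "smooth_manifold N" and Q: "smooth_manifold Q" and p: "smooth_at N Q p y"
    and \<pi>: "smooth_bivector N \<pi>" and h: "sharp N \<pi> y ` cotangent_space N y \<inter> vertical N Q p y = {\<lambda>_. 0}"
    and \<xi>: "\<xi> \<in> cotangent_space N y"
  obtains \<mu> where "\<mu> \<in> cotangent_space Q (p y)"
    "\<forall>\<eta>\<in>cotangent_space N y. \<pi> y \<xi> \<eta> = \<pi> y (pullback N Q p y \<mu>) \<eta>"
proof -
  note y = smooth_at_points(1)[OF p]
  define H where "H = sharp N \<pi> y ` cotangent_space N y"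
  define push where "push = pushforward Q p y"
  let ?s = "\<lambda>(a::real) (v :: 'a tangent). (\<lambda>f. a * v f)" and ?t = "\<lambda>(a::real) (v :: 'b tangent). (\<lambda>f. a * v f)"
  interpret VS: vector_space_pair ?s ?t by (intro vector_space_pair.intro vector_space_fun)
  have HT: "v \<in> tangent_space N y" if "v \<in> H" for v
    using that sharp_tangent[OF N \<pi> y] by (auto simp: H_def)
  have Hlin: "(\<lambda>f. a * v f + b * w f) \<in> H" if "v \<in> H" "w \<in> H" for a b v w
  proof -
    obtain \<xi> \<eta> where *: "\<xi> \<in> cotangent_space N y" "\<eta> \<in> cotangent_space N y" "v = sharp N \<pi> y \<xi>" "w = sharp N \<pi> y \<eta>"
      using \<open>v \<in> H\<close> \<open>w \<in> H\<close> unfolding H_def by blast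
    show ?thesis unfolding *(3,4) sharp_lin[OF \<pi> y *(1,2), symmetric] H_def
      by (rule imageI[OF cotangent_lin[OF *(1,2)]])
  qed
  have lin: "Vector_Spaces.linear ?s ?t push"
    unfolding Vector_Spaces.linear_iff
    by (intro conjI vector_space_fun) (auto simp: push_def pushforward_def fun_eq_iff)
  have zH: "(\<lambda>_. 0) \<in> H" using h unfolding H_def[symmetric] by blast
  have sub: "VS.vs1.subspace H"
  proof (rule VS.vs1.subspaceI)
    show "0 \<in> H" using zH by (simp add: zero_fun_def)
    show "v + w \<in> H" if "v \<in> H" "w \<in> H" for v w using Hlin[OF that, of 1 1] by (simp add: plus_fun_def)
    show "(\<lambda>f. c * v f) \<in> H" if "v \<in> H" for c v using Hlin[OF that that, of c 0] by simp
  qed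
  have inj: "inj_on push H"
  proof (rule inj_onI)
    fix v w assume v: "v \<in> H" and w: "w \<in> H" and eq: "push v = push w"
    define d where "d = (\<lambda>f. 1 * v f + (-1) * w f)"
    have d: "d \<in> H" unfolding d_def by (rule Hlin[OF v w])
    have "push d = (\<lambda>f. 1 * push v f + (-1) * push w f)" unfolding push_def d_def by (rule pushforward_lin)
    then have "push d = (\<lambda>_. 0)" by (simp add: eq)
    then have "d \<in> vertical N Q p y" using HT[OF d] by (simp add: vertical_def push_def)
    then have "d = (\<lambda>_. 0)" using d h unfolding H_def[symmetric] by blast
    then show "v = w" by (simp add: d_def fun_eq_iff)
  qed
  \<comment> \<open>A linear left inverse of \<open>push\<close> on \<open>H\<close>, with all
    values in \<open>H\<close> and hence tangent. Then \<open>\<xi> \<circ> g\<close> is a covector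
    on the base whose pull-back agrees with \<xi> on \<open>H\<close>. Agreement there is enough,
    since the value of \<pi> on \<eta> and \<xi> is \<xi> evaluated at the vector
    \<open>sharp\<close> of \<eta>.\<close>
  obtain g where g: "range g \<subseteq> H" "Vector_Spaces.linear ?t ?s g" "\<forall>v\<in>H. g (push v) = v"
    using VS.linear_exists_left_inverse_on[OF lin sub inj] by blast
  have gl: "g (\<lambda>f. a * v f + b * w f) = (\<lambda>f. a * g v f + b * g w f)" for a b v w
  proof -
    have "g ((\<lambda>f. a * v f) + (\<lambda>f. b * w f)) = (\<lambda>f. a * g v f) + (\<lambda>f. b * g w f)"
      using g(2) unfolding Vector_Spaces.linear_iff by simp
    then show ?thesis by (simp add: plus_fun_def)
  qed
  have gT: "g w \<in> tangent_space N y" for w using g(1) HT by blast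
  define \<mu> where "\<mu> w = (if w \<in> tangent_space Q (p y) then \<xi> (g w) else 0)" for w
  show thesis
  proof (rule that)
    show "\<mu> \<in> cotangent_space Q (p y)"
      by (rule cotangentI) (simp_all add: \<mu>_def tangent_lin gl cotangentD(2)[OF \<xi> gT gT])
    then have \<mu>': "pullback N Q p y \<mu> \<in> cotangent_space N y" by (rule pullback_cotangent[OF p Q])
    show "\<forall>\<eta>\<in>cotangent_space N y. \<pi> y \<xi> \<eta> = \<pi> y (pullback N Q p y \<mu>) \<eta>"
    proof
      fix \<eta> assume \<eta>: "\<eta> \<in> cotangent_space N y"
      define v where "v = sharp N \<pi> y \<eta>"
      have v: "v \<in> H" unfolding v_def H_def using \<eta> by blast
      have "pullback N Q p y \<mu> v = \<xi> v"
        using pushforward_tangent[OF p Q HT[OF v]] g(3) v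
        by (simp add: pullback_apply[OF HT[OF v]] \<mu>_def push_def)
      then have "\<pi> y \<eta> (pullback N Q p y \<mu>) = \<pi> y \<eta> \<xi>"
        unfolding v_def cotangent_sharp[OF N \<pi> y \<eta> \<mu>'] cotangent_sharp[OF N \<pi> y \<eta> \<xi>] .
      then show "\<pi> y \<xi> \<eta> = \<pi> y (pullback N Q p y \<mu>) \<eta>"
        using smooth_bivectorD(1)[OF \<pi> y \<xi> \<eta>] smooth_bivectorD(1)[OF \<pi> y \<mu>' \<eta>] by simp
    qed
  qed
qed

lemma smooth_bivector_zero:
  assumes M: "smooth_manifold M"
  shows "smooth_bivector M (\<lambda>_ _ _. 0)"
proof (rule smooth_bivectorI)
  fix W f g assume W: "openin (mtop M) W"
  have "(\<lambda>_. 0) \<in> germs M x" if "x \<in> W" for x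
    by (rule germs_const[OF M]) (use that openin_subset[OF W] in blast)
  then show "smooth_fun_on M W (bracket M (\<lambda>_ _ _. 0) f g)"
    unfolding bracket_def smooth_fun_on_iff_germs[OF M W] by blast
qed simp_all

lemma schouten_commute_zero:
  assumes M: "smooth_manifold M" and \<pi>: "smooth_bivector M \<pi>"
  shows "schouten_commute M \<pi> (\<lambda>_ _ _. 0)"
proof -
  have z: "bracket M (\<lambda>_ _ _. 0) f g = (\<lambda>_. 0)" for f g by (simp add: bracket_def)
  show ?thesis
    unfolding schouten_commute_def schouten_def Let_def z using bracket_const(1)[OF M \<pi>] by simp
qed

section \<open>The commutative square and pencils on the associated bundle\<close>

context principal_action
begin

lemma poisson_submersion_fst:
  assumes \<pi>: "poisson_structure P \<pi>" and \<rho>: "poisson_structure X \<rho>"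
  shows "poisson_submersion PX (prod_bivector P \<pi> X \<rho>) P \<pi> fst"
proof -
  have b: "smooth_bivector P \<pi>" "smooth_bivector X \<rho>" using \<pi> \<rho> by (simp_all add: poisson_structure_def)
  have "poisson_map PX (prod_bivector P \<pi> X \<rho>) P \<pi> fst"
    unfolding poisson_map_iff[OF PX P]
  proof (intro conjI ballI)
    show "smooth_map PX P fst" using submersion_fst by (simp add: submersion_def)
    show "bracket P \<pi> f g (fst z) = bracket PX (prod_bivector P \<pi> X \<rho>) (\<lambda>z. f (fst z)) (\<lambda>z. g (fst z)) z"
      if "z \<in> points PX" "f \<in> germs P (fst z)" "g \<in> germs P (fst z)" for z f g
      by (rule bracket_prod_pure(1)[OF P X b that, symmetric])
  qed
  then show ?thesis
    unfolding poisson_submersion_def poisson_manifold_def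
    using PX P \<pi> poisson_structure_prod[OF P X \<pi> \<rho>] submersion_fst by blast
qed

text \<open>Commutativity of the square: a bracket of functions on \<open>M\<close> is computed on
  \<open>P \<times> X\<close>, reached through \<open>P\<close> by \<open>fst\<close> and through
  \<Sigma> by the quotient map.\<close>

lemma poisson_submersion_p\<Sigma>:
  assumes \<pi>: "poisson_structure P \<pi>" and \<rho>: "poisson_structure X \<rho>"
    and inv: "\<forall>g\<in>carrier G. poisson_map P \<pi> P \<pi> (\<lambda>y. r y g)" "\<forall>g\<in>carrier G. poisson_map X \<rho> X \<rho> (l g)"
  shows "poisson_submersion \<Sigma> (descend PX \<Sigma> qt (prod_bivector P \<pi> X \<rho>)) M (descend P M p \<pi>) p\<Sigma>"
proof -
  note i1 = fibre_invariant_p[OF inv(1)] and i2 = fibre_invariant_qt[OF inv]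
  have b: "smooth_bivector P \<pi>" "smooth_bivector X \<rho>" using \<pi> \<rho> by (simp_all add: poisson_structure_def)
  have "poisson_map \<Sigma> (descend PX \<Sigma> qt (prod_bivector P \<pi> X \<rho>)) M (descend P M p \<pi>) p\<Sigma>"
    unfolding poisson_map_iff[OF \<Sigma> M]
  proof (intro conjI ballI)
    show "smooth_map \<Sigma> M p\<Sigma>" using submersion_p\<Sigma> by (simp add: submersion_def)
    fix \<sigma> f g assume "\<sigma> \<in> points \<Sigma>" and f: "f \<in> germs M (p\<Sigma> \<sigma>)" and g: "g \<in> germs M (p\<Sigma> \<sigma>)"
    then obtain z where z: "z \<in> points PX" "\<sigma> = qt z" unfolding points_\<Sigma> by blast
    have y: "fst z \<in> points P" using z by (auto simp: points_PX)
    have f': "f \<in> germs M (p (fst z))" and g': "g \<in> germs M (p (fst z))" using f g z p\<Sigma>_qt' by auto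
    note s = smooth_at_germ'[OF p\<Sigma>_smooth_at[OF \<open>\<sigma> \<in> points \<Sigma>\<close>]]
    have sf: "(\<lambda>\<sigma>. f (p\<Sigma> \<sigma>)) \<in> germs \<Sigma> (qt z)" and sg: "(\<lambda>\<sigma>. g (p\<Sigma> \<sigma>)) \<in> germs \<Sigma> (qt z)" using s f g z(2) by auto
    have "bracket M (descend P M p \<pi>) f g (p\<Sigma> \<sigma>) = bracket M (descend P M p \<pi>) f g (p (fst z))"
      by (simp add: z(2) p\<Sigma>_qt'[OF z(1)])
    also have "\<dots> = bracket P \<pi> (\<lambda>y. f (p y)) (\<lambda>y. g (p y)) (fst z)"
      by (rule descend_bracket[OF P M has_sections_p i1 y f' g'])
    also have "\<dots> = bracket PX (prod_bivector P \<pi> X \<rho>) (\<lambda>z. f (p (fst z))) (\<lambda>z. g (p (fst z))) z"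
      by (rule bracket_prod_pure(1)[OF P X b z(1), symmetric]; rule smooth_at_germ'[OF p_smooth_at[OF y]]; fact f' g')
    also have "\<dots> = bracket PX (prod_bivector P \<pi> X \<rho>) (\<lambda>z. f (p\<Sigma> (qt z))) (\<lambda>z. g (p\<Sigma> (qt z))) z"
      by (rule bracket_cong[OF PX openin_topspace z(1)]) (simp_all add: p\<Sigma>_qt')
    also have "\<dots> = bracket \<Sigma> (descend PX \<Sigma> qt (prod_bivector P \<pi> X \<rho>)) (\<lambda>\<sigma>. f (p\<Sigma> \<sigma>)) (\<lambda>\<sigma>. g (p\<Sigma> \<sigma>)) \<sigma>"
      unfolding z(2) by (rule descend_bracket[OF PX \<Sigma> has_sections_qt i2 z(1) sf sg, symmetric])
    finally show "bracket M (descend P M p \<pi>) f g (p\<Sigma> \<sigma>) =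
        bracket \<Sigma> (descend PX \<Sigma> qt (prod_bivector P \<pi> X \<rho>)) (\<lambda>\<sigma>. f (p\<Sigma> \<sigma>)) (\<lambda>\<sigma>. g (p\<Sigma> \<sigma>)) \<sigma>" .
  qed
  then show ?thesis
    unfolding poisson_submersion_def poisson_manifold_def
    using \<Sigma> M descend_poisson_structure[OF P M has_sections_p i1 \<pi>]
      descend_poisson_structure[OF PX \<Sigma> has_sections_qt i2 poisson_structure_prod[OF P X \<pi> \<rho>]] submersion_p\<Sigma> by blast
qed

lemma orbit_smooth_at: "y \<in> points P \<Longrightarrow> x \<in> points X \<Longrightarrow> smooth_at P \<Sigma> (\<lambda>y. qt (y, x)) y"
  by (rule smooth_at_qt_pair[OF P smooth_at_id smooth_at_const[OF P]])

lemma fibre_inclusion_smooth_at: "y \<in> points P \<Longrightarrow> x \<in> points X \<Longrightarrow> smooth_at X \<Sigma> (\<lambda>x. qt (y, x)) x"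
  by (rule smooth_at_qt_pair[OF X smooth_at_const[OF X] smooth_at_id])

lemma qt_points: "y \<in> points P \<Longrightarrow> x \<in> points X \<Longrightarrow> qt (y, x) \<in> points \<Sigma>"
  by (auto simp: points_\<Sigma> points_PX)

text \<open>Composing the two slice inclusions of the product with the quotient map gives the orbit
  map \<open>y \<mapsto> [y, x]\<close> and the fibre inclusion \<open>x \<mapsto> [y, x]\<close>.
  The later arguments about \<Sigma> use its bivector in this two-term form.\<close>

lemma descend_qt_apply:
  assumes inv: "\<forall>g\<in>carrier G. poisson_map P \<pi> P \<pi> (\<lambda>y. r y g)" "\<forall>g\<in>carrier G. poisson_map X \<rho> X \<rho> (l g)"
    and y: "y \<in> points P" and x: "x \<in> points X"
    and \<xi>: "\<xi> \<in> cotangent_space \<Sigma> (qt (y, x))" and \<eta>: "\<eta> \<in> cotangent_space \<Sigma> (qt (y, x))"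
  shows "descend PX \<Sigma> qt (prod_bivector P \<pi> X \<rho>) (qt (y, x)) \<xi> \<eta> =
    \<pi> y (pullback P \<Sigma> (\<lambda>y. qt (y, x)) y \<xi>) (pullback P \<Sigma> (\<lambda>y. qt (y, x)) y \<eta>) +
    \<rho> x (pullback X \<Sigma> (\<lambda>x. qt (y, x)) x \<xi>) (pullback X \<Sigma> (\<lambda>x. qt (y, x)) x \<eta>)"
proof -
  have z: "(y, x) \<in> points PX" using x y by (simp add: points_PX)
  note c1 = pullback_compose[OF slice1_smooth_at[OF P X y x] PX qt_smooth_at[OF z] \<Sigma> P]
    and c2 = pullback_compose[OF slice2_smooth_at[OF P X y x] PX qt_smooth_at[OF z] \<Sigma> X]
  show ?thesis
    unfolding descend_apply[OF PX \<Sigma> has_sections_qt fibre_invariant_qt[OF inv] z \<xi> \<eta>]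
    unfolding prod_bivector_def Let_def prod.case c1[OF \<xi>] c1[OF \<eta>] c2[OF \<xi>] c2[OF \<eta>] ..
qed

text \<open>On covectors pulled back from \<open>M\<close> the vertical part contributes nothing, so
  \<pi>H agrees with the invariant \<pi> as soon as one argument is of this kind.
  \<open>horizontal_covector\<close> replaces general arguments by such ones.\<close>

lemma horizontal_invariant:
  assumes \<pi>: "\<forall>g\<in>carrier G. poisson_map P \<pi> P \<pi> (\<lambda>y. r y g)" and H: "smooth_bivector P \<pi>H" and V: "smooth_bivector P \<pi>V"
    and sum: "\<forall>x\<in>points P. \<forall>\<xi>\<in>cotangent_space P x. \<forall>\<eta>\<in>cotangent_space P x. \<pi> x \<xi> \<eta> = \<pi>V x \<xi> \<eta> + \<pi>H x \<xi> \<eta>"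
    and vert: "vertical_bivector P M p \<pi>V"
    and hor: "\<forall>x\<in>points P. sharp P \<pi>H x ` cotangent_space P x \<inter> vertical P M p x = {\<lambda>_. 0}"
    and g: "g \<in> carrier G"
  shows "poisson_map P \<pi>H P \<pi>H (\<lambda>y. r y g)"
  unfolding poisson_map_def
proof (intro conjI ballI)
  note pm = \<pi>[rule_format, OF g, unfolded poisson_map_def]
  show sm: "smooth_map P P (\<lambda>y. r y g)" using pm by blast
  fix y \<xi> \<eta> assume y: "y \<in> points P" and \<xi>: "\<xi> \<in> cotangent_space P (r y g)" and \<eta>: "\<eta> \<in> cotangent_space P (r y g)"
  define y' where "y' = r y g"
  note \<xi> = \<xi>[folded y'_def] and \<eta> = \<eta>[folded y'_def]
  have y': "y' \<in> points P" unfolding y'_def by (rule r_facts(2)[OF y g])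
  have pp: "p y' = p y" unfolding y'_def by (rule r_facts(4)[OF y g])
  have rg: "smooth_at P P (\<lambda>y. r y g) y" using sm y unfolding smooth_map_iff[OF P P] by blast
  define R where "R = pullback P P (\<lambda>y. r y g) y"
  define b b' where "b = pullback P M p y" and "b' = pullback P M p y'"
  have R: "R \<zeta> \<in> cotangent_space P y" if "\<zeta> \<in> cotangent_space P y'" for \<zeta>
    unfolding R_def by (rule pullback_cotangent[OF rg P]) (use that in \<open>simp add: y'_def\<close>)
  have b: "b \<kappa> \<in> cotangent_space P y" and b': "b' \<kappa> \<in> cotangent_space P y'" if "\<kappa> \<in> cotangent_space M (p y)" for \<kappa>
    unfolding b_def b'_def using pullback_cotangent[OF p_smooth_at[OF y] M that]
      pullback_cotangent[OF p_smooth_at[OF y'] M, unfolded pp, OF that] by blast+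
  have Rb: "R (b' \<kappa>) = b \<kappa>" if \<kappa>: "\<kappa> \<in> cotangent_space M (p y)" for \<kappa>
  proof -
    obtain f where f: "f \<in> germs M (p y)" "\<kappa> = differential M f (p y)" by (rule cotangent_differential[OF M p_points[OF y] \<kappa>])
    have 1: "b' \<kappa> = differential P (\<lambda>y. f (p y)) y'"
      unfolding b'_def f(2) using pullback_differential[OF p_smooth_at[OF y'] M, unfolded pp, OF f(1)] .
    have "(\<lambda>y. f (p y)) \<in> germs P y'" using smooth_at_germ'[OF p_smooth_at[OF y'], unfolded pp, OF f(1)] .
    then have "R (b' \<kappa>) = differential P (\<lambda>y. f (p (r y g))) y"
      unfolding 1 R_def y'_def by (rule pullback_differential[OF rg P])
    also have "\<dots> = differential P (\<lambda>y. f (p y)) y"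
      by (rule differential_cong[OF P openin_topspace y]) (simp add: r_facts(4)[OF _ g])
    also have "\<dots> = b \<kappa>" unfolding b_def f(2) by (rule pullback_differential[OF p_smooth_at[OF y] M f(1), symmetric])
    finally show ?thesis .
  qed
  \<comment> \<open>A covector pulled back from the base vanishes on vertical vectors, so the
    vertical bivector does not distinguish it from \<open>0\<close>.\<close>
  have V0: "\<pi>V w (pullback P M p w \<kappa>) \<zeta> = 0"
    if w: "w \<in> points P" and \<kappa>: "\<kappa> \<in> cotangent_space M (p w)" and \<zeta>: "\<zeta> \<in> cotangent_space P w" for w \<kappa> \<zeta>
  proof -
    have "\<pi>V w (pullback P M p w \<kappa>) \<zeta> = \<pi>V w (\<lambda>_. 0) \<zeta>"
      by (rule vert[unfolded vertical_bivector_def, rule_format, OF w pullback_cotangent[OF p_smooth_at[OF w] M \<kappa>] cotangent_zero \<zeta> \<zeta>])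
        (auto simp: vertical_def pullback_def cotangent_zero_vec[OF \<kappa>])
    then show ?thesis using bivector_zero(1)[OF V w \<zeta>] by simp
  qed
  have Hb: "\<pi>H y (b \<kappa>) \<zeta> = \<pi> y (b \<kappa>) \<zeta>" if "\<kappa> \<in> cotangent_space M (p y)" "\<zeta> \<in> cotangent_space P y" for \<kappa> \<zeta>
    using sum[rule_format, OF y b[OF that(1)] that(2)] V0[OF y that] by (simp add: b_def)
  have Hb': "\<pi>H y' (b' \<kappa>) \<zeta> = \<pi> y' (b' \<kappa>) \<zeta>" if "\<kappa> \<in> cotangent_space M (p y)" "\<zeta> \<in> cotangent_space P y'" for \<kappa> \<zeta>
    using sum[rule_format, OF y' b'[OF that(1)] that(2)] V0[OF y' _ that(2), unfolded pp, OF that(1)] by (simp add: b'_def)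
  have \<pi>R: "\<pi> y' \<zeta> \<theta> = \<pi> y (R \<zeta>) (R \<theta>)" if "\<zeta> \<in> cotangent_space P y'" "\<theta> \<in> cotangent_space P y'" for \<zeta> \<theta>
    unfolding R_def y'_def using pm that y unfolding y'_def by blast
  have star: "\<pi>H y' (b' \<kappa>) \<zeta> = \<pi>H y (b \<kappa>) (R \<zeta>)" if \<kappa>: "\<kappa> \<in> cotangent_space M (p y)" and \<zeta>: "\<zeta> \<in> cotangent_space P y'" for \<kappa> \<zeta>
    unfolding Hb'[OF \<kappa> \<zeta>] Hb[OF \<kappa> R[OF \<zeta>]] \<pi>R[OF b'[OF \<kappa>] \<zeta>] Rb[OF \<kappa>] ..
  note sk = smooth_bivectorD(1)[OF H y] and sk' = smooth_bivectorD(1)[OF H y']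
  have star': "\<pi>H y' \<zeta> (b' \<kappa>) = \<pi>H y (R \<zeta>) (b \<kappa>)" if \<kappa>: "\<kappa> \<in> cotangent_space M (p y)" and \<zeta>: "\<zeta> \<in> cotangent_space P y'" for \<kappa> \<zeta>
    using star[OF \<kappa> \<zeta>] sk'[OF \<zeta> b'[OF \<kappa>]] sk[OF R[OF \<zeta>] b[OF \<kappa>]] by simp
  obtain \<sigma> where \<sigma>: "\<sigma> \<in> cotangent_space M (p y)" "\<forall>\<eta>\<in>cotangent_space P y'. \<pi>H y' \<xi> \<eta> = \<pi>H y' (b' \<sigma>) \<eta>"
    using horizontal_covector[OF P M p_smooth_at[OF y'] H hor[rule_format, OF y'] \<xi>] unfolding pp b'_def by blast
  obtain \<nu> where \<nu>: "\<nu> \<in> cotangent_space M (p y)" "\<forall>\<zeta>\<in>cotangent_space P y. \<pi>H y (R \<eta>) \<zeta> = \<pi>H y (b \<nu>) \<zeta>"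
    using horizontal_covector[OF P M p_smooth_at[OF y] H hor[rule_format, OF y] R[OF \<eta>]] unfolding b_def by blast
  \<comment> \<open>The two arguments are replaced at different points, \<xi> at \<open>y'\<close>
    by \<open>b' \<sigma>\<close> and \<open>R \<eta>\<close> at \<open>y\<close> by
    \<open>b \<nu>\<close>. In this order every passage between \<open>y\<close> and
    \<open>y'\<close> has a pulled-back covector in one slot, as \<open>star\<close> and
    \<open>star'\<close> require.\<close>
  have "\<pi>H y (R \<xi>) (R \<eta>) = \<pi>H y (R \<xi>) (b \<nu>)"
    using \<nu>(2) R[OF \<xi>] sk[OF R[OF \<xi>] R[OF \<eta>]] sk[OF R[OF \<xi>] b[OF \<nu>(1)]] by simp
  also have "\<dots> = \<pi>H y' \<xi> (b' \<nu>)" by (rule star'[OF \<nu>(1) \<xi>, symmetric])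
  also have "\<dots> = \<pi>H y' (b' \<sigma>) (b' \<nu>)" using \<sigma>(2) b'[OF \<nu>(1)] by simp
  also have "\<dots> = \<pi>H y (b \<sigma>) (b \<nu>)" using star[OF \<sigma>(1) b'[OF \<nu>(1)]] Rb[OF \<nu>(1)] by simp
  also have "\<dots> = \<pi>H y (b \<sigma>) (R \<eta>)"
    using \<nu>(2) b[OF \<sigma>(1)] sk[OF b[OF \<sigma>(1)] R[OF \<eta>]] sk[OF b[OF \<sigma>(1)] b[OF \<nu>(1)]] by simp
  also have "\<dots> = \<pi>H y' (b' \<sigma>) \<eta>" by (rule star[OF \<sigma>(1) \<eta>, symmetric])
  also have "\<dots> = \<pi>H y' \<xi> \<eta>" using \<sigma>(2) \<eta> by simp
  finally show "\<pi>H (r y g) \<xi> \<eta> = \<pi>H y (pullback P P (\<lambda>y. r y g) y \<xi>) (pullback P P (\<lambda>y. r y g) y \<eta>)"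
    by (simp add: R_def y'_def)
qed

lemma orthogonal_pencil_\<Sigma>:
  assumes \<pi>: "poisson_structure P \<pi>" and \<rho>: "poisson_structure X \<rho>"
    and inv: "\<forall>g\<in>carrier G. poisson_map P \<pi> P \<pi> (\<lambda>y. r y g)" "\<forall>g\<in>carrier G. poisson_map X \<rho> X \<rho> (l g)"
    and pencil: "orthogonal_pencil P \<pi> M (descend P M p \<pi>) p"
  shows "orthogonal_pencil \<Sigma> (descend PX \<Sigma> qt (prod_bivector P \<pi> X \<rho>)) M (descend P M p \<pi>) p\<Sigma>"
proof -
  obtain \<pi>V \<pi>H where VH: "poisson_structure P \<pi>V" "poisson_structure P \<pi>H" "schouten_commute P \<pi>V \<pi>H"
    and sum: "\<forall>x\<in>points P. \<forall>\<xi>\<in>cotangent_space P x. \<forall>\<eta>\<in>cotangent_space P x. \<pi> x \<xi> \<eta> = \<pi>V x \<xi> \<eta> + \<pi>H x \<xi> \<eta>"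
    and vert: "vertical_bivector P M p \<pi>V"
    and hor: "\<forall>x\<in>points P. sharp P \<pi>H x ` cotangent_space P x \<inter> vertical P M p x = {\<lambda>_. 0}"
    using pencil unfolding orthogonal_pencil_def by blast
  have V: "smooth_bivector P \<pi>V" and H: "smooth_bivector P \<pi>H" and \<rho>b: "smooth_bivector X \<rho>"
    using VH \<rho> by (simp_all add: poisson_structure_def)
  \<comment> \<open>The zero bivector on \<open>X\<close>, so that the horizontal summand also
    descends from a product and the same lemmas serve both summands.\<close>
  define Z where "Z = (\<lambda>(_::'x) (_::'x cotangent) (_::'x cotangent). 0::real)"
  have Zb: "smooth_bivector X Z" unfolding Z_def by (rule smooth_bivector_zero[OF X])
  have Z: "poisson_structure X Z"
    unfolding poisson_structure_def using Zb schouten_commute_zero[OF X Zb] by (simp add: Z_def)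
  have invH: "\<forall>g\<in>carrier G. poisson_map P \<pi>H P \<pi>H (\<lambda>y. r y g)"
    using horizontal_invariant[OF inv(1) H V sum vert hor] by blast
  have invV: "\<forall>g\<in>carrier G. poisson_map P \<pi>V P \<pi>V (\<lambda>y. r y g)"
  proof
    fix g assume g: "g \<in> carrier G"
    note h = invH[rule_format, OF g, unfolded poisson_map_def] and q = inv(1)[rule_format, OF g, unfolded poisson_map_def]
    show "poisson_map P \<pi>V P \<pi>V (\<lambda>y. r y g)"
      unfolding poisson_map_def
    proof (intro conjI ballI)
      show sm: "smooth_map P P (\<lambda>y. r y g)" using q by blast
      fix y \<xi> \<eta> assume y: "y \<in> points P" and \<xi>: "\<xi> \<in> cotangent_space P (r y g)" and \<eta>: "\<eta> \<in> cotangent_space P (r y g)"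
      have rg: "smooth_at P P (\<lambda>y. r y g) y" using sm y unfolding smooth_map_iff[OF P P] by blast
      note R = pullback_cotangent[OF rg P]
      show "\<pi>V (r y g) \<xi> \<eta> = \<pi>V y (pullback P P (\<lambda>y. r y g) y \<xi>) (pullback P P (\<lambda>y. r y g) y \<eta>)"
        using h[THEN conjunct2, rule_format, OF y \<xi> \<eta>] q[THEN conjunct2, rule_format, OF y \<xi> \<eta>]
          sum[rule_format, OF r_facts(2)[OF y g] \<xi> \<eta>] sum[rule_format, OF y R[OF \<xi>] R[OF \<eta>]] by linarith
    qed
  qed
  have invZ: "\<forall>g\<in>carrier G. poisson_map X Z X Z (l g)"
    using inv(2) unfolding poisson_map_def by (simp add: Z_def)
  define A where "A = descend PX \<Sigma> qt (prod_bivector P \<pi>V X \<rho>)"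
  define B where "B = descend PX \<Sigma> qt (prod_bivector P \<pi>H X Z)"
  note iA = fibre_invariant_qt[OF invV inv(2)] and iB = fibre_invariant_qt[OF invH invZ]
  have cA: "poisson_structure \<Sigma> A" unfolding A_def
    by (rule descend_poisson_structure[OF PX \<Sigma> has_sections_qt iA poisson_structure_prod[OF P X VH(1) \<rho>]])
  have cB: "poisson_structure \<Sigma> B" unfolding B_def
    by (rule descend_poisson_structure[OF PX \<Sigma> has_sections_qt iB poisson_structure_prod[OF P X VH(2) Z]])
  have cAB: "schouten_commute \<Sigma> A B" unfolding A_def B_def
    by (rule descend_schouten_commute[OF PX \<Sigma> has_sections_qt iA smooth_bivector_prod[OF P X V \<rho>b] iB smooth_bivector_prod[OF P X H Zb]
          schouten_commute_prod[OF P X V \<rho>b H Zb VH(3)]])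
      (unfold Z_def, rule schouten_commute_zero[OF X \<rho>b])
  have Bb: "smooth_bivector \<Sigma> B" using cB by (simp add: poisson_structure_def)
  note pa = pullback_cotangent[OF orbit_smooth_at \<Sigma>]
  have summ: "descend PX \<Sigma> qt (prod_bivector P \<pi> X \<rho>) \<sigma> \<xi> \<eta> = A \<sigma> \<xi> \<eta> + B \<sigma> \<xi> \<eta>"
    if \<sigma>: "\<sigma> \<in> points \<Sigma>" and \<xi>: "\<xi> \<in> cotangent_space \<Sigma> \<sigma>" and \<eta>: "\<eta> \<in> cotangent_space \<Sigma> \<sigma>" for \<sigma> \<xi> \<eta>
  proof -
    obtain y x where z: "y \<in> points P" "x \<in> points X" "\<sigma> = qt (y, x)" by (rule \<Sigma>_E[OF \<sigma>])
    note \<xi>' = \<xi>[unfolded z(3)] and \<eta>' = \<eta>[unfolded z(3)]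
    show ?thesis
      unfolding z(3) A_def B_def descend_qt_apply[OF inv z(1,2) \<xi>' \<eta>'] descend_qt_apply[OF invV inv(2) z(1,2) \<xi>' \<eta>']
        descend_qt_apply[OF invH invZ z(1,2) \<xi>' \<eta>']
      using sum[rule_format, OF z(1) pa[OF z(1,2) \<xi>'] pa[OF z(1,2) \<eta>']] by (simp add: Z_def)
  qed
  \<comment> \<open>The orbit map covers the identity of \<open>M\<close>, so it carries vertical
    vectors to vertical ones and detects verticality.\<close>
  have p\<Sigma>_orbit: "pushforward M p\<Sigma> (qt (y, x)) (pushforward \<Sigma> (\<lambda>y. qt (y, x)) y v) = pushforward M p y v"
    if y: "y \<in> points P" and x: "x \<in> points X" and v: "v \<in> tangent_space P y" for y x v
  proof (rule ext)
    fix f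
    show "pushforward M p\<Sigma> (qt (y, x)) (pushforward \<Sigma> (\<lambda>y. qt (y, x)) y v) f = pushforward M p y v f"
    proof (cases "f \<in> germs M (p y)")
      case True
      then have f': "f \<in> germs M (p\<Sigma> (qt (y, x)))" by (simp add: p\<Sigma>_qt[OF y x])
      have "v (\<lambda>y. f (p\<Sigma> (qt (y, x)))) = v (\<lambda>y. f (p y))"
        by (rule tangent_germ_eq[OF P v openin_topspace y]) (simp add: p\<Sigma>_qt x)
      then show ?thesis
        using smooth_at_germ'[OF p\<Sigma>_smooth_at[OF qt_points[OF y x]] f'] True f' by (simp add: pushforward_apply)
    qed (simp add: pushforward_def p\<Sigma>_qt[OF y x])
  qed
  \<comment> \<open>The fibre inclusion followed by the projection is constant, so all its tangent
    vectors are vertical; this puts the contribution of \<rho> into the vertical summand.\<close>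
  have p\<Sigma>_fibre: "pushforward M p\<Sigma> (qt (y, x)) (pushforward \<Sigma> (\<lambda>x. qt (y, x)) x v) = (\<lambda>_. 0)"
    if y: "y \<in> points P" and x: "x \<in> points X" and v: "v \<in> tangent_space X x" for y x v
  proof (rule ext)
    fix f
    show "pushforward M p\<Sigma> (qt (y, x)) (pushforward \<Sigma> (\<lambda>x. qt (y, x)) x v) f = 0"
    proof (cases "f \<in> germs M (p\<Sigma> (qt (y, x)))")
      case True
      have "v (\<lambda>x. f (p\<Sigma> (qt (y, x)))) = v (\<lambda>x. f (p y))"
        by (rule tangent_germ_eq[OF X v openin_topspace x]) (simp add: p\<Sigma>_qt y)
      then show ?thesis
        using smooth_at_germ'[OF p\<Sigma>_smooth_at[OF qt_points[OF y x]] True] True tangent_const[OF X v x] by (simp add: pushforward_apply)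
    qed (simp add: pushforward_def)
  qed
  have vertA: "vertical_bivector \<Sigma> M p\<Sigma> A"
    unfolding vertical_bivector_def
  proof (intro ballI impI)
    fix \<sigma> \<xi> \<xi>' \<eta> \<eta>' assume \<sigma>: "\<sigma> \<in> points \<Sigma>" and c: "\<xi> \<in> cotangent_space \<Sigma> \<sigma>" "\<xi>' \<in> cotangent_space \<Sigma> \<sigma>"
      "\<eta> \<in> cotangent_space \<Sigma> \<sigma>" "\<eta>' \<in> cotangent_space \<Sigma> \<sigma>"
      and eq: "\<forall>v\<in>vertical \<Sigma> M p\<Sigma> \<sigma>. \<xi> v = \<xi>' v \<and> \<eta> v = \<eta>' v"
    obtain y x where z: "y \<in> points P" "x \<in> points X" "\<sigma> = qt (y, x)" by (rule \<Sigma>_E[OF \<sigma>])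
    note c = c[unfolded z(3)] and eq = eq[unfolded z(3)]
    note os = orbit_smooth_at[OF z(1,2)] and fs = fibre_inclusion_smooth_at[OF z(1,2)]
    have e1: "\<forall>v\<in>vertical P M p y. pullback P \<Sigma> (\<lambda>y. qt (y, x)) y \<xi> v = pullback P \<Sigma> (\<lambda>y. qt (y, x)) y \<xi>' v \<and>
        pullback P \<Sigma> (\<lambda>y. qt (y, x)) y \<eta> v = pullback P \<Sigma> (\<lambda>y. qt (y, x)) y \<eta>' v"
    proof
      fix v assume v: "v \<in> vertical P M p y"
      then have vT: "v \<in> tangent_space P y" and v0: "pushforward M p y v = (\<lambda>_. 0)" by (auto simp: vertical_def)
      have "pushforward \<Sigma> (\<lambda>y. qt (y, x)) y v \<in> vertical \<Sigma> M p\<Sigma> (qt (y, x))"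
        using pushforward_tangent[OF os \<Sigma> vT] p\<Sigma>_orbit[OF z(1,2) vT] v0 by (simp add: vertical_def)
      then show "pullback P \<Sigma> (\<lambda>y. qt (y, x)) y \<xi> v = pullback P \<Sigma> (\<lambda>y. qt (y, x)) y \<xi>' v \<and>
        pullback P \<Sigma> (\<lambda>y. qt (y, x)) y \<eta> v = pullback P \<Sigma> (\<lambda>y. qt (y, x)) y \<eta>' v"
        using eq by (simp add: pullback_apply[OF vT])
    qed
    have e2: "pullback X \<Sigma> (\<lambda>x. qt (y, x)) x \<zeta> = pullback X \<Sigma> (\<lambda>x. qt (y, x)) x \<zeta>'"
      if "\<And>v. v \<in> vertical \<Sigma> M p\<Sigma> (qt (y, x)) \<Longrightarrow> \<zeta> v = \<zeta>' v" for \<zeta> \<zeta>'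
    proof
      fix v
      show "pullback X \<Sigma> (\<lambda>x. qt (y, x)) x \<zeta> v = pullback X \<Sigma> (\<lambda>x. qt (y, x)) x \<zeta>' v"
      proof (cases "v \<in> tangent_space X x")
        case True
        have "pushforward \<Sigma> (\<lambda>x. qt (y, x)) x v \<in> vertical \<Sigma> M p\<Sigma> (qt (y, x))"
          using pushforward_tangent[OF fs \<Sigma> True] p\<Sigma>_fibre[OF z(1,2) True] by (simp add: vertical_def)
        then show ?thesis by (simp add: pullback_apply[OF True] that)
      qed (simp add: pullback_def)
    qed
    have v1: "\<pi>V y (pullback P \<Sigma> (\<lambda>y. qt (y, x)) y \<xi>) (pullback P \<Sigma> (\<lambda>y. qt (y, x)) y \<eta>) =
        \<pi>V y (pullback P \<Sigma> (\<lambda>y. qt (y, x)) y \<xi>') (pullback P \<Sigma> (\<lambda>y. qt (y, x)) y \<eta>')"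
      by (rule vert[unfolded vertical_bivector_def, THEN bspec, OF z(1), THEN bspec, OF pa[OF z(1,2) c(1)], THEN bspec, OF pa[OF z(1,2) c(2)],
            THEN bspec, OF pa[OF z(1,2) c(3)], THEN bspec, OF pa[OF z(1,2) c(4)], THEN mp, OF e1])
    have v2: "pullback X \<Sigma> (\<lambda>x. qt (y, x)) x \<xi> = pullback X \<Sigma> (\<lambda>x. qt (y, x)) x \<xi>'"
      "pullback X \<Sigma> (\<lambda>x. qt (y, x)) x \<eta> = pullback X \<Sigma> (\<lambda>x. qt (y, x)) x \<eta>'"
      by (rule e2, use eq in blast)+
    show "A \<sigma> \<xi> \<eta> = A \<sigma> \<xi>' \<eta>'"
      unfolding A_def z(3) descend_qt_apply[OF invV inv(2) z(1,2) c(1,3)] descend_qt_apply[OF invV inv(2) z(1,2) c(2,4)] v1 v2 ..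
  qed
  \<comment> \<open>With zero on \<open>X\<close>, the image vector under \<open>B\<close> is the
    push-forward along the orbit map of an image vector under \<pi>H. If it is vertical on \<Sigma>,
    the vector on \<open>P\<close> is vertical too, hence zero by the hypothesis on \<pi>H.\<close>
  have horB: "sharp \<Sigma> B \<sigma> ` cotangent_space \<Sigma> \<sigma> \<inter> vertical \<Sigma> M p\<Sigma> \<sigma> = {\<lambda>_. 0}" if \<sigma>: "\<sigma> \<in> points \<Sigma>" for \<sigma>
  proof (intro equalityI subsetI)
    fix u assume "u \<in> sharp \<Sigma> B \<sigma> ` cotangent_space \<Sigma> \<sigma> \<inter> vertical \<Sigma> M p\<Sigma> \<sigma>"
    then obtain \<xi> where \<xi>: "\<xi> \<in> cotangent_space \<Sigma> \<sigma>" "u = sharp \<Sigma> B \<sigma> \<xi>" and u: "u \<in> vertical \<Sigma> M p\<Sigma> \<sigma>" by blast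
    obtain y x where z: "y \<in> points P" "x \<in> points X" "\<sigma> = qt (y, x)" by (rule \<Sigma>_E[OF \<sigma>])
    note \<xi>' = \<xi>(1)[unfolded z(3)] and os = orbit_smooth_at[OF z(1,2)]
    define a where "a = pullback P \<Sigma> (\<lambda>y. qt (y, x)) y \<xi>"
    have a: "a \<in> cotangent_space P y" unfolding a_def by (rule pa[OF z(1,2) \<xi>'])
    define v where "v = sharp P \<pi>H y a"
    have v: "v \<in> tangent_space P y" unfolding v_def by (rule sharp_tangent[OF P H z(1) a])
    have uT: "u \<in> tangent_space \<Sigma> (qt (y, x))" using u by (simp add: vertical_def z(3))
    have uv: "u = pushforward \<Sigma> (\<lambda>y. qt (y, x)) y v"
    proof (rule tangent_eqI[OF uT pushforward_tangent[OF os \<Sigma> v]])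
      fix c assume c: "c \<in> germs \<Sigma> (qt (y, x))"
      have "u c = B (qt (y, x)) \<xi> (differential \<Sigma> c (qt (y, x)))" unfolding \<xi>(2) z(3) by (rule sharp_apply[OF c])
      also have "\<dots> = \<pi>H y a (differential P (\<lambda>y. c (qt (y, x))) y)"
        unfolding B_def descend_qt_apply[OF invH invZ z(1,2) \<xi>' differential_cotangent] a_def[symmetric]
          pullback_differential[OF os \<Sigma> c] by (simp add: Z_def)
      also have "\<dots> = v (\<lambda>y. c (qt (y, x)))" unfolding v_def by (rule sharp_apply[OF smooth_at_germ'[OF os c], symmetric])
      also have "\<dots> = pushforward \<Sigma> (\<lambda>y. qt (y, x)) y v c" by (rule pushforward_apply[symmetric]) (rule c)
      finally show "u c = pushforward \<Sigma> (\<lambda>y. qt (y, x)) y v c" .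
    qed
    have "pushforward M p y v = (\<lambda>_. 0)"
      unfolding p\<Sigma>_orbit[OF z(1,2) v, symmetric] uv[symmetric] using u by (simp add: vertical_def z(3))
    then have "v \<in> sharp P \<pi>H y ` cotangent_space P y \<inter> vertical P M p y" using v a by (auto simp: v_def vertical_def)
    then have "v = (\<lambda>_. 0)" using hor z(1) by blast
    then show "u \<in> {\<lambda>_. 0}" by (simp add: uv pushforward_zero)
  next
    fix u :: "('p \<times> 'x) set tangent" assume "u \<in> {\<lambda>_. 0}"
    then have u: "u = (\<lambda>_. 0)" by simp
    have "u \<in> sharp \<Sigma> B \<sigma> ` cotangent_space \<Sigma> \<sigma>"
      unfolding u using imageI[OF cotangent_zero, of "sharp \<Sigma> B \<sigma>" \<Sigma> \<sigma>] unfolding sharp_zero[OF Bb \<sigma>] .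
    moreover have "u \<in> vertical \<Sigma> M p\<Sigma> \<sigma>" unfolding u by (simp add: vertical_def tangent_zero pushforward_zero)
    ultimately show "u \<in> sharp \<Sigma> B \<sigma> ` cotangent_space \<Sigma> \<sigma> \<inter> vertical \<Sigma> M p\<Sigma> \<sigma>" by blast
  qed
  show ?thesis
    unfolding orthogonal_pencil_def
    using poisson_submersion_p\<Sigma>[OF \<pi> \<rho> inv] cA cB cAB summ vertA horB by blast
qed

end

section \<open>Poisson-Dirac fibres\<close>

lemma pushforward_id: "pushforward M id x = pushforward M (\<lambda>z. z) x"
  and pullback_id: "pullback F M id x = pullback F M (\<lambda>z. z) x"
  by (simp_all add: id_def)

section \<open>Slice charts and embedded submanifolds\<close>

lemma atlas_smooth_charts: "smooth_manifold M \<Longrightarrow> c \<in> atlas M \<Longrightarrow> c \<in> smooth_charts M"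
  unfolding smooth_charts_def using atlas_is_chart atlas_transition by blast

text \<open>Slice charts belong to the maximal atlas, whereas germs are defined through
  \<open>atlas M\<close>. Compatibility with the given charts, in both directions, carries
  smoothness across.\<close>

lemma smooth_chart_local_coords:
  assumes M: "smooth_manifold M" and c: "(U, \<phi>) \<in> smooth_charts M"
  shows "is_chart (mtop M) (mdim M) (U, \<phi>)" "local_coords M U \<phi> (inv_into U \<phi>)"
proof -
  show ch: "is_chart (mtop M) (mdim M) (U, \<phi>)" using c unfolding smooth_charts_def by blast
  have tr: "smooth_transition (mdim M) (U, \<phi>) c'" "smooth_transition (mdim M) c' (U, \<phi>)" if "c' \<in> atlas M" for c'
    using c that unfolding smooth_charts_def by blast+
  have op: "openin (mtop M) U" "openin (Euclidean_space (mdim M)) (\<phi> ` U)" using ch by auto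
  have inj: "inj_on \<phi> U" by (rule chart_continuous(3)[OF ch])
  show "local_coords M U \<phi> (inv_into U \<phi>)"
    unfolding local_coords_def
  proof (intro conjI ballI op)
    fix x assume x: "x \<in> U"
    then have xM: "x \<in> points M" using openin_subset[OF op(1)] by blast
    obtain V \<psi> where d: "(V, \<psi>) \<in> atlas M" "x \<in> V" by (rule chart_at[OF M xM])
    have VU: "openin (mtop M) (V \<inter> U)" using op(1) atlasD(1)[OF M d(1)] by blast
    show "smooth_at M (euclid (mdim M)) \<phi> x"
    proof (rule smooth_at_euclidI[OF M op(1) x])
      show "\<phi> z \<in> E (mdim M)" if "z \<in> U" for z using openE_subset[OF op(2)] that by blast
      show "(\<lambda>z. \<phi> z i) \<in> germs M x" if i: "i < mdim M" for i
        by (rule germ_chartI[OF M d chart_image_open[OF atlas_is_chart[OF M d(1)] op(1)]])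
          (use smooth_transitionD[OF tr(2)[OF d(1)] i] d(2) x in auto)
    qed
    show inv: "inv_into U \<phi> (\<phi> x) = x" using inj x by simp
    show "smooth_at (euclid (mdim M)) M (inv_into U \<phi>) (\<phi> x)"
    proof (rule smooth_atI[where F = "inv_into U \<phi>", OF smooth_manifold_euclid M _ d(1)])
      show "\<phi> x \<in> points (euclid (mdim M))" using openE_subset[OF op(2)] x by auto
      show "inv_into U \<phi> (\<phi> x) \<in> V" using inv d(2) by simp
      show "\<exists>W. openin (mtop (euclid (mdim M))) W \<and> \<phi> x \<in> W \<and> inv_into U \<phi> ` W \<subseteq> O'"
        if O': "openin (mtop M) O'" "inv_into U \<phi> (\<phi> x) \<in> O'" for O'
        using chart_image_open[OF ch O'(1)] O'(2) inv x inj by (intro exI[of _ "\<phi> ` (U \<inter> O')"]) auto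
      show "(\<lambda>z. \<psi> (inv_into U \<phi> z) i) \<in> germs (euclid (mdim M)) (\<phi> x)" if i: "i < mdim M" for i
        by (rule germs_euclid[OF chart_image_open[OF ch atlasD(1)[OF M d(1)]] _ smooth_transitionD[OF tr(1)[OF d(1)] i]])
          (use d(2) x in auto)
    qed
  qed
qed

text \<open>Compatibility is given only with charts of \<open>atlas M\<close>, not between two
  members of the maximal atlas; the transition map is smooth because it factors through
  \<open>M\<close> itself, one point at a time.\<close>

lemma smooth_charts_transition:
  assumes M: "smooth_manifold M" and c: "(U, \<phi>) \<in> smooth_charts M" and d: "(V, \<psi>) \<in> smooth_charts M"
  shows "Cinf_on (mdim M) (\<phi> ` (U \<inter> V)) (\<lambda>u. \<psi> (inv_into U \<phi> u) i)"
proof -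
  note C = smooth_chart_local_coords[OF M c] and D = smooth_chart_local_coords[OF M d]
  have op: "openin (Euclidean_space (mdim M)) (\<phi> ` (U \<inter> V))"
    by (rule chart_image_open[OF C(1) local_coordsD(1)[OF D(2)]])
  show ?thesis
    unfolding smooth_fun_on_euclid[OF op, symmetric]
  proof (subst smooth_fun_on_iff_germs[OF smooth_manifold_euclid])
    show "openin (mtop (euclid (mdim M))) (\<phi> ` (U \<inter> V))" using op by simp
    show "\<forall>u\<in>\<phi> ` (U \<inter> V). (\<lambda>u. \<psi> (inv_into U \<phi> u) i) \<in> germs (euclid (mdim M)) u"
    proof
      fix u assume "u \<in> \<phi> ` (U \<inter> V)"
      then obtain x where x: "x \<in> U" "x \<in> V" "u = \<phi> x" by blast
      have "(\<lambda>z. \<psi> z i) \<in> germs M (inv_into U \<phi> (\<phi> x))"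
        unfolding local_coordsD(5)[OF C(2) x(1)] by (rule smooth_at_euclid_coord[OF local_coordsD(3)[OF D(2) x(2)]])
      from smooth_at_germ'[where F = "inv_into U \<phi>" and x = "\<phi> x", OF local_coordsD(4)[OF C(2) x(1)] this]
      show "(\<lambda>u. \<psi> (inv_into U \<phi> u) i) \<in> germs (euclid (mdim M)) u" by (simp add: x(3))
    qed
  qed
qed

lemma E_mono: "k \<le> n \<Longrightarrow> u \<in> E k \<Longrightarrow> u \<in> E n"
  by (auto simp: E_iff)

lemma E_inclusion_smooth_at:
  assumes "k \<le> n" "u \<in> E k"
  shows "smooth_at (euclid k) (euclid n) (\<lambda>u. u) u"
  by (rule smooth_at_euclidI[OF smooth_manifold_euclid, where W = "E k"])
    (use assms E_mono[OF assms(1)] openin_E_UNIV germs_euclid_coord[OF assms(2)] in auto)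

lemma E_projection_smooth_at:
  assumes "k \<le> n" "u \<in> E n"
  shows "smooth_at (euclid n) (euclid k) (lo k) u"
  using lo_smooth_at[of u k "n - k"] assms by simp

context
  fixes M :: "'a manifold" and k :: nat and S
  assumes M: "smooth_manifold M" and emb: "embedded_submanifold M k S"
begin

lemma sub_simps: "mtop (submanifold M k S) = subtopology (mtop M) S" "mdim (submanifold M k S) = k"
  "points (submanifold M k S) = S"
  "(V, \<phi>) \<in> atlas (submanifold M k S) \<longleftrightarrow> (\<exists>U. V = U \<inter> S \<and> (U, \<phi>) \<in> slice_charts M k S)"
  using emb by (auto simp: submanifold_def embedded_submanifold_def)

lemma sub_dim: "k \<le> mdim M" and sub_points: "S \<subseteq> points M"
  using emb by (auto simp: embedded_submanifold_def)

lemma slice_chart_at: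
  assumes "x \<in> S"
  obtains U \<phi> where "(U, \<phi>) \<in> slice_charts M k S" "x \<in> U"
proof -
  have "x \<in> (\<Union>c\<in>slice_charts M k S. fst c)" using emb assms by (auto simp: embedded_submanifold_def)
  then obtain c where "c \<in> slice_charts M k S" "x \<in> fst c" by blast
  then show thesis using that[of "fst c" "snd c"] by simp
qed

lemma slice_chartD:
  assumes "(U, \<phi>) \<in> slice_charts M k S"
  shows "(U, \<phi>) \<in> smooth_charts M" "\<phi> ` (U \<inter> S) = \<phi> ` U \<inter> E k"
  using assms by (auto simp: slice_charts_def)

lemma slice_inv:
  assumes c: "(U, \<phi>) \<in> slice_charts M k S" and u: "u \<in> \<phi> ` (U \<inter> S)"
  shows "inv_into (U \<inter> S) \<phi> u = inv_into U \<phi> u"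
proof -
  note inj = chart_continuous(3)[OF smooth_chart_local_coords(1)[OF M slice_chartD(1)[OF c]]]
  obtain x where x: "x \<in> U \<inter> S" "u = \<phi> x" using u by blast
  have "inj_on \<phi> (U \<inter> S)" using inj by (rule inj_on_subset) blast
  then show ?thesis using x inj by simp
qed

lemma sub_is_chart:
  assumes c: "(U, \<phi>) \<in> slice_charts M k S"
  shows "is_chart (subtopology (mtop M) S) k (U \<inter> S, \<phi>)"
proof -
  note ch = smooth_chart_local_coords(1)[OF M slice_chartD(1)[OF c]]
  note cc = chart_continuous[OF ch]
  have U: "openin (mtop M) U" and \<phi>U: "openin (Euclidean_space (mdim M)) (\<phi> ` U)" using ch by auto
  have im: "openin (Euclidean_space k) (\<phi> ` (U \<inter> S))"
  proof -
    obtain V where "open V" "\<phi> ` U = E (mdim M) \<inter> V" using \<phi>U unfolding openin_E_iff by blast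
    then show ?thesis unfolding slice_chartD(2)[OF c] openin_E_iff using E_mono[OF sub_dim] by (intro exI[of _ V]) auto
  qed
  have eq: "subtopology (subtopology (mtop M) S) (U \<inter> S) = subtopology (mtop M) (U \<inter> S)"
    by (simp add: subtopology_subtopology Int_absorb1)
  show ?thesis
  proof (rule is_chartI(1)[OF openin_subtopology_Int[OF U] im])
    show "continuous_map (subtopology (subtopology (mtop M) S) (U \<inter> S)) (Euclidean_space k) \<phi>"
      unfolding eq
    proof (rule continuous_map_into_E)
      show "\<phi> x \<in> E k" if "x \<in> topspace (subtopology (mtop M) (U \<inter> S))" for x
        using that slice_chartD(2)[OF c] by auto
      have "continuous_map (subtopology (mtop M) (U \<inter> S)) (Euclidean_space (mdim M)) \<phi>"
        by (rule continuous_map_from_subtopology_mono[OF cc(1)]) blast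
      from continuous_map_compose[OF this continuous_map_coordE]
      show "continuous_map (subtopology (mtop M) (U \<inter> S)) euclideanreal (\<lambda>x. \<phi> x i)" for i by (simp add: comp_def)
    qed
    have sub: "subtopology (Euclidean_space k) (\<phi> ` (U \<inter> S)) = subtopology (Euclidean_space (mdim M)) (\<phi> ` (U \<inter> S))"
      using openE_subset[OF im] E_mono[OF sub_dim] by (simp add: subtopology_E subset_iff)
    have "continuous_map (subtopology (Euclidean_space k) (\<phi> ` (U \<inter> S))) (mtop M) (inv_into U \<phi>)"
      unfolding sub by (rule continuous_map_from_subtopology_mono[OF cc(2)]) blast
    then show "continuous_map (subtopology (Euclidean_space k) (\<phi> ` (U \<inter> S))) (subtopology (mtop M) S) (inv_into U \<phi>)"
      using cc(3) by (auto simp: continuous_map_in_subtopology)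
  qed (use cc(3) in auto)
qed

lemma smooth_manifold_sub: "smooth_manifold (submanifold M k S)"
proof (rule smooth_manifoldI)
  show "Hausdorff_space (mtop (submanifold M k S))" "second_countable (mtop (submanifold M k S))"
    using M by (simp_all add: sub_simps smooth_manifold_def Hausdorff_space_subtopology second_countable_subtopology)
  fix U' \<phi> assume "(U', \<phi>) \<in> atlas (submanifold M k S)"
  then obtain U where c: "U' = U \<inter> S" "(U, \<phi>) \<in> slice_charts M k S" by (auto simp: sub_simps)
  show "is_chart (mtop (submanifold M k S)) (mdim (submanifold M k S)) (U', \<phi>)"
    unfolding sub_simps c(1) by (rule sub_is_chart[OF c(2)])
  fix V' \<psi> i assume "(V', \<psi>) \<in> atlas (submanifold M k S)"
  then obtain V where d: "V' = V \<inter> S" "(V, \<psi>) \<in> slice_charts M k S" by (auto simp: sub_simps)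
  note C = slice_chartD(1)[OF c(2)] and D = slice_chartD(1)[OF d(2)]
  have V: "openin (mtop M) V" by (rule local_coordsD(1)[OF smooth_chart_local_coords(2)[OF M D]])
  have eq: "U' \<inter> V' = (U \<inter> S) \<inter> (V \<inter> S)" unfolding c d by blast
  have op: "openin (Euclidean_space k) (\<phi> ` (U' \<inter> V'))"
    unfolding eq by (rule chart_image_open[OF sub_is_chart[OF c(2)] openin_subtopology_Int[OF V]])
  note op' = chart_image_open[OF smooth_chart_local_coords(1)[OF M C] V]
  have "Cinf_on k (\<phi> ` (U' \<inter> V')) (\<lambda>u. \<psi> (inv_into U \<phi> u) i)"
    by (rule Cinf_on_compose[where g = "\<lambda>u. u", OF op op' _ _ smooth_charts_transition[OF M C D]])
      (use Cinf_on_coord[OF openE_subset[OF op]] in \<open>auto simp: c(1) d(1)\<close>)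
  then have "Cinf_on k (\<phi> ` (U' \<inter> V')) (\<lambda>u. \<psi> (inv_into U' \<phi> u) i)"
    by (rule Cinf_on_cong[OF op, rotated]) (use slice_inv[OF c(2)] in \<open>auto simp: c(1)\<close>)
  then show "Cinf_on (mdim (submanifold M k S)) (\<phi> ` (U' \<inter> V')) (\<lambda>u. \<psi> (inv_into U' \<phi> u) i)"
    by (simp add: sub_simps)
next
  fix x assume "x \<in> points (submanifold M k S)"
  then have x: "x \<in> S" by (simp only: sub_simps(3))
  obtain U \<phi> where "(U, \<phi>) \<in> slice_charts M k S" "x \<in> U" by (rule slice_chart_at[OF x])
  then show "\<exists>U \<phi>. (U, \<phi>) \<in> atlas (submanifold M k S) \<and> x \<in> U" using x by (auto simp: sub_simps)
qed

lemma inclusion_smooth_at: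
  assumes x: "x \<in> S"
  shows "smooth_at (submanifold M k S) M (\<lambda>z. z) x"
proof -
  note F = smooth_manifold_sub
  obtain U \<phi> where c: "(U, \<phi>) \<in> slice_charts M k S" "x \<in> U" by (rule slice_chart_at[OF x])
  then have at: "(U \<inter> S, \<phi>) \<in> atlas (submanifold M k S)" and xU: "x \<in> U \<inter> S" using x by (auto simp: sub_simps)
  note C = smooth_chart_local_coords[OF M slice_chartD(1)[OF c(1)]]
  have \<phi>x: "\<phi> x \<in> E k" using slice_chartD(2)[OF c(1)] xU by blast
  have 1: "smooth_at (submanifold M k S) (euclid k) \<phi> x"
    using chart_smooth_at[OF F at xU] by (simp add: sub_simps)
  have "smooth_at (submanifold M k S) M (\<lambda>z. inv_into U \<phi> (\<phi> z)) x"
    by (rule smooth_at_compose[OF smooth_at_compose[OF 1 E_inclusion_smooth_at[OF sub_dim \<phi>x]] local_coordsD(4)[OF C(2) c(2)]])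
  then show ?thesis
    by (rule smooth_at_cong[OF F _ atlasD(1)[OF F at] xU]) (use local_coordsD(5)[OF C(2)] in auto)
qed

text \<open>In a slice chart the coordinates from index \<open>k\<close> on are set to zero. The
  resulting map is meaningful only near \<open>x\<close>, which \<open>smooth_at\<close> allows. It
  extends germs from the submanifold and makes smooth maps into \<open>M\<close> with values in
  \<open>S\<close> smooth into the submanifold.\<close>

lemma local_retraction:
  assumes x: "x \<in> S"
  obtains \<rho> U where "smooth_at M (submanifold M k S) \<rho> x" "openin (mtop M) U" "x \<in> U" "\<forall>z\<in>U \<inter> S. \<rho> z = z"
proof -
  note F = smooth_manifold_sub
  obtain U \<phi> where c: "(U, \<phi>) \<in> slice_charts M k S" "x \<in> U" by (rule slice_chart_at[OF x])
  then have at: "(U \<inter> S, \<phi>) \<in> atlas (submanifold M k S)" and xU: "x \<in> U \<inter> S" using x by (auto simp: sub_simps)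
  note C = smooth_chart_local_coords[OF M slice_chartD(1)[OF c(1)]]
  have \<phi>S: "lo k (\<phi> z) = \<phi> z" if "z \<in> U \<inter> S" for z
  proof -
    have "\<phi> z \<in> E k" using slice_chartD(2)[OF c(1)] that by blast
    then show ?thesis by (auto simp: lo_def E_iff fun_eq_iff)
  qed
  have \<phi>x: "\<phi> x \<in> E (mdim M)" using smooth_at_points(2)[OF local_coordsD(3)[OF C(2) c(2)]] by simp
  have inv: "smooth_at (euclid k) (submanifold M k S) (inv_into (U \<inter> S) \<phi>) (lo k (\<phi> x))"
    using chart_inv_smooth_at[OF F at, of "\<phi> x"] xU \<phi>S[OF xU] by (simp add: sub_simps)
  show thesis
  proof (rule that[of "\<lambda>z. inv_into (U \<inter> S) \<phi> (lo k (\<phi> z))" U])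
    show "smooth_at M (submanifold M k S) (\<lambda>z. inv_into (U \<inter> S) \<phi> (lo k (\<phi> z))) x"
      by (rule smooth_at_compose[OF smooth_at_compose[OF local_coordsD(3)[OF C(2) c(2)] E_projection_smooth_at[OF sub_dim \<phi>x]] inv])
    show "openin (mtop M) U" by (rule local_coordsD(1)[OF C(2)])
    show "\<forall>z\<in>U \<inter> S. inv_into (U \<inter> S) \<phi> (lo k (\<phi> z)) = z"
      using \<phi>S slice_inv[OF c(1)] local_coordsD(5)[OF C(2)] by auto
  qed (rule c(2))
qed

lemma germ_extension:
  assumes x: "x \<in> S" and f: "f \<in> germs (submanifold M k S) x"
  obtains f' W where "f' \<in> germs M x" "openin (mtop (submanifold M k S)) W" "x \<in> W" "\<forall>w\<in>W. f' w = f w"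
proof -
  obtain \<rho> U where \<rho>: "smooth_at M (submanifold M k S) \<rho> x" "openin (mtop M) U" "x \<in> U" "\<forall>z\<in>U \<inter> S. \<rho> z = z"
    by (rule local_retraction[OF x])
  show thesis
  proof (rule that[of "\<lambda>z. f (\<rho> z)" "U \<inter> S"])
    show "(\<lambda>z. f (\<rho> z)) \<in> germs M x" by (rule smooth_at_germ'[OF \<rho>(1)]) (use \<rho>(3,4) x f in simp)
    show "openin (mtop (submanifold M k S)) (U \<inter> S)" unfolding sub_simps by (rule openin_subtopology_Int[OF \<rho>(2)])
  qed (use \<rho> x in auto)
qed

lemma smooth_at_into_sub:
  assumes A: "smooth_manifold A" and a: "smooth_at A M a z" and W: "openin (mtop A) W" "z \<in> W" "\<And>w. w \<in> W \<Longrightarrow> a w \<in> S"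
  shows "smooth_at A (submanifold M k S) a z"
proof -
  obtain \<rho> U where \<rho>: "smooth_at M (submanifold M k S) \<rho> (a z)" "openin (mtop M) U" "a z \<in> U" "\<forall>z\<in>U \<inter> S. \<rho> z = z"
    by (rule local_retraction[OF W(3)[OF W(2)]])
  obtain W' where W': "openin (mtop A) W'" "z \<in> W'" "a ` W' \<subseteq> U" by (rule smooth_at_open[OF a \<rho>(2,3)])
  have WW: "openin (mtop A) (W \<inter> W')" "z \<in> W \<inter> W'" using W W' by auto
  show ?thesis
    by (rule smooth_at_cong[OF A smooth_at_compose[OF a \<rho>(1)] WW]) (use W(3) W'(3) \<rho>(4) in auto)
qed

text \<open>Every germ on the submanifold is the restriction of a germ on \<open>M\<close>, so a
  tangent vector is determined by its push-forward.\<close>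

lemma inclusion_injective:
  assumes x: "x \<in> S" and u: "u \<in> tangent_space (submanifold M k S) x"
    and 0: "pushforward M (\<lambda>z. z) x u = (\<lambda>_. 0)"
  shows "u = (\<lambda>_. 0)"
proof (rule tangent_eqI[OF u tangent_zero])
  fix f assume "f \<in> germs (submanifold M k S) x"
  then obtain f' W where f': "f' \<in> germs M x" and W: "openin (mtop (submanifold M k S)) W" "x \<in> W" "\<forall>w\<in>W. f' w = f w"
    by (rule germ_extension[OF x])
  have "u f = u f'" by (rule tangent_germ_eq[OF smooth_manifold_sub u W(1,2)]) (simp add: W(3))
  also have "\<dots> = pushforward M (\<lambda>z. z) x u f'" by (simp add: pushforward_apply f')
  finally show "u f = 0" by (simp add: 0)
qed

end

section \<open>The graph condition of Poisson-Dirac submanifolds\<close>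

lemma poisson_dirac_graphD:
  assumes "{(u, pullback F M id x \<xi>) | u \<xi>.
              u \<in> tangent_space F x \<and> \<xi> \<in> cotangent_space M x \<and>
              pushforward M id x u = sharp M \<pi> x \<xi>} =
           {(sharp F \<pi>F x \<eta>, \<eta>) | \<eta>. \<eta> \<in> cotangent_space F x}"
  shows "\<eta> \<in> cotangent_space F x \<Longrightarrow> \<exists>\<xi>\<in>cotangent_space M x. pullback F M (\<lambda>z. z) x \<xi> = \<eta> \<and>
      pushforward M (\<lambda>z. z) x (sharp F \<pi>F x \<eta>) = sharp M \<pi> x \<xi>"
    and "u \<in> tangent_space F x \<Longrightarrow> \<xi> \<in> cotangent_space M x \<Longrightarrow> pushforward M (\<lambda>z. z) x u = sharp M \<pi> x \<xi> \<Longrightarrow>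
      u = sharp F \<pi>F x (pullback F M (\<lambda>z. z) x \<xi>)"
proof -
  assume "\<eta> \<in> cotangent_space F x"
  then have "(sharp F \<pi>F x \<eta>, \<eta>) \<in> {(sharp F \<pi>F x \<eta>, \<eta>) | \<eta>. \<eta> \<in> cotangent_space F x}" by blast
  then show "\<exists>\<xi>\<in>cotangent_space M x. pullback F M (\<lambda>z. z) x \<xi> = \<eta> \<and>
      pushforward M (\<lambda>z. z) x (sharp F \<pi>F x \<eta>) = sharp M \<pi> x \<xi>"
    unfolding assms[symmetric] pullback_id pushforward_id by auto
next
  assume "u \<in> tangent_space F x" "\<xi> \<in> cotangent_space M x" "pushforward M (\<lambda>z. z) x u = sharp M \<pi> x \<xi>"
  then have "(u, pullback F M id x \<xi>) \<in> {(u, pullback F M id x \<xi>) | u \<xi>.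
              u \<in> tangent_space F x \<and> \<xi> \<in> cotangent_space M x \<and>
              pushforward M id x u = sharp M \<pi> x \<xi>}" unfolding pushforward_id by blast
  then have "(u, pullback F M id x \<xi>) \<in> {(sharp F \<pi>F x \<eta>, \<eta>) | \<eta>. \<eta> \<in> cotangent_space F x}" unfolding assms .
  then show "u = sharp F \<pi>F x (pullback F M (\<lambda>z. z) x \<xi>)" unfolding pullback_id by auto
qed

text \<open>The relation between vectors and covectors of the submanifold is linear, so it is a
  graph once each covector has a lift realizing the prescribed vector and only the zero vector is
  related to the zero covector: two vectors related to one covector differ by a vector related to
  zero.\<close>

lemma poisson_dirac_graphI:
  assumes M: "smooth_manifold M" and emb: "embedded_submanifold M k S" and x: "x \<in> S"
    and \<pi>: "smooth_bivector M \<pi>" and \<pi>F: "smooth_bivector (submanifold M k S) \<pi>F"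
    and 1: "\<And>\<eta>. \<eta> \<in> cotangent_space (submanifold M k S) x \<Longrightarrow> \<exists>\<xi>\<in>cotangent_space M x.
      pullback (submanifold M k S) M (\<lambda>z. z) x \<xi> = \<eta> \<and>
      pushforward M (\<lambda>z. z) x (sharp (submanifold M k S) \<pi>F x \<eta>) = sharp M \<pi> x \<xi>"
    and 2: "\<And>u \<xi>. u \<in> tangent_space (submanifold M k S) x \<Longrightarrow> \<xi> \<in> cotangent_space M x \<Longrightarrow>
      pullback (submanifold M k S) M (\<lambda>z. z) x \<xi> = (\<lambda>_. 0) \<Longrightarrow>
      pushforward M (\<lambda>z. z) x u = sharp M \<pi> x \<xi> \<Longrightarrow> u = (\<lambda>_. 0)"
  shows "{(u, pullback (submanifold M k S) M id x \<xi>) | u \<xi>.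
              u \<in> tangent_space (submanifold M k S) x \<and> \<xi> \<in> cotangent_space M x \<and>
              pushforward M id x u = sharp M \<pi> x \<xi>} =
           {(sharp (submanifold M k S) \<pi>F x \<eta>, \<eta>) | \<eta>. \<eta> \<in> cotangent_space (submanifold M k S) x}" (is "?L = ?R")
proof -
  let ?F = "submanifold M k S"
  note F = smooth_manifold_sub[OF M emb]
  have xF: "x \<in> points ?F" using x by (simp only: sub_simps(3)[OF M emb])
  have xM: "x \<in> points M" using x sub_points[OF M emb] by blast
  note inc = inclusion_smooth_at[OF M emb x]
  show ?thesis
    unfolding pushforward_id pullback_id
  proof (intro equalityI subsetI)
    fix w assume "w \<in> {(sharp ?F \<pi>F x \<eta>, \<eta>) | \<eta>. \<eta> \<in> cotangent_space ?F x}"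
    then obtain \<eta> where \<eta>: "w = (sharp ?F \<pi>F x \<eta>, \<eta>)" "\<eta> \<in> cotangent_space ?F x" by blast
    obtain \<xi> where \<xi>: "\<xi> \<in> cotangent_space M x" "pullback ?F M (\<lambda>z. z) x \<xi> = \<eta>"
      "pushforward M (\<lambda>z. z) x (sharp ?F \<pi>F x \<eta>) = sharp M \<pi> x \<xi>" using 1[OF \<eta>(2)] by blast
    have "sharp ?F \<pi>F x \<eta> \<in> tangent_space ?F x" by (rule sharp_tangent[OF F \<pi>F xF \<eta>(2)])
    then show "w \<in> {(u, pullback ?F M (\<lambda>z. z) x \<xi>) | u \<xi>. u \<in> tangent_space ?F x \<and> \<xi> \<in> cotangent_space M x \<and>
        pushforward M (\<lambda>z. z) x u = sharp M \<pi> x \<xi>}"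
      unfolding \<eta>(1) using \<xi> by blast
  next
    fix w assume "w \<in> {(u, pullback ?F M (\<lambda>z. z) x \<xi>) | u \<xi>. u \<in> tangent_space ?F x \<and> \<xi> \<in> cotangent_space M x \<and>
        pushforward M (\<lambda>z. z) x u = sharp M \<pi> x \<xi>}"
    then obtain u \<xi> where w: "w = (u, pullback ?F M (\<lambda>z. z) x \<xi>)" and u: "u \<in> tangent_space ?F x"
      and \<xi>: "\<xi> \<in> cotangent_space M x" and eq: "pushforward M (\<lambda>z. z) x u = sharp M \<pi> x \<xi>" by blast
    define \<eta> where "\<eta> = pullback ?F M (\<lambda>z. z) x \<xi>"
    have \<eta>: "\<eta> \<in> cotangent_space ?F x" unfolding \<eta>_def by (rule pullback_cotangent[OF inc M \<xi>])
    obtain \<xi>' where \<xi>': "\<xi>' \<in> cotangent_space M x" "pullback ?F M (\<lambda>z. z) x \<xi>' = \<eta>"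
      "pushforward M (\<lambda>z. z) x (sharp ?F \<pi>F x \<eta>) = sharp M \<pi> x \<xi>'" using 1[OF \<eta>] by blast
    define u' where "u' = sharp ?F \<pi>F x \<eta>"
    have u': "u' \<in> tangent_space ?F x" unfolding u'_def by (rule sharp_tangent[OF F \<pi>F xF \<eta>])
    have "(\<lambda>f. 1 * u f + (-1) * u' f) = (\<lambda>_. 0)"
    proof (rule 2[OF tangent_lin[OF u u'] cotangent_lin[OF \<xi> \<xi>'(1)]])
      show "pullback ?F M (\<lambda>z. z) x (\<lambda>v. 1 * \<xi> v + (-1) * \<xi>' v) = (\<lambda>_. 0)"
        unfolding pullback_lin \<xi>'(2) \<eta>_def[symmetric] by simp
      show "pushforward M (\<lambda>z. z) x (\<lambda>f. 1 * u f + (-1) * u' f) = sharp M \<pi> x (\<lambda>v. 1 * \<xi> v + (-1) * \<xi>' v)"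
        unfolding pushforward_lin sharp_lin[OF \<pi> xM \<xi> \<xi>'(1)] eq \<xi>'(3)[folded u'_def] ..
    qed
    then have "u = u'" by (simp add: fun_eq_iff)
    then show "w \<in> {(sharp ?F \<pi>F x \<eta>, \<eta>) | \<eta>. \<eta> \<in> cotangent_space ?F x}"
      unfolding w \<eta>_def[symmetric] using \<eta> by (auto simp: u'_def)
  qed
qed

section \<open>Fibres of the associated bundle\<close>

context principal_action
begin

lemma embedded_fibre_\<Sigma>:
  assumes m: "m \<in> p\<Sigma> ` points \<Sigma>"
  shows "embedded_submanifold \<Sigma> (mdim X) {\<sigma> \<in> points \<Sigma>. p\<Sigma> \<sigma> = m}"
  unfolding embedded_submanifold_def
proof (intro conjI subsetI)
  obtain \<sigma>0 where "\<sigma>0 \<in> points \<Sigma>" using m by blast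
  then obtain y0 where y0: "y0 \<in> points P" by (rule \<Sigma>_E)
  then have "points P \<noteq> {}" by blast
  from mdim_\<Sigma>'[OF this] show "mdim X \<le> mdim \<Sigma>" by simp
  fix \<sigma> assume "\<sigma> \<in> {\<sigma> \<in> points \<Sigma>. p\<Sigma> \<sigma> = m}"
  then have \<sigma>: "\<sigma> \<in> points \<Sigma>" "p\<Sigma> \<sigma> = m" by auto
  show "\<sigma> \<in> points \<Sigma>" by (rule \<sigma>(1))
  obtain y x where z: "y \<in> points P" "x \<in> points X" "\<sigma> = qt (y, x)" by (rule \<Sigma>_E[OF \<sigma>(1)])
  have py: "p y = m" using \<sigma>(2) z p\<Sigma>_qt by simp
  obtain U \<phi> \<tau> where c: "quotient_chart PX qt (mdim P + mdim X - mdim Gm) U \<phi> \<tau>"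
    "qt (y, x) \<in> U" "\<forall>\<sigma>\<in>U. p\<Sigma> \<sigma> = p y \<longleftrightarrow> \<phi> \<sigma> \<in> E (mdim X)" by (rule bundle_chart[OF z(1,2)])
  have at: "(U, \<phi>) \<in> atlas \<Sigma>" unfolding assoc_bundle_def by (rule quotient_chart_atlas[OF PX c(1)])
  have "\<phi> ` (U \<inter> {\<sigma> \<in> points \<Sigma>. p\<Sigma> \<sigma> = m}) = \<phi> ` U \<inter> E (mdim X)"
    using c(3) atlasD(5)[OF \<Sigma> at] py by auto
  then have "(U, \<phi>) \<in> slice_charts \<Sigma> (mdim X) {\<sigma> \<in> points \<Sigma>. p\<Sigma> \<sigma> = m}"
    unfolding slice_charts_def using atlas_smooth_charts[OF \<Sigma> at] by blast
  then show "\<sigma> \<in> (\<Union>c\<in>slice_charts \<Sigma> (mdim X) {\<sigma> \<in> points \<Sigma>. p\<Sigma> \<sigma> = m}. fst c)" using c(2) z(3) by force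
qed

text \<open>A point of the fibre is \<open>qt (y0, x)\<close> with \<open>y0\<close> fixed. The induced bivector there is the sum of the
  push-forward of \<open>\<beta> y0\<close>, for the bivector \<open>\<beta>\<close> on the fibre of \<open>P\<close>, along the orbit map
  \<open>y \<mapsto> qt (y, x)\<close>, and of \<open>\<rho>\<close> along \<open>x \<mapsto> qt (y0, x)\<close>.\<close>

lemma poisson_dirac_fibre:
  assumes \<pi>: "smooth_bivector P \<pi>" and \<rho>: "smooth_bivector X \<rho>"
    and inv: "\<forall>g\<in>carrier G. poisson_map P \<pi> P \<pi> (\<lambda>y. r y g)" "\<forall>g\<in>carrier G. poisson_map X \<rho> X \<rho> (l g)"
    and m: "m \<in> p\<Sigma> ` points \<Sigma>" and dirac: "poisson_dirac P \<pi> kP {y \<in> points P. p y = m}"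
  shows "poisson_dirac \<Sigma> (descend PX \<Sigma> qt (prod_bivector P \<pi> X \<rho>)) (mdim X) {\<sigma> \<in> points \<Sigma>. p\<Sigma> \<sigma> = m}"
proof -
  define \<pi>\<Sigma> where "\<pi>\<Sigma> = descend PX \<Sigma> qt (prod_bivector P \<pi> X \<rho>)"
  have \<pi>\<Sigma>: "smooth_bivector \<Sigma> \<pi>\<Sigma>" unfolding \<pi>\<Sigma>_def
    by (rule descend_smooth[OF PX \<Sigma> has_sections_qt fibre_invariant_qt[OF inv] smooth_bivector_prod[OF P X \<pi> \<rho>]])
  note \<pi>\<Sigma>_apply = descend_qt_apply[OF inv, folded \<pi>\<Sigma>_def]
  define S Q where "S = {\<sigma> \<in> points \<Sigma>. p\<Sigma> \<sigma> = m}" and "Q = {y \<in> points P. p y = m}"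
  define F FP where "F = submanifold \<Sigma> (mdim X) S" and "FP = submanifold P kP Q"
  have embS: "embedded_submanifold \<Sigma> (mdim X) S" unfolding S_def by (rule embedded_fibre_\<Sigma>[OF m])
  have embQ: "embedded_submanifold P kP Q" using dirac unfolding poisson_dirac_def Q_def by blast
  obtain \<beta> where \<beta>: "smooth_bivector FP \<beta>" and graph: "\<forall>x\<in>Q.
           {(u, pullback FP P id x \<xi>) | u \<xi>. u \<in> tangent_space FP x \<and> \<xi> \<in> cotangent_space P x \<and>
              pushforward P id x u = sharp P \<pi> x \<xi>} =
           {(sharp FP \<beta> x \<eta>, \<eta>) | \<eta>. \<eta> \<in> cotangent_space FP x}"
    using dirac unfolding poisson_dirac_def Q_def[symmetric] FP_def[symmetric] Let_def by (elim conjE exE)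
  have F: "smooth_manifold F" and FP: "smooth_manifold FP"
    unfolding F_def FP_def by (rule smooth_manifold_sub[OF \<Sigma> embS], rule smooth_manifold_sub[OF P embQ])
  have pF: "points F = S" and pFP: "points FP = Q"
    unfolding F_def FP_def by (rule sub_simps(3)[OF \<Sigma> embS], rule sub_simps(3)[OF P embQ])
  have incF: "smooth_at F \<Sigma> (\<lambda>z. z) \<sigma>" if "\<sigma> \<in> S" for \<sigma>
    unfolding F_def by (rule inclusion_smooth_at[OF \<Sigma> embS that])
  have incP: "smooth_at FP P (\<lambda>z. z) y" if "y \<in> Q" for y
    unfolding FP_def by (rule inclusion_smooth_at[OF P embQ that])
  note into_F = smooth_at_into_sub[OF \<Sigma> embS, folded F_def] and into_FP = smooth_at_into_sub[OF P embQ, folded FP_def]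
  obtain \<sigma>0 where \<sigma>0: "\<sigma>0 \<in> points \<Sigma>" "m = p\<Sigma> \<sigma>0" using m by blast
  obtain y0 x0 where "y0 \<in> points P" "x0 \<in> points X" "\<sigma>0 = qt (y0, x0)" by (rule \<Sigma>_E[OF \<sigma>0(1)])
  then have y0: "y0 \<in> points P" "p y0 = m" using \<sigma>0(2) p\<Sigma>_qt by auto
  have y0Q: "y0 \<in> Q" using y0 by (simp add: Q_def)
  obtain U s \<gamma> where t: "trivialization U s \<gamma>" and "p y0 \<in> U" "s (p y0) = y0" and \<gamma>0: "\<gamma> y0 = \<one>\<^bsub>G\<^esub>"
    by (rule trivialization_at[OF y0(1)])
  then have mU: "m \<in> U" and sm: "s m = y0" using y0 by auto
  note tD = trivializationD[OF t]
  \<comment> \<open>On the fibre over \<open>m\<close> this is the inverse of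
    \<open>x \<mapsto> qt (y0, x)\<close>, because \<open>\<gamma> y0\<close> is the unit. It is
    smooth near the fibre, so it also extends functions off the fibre.\<close>
  define \<psi> where "\<psi> = fibre_coord \<gamma>"
  have \<psi>qt: "\<psi> (qt (y, x)) = l (\<gamma> y) x" if "y \<in> points P" "p y \<in> U" "x \<in> points X" for y x
    unfolding \<psi>_def by (rule fibre_coord_qt[OF t that])
  have \<psi>j: "\<psi> (qt (y0, x)) = x" if "x \<in> points X" for x
    using \<psi>qt[OF y0(1) _ that] mU y0(2) \<gamma>0 l_facts(1)[OF that] by simp
  have inS: "qt (y, x) \<in> S" if "y \<in> Q" "x \<in> points X" for y x
    using that qt_points p\<Sigma>_qt by (auto simp: S_def Q_def)
  have S_E: "\<psi> \<sigma> \<in> points X \<and> qt (y0, \<psi> \<sigma>) = \<sigma>" if \<sigma>: "\<sigma> \<in> S" for \<sigma>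
  proof -
    have "\<sigma> \<in> points \<Sigma>" using \<sigma> by (simp add: S_def)
    then obtain y x where z: "y \<in> points P" "x \<in> points X" "\<sigma> = qt (y, x)" by (rule \<Sigma>_E)
    have py: "p y = m" using \<sigma> z p\<Sigma>_qt by (simp add: S_def)
    then have pU: "p y \<in> U" using mU by simp
    show ?thesis
      using \<psi>qt[OF z(1) pU z(2)] qt_normal[OF t z(1) pU z(2)] py sm l_facts(2)[OF z(2) tD(6)[OF z(1) pU]] z(3) by simp
  qed
  have opU: "openin (mtop P) {y \<in> points P. p y \<in> U}"
    by (rule smooth_at_preimage_open[OF openin_topspace p_smooth_at tD(1)])
  have \<psi>s: "smooth_at \<Sigma> X \<psi> \<sigma>" if \<sigma>: "\<sigma> \<in> S" for \<sigma>
  proof -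
    have x: "\<psi> \<sigma> \<in> points X" "qt (y0, \<psi> \<sigma>) = \<sigma>" using S_E[OF \<sigma>] by auto
    have z: "(y0, \<psi> \<sigma>) \<in> points PX" using y0 x by (simp add: points_PX)
    have D: "openin (mtop PX) {z \<in> points PX. p (fst z) \<in> U}"
      by (rule smooth_at_preimage_open[OF openin_topspace p_fst_smooth tD(1)])
    have "smooth_at PX X (\<lambda>z. l (\<gamma> (fst z)) (snd z)) (y0, \<psi> \<sigma>)"
      by (rule fibre_smooth[OF t z]) (use y0 mU in simp)
    then have "smooth_at PX X (\<lambda>z. \<psi> (qt z)) (y0, \<psi> \<sigma>)"
      by (rule smooth_at_cong[OF PX _ D]) (use z y0 mU \<psi>qt in \<open>auto simp: points_PX\<close>)
    from smooth_at_descends[OF PX \<Sigma> has_sections_qt z this] show ?thesis by (simp only: x(2))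
  qed
  have jsm: "smooth_at X F (\<lambda>x. qt (y0, x)) x" if x: "x \<in> points X" for x
    by (rule into_F[OF X fibre_inclusion_smooth_at[OF y0(1) x] openin_topspace x]) (rule inS[OF y0Q])
  have asm: "smooth_at FP F (\<lambda>y. qt (y, x)) y0" if x: "x \<in> points X" for x
  proof (rule into_F[OF FP _ openin_topspace])
    have y0FP: "y0 \<in> points FP" using y0Q pFP by simp
    then show "y0 \<in> points FP" .
    show "smooth_at FP \<Sigma> (\<lambda>y. qt (y, x)) y0"
      by (rule smooth_at_qt_pair[OF FP incP[OF y0Q] smooth_at_const[OF FP y0FP x]])
    show "qt (w, x) \<in> S" if "w \<in> points FP" for w using inS that x pFP by simp
  qed
  \<comment> \<open>A retraction of \<open>P\<close> near \<open>y0\<close> onto the fibre through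
    \<open>y0\<close>: the group coordinate is kept and the base point is moved to
    \<open>m\<close>.\<close>
  define \<kappa> where "\<kappa> y = r y0 (\<gamma> y)" for y
  have \<kappa>0: "\<kappa> y0 = y0" by (simp add: \<kappa>_def \<gamma>0 r_facts(1)[OF y0(1)])
  have y0U: "y0 \<in> {y \<in> points P. p y \<in> U}" using y0 mU by simp
  have \<kappa>P: "smooth_at P P \<kappa> y0" unfolding \<kappa>_def
    by (rule r_smooth_at[OF P smooth_at_const[OF P y0(1) y0(1)] tD(5)[OF y0(1)]]) (use y0 mU in simp)
  have \<kappa>FP: "smooth_at P FP \<kappa> y0"
    by (rule into_FP[OF P \<kappa>P opU y0U]) (use tD(6) r_facts(2,4)[OF y0(1)] y0 in \<open>auto simp: \<kappa>_def Q_def\<close>)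
  \<comment> \<open>Since \<open>y\<close> is \<open>r (s (p y)) (\<gamma> y)\<close>, a vector at
    \<open>y0\<close> is the sum of its motion along the section and its motion along the fibre, by
    \<open>tangent_pair\<close>.\<close>
  have decomp: "v h = v (\<lambda>y. h (s (p y))) + v (\<lambda>y. h (\<kappa> y))"
    if v: "v \<in> tangent_space P y0" and h: "h \<in> germs P y0" for v h
  proof -
    let ?K = "prod_manifold M Gm"
    note K = smooth_manifold_prod[OF M Gm]
    have z: "(m, \<one>\<^bsub>G\<^esub>) \<in> points ?K" using mU openin_subset[OF tD(1)] points_Gm by (auto simp: prod_manifold_simps(3))
    have p0: "smooth_at P M p y0" and g0: "smooth_at P Gm \<gamma> y0"
      by (rule p_smooth_at[OF y0(1)], rule tD(5)[OF y0(1)]) (use y0 mU in simp)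
    have 1: "smooth_at ?K P (\<lambda>z. s (fst z)) (m, \<one>\<^bsub>G\<^esub>)"
      by (rule smooth_at_compose[OF fst_smooth_at[OF M Gm z]]) (use tD(2)[OF mU] in simp)
    have hK: "(\<lambda>z. h (r (s (fst z)) (snd z))) \<in> germs ?K (p y0, \<gamma> y0)"
      unfolding y0(2) \<gamma>0
      by (rule smooth_at_germ'[OF r_smooth_at[OF K 1 snd_smooth_at[OF M Gm z]]]) (simp add: sm r_facts(1)[OF y0(1)] h)
    have "v h = v (\<lambda>y. h (r (s (p y)) (\<gamma> y)))"
      by (rule tangent_germ_eq[OF P v opU y0U]) (use tD(7) in auto)
    also have "\<dots> = v (\<lambda>y. h (r (s (p y)) (\<gamma> y0))) + v (\<lambda>y. h (r (s (p y0)) (\<gamma> y)))"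
      using tangent_pair[OF M Gm P p0 g0 hK v] by simp
    also have "v (\<lambda>y. h (r (s (p y)) (\<gamma> y0))) = v (\<lambda>y. h (s (p y)))"
      by (rule tangent_germ_eq[OF P v opU y0U]) (use tD(4) r_facts(1) in \<open>auto simp: \<gamma>0\<close>)
    finally show ?thesis by (simp add: y0(2) sm \<kappa>_def)
  qed
  define A where "A x = pullback FP F (\<lambda>y. qt (y, x)) y0" for x
  define J where "J x = pullback X F (\<lambda>x. qt (y0, x)) x" for x
  define \<pi>F where "\<pi>F \<sigma> \<eta> \<eta>' = \<beta> y0 (A (\<psi> \<sigma>) \<eta>) (A (\<psi> \<sigma>) \<eta>') + \<rho> (\<psi> \<sigma>) (J (\<psi> \<sigma>) \<eta>) (J (\<psi> \<sigma>) \<eta>')" for \<sigma> \<eta> \<eta>'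
  have A: "A x \<eta> \<in> cotangent_space FP y0" and J: "J x \<eta> \<in> cotangent_space X x"
    if "x \<in> points X" "\<eta> \<in> cotangent_space F (qt (y0, x))" for x \<eta>
    unfolding A_def J_def by (rule pullback_cotangent[OF asm[OF that(1)] F that(2)], rule pullback_cotangent[OF jsm[OF that(1)] F that(2)])
  have A_diff: "A x (differential F f (qt (y0, x))) = differential FP (\<lambda>y. f (qt (y, x))) y0"
    and J_diff: "J x (differential F f (qt (y0, x))) = differential X (\<lambda>x. f (qt (y0, x))) x"
    if "x \<in> points X" "f \<in> germs F (qt (y0, x))" for x f
    unfolding A_def J_def by (rule pullback_differential[OF asm[OF that(1)] F that(2)], rule pullback_differential[OF jsm[OF that(1)] F that(2)])
  have y0FP: "y0 \<in> points FP" using y0Q pFP by simp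
  have bracket_F: "bracket F \<pi>F f g (qt (y0, x)) =
      bracket FP \<beta> (\<lambda>y. f (qt (y, x))) (\<lambda>y. g (qt (y, x))) y0 + bracket X \<rho> (\<lambda>x. f (qt (y0, x))) (\<lambda>x. g (qt (y0, x))) x"
    if x: "x \<in> points X" and f: "f \<in> germs F (qt (y0, x))" and g: "g \<in> germs F (qt (y0, x))" for x f g
    unfolding bracket_def \<pi>F_def \<psi>j[OF x] A_diff[OF x f] A_diff[OF x g] J_diff[OF x f] J_diff[OF x g] ..
  have \<pi>F: "smooth_bivector F \<pi>F"
  proof (rule smooth_bivectorI)
    fix \<sigma> \<xi> \<eta> assume "\<sigma> \<in> points F" and c: "\<xi> \<in> cotangent_space F \<sigma>" "\<eta> \<in> cotangent_space F \<sigma>"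
    then have \<sigma>: "\<sigma> \<in> S" using pF by simp
    have x: "\<psi> \<sigma> \<in> points X" "qt (y0, \<psi> \<sigma>) = \<sigma>" using S_E[OF \<sigma>] by auto
    note A' = A[OF x(1), unfolded x(2)] and J' = J[OF x(1), unfolded x(2)]
    show "\<pi>F \<sigma> \<xi> \<eta> = - \<pi>F \<sigma> \<eta> \<xi>"
      using smooth_bivectorD(1)[OF \<beta> y0FP A'[OF c(1)] A'[OF c(2)]] smooth_bivectorD(1)[OF \<rho> x(1) J'[OF c(1)] J'[OF c(2)]]
      unfolding \<pi>F_def by linarith
    fix \<zeta> a b assume \<zeta>: "\<zeta> \<in> cotangent_space F \<sigma>"
    have lin: "A x (\<lambda>v. a * \<xi> v + b * \<eta> v) = (\<lambda>v. a * A x \<xi> v + b * A x \<eta> v)"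
      "J x (\<lambda>v. a * \<xi> v + b * \<eta> v) = (\<lambda>v. a * J x \<xi> v + b * J x \<eta> v)" for x
      unfolding A_def J_def by (rule pullback_lin)+
    show "\<pi>F \<sigma> (\<lambda>v. a * \<xi> v + b * \<eta> v) \<zeta> = a * \<pi>F \<sigma> \<xi> \<zeta> + b * \<pi>F \<sigma> \<eta> \<zeta>"
      unfolding \<pi>F_def lin smooth_bivectorD(2)[OF \<beta> y0FP A'[OF c(1)] A'[OF c(2)] A'[OF \<zeta>]]
        smooth_bivectorD(2)[OF \<rho> x(1) J'[OF c(1)] J'[OF c(2)] J'[OF \<zeta>]] by (simp add: algebra_simps)
  next
    fix W f g assume W: "openin (mtop F) W" and f: "smooth_fun_on F W f" and g: "smooth_fun_on F W g"
    show "smooth_fun_on F W (bracket F \<pi>F f g)"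
      unfolding smooth_fun_on_iff_germs[OF F W]
    proof
      fix \<sigma> assume \<sigma>W: "\<sigma> \<in> W"
      have WS: "W \<subseteq> S" using openin_subset[OF W] pF by simp
      then have \<sigma>: "\<sigma> \<in> S" using \<sigma>W by blast
      define x where "x = \<psi> \<sigma>"
      have x: "x \<in> points X" "qt (y0, x) = \<sigma>" using S_E[OF \<sigma>] by (auto simp: x_def)
      have gs: "h \<in> germs F \<tau>" if "\<tau> \<in> W" "h = f \<or> h = g" for h \<tau>
        using that smooth_fun_on_germs[OF W that(1) f] smooth_fun_on_germs[OF W that(1) g] by auto
      have jx: "qt (y0, x) \<in> W" using x \<sigma>W by simp
      obtain V where V: "openin (mtop X) V" "x \<in> V" "(\<lambda>x. qt (y0, x)) ` V \<subseteq> W"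
        by (rule smooth_at_open[OF jsm[OF x(1)] W jx])
      have VX: "V \<subseteq> points X" by (rule openin_subset[OF V(1)])
      obtain B \<phi> where c: "(B, \<phi>) \<in> atlas FP" "y0 \<in> B" by (rule chart_at[OF FP y0FP])
      \<comment> \<open>As \<beta> enters only at the fixed point \<open>y0\<close>, its coordinate
        brackets there are constants. The dependence on \<open>x\<close> sits in these derivatives
        at \<open>y0\<close>, which are smooth in \<open>x\<close> by
        \<open>germ_partial_vector\<close>.\<close>
      define D where "D h i x = chart_vec FP B \<phi> y0 i (\<lambda>y. h (qt (y, x)))" for h i x
      have D: "D h i \<in> germs X x" if i: "i < mdim FP" and h: "h = f \<or> h = g" for h i
      proof -
        let ?K = "prod_manifold FP X"
        note K = smooth_manifold_prod[OF FP X]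
        have z: "(y0, x) \<in> points ?K" using y0FP x by (simp add: prod_manifold_simps(3))
        have 1: "smooth_at ?K P fst w" if "w \<in> points ?K" for w
          using smooth_at_compose[OF fst_smooth_at[OF FP X that] incP] that pFP by (simp add: prod_manifold_simps(3) mem_Times_iff)
        have "smooth_at ?K F (\<lambda>w. qt (fst w, snd w)) (y0, x)"
          by (rule into_F[OF K smooth_at_qt_pair[OF K 1[OF z] snd_smooth_at[OF FP X z]] openin_topspace z])
            (use inS pFP in \<open>auto simp: prod_manifold_simps(3)\<close>)
        then have "(\<lambda>w. h (qt (fst w, snd w))) \<in> germs ?K (y0, x)"
          by (rule smooth_at_germ') (use gs[OF jx h] in simp)
        from germ_partial_vector[OF FP X this chart_vec_tangent[OF FP c i]]
        show ?thesis unfolding D_def by simp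
      qed
      have co: "(\<lambda>x. bracket FP \<beta> (\<lambda>y. f (qt (y, x))) (\<lambda>y. g (qt (y, x))) y0) \<in> germs X x"
      proof -
        have "(\<lambda>x. \<Sum>i<mdim FP. \<Sum>j<mdim FP. D f i x * (D g j x * bracket FP \<beta> (\<lambda>z. \<phi> z i) (\<lambda>z. \<phi> z j) y0)) \<in> germs X x"
          by (intro germs_sum[OF X x(1)] germs_mult[OF X] germs_const[OF X x(1)] D) auto
        then show ?thesis
        proof (rule germ_cong[OF X V(1,2)])
          fix x' assume x': "x' \<in> V"
          have jx': "qt (y0, x') \<in> W" and xX: "x' \<in> points X" using V(3) VX x' by auto
          show "(\<Sum>i<mdim FP. \<Sum>j<mdim FP. D f i x' * (D g j x' * bracket FP \<beta> (\<lambda>z. \<phi> z i) (\<lambda>z. \<phi> z j) y0)) =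
            bracket FP \<beta> (\<lambda>y. f (qt (y, x'))) (\<lambda>y. g (qt (y, x'))) y0"
            unfolding D_def
            by (rule bracket_expand[OF FP c smooth_bivector_bilin_at[OF \<beta> y0FP], symmetric];
                rule smooth_at_germ'[OF asm[OF xX]]; rule gs[OF jx']; simp)
        qed
      qed
      have fx: "(\<lambda>x. f (qt (y0, x))) \<in> germs X x" "(\<lambda>x. g (qt (y0, x))) \<in> germs X x"
        by (rule smooth_at_germ'[OF jsm[OF x(1)]]; rule gs[OF jx]; simp)+
      have sum: "(\<lambda>x. bracket FP \<beta> (\<lambda>y. f (qt (y, x))) (\<lambda>y. g (qt (y, x))) y0 +
          bracket X \<rho> (\<lambda>x. f (qt (y0, x))) (\<lambda>x. g (qt (y0, x))) x) \<in> germs X (\<psi> \<sigma>)"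
        unfolding x_def[symmetric] by (rule germs_add[OF X co bracket_germ[OF \<rho> fx]])
      have "smooth_at F X \<psi> \<sigma>" by (rule smooth_at_compose[OF incF[OF \<sigma>] \<psi>s[OF \<sigma>]])
      from smooth_at_germ'[OF this sum] show "bracket F \<pi>F f g \<in> germs F \<sigma>"
      proof (rule germ_cong[OF F W \<sigma>W])
        fix \<tau> assume \<tau>: "\<tau> \<in> W"
        have y: "\<psi> \<tau> \<in> points X" "qt (y0, \<psi> \<tau>) = \<tau>" using S_E WS \<tau> by auto
        from bracket_F[OF y(1), unfolded y(2), OF gs[OF \<tau>] gs[OF \<tau>], of f g]
        show "bracket FP \<beta> (\<lambda>y. f (qt (y, \<psi> \<tau>))) (\<lambda>y. g (qt (y, \<psi> \<tau>))) y0 +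
          bracket X \<rho> (\<lambda>x. f (qt (y0, x))) (\<lambda>x. g (qt (y0, x))) (\<psi> \<tau>) = bracket F \<pi>F f g \<tau>" by simp
      qed
    qed
  qed
  note graphP = poisson_dirac_graphD[OF graph[rule_format, OF y0Q]]
  have graphF: "{(u, pullback F \<Sigma> id \<sigma> \<xi>) | u \<xi>. u \<in> tangent_space F \<sigma> \<and> \<xi> \<in> cotangent_space \<Sigma> \<sigma> \<and>
              pushforward \<Sigma> id \<sigma> u = sharp \<Sigma> \<pi>\<Sigma> \<sigma> \<xi>} =
           {(sharp F \<pi>F \<sigma> \<eta>, \<eta>) | \<eta>. \<eta> \<in> cotangent_space F \<sigma>}" if \<sigma>: "\<sigma> \<in> S" for \<sigma>
  proof -
    define x where "x = \<psi> \<sigma>"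
    have x: "x \<in> points X" and \<sigma>x: "\<sigma> = qt (y0, x)" using S_E[OF \<sigma>] by (auto simp: x_def)
    note os = orbit_smooth_at[OF y0(1) x] and fs = fibre_inclusion_smooth_at[OF y0(1) x]
    have qS: "qt (y0, x) \<in> S" using \<sigma> \<sigma>x by simp
    have qF: "qt (y0, x) \<in> points F" and q\<Sigma>: "qt (y0, x) \<in> points \<Sigma>" using qS pF by (auto simp: S_def)
    note inc = incF[OF qS]
    have resF: "c \<in> germs F (qt (y0, x))" if "c \<in> germs \<Sigma> (qt (y0, x))" for c
      using smooth_at_germ'[OF inc that] by simp
    have inc_diff: "pullback F \<Sigma> (\<lambda>z. z) (qt (y0, x)) (differential \<Sigma> c (qt (y0, x))) = differential F c (qt (y0, x))"
      if "c \<in> germs \<Sigma> (qt (y0, x))" for c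
      using pullback_differential[OF inc \<Sigma> that] by simp
    have sharp_c: "sharp \<Sigma> \<pi>\<Sigma> (qt (y0, x)) (differential \<Sigma> e (qt (y0, x))) c =
        \<pi> y0 (differential P (\<lambda>y. e (qt (y, x))) y0) (differential P (\<lambda>y. c (qt (y, x))) y0) +
        \<rho> x (differential X (\<lambda>x. e (qt (y0, x))) x) (differential X (\<lambda>x. c (qt (y0, x))) x)"
      if e: "e \<in> germs \<Sigma> (qt (y0, x))" and c: "c \<in> germs \<Sigma> (qt (y0, x))" for e c
      unfolding sharp_apply[OF c] \<pi>\<Sigma>_apply[OF y0(1) x differential_cotangent differential_cotangent]
        pullback_differential[OF os \<Sigma> e] pullback_differential[OF os \<Sigma> c]
        pullback_differential[OF fs \<Sigma> e] pullback_differential[OF fs \<Sigma> c] ..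
    have p\<Sigma>m: "p\<Sigma> (qt (y0, x)) = m" using qS by (simp add: S_def)
    have \<kappa>qt: "qt (y0, \<psi> (qt (y, x))) = qt (\<kappa> y, x)" if "y \<in> points P" "p y \<in> U" for y
      unfolding \<psi>qt[OF that x] \<kappa>_def by (rule qt_move[OF y0(1) x tD(6)[OF that], symmetric])
    show ?thesis
      unfolding \<sigma>x F_def
    proof (rule poisson_dirac_graphI[OF \<Sigma> embS qS \<pi>\<Sigma> \<pi>F[unfolded F_def]]; unfold F_def[symmetric])
      fix \<eta> assume \<eta>: "\<eta> \<in> cotangent_space F (qt (y0, x))"
      obtain f where f: "f \<in> germs F (qt (y0, x))" "\<eta> = differential F f (qt (y0, x))" by (rule cotangent_differential[OF F qF \<eta>])
      define \<alpha> where "\<alpha> = A x \<eta>"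
      have \<alpha>: "\<alpha> \<in> cotangent_space FP y0" unfolding \<alpha>_def by (rule A[OF x \<eta>])
      have \<alpha>f: "\<alpha> = differential FP (\<lambda>y. f (qt (y, x))) y0" unfolding \<alpha>_def f(2) by (rule A_diff[OF x f(1)])
      have fFP: "(\<lambda>y. f (qt (y, x))) \<in> germs FP y0" by (rule smooth_at_germ'[OF asm[OF x] f(1)])
      obtain \<xi>P where \<xi>P: "\<xi>P \<in> cotangent_space P y0" "pullback FP P (\<lambda>z. z) y0 \<xi>P = \<alpha>"
        "pushforward P (\<lambda>z. z) y0 (sharp FP \<beta> y0 \<alpha>) = sharp P \<pi> y0 \<xi>P" using graphP(1)[OF \<alpha>] by blast
      obtain h where h: "h \<in> germs P y0" "\<xi>P = differential P h y0" by (rule cotangent_differential[OF P y0(1) \<xi>P(1)])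
      \<comment> \<open>The function whose differential is the lift of \<eta>. The first term
        extends \<open>f\<close> from the fibre; the second is constant on the fibre and contributes
        the values of \<open>h\<close> along the section, chosen so that the pull-back of the
        differential along the orbit map is \<open>\<xi>P\<close>.\<close>
      define e where "e \<sigma> = f (qt (y0, \<psi> \<sigma>)) + h (s (p\<Sigma> \<sigma>))" for \<sigma>
      have e1: "(\<lambda>\<sigma>. f (qt (y0, \<psi> \<sigma>))) \<in> germs \<Sigma> (qt (y0, x))"
        by (rule smooth_at_germ'[OF smooth_at_compose[OF \<psi>s[OF qS], unfolded \<psi>j[OF x], OF jsm[OF x]]])
          (simp add: \<psi>j[OF x] f(1))
      have e2: "(\<lambda>\<sigma>. h (s (p\<Sigma> \<sigma>))) \<in> germs \<Sigma> (qt (y0, x))"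
        by (rule smooth_at_germ'[OF smooth_at_compose[OF p\<Sigma>_smooth_at[OF q\<Sigma>], unfolded p\<Sigma>m, OF tD(2)[OF mU]]])
          (simp add: p\<Sigma>m sm h(1))
      have e: "e \<in> germs \<Sigma> (qt (y0, x))" unfolding e_def by (rule germs_add[OF \<Sigma> e1 e2])
      have eF: "differential F e (qt (y0, x)) = \<eta>"
        unfolding f(2)
      proof (rule differential_eqI)
        fix v assume v: "v \<in> tangent_space F (qt (y0, x))"
        have "v e = v (\<lambda>\<sigma>. f \<sigma> + h (s m))"
          by (rule tangent_germ_eq[OF F v openin_topspace qF]) (use S_E pF in \<open>auto simp: e_def S_def\<close>)
        then show "v e = v f"
          using tangent_add[OF v f(1) germs_const[OF F qF]] tangent_const[OF F v qF] by simp
      qed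
      have eX: "differential X (\<lambda>x. e (qt (y0, x))) x = differential X (\<lambda>x. f (qt (y0, x))) x"
      proof (rule differential_eqI)
        fix v assume v: "v \<in> tangent_space X x"
        have "v (\<lambda>x. e (qt (y0, x))) = v (\<lambda>x. f (qt (y0, x)) + h (s m))"
          by (rule tangent_germ_eq[OF X v openin_topspace x]) (simp add: e_def \<psi>j p\<Sigma>_qt y0)
        then show "v (\<lambda>x. e (qt (y0, x))) = v (\<lambda>x. f (qt (y0, x)))"
          using tangent_add[OF v smooth_at_germ'[OF jsm[OF x] f(1)] germs_const[OF X x]] tangent_const[OF X v x] by simp
      qed
      \<comment> \<open>Along the fibre of \<open>P\<close> the first term of \<open>e\<close> and
        the function \<open>h\<close> have the same differential, because \<open>\<xi>P\<close>
        restricts to \<alpha>; along the section the second term is \<open>h\<close> itself. By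
        \<open>decomp\<close> the two parts add up to the differential of \<open>h\<close>.\<close>
      have eP: "differential P (\<lambda>y. e (qt (y, x))) y0 = \<xi>P"
        unfolding h(2)
      proof (rule differential_eqI)
        fix v assume v: "v \<in> tangent_space P y0"
        define w where "w = pushforward FP \<kappa> y0 v"
        have w: "w \<in> tangent_space FP y0" using pushforward_tangent[OF \<kappa>FP FP v] by (simp add: w_def \<kappa>0)
        have wc: "w c = v (\<lambda>y. c (\<kappa> y))" if "c \<in> germs FP y0" for c
          unfolding w_def by (rule pushforward_apply) (simp add: \<kappa>0 that)
        have hFP: "h \<in> germs FP y0" using smooth_at_germ'[OF incP[OF y0Q] h(1)] by simp
        have "v (\<lambda>y. f (qt (\<kappa> y, x))) = w (\<lambda>y. f (qt (y, x)))" by (rule wc[OF fFP, symmetric])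
        also have "\<dots> = \<alpha> w" unfolding \<alpha>f by (rule differential_apply[OF w, symmetric])
        also have "\<dots> = \<xi>P (pushforward P (\<lambda>z. z) y0 w)" unfolding \<xi>P(2)[symmetric] by (rule pullback_apply[OF w])
        also have "\<dots> = pushforward P (\<lambda>z. z) y0 w h"
          unfolding h(2) by (rule differential_apply) (rule pushforward_tangent[OF incP[OF y0Q] P w])
        also have "\<dots> = w h" by (simp add: pushforward_apply h(1))
        also have "\<dots> = v (\<lambda>y. h (\<kappa> y))" by (rule wc[OF hFP])
        finally have 1: "v (\<lambda>y. f (qt (\<kappa> y, x))) = v (\<lambda>y. h (\<kappa> y))" .
        have g1: "(\<lambda>y. f (qt (\<kappa> y, x))) \<in> germs P y0"
          by (rule smooth_at_germ'[OF \<kappa>FP, of "\<lambda>y. f (qt (y, x))"]) (simp add: \<kappa>0 fFP)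
        have g2: "(\<lambda>y. h (s (p y))) \<in> germs P y0"
          by (rule smooth_at_germ'[OF smooth_at_compose[OF p_smooth_at[OF y0(1)], unfolded y0(2), OF tD(2)[OF mU]]])
            (simp add: y0(2) sm h(1))
        have "v (\<lambda>y. e (qt (y, x))) = v (\<lambda>y. f (qt (\<kappa> y, x)) + h (s (p y)))"
          by (rule tangent_germ_eq[OF P v opU y0U]) (use \<kappa>qt in \<open>auto simp: e_def p\<Sigma>_qt x\<close>)
        also have "\<dots> = v (\<lambda>y. f (qt (\<kappa> y, x))) + v (\<lambda>y. h (s (p y)))" by (rule tangent_add[OF v g1 g2])
        also have "\<dots> = v h" unfolding 1 using decomp[OF v h(1)] by simp
        finally show "v (\<lambda>y. e (qt (y, x))) = v h" .
      qed
      show "\<exists>\<xi>\<in>cotangent_space \<Sigma> (qt (y0, x)). pullback F \<Sigma> (\<lambda>z. z) (qt (y0, x)) \<xi> = \<eta> \<and>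
          pushforward \<Sigma> (\<lambda>z. z) (qt (y0, x)) (sharp F \<pi>F (qt (y0, x)) \<eta>) = sharp \<Sigma> \<pi>\<Sigma> (qt (y0, x)) \<xi>"
      proof (intro bexI[of _ "differential \<Sigma> e (qt (y0, x))"] conjI differential_cotangent)
        show "pullback F \<Sigma> (\<lambda>z. z) (qt (y0, x)) (differential \<Sigma> e (qt (y0, x))) = \<eta>"
          unfolding inc_diff[OF e] by (rule eF)
        note u = sharp_tangent[OF F \<pi>F qF \<eta>]
        show "pushforward \<Sigma> (\<lambda>z. z) (qt (y0, x)) (sharp F \<pi>F (qt (y0, x)) \<eta>) =
            sharp \<Sigma> \<pi>\<Sigma> (qt (y0, x)) (differential \<Sigma> e (qt (y0, x)))"
        proof (rule tangent_eqI[OF pushforward_tangent[OF inc \<Sigma> u] sharp_tangent[OF \<Sigma> \<pi>\<Sigma> q\<Sigma> differential_cotangent]])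
          fix c assume c: "c \<in> germs \<Sigma> (qt (y0, x))"
          have cP: "(\<lambda>y. c (qt (y, x))) \<in> germs P y0" by (rule smooth_at_germ'[OF os c])
          have cFP: "(\<lambda>y. c (qt (y, x))) \<in> germs FP y0" by (rule smooth_at_germ'[OF asm[OF x] resF[OF c]])
          have "pushforward \<Sigma> (\<lambda>z. z) (qt (y0, x)) (sharp F \<pi>F (qt (y0, x)) \<eta>) c = sharp F \<pi>F (qt (y0, x)) \<eta> c"
            by (simp add: pushforward_apply c)
          also have "\<dots> = \<beta> y0 \<alpha> (differential FP (\<lambda>y. c (qt (y, x))) y0) +
              \<rho> x (differential X (\<lambda>x. f (qt (y0, x))) x) (differential X (\<lambda>x. c (qt (y0, x))) x)"
            unfolding sharp_apply[OF resF[OF c]] \<pi>F_def \<psi>j[OF x] A_diff[OF x resF[OF c]] J_diff[OF x resF[OF c]] \<alpha>_def[symmetric]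
            unfolding f(2) J_diff[OF x f(1)] ..
          also have "\<beta> y0 \<alpha> (differential FP (\<lambda>y. c (qt (y, x))) y0) = sharp FP \<beta> y0 \<alpha> (\<lambda>y. c (qt (y, x)))"
            by (rule sharp_apply[OF cFP, symmetric])
          also have "\<dots> = pushforward P (\<lambda>z. z) y0 (sharp FP \<beta> y0 \<alpha>) (\<lambda>y. c (qt (y, x)))"
            by (simp add: pushforward_apply cP)
          also have "\<dots> = \<pi> y0 \<xi>P (differential P (\<lambda>y. c (qt (y, x))) y0)" unfolding \<xi>P(3) by (rule sharp_apply[OF cP])
          finally show "pushforward \<Sigma> (\<lambda>z. z) (qt (y0, x)) (sharp F \<pi>F (qt (y0, x)) \<eta>) c =
              sharp \<Sigma> \<pi>\<Sigma> (qt (y0, x)) (differential \<Sigma> e (qt (y0, x))) c"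
            unfolding sharp_c[OF e c] eP eX .
        qed
      qed
    next
      fix u \<xi> assume u: "u \<in> tangent_space F (qt (y0, x))" and \<xi>: "\<xi> \<in> cotangent_space \<Sigma> (qt (y0, x))"
        and \<xi>0: "pullback F \<Sigma> (\<lambda>z. z) (qt (y0, x)) \<xi> = (\<lambda>_. 0)"
        and eq: "pushforward \<Sigma> (\<lambda>z. z) (qt (y0, x)) u = sharp \<Sigma> \<pi>\<Sigma> (qt (y0, x)) \<xi>"
      obtain d where d: "d \<in> germs \<Sigma> (qt (y0, x))" "\<xi> = differential \<Sigma> d (qt (y0, x))" by (rule cotangent_differential[OF \<Sigma> q\<Sigma> \<xi>])
      have dF: "differential F d (qt (y0, x)) = (\<lambda>_. 0)" using inc_diff[OF d(1)] \<xi>0 d(2) by simp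
      \<comment> \<open>Since \<xi> restricts to zero on the fibre, the contribution of \<rho> to
        its image vanishes and \<delta> restricts to zero on the fibre of \<open>P\<close>. The
        image of \<xi> is the push-forward of the vector \<open>w\<close> of \<delta>. If
        \<open>w\<close> is tangent to the fibre of \<open>P\<close>, the graph condition there
        forces it to be zero.\<close>
      define \<delta> where "\<delta> = differential P (\<lambda>y. d (qt (y, x))) y0"
      have \<delta>: "\<delta> \<in> cotangent_space P y0" unfolding \<delta>_def by (rule differential_cotangent)
      have AJ0: "A x (\<lambda>_. 0) = (\<lambda>_. 0)" "J x (\<lambda>_. 0) = (\<lambda>_. 0)" by (auto simp: A_def J_def pullback_def)
      have dP: "(\<lambda>y. d (qt (y, x))) \<in> germs P y0" by (rule smooth_at_germ'[OF os d(1)])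
      have \<delta>0: "pullback FP P (\<lambda>z. z) y0 \<delta> = (\<lambda>_. 0)"
        using pullback_differential[OF incP[OF y0Q] P dP] A_diff[OF x resF[OF d(1)]] dF AJ0 by (simp add: \<delta>_def)
      have dX: "differential X (\<lambda>x. d (qt (y0, x))) x = (\<lambda>_. 0)"
        using J_diff[OF x resF[OF d(1)]] dF AJ0 by simp
      define w where "w = sharp P \<pi> y0 \<delta>"
      have w: "w \<in> tangent_space P y0" unfolding w_def by (rule sharp_tangent[OF P \<pi> y0(1) \<delta>])
      have uc: "u c = w (\<lambda>y. c (qt (y, x)))" if c: "c \<in> germs \<Sigma> (qt (y0, x))" for c
      proof -
        have "u c = pushforward \<Sigma> (\<lambda>z. z) (qt (y0, x)) u c" by (simp add: pushforward_apply c)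
        also have "\<dots> = \<pi> y0 \<delta> (differential P (\<lambda>y. c (qt (y, x))) y0)"
          unfolding eq d(2) sharp_c[OF d(1) c] dX \<delta>_def bivector_zero(1)[OF \<rho> x differential_cotangent] by simp
        also have "\<dots> = w (\<lambda>y. c (qt (y, x)))" unfolding w_def by (rule sharp_apply[OF smooth_at_germ'[OF os c], symmetric])
        finally show ?thesis .
      qed
      \<comment> \<open>The vector \<open>u\<close> is tangent to the fibre of \<Sigma>, on which
        functions from the base are constant, and \<open>w\<close> takes the same values on such
        functions.\<close>
      have vert: "w (\<lambda>y. \<mu> (p y)) = 0" if \<mu>: "\<mu> \<in> germs M m" for \<mu>
      proof -
        have "(\<lambda>\<sigma>. \<mu> (p\<Sigma> \<sigma>)) \<in> germs \<Sigma> (qt (y0, x))"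
          by (rule smooth_at_germ'[OF p\<Sigma>_smooth_at[OF q\<Sigma>]]) (simp add: p\<Sigma>m \<mu>)
        from uc[OF this] have "u (\<lambda>\<sigma>. \<mu> (p\<Sigma> \<sigma>)) = w (\<lambda>y. \<mu> (p\<Sigma> (qt (y, x))))" .
        also have "\<dots> = w (\<lambda>y. \<mu> (p y))"
          by (rule tangent_germ_eq[OF P w openin_topspace y0(1)]) (simp add: p\<Sigma>_qt x)
        also have "u (\<lambda>\<sigma>. \<mu> (p\<Sigma> \<sigma>)) = u (\<lambda>_. \<mu> m)"
          by (rule tangent_germ_eq[OF F u openin_topspace qF]) (use pF in \<open>auto simp: S_def\<close>)
        finally show ?thesis using tangent_const[OF F u qF] by simp
      qed
      define v where "v = pushforward FP \<kappa> y0 w"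
      have v: "v \<in> tangent_space FP y0" using pushforward_tangent[OF \<kappa>FP FP w] by (simp add: v_def \<kappa>0)
      \<comment> \<open>By \<open>vert\<close> the vector \<open>w\<close> has no component along
        the section in \<open>decomp\<close>, so pushing it into the fibre by \<kappa> and including
        it again gives it back. This is the required tangency.\<close>
      have vw: "pushforward P (\<lambda>z. z) y0 v = w"
      proof (rule tangent_eqI[OF pushforward_tangent[OF incP[OF y0Q] P v] w])
        fix h assume h: "h \<in> germs P y0"
        have hFP: "h \<in> germs FP y0" using smooth_at_germ'[OF incP[OF y0Q] h] by simp
        have hs: "(\<lambda>m. h (s m)) \<in> germs M m" by (rule smooth_at_germ'[OF tD(2)[OF mU]]) (simp add: sm h)
        have "pushforward P (\<lambda>z. z) y0 v h = v h" by (simp add: pushforward_apply h)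
        also have "\<dots> = w (\<lambda>y. h (\<kappa> y))" unfolding v_def by (rule pushforward_apply) (simp add: \<kappa>0 hFP)
        also have "\<dots> = w h" using decomp[OF w h] vert[OF hs] by simp
        finally show "pushforward P (\<lambda>z. z) y0 v h = w h" .
      qed
      have "v = sharp FP \<beta> y0 (pullback FP P (\<lambda>z. z) y0 \<delta>)" by (rule graphP(2)[OF v \<delta>]) (simp only: vw w_def)
      then have "v = (\<lambda>_. 0)" unfolding \<delta>0 sharp_zero[OF \<beta> y0FP] .
      then have "w = (\<lambda>_. 0)" using vw by (simp add: pushforward_zero)
      then have "pushforward \<Sigma> (\<lambda>z. z) (qt (y0, x)) u = (\<lambda>_. 0)"
        using uc by (auto simp: pushforward_def comp_def)
      then show "u = (\<lambda>_. 0)" by (rule inclusion_injective[OF \<Sigma> embS qS u[unfolded F_def]])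
    qed
  qed
  show ?thesis
    unfolding poisson_dirac_def S_def[symmetric] Let_def F_def[symmetric] \<pi>\<Sigma>_def[symmetric]
    by (intro conjI embS exI[of _ \<pi>F] \<pi>F ballI graphF)
qed

lemma poisson_fibres_\<Sigma>:
  assumes \<pi>: "smooth_bivector P \<pi>" and \<rho>: "smooth_bivector X \<rho>"
    and inv: "\<forall>g\<in>carrier G. poisson_map P \<pi> P \<pi> (\<lambda>y. r y g)" "\<forall>g\<in>carrier G. poisson_map X \<rho> X \<rho> (l g)"
    and fibres: "has_poisson_fibres P \<pi> M p"
  shows "has_poisson_fibres \<Sigma> (descend PX \<Sigma> qt (prod_bivector P \<pi> X \<rho>)) M p\<Sigma>"
  unfolding has_poisson_fibres_def
proof
  fix m assume m: "m \<in> p\<Sigma> ` points \<Sigma>"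
  then obtain \<sigma> where "\<sigma> \<in> points \<Sigma>" "m = p\<Sigma> \<sigma>" by blast
  then obtain y x where y: "y \<in> points P" "x \<in> points X" "m = p\<Sigma> (qt (y, x))" using \<Sigma>_E by metis
  have "m \<in> p ` points P" using y p\<Sigma>_qt by auto
  then have "poisson_dirac P \<pi> (mdim P - mdim M) {y \<in> points P. p y = m}" using fibres unfolding has_poisson_fibres_def by blast
  moreover have "points P \<noteq> {}" using y(1) by blast
  from mdim_\<Sigma>'[OF this] have "mdim \<Sigma> - mdim M = mdim X" by simp
  ultimately show "poisson_dirac \<Sigma> (descend PX \<Sigma> qt (prod_bivector P \<pi> X \<rho>)) (mdim \<Sigma> - mdim M) {\<sigma> \<in> points \<Sigma>. p\<Sigma> \<sigma> = m}"
    using poisson_dirac_fibre[OF \<pi> \<rho> inv m] by simp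
qed

end

theorem lemma4p11:
  fixes G :: "'g monoid" and Gm :: "'g manifold"
    and P :: "'p manifold" and M :: "'m manifold" and X :: "'x manifold"
    and r :: "'p \<Rightarrow> 'g \<Rightarrow> 'p" and p :: "'p \<Rightarrow> 'm" and l :: "'g \<Rightarrow> 'x \<Rightarrow> 'x"
    and \<pi>P :: "'p bivector" and \<pi>X :: "'x bivector"
  assumes "principal_bundle G Gm P r M p"
    and "poisson_manifold P \<pi>P"
    and "\<forall>g\<in>carrier G. poisson_map P \<pi>P P \<pi>P (\<lambda>y. r y g)"
    and "poisson_manifold X \<pi>X"
    and "smooth_left_action G Gm X l"
    and "\<forall>g\<in>carrier G. poisson_map X \<pi>X X \<pi>X (l g)"
  shows "\<exists>\<pi>M \<pi>\<Sigma>.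
    (let \<Sigma> = assoc_bundle G Gm P r X l;
         q = assoc_quot G r l;
         p\<Sigma> = (assoc_proj p :: ('p \<times> 'x) set \<Rightarrow> 'm);
         PX = prod_manifold P X;
         \<pi>PX = prod_bivector P \<pi>P X \<pi>X
     in poisson_submersion PX \<pi>PX \<Sigma> \<pi>\<Sigma> q \<and>
        poisson_submersion PX \<pi>PX P \<pi>P fst \<and>
        poisson_submersion P \<pi>P M \<pi>M p \<and>
        poisson_submersion \<Sigma> \<pi>\<Sigma> M \<pi>M p\<Sigma> \<and>
        (\<forall>z\<in>points PX. p\<Sigma> (q z) = p (fst z)) \<and>
        (has_poisson_fibres P \<pi>P M p \<longrightarrow> has_poisson_fibres \<Sigma> \<pi>\<Sigma> M p\<Sigma>) \<and>
        (orthogonal_pencil P \<pi>P M \<pi>M p \<longrightarrow> orthogonal_pencil \<Sigma> \<pi>\<Sigma> M \<pi>M p\<Sigma>))"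
proof -
  interpret principal_action G Gm P M X r p l
    using assms(1,4,5) by unfold_locales (simp_all add: poisson_manifold_def)
  have \<pi>: "poisson_structure P \<pi>P" and \<rho>: "poisson_structure X \<pi>X" using assms(2,4) by (simp_all add: poisson_manifold_def)
  then have b: "smooth_bivector P \<pi>P" "smooth_bivector X \<pi>X" by (simp_all add: poisson_structure_def)
  note inv = assms(3,6)
  show ?thesis
    unfolding Let_def
    by (intro exI[of _ "descend P M p \<pi>P"] exI[of _ "descend PX \<Sigma> qt (prod_bivector P \<pi>P X \<pi>X)"] conjI impI ballI
        descend_poisson_submersion[OF PX \<Sigma> has_sections_qt fibre_invariant_qt[OF inv] poisson_structure_prod[OF P X \<pi> \<rho>]]
        poisson_submersion_fst[OF \<pi> \<rho>] descend_poisson_submersion[OF P M has_sections_p fibre_invariant_p[OF inv(1)] \<pi>]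
        poisson_submersion_p\<Sigma>[OF \<pi> \<rho> inv] p\<Sigma>_qt' poisson_fibres_\<Sigma>[OF b inv] orthogonal_pencil_\<Sigma>[OF \<pi> \<rho> inv])
qed

end
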